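(* Let $(Y,w)$ be a Landau--Ginzburg model with $w\neq0$. The map $\mathrm{Ob}(\mathrm{MF}(Y,w))\to\mathcal K^0(Y,w)$ given by $$\mathcal E=(E_0,E_1,\phi_0,\phi_1)\ \longmapsto\ i_{<0}^*\big(\alpha^*(E_\bullet)\big),\qquad E_\bullet=(E_1\xrightarrow{\phi_1}E_0),$$ induces a group homomorphism $$\alpha_{(Y,w)}\colon K_0(\mathrm{MF}(Y,w))\to\mathcal K^0(Y,w).$$
   Context: **LG models.** A Landau--Ginzburg model $(Y,w)$ is a smooth quasi-projective complex variety $Y$ with a regular function $w\colon Y\to\mathbb C$. Put $X=w^{-1}(0)$. Standing assumption: $\mathrm{Crit}(w)=\{dw=0\}\subset X$. **Matrix factorizations.** A matrix factorization of $w$ is $\mathcal E=(E_0,E_1,\phi_0,\phi_1)$ with $E_i$ locally free sheaves of finite rank on $Y$, $\phi_0\colon E_0\to E_1$, $\phi_1\colon E_1\to E_0$, $\phi_1\phi_0=w\cdot\mathrm{id}_{E_0}$, $\phi_0\phi_1=w\cdot \mathrm{id}_{E_1}$. They form a $\mathbb Z/2$-graded dg category $\mathrm{Fact}(Y,w)$: $\mathrm{Hom}^0(\mathcal E,\mathcal F)=\mathrm{Hom}(E_0,F_0)\oplus\mathrm{Hom}(E_1,F_1)$, $\mathrm{Hom}^1(\mathcal E,\mathcal F)=\mathrm{Hom}(E_0,F_1)\oplus\mathrm{Hom}(E_1,F_0)$, with $Dp=\phi^F p-(-1)^{k}p\,\phi^E$ for $p$ of degree $k$. $Z^0\mathrm{Fact}$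 has the closed degree 0 morphisms, $H^0\mathrm{Fact}$ these modulo exact ones. The cone of $p\colon\mathcal E\to\mathcal F$ in $Z^0$ has $C(p)_0=F_0\oplus E_1$, $C(p)_1=F_1\oplus E_0$, $\phi_0^C=\begin{pmatrix}\phi_0^F&p_1\\0&-\phi_1^E\end{pmatrix}$, $\phi_1^C=\begin{pmatrix}\phi_1^F&p_0\\0&-\phi_0^E\end{pmatrix}$; the triangles $\mathcal E\to\mathcal F\to C(p)\to\mathcal E[1]$, with $\mathcal E[1]=(E_1,E_0,-\phi_1,-\phi_0)$, make $H^0\mathrm{Fact}(Y,w)$ triangulated. The totalization of a bounded complex $(\mathcal E^m,d^m)$ in $Z^0\mathrm{Fact}$ is the factorization with $T_i=\bigoplus_{k+m\equiv i\,(2)}E^m_k$ and maps $d^m_k+(-1)^m\phi_k^{E^m}$ on $E_k^m$. $\mathrm{Acyc}(Y,w)$ is the thick subcategory generated by totalizations of bounded exact complexes, and $\mathrm{MF}(Y,w)=H^0\mathrm{Fact}(Y,w)/\mathrm{Acyc}(Y,w)$ (Verdier quotient). $K_0$ of a triangulated category is its Grothendieck group. **Relative K-theory.** For a sufficiently nice pair $(A,B)$, $K^0_{\mathrm{top}}(A,B)$ is generated by finite complexes of vector bundles on $A$ exact on $B$, modulo: additivity in short exact sequences of complexes; complexes exact on $A$ are zero; homotopy (a complex on $A\times[0,1]$ exact on $B\times[0,1]$ has equal restrictions to $t=0,1$). **Critical K-theory.** For $U$ a Euclidean open neighborhood of $X$ in $Y$, $U_{<0}=\{y\in U:\mathrm{Re}\,w(y)<0\}$,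 and $\mathcal K^0(Y,w)=\varinjlim_U K^0_{\mathrm{top}}(U,U_{<0})$ over all such $U$ under restriction. **The map.** For a matrix factorization $\mathcal E$, the complex $E_\bullet$ ($E_0$ in degree 0) is exact on $Y\setminus X$; $\alpha^*(E_\bullet)\in K^0_{\mathrm{top}}(Y,Y\setminus X)$ is the class of the associated complex of topological vector bundles. $i_{<0}^*\colon K^0_{\mathrm{top}}(Y,Y\setminus X)\to\mathcal K^0(Y,w)$ is induced by restriction along the inclusions of pairs $(U,U_{<0})\to(Y,Y\setminus X)$. *)

theory Defs
  imports
    "HOL-Analysis.Analysis"
    "HOL-Algebra.Algebra"
    "HOL-Algebra.Free_Abelian_Groups"
    "Jordan_Normal_Form.Matrix"
begin

section \<open>Complex projective space\<close>

text \<open>The projective space of \<open>complex^'n\<close>: its dimension is \<open>CARD('n) - 1\<close>, and since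
  \<open>'n\<close> is a free type variable, all projective spaces are covered.\<close>

definition proportional :: "complex^'n \<Rightarrow> complex^'n \<Rightarrow> bool" where
  "proportional v v' \<longleftrightarrow> v \<noteq> 0 \<and> v' \<noteq> 0 \<and> (\<exists>c. c \<noteq> 0 \<and> v' = c *s v)"

lemma part_equivp_proportional: "part_equivp proportional"
proof (rule part_equivpI)
  have "proportional (1 :: complex^'n) 1"
    unfolding proportional_def by (metis one_neq_zero vector_smult_lid)
  then show "\<exists>x::complex^'n. proportional x x" by blast
  show "symp (proportional :: complex^'n \<Rightarrow> _)"
  proof (rule sympI)
    fix v v' :: "complex^'n" assume "proportional v v'"
    then obtain c where c: "v \<noteq> 0" "v' \<noteq> 0" "c \<noteq> 0" "v' = c *s v"
      unfolding proportional_def by blast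
    then have "v = inverse c *s v'" by (simp add: vector_smult_assoc)
    with c show "proportional v' v"
      unfolding proportional_def by (metis inverse_nonzero_iff_nonzero)
  qed
  show "transp (proportional :: complex^'n \<Rightarrow> _)"
    by (rule transpI) (auto simp: proportional_def vector_smult_assoc)
qed

quotient_type 'n cproj = "complex^'n" / partial: proportional
  by (rule part_equivp_proportional)

text \<open>The line through \<open>v\<close>; meaningful only for \<open>v \<noteq> 0\<close>.\<close>

definition proj :: "complex^'n \<Rightarrow> 'n cproj" where
  "proj v = abs_cproj v"

text \<open>The Euclidean topology, as the quotient topology from the punctured vector space.\<close>

instantiation cproj :: (finite) topological_space
begin

definition open_cproj :: "'a cproj set \<Rightarrow> bool" where
  "open_cproj U \<longleftrightarrow> open {v. v \<noteq> 0 \<and> proj v \<in> U}"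

instance
proof
  have "{v::complex^'a. v \<noteq> 0 \<and> proj v \<in> UNIV} = - {0}" by auto
  then show "open (UNIV :: 'a cproj set)" by (simp add: open_cproj_def open_Compl)
next
  fix S T :: "'a cproj set" assume "open S" "open T"
  moreover have "{v. v \<noteq> 0 \<and> proj v \<in> S \<inter> T}
      = {v. v \<noteq> 0 \<and> proj v \<in> S} \<inter> {v. v \<noteq> 0 \<and> proj v \<in> T}" by auto
  ultimately show "open (S \<inter> T)" by (simp add: open_cproj_def open_Int)
next
  fix K :: "'a cproj set set" assume "\<forall>S\<in>K. open S"
  moreover have "{v. v \<noteq> 0 \<and> proj v \<in> \<Union>K} = (\<Union>S\<in>K. {v. v \<noteq> 0 \<and> proj v \<in> S})" by auto
  ultimately show "open (\<Union>K)" by (simp add: open_cproj_def open_UN)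
qed

end

section \<open>Quasi-projective varieties and regular functions\<close>

definition form :: "nat \<Rightarrow> (complex^'n \<Rightarrow> complex) \<Rightarrow> bool" where
  "form d f \<longleftrightarrow> (\<exists>c :: ('n \<Rightarrow> nat) \<Rightarrow> complex.
     \<forall>v. f v = (\<Sum>m | (\<Sum>i\<in>UNIV. m i) = d. c m * (\<Prod>i\<in>UNIV. vec_nth v i ^ m i)))"

definition vanishes :: "(complex^'n \<Rightarrow> complex) \<Rightarrow> 'n cproj \<Rightarrow> bool" where
  "vanishes f p \<longleftrightarrow> (\<forall>v. v \<noteq> 0 \<and> proj v = p \<longrightarrow> f v = 0)"

definition zariski_closed :: "'n::finite cproj set \<Rightarrow> bool" where
  "zariski_closed Z \<longleftrightarrow> (\<exists>S. (\<forall>f\<in>S. \<exists>d. form d f) \<and> Z = {p. \<forall>f\<in>S. vanishes f p})"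

definition zariski_open :: "'n::finite cproj set \<Rightarrow> bool" where
  "zariski_open U \<longleftrightarrow> zariski_closed (- U)"

definition quasi_projective :: "'n::finite cproj set \<Rightarrow> bool" where
  "quasi_projective Y \<longleftrightarrow> (\<exists>Z U. zariski_closed Z \<and> zariski_open U \<and> Y = Z \<inter> U)"

definition zopen_in :: "'n::finite cproj set \<Rightarrow> 'n cproj set \<Rightarrow> bool" where
  "zopen_in Y V \<longleftrightarrow> (\<exists>U. zariski_open U \<and> V = Y \<inter> U)"

definition regular_on :: "'n::finite cproj set \<Rightarrow> ('n cproj \<Rightarrow> complex) \<Rightarrow> bool" where
  "regular_on V f \<longleftrightarrow> (\<forall>p\<in>V. \<exists>U d a b. zariski_open U \<and> p \<in> U \<and> form d a \<and> form d b \<and>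
     (\<forall>v. v \<noteq> 0 \<and> proj v \<in> V \<inter> U \<longrightarrow> b v \<noteq> 0 \<and> f (proj v) = a v / b v))"

definition gradient :: "(complex^'n \<Rightarrow> complex) \<Rightarrow> complex^'n \<Rightarrow> complex^'n" where
  "gradient f v = (\<chi> i. deriv (\<lambda>t. f (v + t *s axis i 1)) 0)"

text \<open>Jacobian criterion: near each of its points, \<open>Y\<close> is the zero set of forms whose
  differentials at that point are linearly independent. Equality of sets suffices, because
  the scheme defined by such forms is automatically reduced near the point.\<close>

definition smooth_variety :: "'n::finite cproj set \<Rightarrow> bool" where
  "smooth_variety Y \<longleftrightarrow> (\<forall>p\<in>Y. \<exists>U (k::nat) d f. zariski_open U \<and> p \<in> U \<and>
     (\<forall>j<k. form (d j) (f j)) \<and>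
     (\<forall>q\<in>U. q \<in> Y \<longleftrightarrow> (\<forall>j<k. vanishes (f j) q)) \<and>
     (\<forall>v. v \<noteq> 0 \<and> proj v = p \<longrightarrow>
        (\<forall>c. (\<Sum>j<k. c j *s gradient (f j) v) = 0 \<longrightarrow> (\<forall>j<k. c j = 0))))"

text \<open>The points where \<open>dw\<close> vanishes in the cotangent space \<open>m\<^sub>p / m\<^sub>p\<^sup>2\<close>, that is, where
  the germ of \<open>w - w(p)\<close> lies in \<open>m\<^sub>p\<^sup>2\<close>.\<close>

definition critical_locus :: "'n::finite cproj set \<Rightarrow> ('n cproj \<Rightarrow> complex) \<Rightarrow> 'n cproj set" where
  "critical_locus Y w = {p\<in>Y. \<exists>V (k::nat) a b. zopen_in Y V \<and> p \<in> V \<and>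
     (\<forall>j<k. regular_on V (a j) \<and> regular_on V (b j) \<and> a j p = 0 \<and> b j p = 0) \<and>
     (\<forall>q\<in>V. w q - w p = (\<Sum>j<k. a j q * b j q))}"

definition zero_fibre :: "'n::finite cproj set \<Rightarrow> ('n cproj \<Rightarrow> complex) \<Rightarrow> 'n cproj set" where
  "zero_fibre Y w = {y\<in>Y. w y = 0}"

definition lg_model :: "'n::finite cproj set \<Rightarrow> ('n cproj \<Rightarrow> complex) \<Rightarrow> bool" where
  "lg_model Y w \<longleftrightarrow> quasi_projective Y \<and> smooth_variety Y \<and> regular_on Y w \<and>
     critical_locus Y w \<subseteq> zero_fibre Y w"

section \<open>Locally free sheaves\<close>

text \<open>Entries of a matrix, extended by zero outside its dimensions.\<close>

definition entry :: "complex mat \<Rightarrow> nat \<Rightarrow> nat \<Rightarrow> complex" where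
  "entry M i j = (if i < dim_row M \<and> j < dim_col M then M $$ (i, j) else 0)"

definition ventry :: "complex Matrix.vec \<Rightarrow> nat \<Rightarrow> complex" where
  "ventry x i = (if i < dim_vec x then vec_index x i else 0)"

text \<open>A locally free sheaf of finite rank on the (reduced) variety \<open>Y\<close> is a subsheaf of the sheaf
  of all functions with values in its fibres. After choosing bases of the individual fibres, the
  fibre at \<open>y\<close> is \<open>\<complex>\<^sup>r\<close> with \<open>r = rk E y\<close>; \<open>sec E V\<close> is the set of sections over the
  Zariski open \<open>V\<close>. No compatibility of the chosen bases for different points is assumed.\<close>

record 'p sheaf =
  rk :: "'p \<Rightarrow> nat"
  sec :: "'p set \<Rightarrow> ('p \<Rightarrow> complex Matrix.vec) set"

text \<open>A frame over \<open>V\<close>: the columns of \<open>g\<close> are sections that form a basis of \<open>E\<close> restricted to \<open>V\<close>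
  as a module over the structure sheaf.\<close>

definition local_frame ::
  "'n::finite cproj set \<Rightarrow> 'n cproj sheaf \<Rightarrow> 'n cproj set \<Rightarrow> ('n cproj \<Rightarrow> complex mat) \<Rightarrow> bool" where
  "local_frame Y E V g \<longleftrightarrow> zopen_in Y V \<and> (\<exists>r.
     (\<forall>y\<in>V. rk E y = r \<and> g y \<in> carrier_mat r r \<and> invertible_mat (g y)) \<and>
     (\<forall>W. zopen_in Y W \<and> W \<subseteq> V \<longrightarrow>
        sec E W = {(\<lambda>y\<in>W. g y *\<^sub>v a y) | a.
          (\<forall>y\<in>W. a y \<in> carrier_vec r) \<and> (\<forall>i. regular_on W (\<lambda>y. ventry (a y) i))}))"

definition locally_free :: "'n::finite cproj set \<Rightarrow> 'n cproj sheaf \<Rightarrow> bool" where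
  "locally_free Y E \<longleftrightarrow>
     (\<forall>V s. zopen_in Y V \<and> s \<in> sec E V \<longrightarrow>
        s \<in> extensional V \<and> (\<forall>y\<in>V. s y \<in> carrier_vec (rk E y))) \<and>
     (\<forall>V W s. zopen_in Y V \<and> zopen_in Y W \<and> W \<subseteq> V \<and> s \<in> sec E V \<longrightarrow> restrict s W \<in> sec E W) \<and>
     (\<forall>\<V> s. (\<forall>V\<in>\<V>. zopen_in Y V \<and> restrict s V \<in> sec E V) \<and> s \<in> extensional (\<Union>\<V>) \<longrightarrow>
        s \<in> sec E (\<Union>\<V>)) \<and>
     (\<forall>y\<in>Y. \<exists>V g. y \<in> V \<and> local_frame Y E V g)"

text \<open>A homomorphism of locally free sheaves, given by its fibres.\<close>

definition sheaf_mor ::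
  "'n::finite cproj set \<Rightarrow> 'n cproj sheaf \<Rightarrow> 'n cproj sheaf \<Rightarrow> ('n cproj \<Rightarrow> complex mat) \<Rightarrow> bool" where
  "sheaf_mor Y E F p \<longleftrightarrow> (\<forall>y\<in>Y. p y \<in> carrier_mat (rk F y) (rk E y)) \<and>
     (\<forall>V. zopen_in Y V \<longrightarrow> (\<forall>s\<in>sec E V. (\<lambda>y\<in>V. p y *\<^sub>v s y) \<in> sec F V))"

definition zero_sheaf :: "'p sheaf" where
  "zero_sheaf = \<lparr>rk = (\<lambda>y. 0), sec = (\<lambda>V. {\<lambda>y\<in>V. 0\<^sub>v 0})\<rparr>"

definition dsum :: "'p sheaf \<Rightarrow> 'p sheaf \<Rightarrow> 'p sheaf" where
  "dsum E F = \<lparr>rk = (\<lambda>y. rk E y + rk F y),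
     sec = (\<lambda>V. {(\<lambda>y\<in>V. a y @\<^sub>v b y) | a b. a \<in> sec E V \<and> b \<in> sec F V})\<rparr>"

section \<open>Matrix factorizations\<close>

record 'p mfact =
  mE0 :: "'p sheaf"
  mE1 :: "'p sheaf"
  phi0 :: "'p \<Rightarrow> complex mat"
  phi1 :: "'p \<Rightarrow> complex mat"

definition is_mfact :: "'n::finite cproj set \<Rightarrow> ('n cproj \<Rightarrow> complex) \<Rightarrow> 'n cproj mfact \<Rightarrow> bool" where
  "is_mfact Y w E \<longleftrightarrow> locally_free Y (mE0 E) \<and> locally_free Y (mE1 E) \<and>
     sheaf_mor Y (mE0 E) (mE1 E) (phi0 E) \<and> sheaf_mor Y (mE1 E) (mE0 E) (phi1 E) \<and>
     (\<forall>y\<in>Y. phi1 E y * phi0 E y = w y \<cdot>\<^sub>m 1\<^sub>m (rk (mE0 E) y) \<and>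
            phi0 E y * phi1 E y = w y \<cdot>\<^sub>m 1\<^sub>m (rk (mE1 E) y))"

type_synonym 'p mf_map = "('p \<Rightarrow> complex mat) \<times> ('p \<Rightarrow> complex mat)"

text \<open>Closed morphisms of degree 0, and the exact ones among them: for \<open>h\<close> of degree 1 one has
  \<open>D h = \<phi>\<^sup>F h + h \<phi>\<^sup>E\<close>.\<close>

definition Z0_hom :: "'n::finite cproj set \<Rightarrow> 'n cproj mfact \<Rightarrow> 'n cproj mfact \<Rightarrow> 'n cproj mf_map set" where
  "Z0_hom Y E F = {(p0, p1). sheaf_mor Y (mE0 E) (mE0 F) p0 \<and> sheaf_mor Y (mE1 E) (mE1 F) p1 \<and>
     (\<forall>y\<in>Y. phi0 F y * p0 y = p1 y * phi0 E y \<and> phi1 F y * p1 y = p0 y * phi1 E y)}"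

definition homotopic_maps ::
  "'n::finite cproj set \<Rightarrow> 'n cproj mfact \<Rightarrow> 'n cproj mfact \<Rightarrow> 'n cproj mf_map \<Rightarrow> 'n cproj mf_map \<Rightarrow> bool" where
  "homotopic_maps Y E F p q \<longleftrightarrow>
     (\<exists>h0 h1. sheaf_mor Y (mE0 E) (mE1 F) h0 \<and> sheaf_mor Y (mE1 E) (mE0 F) h1 \<and>
       (\<forall>y\<in>Y. fst q y = fst p y + (phi1 F y * h0 y + h1 y * phi0 E y) \<and>
              snd q y = snd p y + (phi0 F y * h1 y + h0 y * phi1 E y)))"

definition mf_comp :: "'p mf_map \<Rightarrow> 'p mf_map \<Rightarrow> 'p mf_map" where
  "mf_comp g f = (\<lambda>y. fst g y * fst f y, \<lambda>y. snd g y * snd f y)"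

definition mf_id :: "'p mfact \<Rightarrow> 'p mf_map" where
  "mf_id E = (\<lambda>y. 1\<^sub>m (rk (mE0 E) y), \<lambda>y. 1\<^sub>m (rk (mE1 E) y))"

definition mf_shift :: "'p mfact \<Rightarrow> 'p mfact" where
  "mf_shift E = \<lparr>mE0 = mE1 E, mE1 = mE0 E, phi0 = (\<lambda>y. - phi1 E y), phi1 = (\<lambda>y. - phi0 E y)\<rparr>"

definition mf_cone :: "'p mfact \<Rightarrow> 'p mfact \<Rightarrow> 'p mf_map \<Rightarrow> 'p mfact" where
  "mf_cone E F p = \<lparr>mE0 = dsum (mE0 F) (mE1 E), mE1 = dsum (mE1 F) (mE0 E),
     phi0 = (\<lambda>y. four_block_mat (phi0 F y) (snd p y)
                   (0\<^sub>m (rk (mE0 E) y) (rk (mE0 F) y)) (- phi1 E y)),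
     phi1 = (\<lambda>y. four_block_mat (phi1 F y) (fst p y)
                   (0\<^sub>m (rk (mE1 E) y) (rk (mE1 F) y)) (- phi0 E y))\<rparr>"

definition cone_incl :: "'p mfact \<Rightarrow> 'p mfact \<Rightarrow> 'p mf_map" where
  "cone_incl E F =
     (\<lambda>y. 1\<^sub>m (rk (mE0 F) y) @\<^sub>r 0\<^sub>m (rk (mE1 E) y) (rk (mE0 F) y),
      \<lambda>y. 1\<^sub>m (rk (mE1 F) y) @\<^sub>r 0\<^sub>m (rk (mE0 E) y) (rk (mE1 F) y))"

text \<open>The projection of the cone to \<open>E[1]\<close>; the blocks without rows only pad the matrix with
  zero columns.\<close>

definition cone_proj :: "'p mfact \<Rightarrow> 'p mfact \<Rightarrow> 'p mf_map" where
  "cone_proj E F =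
     (\<lambda>y. four_block_mat (0\<^sub>m (rk (mE1 E) y) (rk (mE0 F) y)) (1\<^sub>m (rk (mE1 E) y))
            (0\<^sub>m 0 (rk (mE0 F) y)) (0\<^sub>m 0 (rk (mE1 E) y)),
      \<lambda>y. four_block_mat (0\<^sub>m (rk (mE0 E) y) (rk (mE1 F) y)) (1\<^sub>m (rk (mE0 E) y))
            (0\<^sub>m 0 (rk (mE1 F) y)) (0\<^sub>m 0 (rk (mE0 E) y)))"

section \<open>Categories with shift and triangles, Verdier quotients, Grothendieck groups\<close>

text \<open>In \<open>cmp T A B C g f\<close>, \<open>f\<close> is a morphism from \<open>A\<close> to \<open>B\<close> and \<open>g\<close> one from \<open>B\<close> to \<open>C\<close>.\<close>

record ('o, 'm) shift_cat =
  ob :: "'o set"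
  mor :: "'o \<Rightarrow> 'o \<Rightarrow> 'm set"
  idm :: "'o \<Rightarrow> 'm"
  cmp :: "'o \<Rightarrow> 'o \<Rightarrow> 'o \<Rightarrow> 'm \<Rightarrow> 'm \<Rightarrow> 'm"
  sh_ob :: "'o \<Rightarrow> 'o"
  sh_mor :: "'o \<Rightarrow> 'o \<Rightarrow> 'm \<Rightarrow> 'm"

type_synonym ('o, 'm) triangle = "'o \<times> 'o \<times> 'o \<times> 'm \<times> 'm \<times> 'm"

record ('o, 'm) tri_cat = "('o, 'm) shift_cat" +
  tri :: "('o, 'm) triangle set"

definition is_iso :: "('o, 'm, 'z) shift_cat_scheme \<Rightarrow> 'o \<Rightarrow> 'o \<Rightarrow> 'm \<Rightarrow> bool" where
  "is_iso T A B f \<longleftrightarrow> f \<in> mor T A B \<and>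
     (\<exists>g\<in>mor T B A. cmp T A B A g f = idm T A \<and> cmp T B A B f g = idm T B)"

fun tri_iso :: "('o, 'm, 'z) shift_cat_scheme \<Rightarrow> ('o, 'm) triangle \<Rightarrow> ('o, 'm) triangle \<Rightarrow> bool" where
  "tri_iso T (A, B, C, u, v, x) (A', B', C', u', v', x') \<longleftrightarrow>
     (\<exists>a b c. is_iso T A A' a \<and> is_iso T B B' b \<and> is_iso T C C' c \<and>
        cmp T A B B' b u = cmp T A A' B' u' a \<and>
        cmp T B C C' c v = cmp T B B' C' v' b \<and>
        cmp T C (sh_ob T A) (sh_ob T A') (sh_mor T A A' a) x = cmp T C C' (sh_ob T A') x' c)"

definition candidate_triangles :: "('o, 'm, 'z) shift_cat_scheme \<Rightarrow> ('o, 'm) triangle set" where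
  "candidate_triangles T = {(A, B, C, u, v, x). A \<in> ob T \<and> B \<in> ob T \<and> C \<in> ob T \<and>
     u \<in> mor T A B \<and> v \<in> mor T B C \<and> x \<in> mor T C (sh_ob T A)}"

text \<open>The category with the triangles isomorphic to a member of \<open>S\<close> as distinguished ones.\<close>

definition with_triangles :: "('o, 'm) shift_cat \<Rightarrow> ('o, 'm) triangle set \<Rightarrow> ('o, 'm) tri_cat" where
  "with_triangles T S =
     shift_cat.extend T \<lparr>tri = {t \<in> candidate_triangles T. \<exists>t'\<in>S. tri_iso T t t'}\<rparr>"

definition zero_object :: "('o, 'm, 'z) shift_cat_scheme \<Rightarrow> 'o \<Rightarrow> bool" where
  "zero_object T Z \<longleftrightarrow> Z \<in> ob T \<and>
     (\<forall>A\<in>ob T. (\<exists>!f. f \<in> mor T A Z) \<and> (\<exists>!f. f \<in> mor T Z A))"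

definition is_coproduct ::
  "('o, 'm, 'z) shift_cat_scheme \<Rightarrow> 'o \<Rightarrow> 'o \<Rightarrow> 'o \<Rightarrow> 'm \<Rightarrow> 'm \<Rightarrow> bool" where
  "is_coproduct T A A' B i j \<longleftrightarrow> i \<in> mor T A B \<and> j \<in> mor T A' B \<and>
     (\<forall>Z\<in>ob T. \<forall>f\<in>mor T A Z. \<forall>g\<in>mor T A' Z.
        \<exists>!h. h \<in> mor T B Z \<and> cmp T A B Z h i = f \<and> cmp T A' B Z h j = g)"

text \<open>Full triangulated subcategories closed under direct summands, as sets of objects. Closure under
  isomorphism follows from the two-out-of-three property and the zero objects.\<close>

definition thick :: "('o, 'm) tri_cat \<Rightarrow> 'o set \<Rightarrow> bool" where
  "thick T N \<longleftrightarrow> N \<subseteq> ob T \<and> (\<forall>Z. zero_object T Z \<longrightarrow> Z \<in> N) \<and>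
     (\<forall>A\<in>ob T. sh_ob T A \<in> N \<longleftrightarrow> A \<in> N) \<and>
     (\<forall>A B C u v x. (A, B, C, u, v, x) \<in> tri T \<longrightarrow>
        (A \<in> N \<and> B \<in> N \<longrightarrow> C \<in> N) \<and> (A \<in> N \<and> C \<in> N \<longrightarrow> B \<in> N) \<and> (B \<in> N \<and> C \<in> N \<longrightarrow> A \<in> N)) \<and>
     (\<forall>A\<in>ob T. \<forall>A'\<in>ob T. \<forall>B\<in>N. \<forall>i j. is_coproduct T A A' B i j \<longrightarrow> A \<in> N)"

definition thick_closure :: "('o, 'm) tri_cat \<Rightarrow> 'o set \<Rightarrow> 'o set" where
  "thick_closure T S = \<Inter>{N. thick T N \<and> S \<subseteq> N}"

text \<open>Verdier quotient by calculus of fractions: morphisms from \<open>A\<close> to \<open>B\<close> are classes of roofs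
  \<open>(G, s, f)\<close> with \<open>s\<close> from \<open>G\<close> to \<open>A\<close> having its cone in \<open>N\<close>, and \<open>f\<close> from \<open>G\<close> to \<open>B\<close>.\<close>

type_synonym ('o, 'm) roof = "'o \<times> 'm \<times> 'm"

definition cone_in :: "('o, 'm) tri_cat \<Rightarrow> 'o set \<Rightarrow> 'o \<Rightarrow> 'o \<Rightarrow> 'm \<Rightarrow> bool" where
  "cone_in T N G A s \<longleftrightarrow> (\<exists>C\<in>N. \<exists>v x. (G, A, C, s, v, x) \<in> tri T)"

definition roofs :: "('o, 'm) tri_cat \<Rightarrow> 'o set \<Rightarrow> 'o \<Rightarrow> 'o \<Rightarrow> ('o, 'm) roof set" where
  "roofs T N A B = {(G, s, f). G \<in> ob T \<and> s \<in> mor T G A \<and> cone_in T N G A s \<and> f \<in> mor T G B}"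

fun roof_eq :: "('o, 'm) tri_cat \<Rightarrow> 'o set \<Rightarrow> 'o \<Rightarrow> 'o \<Rightarrow> ('o, 'm) roof \<Rightarrow> ('o, 'm) roof \<Rightarrow> bool" where
  "roof_eq T N A B (G, s, f) (G', s', f') \<longleftrightarrow>
     (\<exists>H\<in>ob T. \<exists>u\<in>mor T H G. \<exists>u'\<in>mor T H G'.
        cmp T H G A s u = cmp T H G' A s' u' \<and> cmp T H G B f u = cmp T H G' B f' u' \<and>
        cone_in T N H A (cmp T H G A s u))"

definition roof_class :: "('o, 'm) tri_cat \<Rightarrow> 'o set \<Rightarrow> 'o \<Rightarrow> 'o \<Rightarrow> ('o, 'm) roof \<Rightarrow> ('o, 'm) roof set" where
  "roof_class T N A B \<rho> = {\<sigma> \<in> roofs T N A B. roof_eq T N A B \<rho> \<sigma>}"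

text \<open>A composite of roofs, given by completing the middle cospan to a commutative square. All
  possible choices give the same class, so the union is a single class; likewise for the shift.\<close>

definition roof_comp ::
  "('o, 'm) tri_cat \<Rightarrow> 'o set \<Rightarrow> 'o \<Rightarrow> 'o \<Rightarrow> 'o \<Rightarrow> ('o, 'm) roof set \<Rightarrow> ('o, 'm) roof set \<Rightarrow> ('o, 'm) roof set" where
  "roof_comp T N A B C M L = \<Union>{roof_class T N A C (H, cmp T H G A s t', cmp T H G' C g f') |
     G s f G' t g H t' f'. (G, s, f) \<in> L \<and> (G', t, g) \<in> M \<and> H \<in> ob T \<and>
       t' \<in> mor T H G \<and> cone_in T N H G t' \<and> f' \<in> mor T H G' \<and>
       cmp T H G B f t' = cmp T H G' B t f'}"

definition verdier_base :: "('o, 'm) tri_cat \<Rightarrow> 'o set \<Rightarrow> ('o, ('o, 'm) roof set) shift_cat" where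
  "verdier_base T N = \<lparr>ob = ob T,
     mor = (\<lambda>A B. roof_class T N A B ` roofs T N A B),
     idm = (\<lambda>A. roof_class T N A A (A, idm T A, idm T A)),
     cmp = roof_comp T N,
     sh_ob = sh_ob T,
     sh_mor = (\<lambda>A B M. \<Union>{roof_class T N (sh_ob T A) (sh_ob T B)
                 (sh_ob T G, sh_mor T G A s, sh_mor T G B f) | G s f. (G, s, f) \<in> M})\<rparr>"

definition verdier_image :: "('o, 'm) tri_cat \<Rightarrow> 'o set \<Rightarrow> 'o \<Rightarrow> 'o \<Rightarrow> 'm \<Rightarrow> ('o, 'm) roof set" where
  "verdier_image T N A B f = roof_class T N A B (A, idm T A, f)"

definition verdier_quotient :: "('o, 'm) tri_cat \<Rightarrow> 'o set \<Rightarrow> ('o, ('o, 'm) roof set) tri_cat" where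
  "verdier_quotient T N = with_triangles (verdier_base T N)
     {(A, B, C, verdier_image T N A B u, verdier_image T N B C v,
         verdier_image T N C (sh_ob T A) x) | A B C u v x. (A, B, C, u, v, x) \<in> tri T}"

text \<open>Abelian groups by generators and relations.\<close>

definition presented :: "'a set \<Rightarrow> ('a \<Rightarrow>\<^sub>0 int) set \<Rightarrow> ('a \<Rightarrow>\<^sub>0 int) set monoid" where
  "presented S R = free_Abelian_group S Mod generate (free_Abelian_group S) R"

definition presented_class :: "'a set \<Rightarrow> ('a \<Rightarrow>\<^sub>0 int) set \<Rightarrow> ('a \<Rightarrow>\<^sub>0 int) \<Rightarrow> ('a \<Rightarrow>\<^sub>0 int) set" where
  "presented_class S R x = generate (free_Abelian_group S) R #>\<^bsub>free_Abelian_group S\<^esub> x"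

definition K0_rels :: "('o, 'm) tri_cat \<Rightarrow> ('o \<Rightarrow>\<^sub>0 int) set" where
  "K0_rels T = {frag_of B - frag_of A - frag_of C | A B C u v x. (A, B, C, u, v, x) \<in> tri T}"

definition K0 :: "('o, 'm) tri_cat \<Rightarrow> ('o \<Rightarrow>\<^sub>0 int) set monoid" where
  "K0 T = presented (ob T) (K0_rels T)"

definition K0_class :: "('o, 'm) tri_cat \<Rightarrow> 'o \<Rightarrow> ('o \<Rightarrow>\<^sub>0 int) set" where
  "K0_class T A = presented_class (ob T) (K0_rels T) (frag_of A)"

section \<open>The category MF\<close>

definition H0_class ::
  "'n::finite cproj set \<Rightarrow> 'n cproj mfact \<Rightarrow> 'n cproj mfact \<Rightarrow> 'n cproj mf_map \<Rightarrow> 'n cproj mf_map set" where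
  "H0_class Y E F p = {q \<in> Z0_hom Y E F. homotopic_maps Y E F p q}"

definition H0_base ::
  "'n::finite cproj set \<Rightarrow> ('n cproj \<Rightarrow> complex) \<Rightarrow> ('n cproj mfact, 'n cproj mf_map set) shift_cat" where
  "H0_base Y w = \<lparr>ob = {E. is_mfact Y w E},
     mor = (\<lambda>E F. H0_class Y E F ` Z0_hom Y E F),
     idm = (\<lambda>E. H0_class Y E E (mf_id E)),
     cmp = (\<lambda>E F G M L. \<Union>g\<in>M. \<Union>f\<in>L. H0_class Y E G (mf_comp g f)),
     sh_ob = mf_shift,
     sh_mor = (\<lambda>E F M. \<Union>p\<in>M. H0_class Y (mf_shift E) (mf_shift F) (snd p, fst p))\<rparr>"

definition H0_Fact ::
  "'n::finite cproj set \<Rightarrow> ('n cproj \<Rightarrow> complex) \<Rightarrow> ('n cproj mfact, 'n cproj mf_map set) tri_cat" where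
  "H0_Fact Y w = with_triangles (H0_base Y w)
     {(E, F, mf_cone E F p, H0_class Y E F p, H0_class Y F (mf_cone E F p) (cone_incl E F),
        H0_class Y (mf_cone E F p) (mf_shift E) (cone_proj E F)) | E F p.
        is_mfact Y w E \<and> is_mfact Y w F \<and> p \<in> Z0_hom Y E F}"

text \<open>The components \<open>E\<^sub>k\<close> and \<open>\<phi>\<^sub>k\<close> (and those of a map), with \<open>k\<close> read modulo 2.\<close>

definition mfE :: "int \<Rightarrow> 'p mfact \<Rightarrow> 'p sheaf" where
  "mfE k E = (if even k then mE0 E else mE1 E)"

definition mfphi :: "int \<Rightarrow> 'p mfact \<Rightarrow> 'p \<Rightarrow> complex mat" where
  "mfphi k E = (if even k then phi0 E else phi1 E)"

definition mfmap :: "int \<Rightarrow> 'p mf_map \<Rightarrow> 'p \<Rightarrow> complex mat" where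
  "mfmap k p = (if even k then fst p else snd p)"

text \<open>Bounded exact complexes \<open>(Em m, dm m)\<close> in \<open>Z\<^sup>0 Fact\<close>, vanishing outside \<open>a \<le> m < a + l\<close>.
  Exactness is that of complexes of sheaves, in both components.\<close>

definition bounded_exact_complex ::
  "'n::finite cproj set \<Rightarrow> ('n cproj \<Rightarrow> complex) \<Rightarrow> int \<Rightarrow> nat \<Rightarrow>
   (int \<Rightarrow> 'n cproj mfact) \<Rightarrow> (int \<Rightarrow> 'n cproj mf_map) \<Rightarrow> bool" where
  "bounded_exact_complex Y w a l Em dm \<longleftrightarrow>
     (\<forall>m. is_mfact Y w (Em m) \<and> dm m \<in> Z0_hom Y (Em m) (Em (m + 1))) \<and>
     (\<forall>m k. \<forall>y\<in>Y. mfmap k (dm (m + 1)) y * mfmap k (dm m) y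
              = 0\<^sub>m (rk (mfE k (Em (m + 2))) y) (rk (mfE k (Em m)) y)) \<and>
     (\<forall>m k. m < a \<or> m \<ge> a + int l \<longrightarrow> (\<forall>y\<in>Y. rk (mfE k (Em m)) y = 0)) \<and>
     (\<forall>m k V s. zopen_in Y V \<and> s \<in> sec (mfE k (Em m)) V \<and>
        (\<forall>y\<in>V. mfmap k (dm m) y *\<^sub>v s y = 0\<^sub>v (rk (mfE k (Em (m + 1))) y)) \<longrightarrow>
        (\<forall>y\<in>V. \<exists>W t. zopen_in Y W \<and> y \<in> W \<and> W \<subseteq> V \<and> t \<in> sec (mfE k (Em (m - 1))) W \<and>
           (\<forall>z\<in>W. mfmap k (dm (m - 1)) z *\<^sub>v t z = s z)))"

text \<open>The sheaf \<open>T\<^sub>i\<close> of the totalization is the direct sum of \<open>E\<^sup>m\<^sub>k\<close> with \<open>k = i - m\<close> modulo 2,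
  over \<open>m = a, \<dots>, a + l - 1\<close>. The matrix of its structure map is block lower bidiagonal; we split off
  the summand of index \<open>a\<close>, on which the map is \<open>(-1)\<^sup>a \<phi>\<close> into itself plus \<open>d\<^sup>a\<close> into the
  summand of index \<open>a + 1\<close>, the first one of the rest.\<close>

fun tot_sheaf :: "int \<Rightarrow> int \<Rightarrow> nat \<Rightarrow> (int \<Rightarrow> 'p mfact) \<Rightarrow> 'p sheaf" where
  "tot_sheaf i a 0 Em = zero_sheaf"
| "tot_sheaf i a (Suc l) Em = dsum (mfE (i - a) (Em a)) (tot_sheaf i (a + 1) l Em)"

fun tot_phi :: "int \<Rightarrow> int \<Rightarrow> nat \<Rightarrow> (int \<Rightarrow> 'p mfact) \<Rightarrow> (int \<Rightarrow> 'p mf_map) \<Rightarrow> 'p \<Rightarrow> complex mat" where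
  "tot_phi i a 0 Em dm y = 0\<^sub>m 0 0"
| "tot_phi i a (Suc l) Em dm y = four_block_mat
     (if even a then mfphi (i - a) (Em a) y else - mfphi (i - a) (Em a) y)
     (0\<^sub>m (rk (mfE (i + 1 - a) (Em a)) y) (rk (tot_sheaf i (a + 1) l Em) y))
     (case l of
        0 \<Rightarrow> 0\<^sub>m 0 (rk (mfE (i - a) (Em a)) y)
      | Suc l' \<Rightarrow> mfmap (i - a) (dm a) y @\<^sub>r
          0\<^sub>m (rk (tot_sheaf (i + 1) (a + 2) l' Em) y) (rk (mfE (i - a) (Em a)) y))
     (tot_phi i (a + 1) l Em dm y)"

definition totalization :: "int \<Rightarrow> nat \<Rightarrow> (int \<Rightarrow> 'p mfact) \<Rightarrow> (int \<Rightarrow> 'p mf_map) \<Rightarrow> 'p mfact" where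
  "totalization a l Em dm = \<lparr>mE0 = tot_sheaf 0 a l Em, mE1 = tot_sheaf 1 a l Em,
     phi0 = tot_phi 0 a l Em dm, phi1 = tot_phi 1 a l Em dm\<rparr>"

definition Acyc :: "'n::finite cproj set \<Rightarrow> ('n cproj \<Rightarrow> complex) \<Rightarrow> 'n cproj mfact set" where
  "Acyc Y w = thick_closure (H0_Fact Y w)
     {totalization a l Em dm | a l Em dm. bounded_exact_complex Y w a l Em dm}"

definition MF ::
  "'n::finite cproj set \<Rightarrow> ('n cproj \<Rightarrow> complex) \<Rightarrow>
   ('n cproj mfact, ('n cproj mfact, 'n cproj mf_map set) roof set) tri_cat" where
  "MF Y w = verdier_quotient (H0_Fact Y w) (Acyc Y w)"

section \<open>Topological vector bundles and relative K-theory\<close>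

text \<open>A complex vector bundle, with its fibre at \<open>y\<close> identified with \<open>\<complex>\<^sup>r\<close>, \<open>r = vrank E y\<close>
  (for each \<open>y\<close> separately), is given by an atlas of local frames \<open>(V, g)\<close>. Over a set \<open>A\<close> only the
  values at points of \<open>A\<close> matter, so the restriction to a subset is given by the same record.\<close>

record 'a vbundle =
  vrank :: "'a \<Rightarrow> nat"
  frames :: "('a set \<times> ('a \<Rightarrow> complex mat)) set"

definition continuous_mat_on :: "'a::topological_space set \<Rightarrow> ('a \<Rightarrow> complex mat) \<Rightarrow> bool" where
  "continuous_mat_on B h \<longleftrightarrow> (\<forall>i j. continuous_on B (\<lambda>y. entry (h y) i j))"

definition vbundle_on :: "'a::topological_space set \<Rightarrow> 'a vbundle \<Rightarrow> bool" where
  "vbundle_on A E \<longleftrightarrow>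
     (\<forall>(V, g)\<in>frames E. openin (top_of_set A) (A \<inter> V) \<and>
        (\<exists>r. \<forall>y\<in>A \<inter> V. vrank E y = r \<and> g y \<in> carrier_mat r r \<and> invertible_mat (g y))) \<and>
     (\<forall>(V, g)\<in>frames E. \<forall>(V', g')\<in>frames E. \<exists>h. continuous_mat_on (A \<inter> V \<inter> V') h \<and>
        (\<forall>y\<in>A \<inter> V \<inter> V'. h y \<in> carrier_mat (vrank E y) (vrank E y) \<and> g' y = g y * h y)) \<and>
     (\<forall>y\<in>A. \<exists>(V, g)\<in>frames E. y \<in> V)"

definition vbundle_map ::
  "'a::topological_space set \<Rightarrow> 'a vbundle \<Rightarrow> 'a vbundle \<Rightarrow> ('a \<Rightarrow> complex mat) \<Rightarrow> bool" where
  "vbundle_map A E F p \<longleftrightarrow> (\<forall>y\<in>A. p y \<in> carrier_mat (vrank F y) (vrank E y)) \<and>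
     (\<forall>(V, g)\<in>frames E. \<forall>(V', g')\<in>frames F. \<exists>h. continuous_mat_on (A \<inter> V \<inter> V') h \<and>
        (\<forall>y\<in>A \<inter> V \<inter> V'. h y \<in> carrier_mat (vrank F y) (vrank E y) \<and> p y * g y = g' y * h y))"

text \<open>Complexes are graded cohomologically: \<open>cdiff C i\<close> goes from degree \<open>i\<close> to degree \<open>i + 1\<close>.\<close>

record 'a vcomplex =
  cbun :: "int \<Rightarrow> 'a vbundle"
  cdiff :: "int \<Rightarrow> 'a \<Rightarrow> complex mat"

definition complex_on :: "'a::topological_space set \<Rightarrow> 'a vcomplex \<Rightarrow> bool" where
  "complex_on A C \<longleftrightarrow>
     (\<forall>i. vbundle_on A (cbun C i) \<and> vbundle_map A (cbun C i) (cbun C (i + 1)) (cdiff C i)) \<and>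
     (\<forall>i. \<forall>y\<in>A. cdiff C (i + 1) y * cdiff C i y
              = 0\<^sub>m (vrank (cbun C (i + 2)) y) (vrank (cbun C i) y)) \<and>
     (\<exists>N. \<forall>i. \<bar>i\<bar> > N \<longrightarrow> (\<forall>y\<in>A. vrank (cbun C i) y = 0))"

definition mat_ker :: "complex mat \<Rightarrow> complex Matrix.vec set" where
  "mat_ker M = {x \<in> carrier_vec (dim_col M). M *\<^sub>v x = 0\<^sub>v (dim_row M)}"

definition mat_range :: "complex mat \<Rightarrow> complex Matrix.vec set" where
  "mat_range M = (\<lambda>x. M *\<^sub>v x) ` carrier_vec (dim_col M)"

definition exact_on :: "'a set \<Rightarrow> 'a vcomplex \<Rightarrow> bool" where
  "exact_on B C \<longleftrightarrow> (\<forall>y\<in>B. \<forall>i. mat_ker (cdiff C i y) = mat_range (cdiff C (i - 1) y))"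

definition complex_map ::
  "'a::topological_space set \<Rightarrow> 'a vcomplex \<Rightarrow> 'a vcomplex \<Rightarrow> (int \<Rightarrow> 'a \<Rightarrow> complex mat) \<Rightarrow> bool" where
  "complex_map A C D f \<longleftrightarrow> (\<forall>i. vbundle_map A (cbun C i) (cbun D i) (f i) \<and>
     (\<forall>y\<in>A. f (i + 1) y * cdiff C i y = cdiff D i y * f i y))"

definition short_exact ::
  "'a::topological_space set \<Rightarrow> 'a vcomplex \<Rightarrow> 'a vcomplex \<Rightarrow> 'a vcomplex \<Rightarrow> bool" where
  "short_exact A C' C C'' \<longleftrightarrow> (\<exists>f g. complex_map A C' C f \<and> complex_map A C C'' g \<and>
     (\<forall>i. \<forall>y\<in>A. mat_ker (f i y) = {0\<^sub>v (vrank (cbun C' i) y)} \<and>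
        mat_ker (g i y) = mat_range (f i y) \<and>
        mat_range (g i y) = carrier_vec (vrank (cbun C'' i) y)))"

definition slice_bundle :: "real \<Rightarrow> ('a \<times> real) vbundle \<Rightarrow> 'a vbundle" where
  "slice_bundle t E = \<lparr>vrank = (\<lambda>y. vrank E (y, t)),
     frames = {({y. (y, t) \<in> V}, \<lambda>y. g (y, t)) | V g. (V, g) \<in> frames E}\<rparr>"

definition slice :: "real \<Rightarrow> ('a \<times> real) vcomplex \<Rightarrow> 'a vcomplex" where
  "slice t C = \<lparr>cbun = (\<lambda>i. slice_bundle t (cbun C i)), cdiff = (\<lambda>i y. cdiff C i (y, t))\<rparr>"

definition rel_complexes :: "'a::topological_space set \<Rightarrow> 'a set \<Rightarrow> 'a vcomplex set" where
  "rel_complexes A B = {C. complex_on A C \<and> exact_on B C}"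

definition Ktop_rels :: "'a::topological_space set \<Rightarrow> 'a set \<Rightarrow> ('a vcomplex \<Rightarrow>\<^sub>0 int) set" where
  "Ktop_rels A B =
     {frag_of C - frag_of C' - frag_of C'' | C C' C''.
        C \<in> rel_complexes A B \<and> C' \<in> rel_complexes A B \<and> C'' \<in> rel_complexes A B \<and>
        short_exact A C' C C''} \<union>
     {frag_of C | C. complex_on A C \<and> exact_on A C} \<union>
     {frag_of (slice 0 C) - frag_of (slice 1 C) | C. C \<in> rel_complexes (A \<times> {0..1}) (B \<times> {0..1})}"

definition Ktop :: "'a::topological_space set \<Rightarrow> 'a set \<Rightarrow> ('a vcomplex \<Rightarrow>\<^sub>0 int) set monoid" where
  "Ktop A B = presented (rel_complexes A B) (Ktop_rels A B)"

definition Ktop_class ::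
  "'a::topological_space set \<Rightarrow> 'a set \<Rightarrow> ('a vcomplex \<Rightarrow>\<^sub>0 int) \<Rightarrow> ('a vcomplex \<Rightarrow>\<^sub>0 int) set" where
  "Ktop_class A B = presented_class (rel_complexes A B) (Ktop_rels A B)"

text \<open>Restriction to the pair \<open>(A, B)\<close> of an element of \<open>Ktop A' B'\<close> with \<open>A \<subseteq> A'\<close>, \<open>B \<subseteq> B'\<close>. The
  element is a coset, whose members all have the same class over \<open>(A, B)\<close>; on generators
  the map is the identity, see the remark on restriction of bundles.\<close>

definition Ktop_restrict ::
  "'a::topological_space set \<Rightarrow> 'a set \<Rightarrow> ('a vcomplex \<Rightarrow>\<^sub>0 int) set \<Rightarrow> ('a vcomplex \<Rightarrow>\<^sub>0 int) set" where
  "Ktop_restrict A B c = the_elem (Ktop_class A B ` c)"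

section \<open>Critical K-theory\<close>

text \<open>Direct limits of abelian groups: \<open>f i j\<close> is the transition map from \<open>G i\<close> to \<open>G j\<close>,
  defined for \<open>fol i j\<close>.\<close>

definition sum_incl :: "'i set \<Rightarrow> ('i \<Rightarrow> 'g monoid) \<Rightarrow> 'i \<Rightarrow> 'g \<Rightarrow> 'i \<Rightarrow> 'g" where
  "sum_incl I G i x = (\<lambda>j\<in>I. if j = i then x else \<one>\<^bsub>G j\<^esub>)"

definition limit_kernel ::
  "'i set \<Rightarrow> ('i \<Rightarrow> 'i \<Rightarrow> bool) \<Rightarrow> ('i \<Rightarrow> 'g monoid) \<Rightarrow> ('i \<Rightarrow> 'i \<Rightarrow> 'g \<Rightarrow> 'g) \<Rightarrow> ('i \<Rightarrow> 'g) set" where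
  "limit_kernel I fol G f = generate (sum_group I G)
     {sum_incl I G i x \<otimes>\<^bsub>sum_group I G\<^esub> inv\<^bsub>sum_group I G\<^esub> sum_incl I G j (f i j x) | i j x.
        i \<in> I \<and> j \<in> I \<and> fol i j \<and> x \<in> carrier (G i)}"

definition direct_limit ::
  "'i set \<Rightarrow> ('i \<Rightarrow> 'i \<Rightarrow> bool) \<Rightarrow> ('i \<Rightarrow> 'g monoid) \<Rightarrow> ('i \<Rightarrow> 'i \<Rightarrow> 'g \<Rightarrow> 'g) \<Rightarrow> ('i \<Rightarrow> 'g) set monoid" where
  "direct_limit I fol G f = sum_group I G Mod limit_kernel I fol G f"

definition to_limit ::
  "'i set \<Rightarrow> ('i \<Rightarrow> 'i \<Rightarrow> bool) \<Rightarrow> ('i \<Rightarrow> 'g monoid) \<Rightarrow> ('i \<Rightarrow> 'i \<Rightarrow> 'g \<Rightarrow> 'g) \<Rightarrow> 'i \<Rightarrow> 'g \<Rightarrow> ('i \<Rightarrow> 'g) set" where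
  "to_limit I fol G f i x = limit_kernel I fol G f #>\<^bsub>sum_group I G\<^esub> sum_incl I G i x"

definition neg_part :: "('a \<Rightarrow> complex) \<Rightarrow> 'a set \<Rightarrow> 'a set" where
  "neg_part w U = {y\<in>U. Re (w y) < 0}"

definition fibre_nbhds :: "'n::finite cproj set \<Rightarrow> ('n cproj \<Rightarrow> complex) \<Rightarrow> 'n cproj set set" where
  "fibre_nbhds Y w = {U. openin (top_of_set Y) U \<and> zero_fibre Y w \<subseteq> U}"

definition Kcrit ::
  "'n::finite cproj set \<Rightarrow> ('n cproj \<Rightarrow> complex) \<Rightarrow>
   ('n cproj set \<Rightarrow> ('n cproj vcomplex \<Rightarrow>\<^sub>0 int) set) set monoid" where
  "Kcrit Y w = direct_limit (fibre_nbhds Y w) (\<lambda>U V. V \<subseteq> U)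
     (\<lambda>U. Ktop U (neg_part w U)) (\<lambda>U V. Ktop_restrict V (neg_part w V))"

text \<open>The map from \<open>Ktop Y (Y - X)\<close>: restriction to \<open>(U, neg_part w U)\<close>, followed by the map to
  the limit. All \<open>U\<close> give the same result; we take the largest one, \<open>U = Y\<close>.\<close>

definition i_neg ::
  "'n::finite cproj set \<Rightarrow> ('n cproj \<Rightarrow> complex) \<Rightarrow> ('n cproj vcomplex \<Rightarrow>\<^sub>0 int) set \<Rightarrow>
   ('n cproj set \<Rightarrow> ('n cproj vcomplex \<Rightarrow>\<^sub>0 int) set) set" where
  "i_neg Y w c = to_limit (fibre_nbhds Y w) (\<lambda>U V. V \<subseteq> U)
     (\<lambda>U. Ktop U (neg_part w U)) (\<lambda>U V. Ktop_restrict V (neg_part w V))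
     Y (Ktop_restrict Y (neg_part w Y) c)"

section \<open>The topological class of a matrix factorization\<close>

definition an_bundle :: "'n::finite cproj set \<Rightarrow> 'n cproj sheaf \<Rightarrow> 'n cproj vbundle" where
  "an_bundle Y E = \<lparr>vrank = rk E, frames = {(V, g). local_frame Y E V g}\<rparr>"

definition zero_bundle :: "'a vbundle" where
  "zero_bundle = \<lparr>vrank = (\<lambda>y. 0), frames = {(UNIV, \<lambda>y. 1\<^sub>m 0)}\<rparr>"

text \<open>\<open>E\<^sub>1 \<rightarrow> E\<^sub>0\<close> with \<open>E\<^sub>0\<close> in degree 0, so that \<open>E\<^sub>1\<close> has cohomological degree -1.\<close>

definition an_complex_bundle :: "'n::finite cproj set \<Rightarrow> 'n cproj mfact \<Rightarrow> int \<Rightarrow> 'n cproj vbundle" where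
  "an_complex_bundle Y E i = (if i = -1 then an_bundle Y (mE1 E)
     else if i = 0 then an_bundle Y (mE0 E) else zero_bundle)"

definition an_complex :: "'n::finite cproj set \<Rightarrow> 'n cproj mfact \<Rightarrow> 'n cproj vcomplex" where
  "an_complex Y E = \<lparr>cbun = an_complex_bundle Y E,
     cdiff = (\<lambda>i y. if i = -1 then phi1 E y
       else 0\<^sub>m (vrank (an_complex_bundle Y E (i + 1)) y) (vrank (an_complex_bundle Y E i) y))\<rparr>"

definition alpha_star ::
  "'n::finite cproj set \<Rightarrow> ('n cproj \<Rightarrow> complex) \<Rightarrow> 'n cproj mfact \<Rightarrow> ('n cproj vcomplex \<Rightarrow>\<^sub>0 int) set" where
  "alpha_star Y w E = Ktop_class Y (Y - zero_fibre Y w) (frag_of (an_complex Y E))"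

end

theory Submission
  imports Defs "Jordan_Normal_Form.Determinant"
begin

text \<open>Writing \<open>\<beta> E\<close> for the class of \<open>E\<^sub>1 \<rightarrow> E\<^sub>0\<close> in critical K-theory, the point is that \<open>\<beta> E = 0\<close> as soon as the
  two-periodic complex of \<open>E\<close> is exact at every point of the zero fibre. With hermitian metrics and
  \<open>\<psi>\<close> the adjoint of \<open>\<phi>\<^sub>0\<close>, the map \<open>\<phi>\<^sub>1 - s \<psi>\<close> is invertible where \<open>Re w < 0\<close>, for all \<open>s \<ge> 0\<close>, and
  also along the zero fibre if \<open>s > 0\<close>; so it is a homotopy, over a neighbourhood of the zero fibre,
  from the complex of \<open>E\<close> to an exact one. The triangulated structure enters only through fibrewise
  cohomology along \<open>w = 0\<close>: objects of \<open>Acyc\<close> are fibrewise exact there, isomorphisms of \<open>MF\<close>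
  are roofs of fibrewise quasi-isomorphisms, and the cone of such a map is fibrewise exact. As
  \<open>\<beta>\<close> of a cone is \<open>\<beta> F + \<beta> (E[1])\<close> and the cone of an identity is exact, \<open>\<beta> (E[1]) = - \<beta> E\<close>, and
  \<open>\<beta>\<close> is additive on triangles.\<close>

section \<open>Forms and regular functions\<close>

text \<open>The vanishing fails over \<open>(Y, Y - X)\<close>: on the affine line with
  \<open>w\<close> the coordinate, the contractible factorization \<open>\<phi>\<^sub>0 = 1\<close>,
  \<open>\<phi>\<^sub>1 = w\<close> gives a generator there, by the winding of \<open>w\<close>. The
  half plane removes this: a kernel vector of \<open>\<phi>\<^sub>1 - s \<psi>\<close> forces
  \<open>w\<close> to be real and nonnegative, so the homotopy may degenerate over
  \<open>w > 0\<close> but never over \<open>Re w < 0\<close>. At \<open>s = 1\<close> invertibility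
  is an open condition that holds along the zero fibre, hence the neighbourhood and the direct
  limit. A second obstacle is that exactness in the definition of \<open>Acyc\<close> is exactness
  of sheaves, which need not survive in fibres; bounded complexes of locally free sheaves split
  locally by regular maps, and a splitting can be evaluated at a point. Finally, morphisms of
  \<open>MF\<close> are classes of roofs; cohomology turns them into injective and surjective maps
  of sets, where two-out-of-three is elementary. For \<open>\<psi>\<close> to be continuous, metrics
  are glued by partitions of unity, and a positive form on the dual of \<open>E\<^sub>0\<close>
  stands in for an inverse metric.\<close>

lemma finite_exponents: "finite {m :: 'n::finite \<Rightarrow> nat. (\<Sum>i\<in>UNIV. m i) = d}"
proof (rule finite_subset)
  show "{m :: 'n \<Rightarrow> nat. (\<Sum>i\<in>UNIV. m i) = d} \<subseteq> PiE UNIV (\<lambda>_. {..d})"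
    by (auto simp: member_le_sum)
qed (rule finite_PiE; simp)

lemma form_const: "form 0 (\<lambda>_::complex^'n::finite. c)"
proof -
  have "{m :: 'n \<Rightarrow> nat. (\<Sum>i\<in>UNIV. m i) = 0} = {\<lambda>_. 0}" by auto
  then show ?thesis unfolding form_def by (intro exI[of _ "\<lambda>_. c"]) simp
qed

lemma form_add: "form d f \<Longrightarrow> form d g \<Longrightarrow> form d (\<lambda>v. f v + g v)"
  unfolding form_def
  apply (elim exE)
  subgoal for c c' by (rule exI[of _ "\<lambda>m. c m + c' m"]) (simp add: sum.distrib distrib_right)
  done

text \<open>Collecting the pairs of exponents by their sum gives the coefficients \<open>c\<close>,
  the convolution of \<open>a\<close> and \<open>b\<close>.\<close>

lemma form_mult:
  fixes f g :: "complex^'n::finite \<Rightarrow> complex"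
  assumes "form d f" and "form e g"
  shows "form (d + e) (\<lambda>v. f v * g v)"
proof -
  define M where "M \<equiv> \<lambda>d. {m :: 'n \<Rightarrow> nat. (\<Sum>i\<in>UNIV. m i) = d}"
  define mono where "mono \<equiv> \<lambda>(m :: 'n \<Rightarrow> nat) (v :: complex^'n). \<Prod>i\<in>UNIV. vec_nth v i ^ m i"
  have fin: "finite (M d)" for d unfolding M_def by (rule finite_exponents)
  obtain a b where a: "\<And>v. f v = (\<Sum>m\<in>M d. a m * mono m v)" and b: "\<And>v. g v = (\<Sum>m\<in>M e. b m * mono m v)"
    using assms unfolding form_def M_def mono_def by blast
  let ?s = "\<lambda>(m::'n \<Rightarrow> nat, m'). (\<lambda>i. m i + m' i)"
  define c where "c \<equiv> \<lambda>m. \<Sum>p | p \<in> M d \<times> M e \<and> ?s p = m. a (fst p) * b (snd p)"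
  have "f v * g v = (\<Sum>m\<in>M (d + e). c m * mono m v)" for v
  proof -
    have "f v * g v = (\<Sum>p\<in>M d \<times> M e. a (fst p) * b (snd p) * mono (?s p) v)"
      by (simp add: a b sum_product sum.cartesian_product case_prod_beta mono_def power_add prod.distrib mult_ac)
    also have "\<dots> = (\<Sum>m\<in>M (d + e). \<Sum>p | p \<in> M d \<times> M e \<and> ?s p = m. a (fst p) * b (snd p) * mono (?s p) v)"
      by (rule sum.group[symmetric]) (use fin in \<open>auto simp: M_def sum.distrib\<close>)
    also have "\<dots> = (\<Sum>m\<in>M (d + e). c m * mono m v)"
      unfolding c_def by (intro sum.cong refl) (auto simp: sum_distrib_right intro!: sum.cong)
    finally show ?thesis .
  qed
  then show ?thesis unfolding form_def M_def mono_def by blast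
qed

lemma form_homogeneous: "form d f \<Longrightarrow> f (c *s v) = c ^ d * f v"
  unfolding form_def
  by (auto simp: sum_distrib_left power_mult_distrib prod.distrib mult_ac simp flip: power_sum intro!: sum.cong)

lemma continuous_form:
  assumes "form d f" shows "continuous_on A f"
proof -
  obtain c where "\<And>v. f v = (\<Sum>m | (\<Sum>i\<in>UNIV. m i) = d. c m * (\<Prod>i\<in>UNIV. vec_nth v i ^ m i))"
    using assms unfolding form_def by blast
  then have "f = (\<lambda>v. \<Sum>m | (\<Sum>i\<in>UNIV. m i) = d. c m * (\<Prod>i\<in>UNIV. vec_nth v i ^ m i))" by blast
  then show ?thesis by (simp only:) (intro continuous_intros)
qed

lemma proj_surj: obtains v where "v \<noteq> 0" "proj v = p"
proof -
  have "proportional (rep_cproj p) (rep_cproj p)" "proj (rep_cproj p) = p"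
    unfolding proj_def using Quotient3_rep_reflp[OF Quotient3_cproj] Quotient3_abs_rep[OF Quotient3_cproj] by auto
  then show ?thesis using that unfolding proportional_def by blast
qed

lemma proj_eq_iff: "v \<noteq> 0 \<Longrightarrow> v' \<noteq> 0 \<Longrightarrow> proj v = proj v' \<longleftrightarrow> (\<exists>c. c \<noteq> 0 \<and> v' = c *s v)"
  using Quotient3_rel[OF Quotient3_cproj, of v v'] unfolding proj_def proportional_def
  by (auto dest: spec[of _ 1])

text \<open>Homogeneity makes vanishing independent of the representative, so zero loci may be
  tested on a single vector of each line.\<close>

lemma vanishes_proj:
  assumes "form d f" "v \<noteq> 0" shows "vanishes f (proj v) \<longleftrightarrow> f v = 0"
  using assms unfolding vanishes_def
  by (metis form_homogeneous proj_eq_iff mult_zero_right)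

lemma proj_in_zero_set_iff:
  assumes "\<And>f. f \<in> S \<Longrightarrow> \<exists>d. form d f" "v \<noteq> 0"
  shows "proj v \<in> {p. \<forall>f\<in>S. vanishes f p} \<longleftrightarrow> (\<forall>f\<in>S. f v = 0)"
  using assms vanishes_proj by blast

text \<open>The products of one form from each family cut out the union: if some \<open>f\<close>
  and some \<open>g\<close> are nonzero at \<open>v\<close>, so is their product.\<close>

lemma zariski_closed_Un:
  fixes Z Z' :: "'n::finite cproj set"
  assumes "zariski_closed Z" "zariski_closed Z'" shows "zariski_closed (Z \<union> Z')"
proof -
  obtain S S' where S: "\<And>f. f \<in> S \<Longrightarrow> \<exists>d. form d f" "Z = {p. \<forall>f\<in>S. vanishes f p}"
    and S': "\<And>f. f \<in> S' \<Longrightarrow> \<exists>d. form d f" "Z' = {p. \<forall>f\<in>S'. vanishes f p}"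
    using assms unfolding zariski_closed_def by blast
  define T where "T = (\<Union>f\<in>S. (\<lambda>g v. f v * g v) ` S')"
  have ball: "(\<forall>h\<in>T. P h) \<longleftrightarrow> (\<forall>f\<in>S. \<forall>g\<in>S'. P (\<lambda>v. f v * g v))" for P
    unfolding T_def by simp
  have T: "\<forall>h\<in>T. \<exists>d. form d h"
    unfolding ball
  proof (intro ballI)
    fix f g assume "f \<in> S" "g \<in> S'"
    then obtain d e where "form d f" "form e g" using S(1) S'(1) by meson
    then show "\<exists>d. form d (\<lambda>v. f v * g v)" using form_mult by blast
  qed
  have "Z \<union> Z' = {p. \<forall>f\<in>T. vanishes f p}"
  proof (intro Set.set_eqI)
    fix p :: "'n cproj" obtain v where v: "v \<noteq> 0" "proj v = p" by (rule proj_surj)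
    have "p \<in> Z \<union> Z' \<longleftrightarrow> (\<forall>f\<in>S. f v = 0) \<or> (\<forall>f\<in>S'. f v = 0)"
      using proj_in_zero_set_iff[OF S(1) v(1)] proj_in_zero_set_iff[OF S'(1) v(1)]
      by (simp only: Un_iff S(2) S'(2) v(2) [symmetric])
    also have "\<dots> \<longleftrightarrow> (\<forall>h\<in>T. h v = 0)" unfolding ball by auto
    also have "\<dots> \<longleftrightarrow> p \<in> {p. \<forall>f\<in>T. vanishes f p}"
      by (subst v(2)[symmetric], rule sym, rule proj_in_zero_set_iff[OF bspec[OF T] v(1)])
    finally show "p \<in> Z \<union> Z' \<longleftrightarrow> p \<in> {p. \<forall>f\<in>T. vanishes f p}" .
  qed
  then show ?thesis unfolding zariski_closed_def using T by blast
qed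

lemma zariski_open_UNIV [simp]: "zariski_open UNIV"
proof -
  have "{p :: 'a cproj. \<forall>f\<in>{\<lambda>_. 1}. vanishes f p} = {}"
    by (auto simp: vanishes_def) (metis proj_surj)
  then show ?thesis unfolding zariski_open_def zariski_closed_def
    by (intro exI[of _ "{\<lambda>_. 1}"]) (use form_const in auto)
qed

lemma zariski_open_Int: "zariski_open U \<Longrightarrow> zariski_open U' \<Longrightarrow> zariski_open (U \<inter> U')"
  unfolding zariski_open_def by (simp add: zariski_closed_Un)

text \<open>In the punctured vector space the set becomes a union of loci where a polynomial does
  not vanish.\<close>

lemma zariski_open_imp_open:
  assumes "zariski_open (U :: 'n::finite cproj set)" shows "open U"
proof -
  obtain S where S: "\<And>f. f \<in> S \<Longrightarrow> \<exists>d. form d f" "- U = {p. \<forall>f\<in>S. vanishes f p}"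
    using assms unfolding zariski_open_def zariski_closed_def by blast
  have "proj v \<in> - U \<longleftrightarrow> (\<forall>f\<in>S. f v = 0)" if "v \<noteq> 0" for v
    unfolding S(2) using S(1) that by (rule proj_in_zero_set_iff)
  then have "proj v \<in> U \<longleftrightarrow> (\<exists>f\<in>S. f v \<noteq> 0)" if "v \<noteq> 0" for v
    using that by (simp only: Compl_iff) metis
  then have "{v. v \<noteq> 0 \<and> proj v \<in> U} = (\<Union>f\<in>S. {v. f v \<noteq> 0} - {0})"
    by (intro Set.set_eqI) (simp only: mem_Collect_eq UN_iff Diff_iff singleton_iff, metis)
  moreover have "open {v. f v \<noteq> 0}" if "f \<in> S" for f
  proof -
    obtain d where "form d f" using S(1)[OF \<open>f \<in> S\<close>] by blast
    then show ?thesis by (intro open_Collect_neq continuous_on_const continuous_form)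
  qed
  ultimately show ?thesis unfolding open_cproj_def by (simp only:) (intro open_UN open_Diff ballI closed_singleton)
qed

section \<open>Relative Zariski opens and the ring of regular functions\<close>

lemma zopen_in_refl [simp]: "zopen_in Y Y"
  unfolding zopen_in_def by (intro exI[of _ UNIV]) auto

lemma zopen_in_subset: "zopen_in Y V \<Longrightarrow> V \<subseteq> Y"
  unfolding zopen_in_def by blast

lemma zopen_in_Int: "zopen_in Y V \<Longrightarrow> zopen_in Y W \<Longrightarrow> zopen_in Y (V \<inter> W)"
  unfolding zopen_in_def by (metis zariski_open_Int inf_assoc inf_left_commute inf_left_idem)

lemma zopen_in_trans: "zopen_in Y W \<Longrightarrow> zopen_in W V \<longleftrightarrow> zopen_in Y V \<and> V \<subseteq> W"
  unfolding zopen_in_def by (auto intro: zariski_open_Int)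

text \<open>The extra factor \<open>Y\<close> keeps the empty intersection inside \<open>Y\<close>;
  that case occurs below for a frame of rank 0.\<close>

lemma zopen_in_INT:
  "finite J \<Longrightarrow> (\<And>j. j \<in> J \<Longrightarrow> zopen_in Y (V j)) \<Longrightarrow> zopen_in Y (Y \<inter> (\<Inter>j\<in>J. V j))"
proof (induction rule: finite_induct)
  case (insert j J)
  then have "zopen_in Y (V j \<inter> (Y \<inter> (\<Inter>j\<in>J. V j)))" by (intro zopen_in_Int[of Y "V j"]) auto
  also have "V j \<inter> (Y \<inter> (\<Inter>j\<in>J. V j)) = Y \<inter> (\<Inter>j\<in>insert j J. V j)" by auto
  finally show ?case .
qed auto

lemma zopen_in_openin: "zopen_in Y V \<Longrightarrow> openin (top_of_set Y) V"
  unfolding zopen_in_def openin_open using zariski_open_imp_open by blast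

lemma regular_on_subset:
  assumes "regular_on V f" "W \<subseteq> V" shows "regular_on W f"
  unfolding regular_on_def
proof
  fix p assume "p \<in> W"
  then have p: "p \<in> V" using assms(2) by blast
  obtain U d a b where U: "zariski_open U" "p \<in> U" "form d a" "form d b"
     "\<forall>v. v \<noteq> 0 \<and> proj v \<in> V \<inter> U \<longrightarrow> b v \<noteq> 0 \<and> f (proj v) = a v / b v"
    using assms(1) p unfolding regular_on_def by meson
  have "\<forall>v. v \<noteq> 0 \<and> proj v \<in> W \<inter> U \<longrightarrow> b v \<noteq> 0 \<and> f (proj v) = a v / b v"
    using U(5) assms(2) by auto
  with U(1-4) show "\<exists>U d a b. zariski_open U \<and> p \<in> U \<and> form d a \<and> form d b \<and>
     (\<forall>v. v \<noteq> 0 \<and> proj v \<in> W \<inter> U \<longrightarrow> b v \<noteq> 0 \<and> f (proj v) = a v / b v)"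
    by meson
qed

lemma regular_on_cong: "regular_on V f \<Longrightarrow> (\<And>p. p \<in> V \<Longrightarrow> f p = g p) \<Longrightarrow> regular_on V g"
  unfolding regular_on_def by (metis Int_iff)

lemma regular_on_const: "regular_on V (\<lambda>_. c)"
  unfolding regular_on_def
  by (intro ballI exI[of _ UNIV] exI[of _ 0] exI[of _ "\<lambda>_. c"] exI[of _ "\<lambda>_. 1"]) (auto intro: form_const)

text \<open>Sum and product share the denominator \<open>b v * b' v\<close>, a form of degree
  \<open>d + d'\<close>, and are therefore treated together.\<close>

lemma regular_on_add: "regular_on V f \<Longrightarrow> regular_on V g \<Longrightarrow> regular_on V (\<lambda>p. f p + g p)" (is "_ \<Longrightarrow> _ \<Longrightarrow> ?add")
  and regular_on_mult: "regular_on V f \<Longrightarrow> regular_on V g \<Longrightarrow> regular_on V (\<lambda>p. f p * g p)" (is "_ \<Longrightarrow> _ \<Longrightarrow> ?mult")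
proof -
  assume fg: "regular_on V f" "regular_on V g"
  have "\<exists>U d n m b. zariski_open U \<and> p \<in> U \<and> form d n \<and> form d m \<and> form d b \<and>
     (\<forall>v. v \<noteq> 0 \<and> proj v \<in> V \<inter> U \<longrightarrow> b v \<noteq> 0 \<and> f (proj v) + g (proj v) = n v / b v \<and> f (proj v) * g (proj v) = m v / b v)"
    if p: "p \<in> V" for p
  proof -
    obtain U d a b where U: "zariski_open U" "p \<in> U" "form d a" "form d b"
      "\<And>v. v \<noteq> 0 \<Longrightarrow> proj v \<in> V \<inter> U \<Longrightarrow> b v \<noteq> 0 \<and> f (proj v) = a v / b v"
      using fg(1) p unfolding regular_on_def by meson
    obtain U' d' a' b' where U': "zariski_open U'" "p \<in> U'" "form d' a'" "form d' b'"
      "\<And>v. v \<noteq> 0 \<Longrightarrow> proj v \<in> V \<inter> U' \<Longrightarrow> b' v \<noteq> 0 \<and> g (proj v) = a' v / b' v"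
      using fg(2) p unfolding regular_on_def by meson
    have "form (d + d') (\<lambda>v. a v * b' v + b v * a' v)" "form (d + d') (\<lambda>v. a v * a' v)" "form (d + d') (\<lambda>v. b v * b' v)"
      using U U' by (auto intro!: form_add form_mult)
    moreover have "zariski_open (U \<inter> U')" "p \<in> U \<inter> U'" using U U' by (auto intro: zariski_open_Int)
    moreover have "b v * b' v \<noteq> 0 \<and> f (proj v) + g (proj v) = (a v * b' v + b v * a' v) / (b v * b' v) \<and>
        f (proj v) * g (proj v) = (a v * a' v) / (b v * b' v)"
      if "v \<noteq> 0" "proj v \<in> V \<inter> (U \<inter> U')" for v
      using U(5)[of v] U'(5)[of v] that by (auto simp: field_simps)
    ultimately show ?thesis by meson
  qed
  then show ?add ?mult unfolding regular_on_def by meson+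
qed

lemma regular_on_sum: "(\<And>i. i \<in> I \<Longrightarrow> regular_on V (f i)) \<Longrightarrow> regular_on V (\<lambda>p. \<Sum>i\<in>I. f i p)"
  by (induction I rule: infinite_finite_induct) (auto intro: regular_on_add regular_on_const)

text \<open>The vectors on lines that meet \<open>N\<close> are swept out by the rescalings of
  \<open>N\<close>, each of which is open. So \<open>proj\<close> is an open map away from
  0.\<close>

lemma open_proj_image:
  assumes "open N" "0 \<notin> N" shows "open (proj ` (N :: (complex^'n::finite) set))"
proof -
  have "{v. v \<noteq> 0 \<and> proj v \<in> proj ` N} = (\<Union>c\<in>-{0}. (\<lambda>v. c *s v) -` N)"
  proof (intro Set.set_eqI iffI)
    fix v assume "v \<in> {v. v \<noteq> 0 \<and> proj v \<in> proj ` N}"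
    then obtain u where "u \<in> N" "proj v = proj u" "v \<noteq> 0" by auto
    then show "v \<in> (\<Union>c\<in>-{0}. (\<lambda>v. c *s v) -` N)"
      using assms(2) proj_eq_iff[of v u] by fastforce
  next
    fix v assume "v \<in> (\<Union>c\<in>-{0}. (\<lambda>v. c *s v) -` N)"
    then obtain c where c: "c \<noteq> 0" "c *s v \<in> N" by auto
    then have "v \<noteq> 0" "c *s v \<noteq> 0" using assms(2) by (auto intro: ccontr)
    then show "v \<in> {v. v \<noteq> 0 \<and> proj v \<in> proj ` N}"
      using c proj_eq_iff[of v "c *s v"] by auto
  qed
  moreover have "open ((\<lambda>v. c *s v) -` N)" for c :: complex
  proof (rule open_vimage[OF assms(1)])
    have "continuous_on UNIV (\<lambda>v::complex^'n. \<chi> i. c * vec_nth v i)" by (intro continuous_intros)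
    then show "continuous_on UNIV (\<lambda>v::complex^'n. c *s v)"
      by (simp add: vector_scalar_mult_def)
  qed
  ultimately show ?thesis unfolding open_cproj_def by auto
qed

text \<open>Because \<open>proj\<close> is open and not merely a quotient map, local lifts to the
  vector space decide continuity on an arbitrary subset \<open>V\<close>, whose preimage may be far
  from open; the lift has to agree with \<open>f\<close> over \<open>V\<close> only.\<close>

lemma continuous_on_cproj_iff:
  fixes V :: "'n::finite cproj set" and f :: "'n cproj \<Rightarrow> 'b::topological_space"
  assumes "\<And>v0. v0 \<noteq> 0 \<Longrightarrow> proj v0 \<in> V \<Longrightarrow> \<exists>U F. open U \<and> v0 \<in> U \<and> 0 \<notin> U \<and> continuous_on U F \<and>
            (\<forall>v\<in>U. proj v \<in> V \<longrightarrow> f (proj v) = F v)"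
  shows "continuous_on V f"
  unfolding continuous_on_topological
proof (intro ballI allI impI)
  fix p T assume p: "p \<in> V" "open T" "f p \<in> T"
  obtain v0 where v0: "v0 \<noteq> 0" "proj v0 = p" by (rule proj_surj)
  obtain U F where U: "open U" "v0 \<in> U" "0 \<notin> U" "continuous_on U F" "\<forall>v\<in>U. proj v \<in> V \<longrightarrow> f (proj v) = F v"
    using assms[of v0] v0 p by blast
  let ?N = "F -` T \<inter> U"
  have "open ?N" by (metis U(1,4) p(2) continuous_on_open_vimage)
  then have "open (proj ` ?N)" using U(3) by (intro open_proj_image) auto
  moreover have "p \<in> proj ` ?N" using U v0 p by force
  moreover have "f q \<in> T" if "q \<in> V" "q \<in> proj ` ?N" for q using that U(5) by auto
  ultimately show "\<exists>A. open A \<and> p \<in> A \<and> (\<forall>y\<in>V. y \<in> A \<longrightarrow> f y \<in> T)" by blast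
qed

lemma regular_on_continuous:
  assumes "regular_on (V :: 'n::finite cproj set) f" shows "continuous_on V f"
proof (rule continuous_on_cproj_iff)
  fix v0 :: "complex^'n" assume v0: "v0 \<noteq> 0" "proj v0 \<in> V"
  obtain U d a b where U: "zariski_open U" "proj v0 \<in> U" "form d a" "form d b"
     "\<And>v. v \<noteq> 0 \<Longrightarrow> proj v \<in> V \<inter> U \<Longrightarrow> b v \<noteq> 0 \<and> f (proj v) = a v / b v"
    using assms v0 unfolding regular_on_def by meson
  let ?U = "{v. v \<noteq> 0 \<and> proj v \<in> U} \<inter> {v. b v \<noteq> 0}"
  have "open ?U"
    by (intro open_Int open_Collect_neq continuous_form[OF U(4)] continuous_on_const)
      (use zariski_open_imp_open[OF U(1)] in \<open>simp add: open_cproj_def\<close>)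
  moreover have "continuous_on ?U (\<lambda>v. a v / b v)"
    by (intro continuous_intros continuous_form[OF U(3)] continuous_form[OF U(4)]) auto
  ultimately show "\<exists>U F. open U \<and> v0 \<in> U \<and> 0 \<notin> U \<and> continuous_on U F \<and>
            (\<forall>v\<in>U. proj v \<in> V \<longrightarrow> f (proj v) = F v)"
    by (intro exI[of _ ?U] exI[of _ "\<lambda>v. a v / b v"]) (use U v0 in auto)
qed

section \<open>Locally free sheaves\<close>

definition reg_vec :: "'n::finite cproj set \<Rightarrow> nat \<Rightarrow> ('n cproj \<Rightarrow> complex Matrix.vec) \<Rightarrow> bool" where
  "reg_vec W r a \<longleftrightarrow> (\<forall>y\<in>W. a y \<in> carrier_vec r) \<and> (\<forall>i. regular_on W (\<lambda>y. ventry (a y) i))"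

definition reg_mat :: "'n::finite cproj set \<Rightarrow> nat \<Rightarrow> nat \<Rightarrow> ('n cproj \<Rightarrow> complex mat) \<Rightarrow> bool" where
  "reg_mat W m n h \<longleftrightarrow> (\<forall>y\<in>W. h y \<in> carrier_mat m n) \<and> (\<forall>i j. regular_on W (\<lambda>y. entry (h y) i j))"

lemma reg_vecI:
  assumes "\<And>y. y \<in> W \<Longrightarrow> a y \<in> carrier_vec r" "\<And>i. i < r \<Longrightarrow> regular_on W (\<lambda>y. vec_index (a y) i)"
  shows "reg_vec W r a"
  unfolding reg_vec_def
proof (intro conjI ballI allI assms)
  fix i show "regular_on W (\<lambda>y. ventry (a y) i)"
  proof (cases "i < r")
    case True then show ?thesis
      using assms by (intro regular_on_cong[OF assms(2)]) (auto simp: ventry_def carrier_vecD[OF assms(1)])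
  next
    case False then show ?thesis
      using assms(1) by (intro regular_on_cong[OF regular_on_const[of W 0]]) (auto simp: ventry_def carrier_vecD[OF assms(1)])
  qed
qed

lemma reg_vecD:
  assumes "reg_vec W r a"
  shows "y \<in> W \<Longrightarrow> a y \<in> carrier_vec r" "i < r \<Longrightarrow> regular_on W (\<lambda>y. vec_index (a y) i)"
proof -
  show 1: "y \<in> W \<Longrightarrow> a y \<in> carrier_vec r" for y using assms by (auto simp: reg_vec_def)
  show "regular_on W (\<lambda>y. vec_index (a y) i)" if "i < r"
  proof (rule regular_on_cong)
    show "regular_on W (\<lambda>y. ventry (a y) i)" using assms by (auto simp: reg_vec_def)
  qed (use that in \<open>auto simp: ventry_def carrier_vecD[OF 1]\<close>)
qed

lemma reg_matI:
  assumes "\<And>y. y \<in> W \<Longrightarrow> h y \<in> carrier_mat m n"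
    "\<And>i j. i < m \<Longrightarrow> j < n \<Longrightarrow> regular_on W (\<lambda>y. h y $$ (i, j))"
  shows "reg_mat W m n h"
  unfolding reg_mat_def
proof (intro conjI ballI allI assms)
  fix i j show "regular_on W (\<lambda>y. entry (h y) i j)"
  proof (cases "i < m \<and> j < n")
    case True then show ?thesis
      using assms by (intro regular_on_cong[OF assms(2)]) (auto simp: entry_def carrier_matD[OF assms(1)])
  next
    case False then show ?thesis
      using assms(1) by (intro regular_on_cong[OF regular_on_const[of W 0]]) (auto simp: entry_def carrier_matD[OF assms(1)])
  qed
qed

lemma reg_matD:
  assumes "reg_mat W m n h"
  shows "y \<in> W \<Longrightarrow> h y \<in> carrier_mat m n" "i < m \<Longrightarrow> j < n \<Longrightarrow> regular_on W (\<lambda>y. h y $$ (i, j))"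
proof -
  show 1: "y \<in> W \<Longrightarrow> h y \<in> carrier_mat m n" for y using assms by (auto simp: reg_mat_def)
  show "regular_on W (\<lambda>y. h y $$ (i, j))" if "i < m" "j < n"
  proof (rule regular_on_cong)
    show "regular_on W (\<lambda>y. entry (h y) i j)" using assms by (auto simp: reg_mat_def)
  qed (use that in \<open>auto simp: entry_def carrier_matD[OF 1]\<close>)
qed

lemma reg_vec_subset: "reg_vec W r a \<Longrightarrow> W' \<subseteq> W \<Longrightarrow> reg_vec W' r a"
  unfolding reg_vec_def using regular_on_subset by blast

lemma reg_mat_mult_vec:
  assumes "reg_mat W m n h" "reg_vec W n a" shows "reg_vec W m (\<lambda>y. h y *\<^sub>v a y)"
proof (rule reg_vecI)
  fix i assume i: "i < m"
  have "regular_on W (\<lambda>y. \<Sum>j\<in>{0..<n}. h y $$ (i, j) * vec_index (a y) j)"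
    using i by (intro regular_on_sum regular_on_mult reg_matD[OF assms(1)] reg_vecD[OF assms(2)]) auto
  then show "regular_on W (\<lambda>y. vec_index (h y *\<^sub>v a y) i)"
    using i carrier_matD[OF reg_matD(1)[OF assms(1)]] carrier_vecD[OF reg_vecD(1)[OF assms(2)]]
    by (elim regular_on_cong) (simp add: scalar_prod_def)
qed (rule mult_mat_vec_carrier[OF reg_matD(1)[OF assms(1)] reg_vecD(1)[OF assms(2)]])

lemma reg_vec_lincomb:
  assumes "regular_on W f" "reg_vec W r a" "reg_vec W r b"
  shows "reg_vec W r (\<lambda>y. f y \<cdot>\<^sub>v a y + b y)"
proof (rule reg_vecI)
  fix i assume i: "i < r"
  have "regular_on W (\<lambda>y. f y * vec_index (a y) i + vec_index (b y) i)"
    using i by (intro regular_on_add regular_on_mult assms(1) reg_vecD[OF assms(2)] reg_vecD[OF assms(3)])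
  then show "regular_on W (\<lambda>y. vec_index (f y \<cdot>\<^sub>v a y + b y) i)"
    using carrier_vecD[OF reg_vecD(1)[OF assms(2)]] carrier_vecD[OF reg_vecD(1)[OF assms(3)]] i
    by (elim regular_on_cong) simp
qed (use reg_vecD(1)[OF assms(2)] reg_vecD(1)[OF assms(3)] in auto)

lemma reg_vec_const: "c \<in> carrier_vec r \<Longrightarrow> reg_vec W r (\<lambda>_. c)"
  by (intro reg_vecI regular_on_const)

lemma reg_vec_append:
  assumes "reg_vec W m a" "reg_vec W n b" shows "reg_vec W (m + n) (\<lambda>y. a y @\<^sub>v b y)"
proof (rule reg_vecI)
  fix i assume i: "i < m + n"
  note d = carrier_vecD[OF reg_vecD(1)[OF assms(1)]] carrier_vecD[OF reg_vecD(1)[OF assms(2)]]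
  show "regular_on W (\<lambda>y. vec_index (a y @\<^sub>v b y) i)"
  proof (cases "i < m")
    case True
    show ?thesis
      using d i True by (intro regular_on_cong[OF reg_vecD(2)[OF assms(1) True]]) simp
  next
    case False
    then have "i - m < n" using i by simp
    then show ?thesis
      using d i False by (intro regular_on_cong[OF reg_vecD(2)[OF assms(2), of "i - m"]]) simp_all
  qed
qed (use reg_vecD(1)[OF assms(1)] reg_vecD(1)[OF assms(2)] in auto)

lemma reg_vec_split:
  assumes "reg_vec W (m + n) c"
  shows "reg_vec W m (\<lambda>y. vec_first (c y) m)" "reg_vec W n (\<lambda>y. vec_last (c y) n)"
proof -
  show "reg_vec W m (\<lambda>y. vec_first (c y) m)"
    using reg_vecD(1)[OF assms]
    by (intro reg_vecI regular_on_cong[OF reg_vecD(2)[OF assms]]) (auto simp: vec_first_def)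
  show "reg_vec W n (\<lambda>y. vec_last (c y) n)"
  proof (rule reg_vecI)
    fix i assume i: "i < n"
    have d: "\<And>y. y \<in> W \<Longrightarrow> dim_vec (c y) = m + n" using reg_vecD(1)[OF assms] by auto
    show "regular_on W (\<lambda>y. vec_index (vec_last (c y) n) i)"
      using reg_vecD(1)[OF assms] i
      by (intro regular_on_cong[OF reg_vecD(2)[OF assms, of "m + i"]]) (auto simp: vec_last_def d)
  qed auto
qed

lemma invertible_matE:
  assumes "invertible_mat (g :: complex mat)" "g \<in> carrier_mat r r"
  obtains g' where "g' \<in> carrier_mat r r" "g * g' = 1\<^sub>m r" "g' * g = 1\<^sub>m r"
proof -
  obtain B where B: "inverts_mat g B" "inverts_mat B g" using assms(1) unfolding invertible_mat_def by blast
  have 1: "g * B = 1\<^sub>m r" "B * g = 1\<^sub>m (dim_row B)" using B assms(2) unfolding inverts_mat_def by auto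
  have "dim_col B = r" using arg_cong[OF 1(1), of dim_col] by simp
  moreover have "dim_row B = r" using arg_cong[OF 1(2), of dim_col] assms(2) by simp
  ultimately show ?thesis using that[of B] 1 by auto
qed

lemma invertible_matI:
  assumes "g \<in> carrier_mat r r" "g' \<in> carrier_mat r r" "g * g' = 1\<^sub>m r" "g' * g = 1\<^sub>m r"
  shows "invertible_mat (g :: complex mat)"
  using assms unfolding invertible_mat_def inverts_mat_def square_mat.simps by fastforce

section \<open>Frames and sections of a locally free sheaf\<close>

lemma local_frame_iff:
  "local_frame Y E V g \<longleftrightarrow> zopen_in Y V \<and> (\<exists>r.
     (\<forall>y\<in>V. rk E y = r \<and> g y \<in> carrier_mat r r \<and> invertible_mat (g y)) \<and>
     (\<forall>W. zopen_in Y W \<and> W \<subseteq> V \<longrightarrow> sec E W = {(\<lambda>y\<in>W. g y *\<^sub>v a y) | a. reg_vec W r a}))"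
  by (simp only: local_frame_def reg_vec_def)

lemma local_frameE:
  assumes "local_frame Y E V g"
  obtains r where "zopen_in Y V"
    "\<And>y. y \<in> V \<Longrightarrow> rk E y = r" "\<And>y. y \<in> V \<Longrightarrow> g y \<in> carrier_mat r r" "\<And>y. y \<in> V \<Longrightarrow> invertible_mat (g y)"
    "\<And>W. zopen_in Y W \<Longrightarrow> W \<subseteq> V \<Longrightarrow> sec E W = {(\<lambda>y\<in>W. g y *\<^sub>v a y) | a. reg_vec W r a}"
proof -
  from assms obtain r where "zopen_in Y V"
    "\<forall>y\<in>V. rk E y = r \<and> g y \<in> carrier_mat r r \<and> invertible_mat (g y)"
    "\<forall>W. zopen_in Y W \<and> W \<subseteq> V \<longrightarrow> sec E W = {(\<lambda>y\<in>W. g y *\<^sub>v a y) | a. reg_vec W r a}"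
    unfolding local_frame_iff by (elim conjE exE) (rule that; assumption)
  then show ?thesis by (intro that[of r]) simp_all
qed

lemma local_frameI:
  assumes "zopen_in Y V"
    "\<And>y. y \<in> V \<Longrightarrow> rk E y = r" "\<And>y. y \<in> V \<Longrightarrow> g y \<in> carrier_mat r r" "\<And>y. y \<in> V \<Longrightarrow> invertible_mat (g y)"
    "\<And>W. zopen_in Y W \<Longrightarrow> W \<subseteq> V \<Longrightarrow> sec E W = {(\<lambda>y\<in>W. g y *\<^sub>v a y) | a. reg_vec W r a}"
  shows "local_frame Y E V g"
  unfolding local_frame_iff
  by (intro conjI exI[of _ r] ballI allI impI assms) auto

lemma local_frame_subset:
  assumes "local_frame Y E V g" "zopen_in Y W" "W \<subseteq> V" shows "local_frame Y E W g"
proof -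
  obtain r where r: "zopen_in Y V"
    "\<And>y. y \<in> V \<Longrightarrow> rk E y = r" "\<And>y. y \<in> V \<Longrightarrow> g y \<in> carrier_mat r r" "\<And>y. y \<in> V \<Longrightarrow> invertible_mat (g y)"
    "\<And>W. zopen_in Y W \<Longrightarrow> W \<subseteq> V \<Longrightarrow> sec E W = {(\<lambda>y\<in>W. g y *\<^sub>v a y) | a. reg_vec W r a}"
    using assms(1) by (rule local_frameE) (rule that; simp)
  show ?thesis
    using assms(3) by (intro local_frameI[of _ _ _ r] assms(2) r) auto
qed

lemma locally_freeD:
  assumes "locally_free Y E"
  shows "\<forall>V s. zopen_in Y V \<and> s \<in> sec E V \<longrightarrow> s \<in> extensional V \<and> (\<forall>y\<in>V. s y \<in> carrier_vec (rk E y))"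
    "\<forall>V W s. zopen_in Y V \<and> zopen_in Y W \<and> W \<subseteq> V \<and> s \<in> sec E V \<longrightarrow> restrict s W \<in> sec E W"
    "\<forall>\<V> s. (\<forall>V\<in>\<V>. zopen_in Y V \<and> restrict s V \<in> sec E V) \<and> s \<in> extensional (\<Union>\<V>) \<longrightarrow> s \<in> sec E (\<Union>\<V>)"
    "\<forall>y\<in>Y. \<exists>V g. y \<in> V \<and> local_frame Y E V g"
  subgoal by (rule conjunct1[OF assms[unfolded locally_free_def]])
  subgoal by (rule conjunct1[OF conjunct2[OF assms[unfolded locally_free_def]]])
  subgoal by (rule conjunct1[OF conjunct2[OF conjunct2[OF assms[unfolded locally_free_def]]]])
  subgoal by (rule conjunct2[OF conjunct2[OF conjunct2[OF assms[unfolded locally_free_def]]]])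
  done

lemma sec_extensional: "locally_free Y E \<Longrightarrow> zopen_in Y V \<Longrightarrow> s \<in> sec E V \<Longrightarrow> s \<in> extensional V"
  by (drule locally_freeD(1)) simp

lemma sec_carrier: "locally_free Y E \<Longrightarrow> zopen_in Y V \<Longrightarrow> s \<in> sec E V \<Longrightarrow> y \<in> V \<Longrightarrow> s y \<in> carrier_vec (rk E y)"
  by (drule locally_freeD(1)) simp

lemma sec_restrict:
  "locally_free Y E \<Longrightarrow> zopen_in Y V \<Longrightarrow> zopen_in Y W \<Longrightarrow> W \<subseteq> V \<Longrightarrow> s \<in> sec E V \<Longrightarrow> restrict s W \<in> sec E W"
  by (drule locally_freeD(2)) simp

lemma locally_free_frame:
  assumes "locally_free Y E" "zopen_in Y W" "y \<in> W"
  obtains V g where "y \<in> V" "V \<subseteq> W" "zopen_in Y V" "local_frame Y E V g"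
proof -
  have "y \<in> Y" using assms zopen_in_subset by blast
  then obtain V g where V: "y \<in> V" "local_frame Y E V g" using bspec[OF locally_freeD(4)[OF assms(1)]] by meson
  then have "zopen_in Y (V \<inter> W)" using assms(2) by (auto simp: local_frame_def intro: zopen_in_Int)
  with V show ?thesis using that[of "V \<inter> W" g] local_frame_subset assms(3) by blast
qed

text \<open>The gluing axiom is applied to the family of all opens on which \<open>s\<close>
  restricts to a section; by hypothesis it covers \<open>W\<close>.\<close>

lemma sec_local:
  assumes "locally_free Y E" "zopen_in Y W" "s \<in> extensional W"
    "\<And>y. y \<in> W \<Longrightarrow> \<exists>V. zopen_in Y V \<and> y \<in> V \<and> V \<subseteq> W \<and> restrict s V \<in> sec E V"
  shows "s \<in> sec E W"
proof -
  let ?V = "{V. zopen_in Y V \<and> V \<subseteq> W \<and> restrict s V \<in> sec E V}"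
  have U: "\<Union>?V = W" using assms(4) by blast
  show ?thesis
    using locally_freeD(3)[OF assms(1), rule_format, of ?V s] assms(3) unfolding U by simp
qed

lemma local_frame_secE:
  assumes "local_frame Y E V g"
  obtains r where "\<And>y. y \<in> V \<Longrightarrow> rk E y = r" "\<And>y. y \<in> V \<Longrightarrow> g y \<in> carrier_mat r r"
    "sec E V = {(\<lambda>y\<in>V. g y *\<^sub>v a y) | a. reg_vec V r a}"
  using assms by (rule local_frameE) (use that in blast)

text \<open>In a local frame \<open>g\<close> the columns of \<open>M\<close> become
  \<open>M = g B\<close> with \<open>B\<close> regular, so that \<open>M a = g (B a)\<close> is a
  section. The number \<open>n\<close> of columns is unrelated to the rank; later \<open>M\<close>
  will be a tuple of lifts through a differential.\<close>

lemma sec_mult_reg: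
  assumes E: "locally_free Y E" and W: "zopen_in Y W"
    and M: "\<And>y. y \<in> W \<Longrightarrow> M y \<in> carrier_mat (rk E y) n"
    and cols: "\<And>j. j < n \<Longrightarrow> (\<lambda>y\<in>W. col (M y) j) \<in> sec E W" and a: "reg_vec W n a"
  shows "(\<lambda>y\<in>W. M y *\<^sub>v a y) \<in> sec E W"
proof (rule sec_local[OF E W])
  fix y assume "y \<in> W"
  then obtain V g where V: "y \<in> V" "V \<subseteq> W" "zopen_in Y V" "local_frame Y E V g"
    using locally_free_frame[OF E W] by blast
  obtain r where r: "\<And>y. y \<in> V \<Longrightarrow> rk E y = r" "\<And>y. y \<in> V \<Longrightarrow> g y \<in> carrier_mat r r"
    "sec E V = {(\<lambda>y\<in>V. g y *\<^sub>v a y) | a. reg_vec V r a}"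
    using V(4) by (rule local_frame_secE) (rule that; simp)
  have "\<exists>b. reg_vec V r b \<and> restrict (\<lambda>y\<in>W. col (M y) j) V = (\<lambda>y\<in>V. g y *\<^sub>v b y)" if "j < n" for j
    using sec_restrict[OF E W V(3,2) cols[OF that]] r(3) by auto
  then obtain b where b: "\<And>j. j < n \<Longrightarrow> reg_vec V r (b j)"
    "\<And>j. j < n \<Longrightarrow> restrict (\<lambda>y\<in>W. col (M y) j) V = (\<lambda>y\<in>V. g y *\<^sub>v b j y)" by metis
  define B where "B y = Matrix.mat r n (\<lambda>(i, j). vec_index (b j y) i)" for y
  have B: "reg_mat V r n B"
    unfolding B_def by (rule reg_matI) (use reg_vecD(2)[OF b(1)] in auto)
  have MB: "M z = g z * B z" if z: "z \<in> V" for z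
  proof (rule mat_col_eqI)
    fix j assume j: "j < dim_col (g z * B z)"
    then have j: "j < n" by (simp add: B_def)
    have "col (M z) j = g z *\<^sub>v b j z" using fun_cong[OF b(2)[OF j], of z] z V(2) by auto
    moreover have "col (B z) j = b j z"
      using j reg_vecD(1)[OF b(1)[OF j] z] by (auto simp: B_def)
    moreover have "B z \<in> carrier_mat r n" by (simp add: B_def)
    ultimately show "col (M z) j = col (g z * B z) j"
      using j by (subst col_mult2[OF r(2)[OF z]]) auto
  next
    have "M z \<in> carrier_mat r n" using M V(2) z r(1) by auto
    then show "dim_row (M z) = dim_row (g z * B z)" "dim_col (M z) = dim_col (g z * B z)"
      using r(2)[OF z] by (auto simp: B_def)
  qed
  have "restrict (\<lambda>y\<in>W. M y *\<^sub>v a y) V = (\<lambda>y\<in>V. g y *\<^sub>v (B y *\<^sub>v a y))"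
  proof (rule ext)
    fix z
    show "restrict (\<lambda>y\<in>W. M y *\<^sub>v a y) V z = (\<lambda>y\<in>V. g y *\<^sub>v (B y *\<^sub>v a y)) z"
      using V(2) assoc_mult_mat_vec[OF r(2) reg_matD(1)[OF B] reg_vecD(1)[OF a], of z] MB[of z] by auto
  qed
  moreover have "reg_vec V r (\<lambda>y. B y *\<^sub>v a y)"
    by (rule reg_mat_mult_vec[OF B reg_vec_subset[OF a V(2)]])
  ultimately have "restrict (\<lambda>y\<in>W. M y *\<^sub>v a y) V \<in> sec E V"
    unfolding r(3) mem_Collect_eq by (intro exI conjI)
  with V show "\<exists>V. zopen_in Y V \<and> y \<in> V \<and> V \<subseteq> W \<and> restrict (\<lambda>y\<in>W. M y *\<^sub>v a y) V \<in> sec E V" by blast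
qed auto

lemma sec_lincomb:
  assumes E: "locally_free Y E" and W: "zopen_in Y W" and f: "regular_on W f"
    and s: "s \<in> sec E W" and t: "t \<in> sec E W"
  shows "(\<lambda>y\<in>W. f y \<cdot>\<^sub>v s y + t y) \<in> sec E W"
proof (rule sec_local[OF E W])
  fix y assume "y \<in> W"
  then obtain V g where V: "y \<in> V" "V \<subseteq> W" "zopen_in Y V" "local_frame Y E V g"
    using locally_free_frame[OF E W] by blast
  obtain r where r: "\<And>y. y \<in> V \<Longrightarrow> rk E y = r" "\<And>y. y \<in> V \<Longrightarrow> g y \<in> carrier_mat r r"
    "sec E V = {(\<lambda>y\<in>V. g y *\<^sub>v a y) | a. reg_vec V r a}"
    using V(4) by (rule local_frame_secE) (rule that; simp)
  obtain a b where a: "reg_vec V r a" "restrict s V = (\<lambda>y\<in>V. g y *\<^sub>v a y)"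
    and b: "reg_vec V r b" "restrict t V = (\<lambda>y\<in>V. g y *\<^sub>v b y)"
    using sec_restrict[OF E W V(3,2) s] sec_restrict[OF E W V(3,2) t] r(3) by auto
  have st: "s z = g z *\<^sub>v a z" "t z = g z *\<^sub>v b z" if "z \<in> V" for z
    using fun_cong[OF a(2), of z] fun_cong[OF b(2), of z] that by auto
  have "restrict (\<lambda>y\<in>W. f y \<cdot>\<^sub>v s y + t y) V = (\<lambda>y\<in>V. g y *\<^sub>v (f y \<cdot>\<^sub>v a y + b y))"
  proof (rule ext)
    fix z
    show "restrict (\<lambda>y\<in>W. f y \<cdot>\<^sub>v s y + t y) V z = (\<lambda>y\<in>V. g y *\<^sub>v (f y \<cdot>\<^sub>v a y + b y)) z"
    proof (cases "z \<in> V")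
      case True
      have "g z *\<^sub>v (f z \<cdot>\<^sub>v a z + b z) = f z \<cdot>\<^sub>v (g z *\<^sub>v a z) + g z *\<^sub>v b z"
        using r(2)[OF True] reg_vecD(1)[OF a(1) True] reg_vecD(1)[OF b(1) True]
        by (simp add: mult_add_distrib_mat_vec mult_mat_vec)
      then show ?thesis using True V(2) st by auto
    qed auto
  qed
  then have "restrict (\<lambda>y\<in>W. f y \<cdot>\<^sub>v s y + t y) V \<in> sec E V"
    unfolding r(3) mem_Collect_eq
    by (intro exI[of _ "\<lambda>y. f y \<cdot>\<^sub>v a y + b y"] conjI)
      (assumption, rule reg_vec_lincomb[OF regular_on_subset[OF f V(2)] a(1) b(1)])
  with V show "\<exists>V. zopen_in Y V \<and> y \<in> V \<and> V \<subseteq> W \<and> restrict (\<lambda>y\<in>W. f y \<cdot>\<^sub>v s y + t y) V \<in> sec E V" by blast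
qed auto

lemma sec_zero:
  assumes E: "locally_free Y E" and W: "zopen_in Y W"
  shows "(\<lambda>y\<in>W. 0\<^sub>v (rk E y)) \<in> sec E W"
proof -
  \<comment> \<open>The zero section is the combination of an empty family: a matrix without columns
    applied to the empty vector.\<close>
  have eq: "(\<lambda>y\<in>W. 0\<^sub>m (rk E y) 0 *\<^sub>v 0\<^sub>v 0) = (\<lambda>y\<in>W. 0\<^sub>v (rk E y) :: complex Matrix.vec)"
    by (intro ext) (auto simp: scalar_prod_def)
  have "(\<lambda>y\<in>W. 0\<^sub>m (rk E y) 0 *\<^sub>v 0\<^sub>v 0) \<in> sec E W"
    by (rule sec_mult_reg[OF E W, of _ 0]) (auto intro: reg_vec_const)
  then show ?thesis by (simp only: eq)
qed

lemma sec_add: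
  assumes E: "locally_free Y E" and W: "zopen_in Y W" and s: "s \<in> sec E W" and t: "t \<in> sec E W"
  shows "(\<lambda>y\<in>W. s y + t y) \<in> sec E W"
  using sec_lincomb[OF E W regular_on_const[of _ 1] s t] by simp

lemma sec_uminus:
  assumes E: "locally_free Y E" and W: "zopen_in Y W" and s: "s \<in> sec E W"
  shows "(\<lambda>y\<in>W. - s y) \<in> sec E W"
proof -
  have "(\<lambda>y\<in>W. - 1 \<cdot>\<^sub>v s y + (\<lambda>y\<in>W. 0\<^sub>v (rk E y)) y) = (\<lambda>y\<in>W. - s y)"
    using sec_carrier[OF E W s] by (intro ext) auto
  then show ?thesis using sec_lincomb[OF E W regular_on_const[of _ "-1"] s sec_zero[OF E W]] by simp
qed

lemma frame_col_sec:
  assumes "local_frame Y E V g" "zopen_in Y W" "W \<subseteq> V" "\<And>y. y \<in> W \<Longrightarrow> rk E y = r" "j < r"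
  shows "(\<lambda>y\<in>W. col (g y) j) \<in> sec E W"
proof -
  obtain r' where r: "\<And>y. y \<in> V \<Longrightarrow> rk E y = r'" "\<And>y. y \<in> V \<Longrightarrow> g y \<in> carrier_mat r' r'"
    "sec E W = {(\<lambda>y\<in>W. g y *\<^sub>v a y) | a. reg_vec W r' a}"
  proof -
    obtain r' where "\<And>y. y \<in> V \<Longrightarrow> rk E y = r'" "\<And>y. y \<in> V \<Longrightarrow> g y \<in> carrier_mat r' r'"
      "\<And>W. zopen_in Y W \<Longrightarrow> W \<subseteq> V \<Longrightarrow> sec E W = {(\<lambda>y\<in>W. g y *\<^sub>v a y) | a. reg_vec W r' a}"
      using assms(1) by (rule local_frameE) (rule that; simp)
    then show ?thesis using that[of r'] assms(2,3) by simp
  qed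
  have eq: "(\<lambda>y\<in>W. col (g y) j) = (\<lambda>y\<in>W. g y *\<^sub>v unit_vec r' j)"
  proof (rule restrict_ext)
    fix y assume y: "y \<in> W"
    then have "g y \<in> carrier_mat r' r'" "r = r'" using r(1,2) assms(3,4) by fastforce+
    then show "col (g y) j = g y *\<^sub>v unit_vec r' j"
      using assms(5) by (intro eq_vecI) (auto simp: carrier_matD)
  qed
  show ?thesis unfolding eq r(3)
    by (intro CollectI exI[of _ "\<lambda>_. unit_vec r' j"] conjI refl reg_vec_const) simp
qed

lemma sheaf_mor_carrier: "sheaf_mor Y E F p \<Longrightarrow> y \<in> Y \<Longrightarrow> p y \<in> carrier_mat (rk F y) (rk E y)"
  unfolding sheaf_mor_def by simp

lemma sheaf_mor_sec:
  "sheaf_mor Y E F p \<Longrightarrow> zopen_in Y V \<Longrightarrow> s \<in> sec E V \<Longrightarrow> (\<lambda>y\<in>V. p y *\<^sub>v s y) \<in> sec F V"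
  unfolding sheaf_mor_def by simp

text \<open>The images of the frame vectors of \<open>E\<close> are sections of \<open>F\<close>;
  their coordinates in \<open>g'\<close> are the columns of \<open>h\<close>, hence regular. This is
  the shape in which \<open>vbundle_map\<close> asks for continuity.\<close>

lemma sheaf_mor_frames:
  assumes E: "locally_free Y E" and F: "locally_free Y F" and p: "sheaf_mor Y E F p"
    and g: "local_frame Y E V g" and g': "local_frame Y F V' g'"
  obtains h where "\<And>i j. regular_on (V \<inter> V') (\<lambda>y. entry (h y) i j)"
    "\<And>y. y \<in> V \<inter> V' \<Longrightarrow> h y \<in> carrier_mat (rk F y) (rk E y) \<and> p y * g y = g' y * h y"
proof -
  let ?W = "V \<inter> V'"
  obtain r where r: "zopen_in Y V" "\<And>y. y \<in> V \<Longrightarrow> rk E y = r" "\<And>y. y \<in> V \<Longrightarrow> g y \<in> carrier_mat r r"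
    using g by (rule local_frameE) (rule that; simp)
  obtain r' where r': "zopen_in Y V'" "\<And>y. y \<in> V' \<Longrightarrow> rk F y = r'" "\<And>y. y \<in> V' \<Longrightarrow> g' y \<in> carrier_mat r' r'"
    "\<And>W. zopen_in Y W \<Longrightarrow> W \<subseteq> V' \<Longrightarrow> sec F W = {(\<lambda>y\<in>W. g' y *\<^sub>v a y) | a. reg_vec W r' a}"
    using g' by (rule local_frameE) (rule that; simp)
  have W: "zopen_in Y ?W" using r r' by (auto intro: zopen_in_Int)
  have ex: "\<exists>b. reg_vec ?W r' b \<and> (\<lambda>y\<in>?W. p y *\<^sub>v (\<lambda>y\<in>?W. col (g y) j) y) = (\<lambda>y\<in>?W. g' y *\<^sub>v b y)"
    if "j < r" for j
  proof -
    have "(\<lambda>y\<in>?W. col (g y) j) \<in> sec E ?W" by (rule frame_col_sec[OF g W _ _ that]) (use r in auto)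
    then have "(\<lambda>y\<in>?W. p y *\<^sub>v (\<lambda>y\<in>?W. col (g y) j) y) \<in> sec F ?W"
      by (rule sheaf_mor_sec[OF p W])
    then show ?thesis using r'(4)[OF W] by auto
  qed
  have "\<forall>j\<in>{..<r}. \<exists>b. reg_vec ?W r' b \<and>
      (\<lambda>y\<in>?W. p y *\<^sub>v (\<lambda>y\<in>?W. col (g y) j) y) = (\<lambda>y\<in>?W. g' y *\<^sub>v b y)"
    using ex by (simp only: lessThan_iff Ball_def) blast
  from bchoice[OF this] obtain b where "\<forall>j\<in>{..<r}. reg_vec ?W r' (b j) \<and>
      (\<lambda>y\<in>?W. p y *\<^sub>v (\<lambda>y\<in>?W. col (g y) j) y) = (\<lambda>y\<in>?W. g' y *\<^sub>v b j y)"
    by (elim exE)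
  then have b: "\<And>j. j < r \<Longrightarrow> reg_vec ?W r' (b j)"
    "\<And>j. j < r \<Longrightarrow> (\<lambda>y\<in>?W. p y *\<^sub>v (\<lambda>y\<in>?W. col (g y) j) y) = (\<lambda>y\<in>?W. g' y *\<^sub>v b j y)" by simp_all
  define h where "h y = Matrix.mat r' r (\<lambda>(i, j). vec_index (b j y) i)" for y
  have h: "reg_mat ?W r' r h"
    unfolding h_def by (rule reg_matI) (use reg_vecD(2)[OF b(1)] in auto)
  have pg: "p z * g z = g' z * h z" if z: "z \<in> ?W" for z
  proof (rule mat_col_eqI)
    have zY: "z \<in> Y" using z r(1) zopen_in_subset by blast
    have pz: "p z \<in> carrier_mat r' r" using p zY z r(2) r'(2) unfolding sheaf_mor_def by auto
    fix j assume "j < dim_col (g' z * h z)"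
    then have j: "j < r" by (simp add: h_def)
    have "col (p z * g z) j = p z *\<^sub>v col (g z) j" using j r(3) z pz by (subst col_mult2) auto
    also have "\<dots> = g' z *\<^sub>v b j z" using fun_cong[OF b(2)[OF j], of z] z by auto
    also have "b j z = col (h z) j" using j reg_vecD(1)[OF b(1)[OF j] z] by (auto simp: h_def)
    also have "g' z *\<^sub>v col (h z) j = col (g' z * h z) j"
      using j r'(3)[of z] z reg_matD(1)[OF h z] by (subst col_mult2) auto
    finally show "col (p z * g z) j = col (g' z * h z) j" .
  next
    have zY: "z \<in> Y" using z r(1) zopen_in_subset by blast
    then have "p z \<in> carrier_mat r' r" using p z r(2) r'(2) unfolding sheaf_mor_def by auto
    then show "dim_row (p z * g z) = dim_row (g' z * h z)" "dim_col (p z * g z) = dim_col (g' z * h z)"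
      using r(3)[of z] r'(3)[of z] z by (auto simp: h_def)
  qed
  show ?thesis
  proof (rule that)
    show "regular_on ?W (\<lambda>y. entry (h y) i j)" for i j using h unfolding reg_mat_def by blast
    show "h y \<in> carrier_mat (rk F y) (rk E y) \<and> p y * g y = g' y * h y" if "y \<in> ?W" for y
      using that pg reg_matD(1)[OF h] r r' by auto
  qed
qed

text \<open>The same record serves over the open subset, because the Zariski opens of
  \<open>W\<close> are those of \<open>Y\<close> inside \<open>W\<close>. The splittings of an exact
  complex exist only locally and live over such \<open>W\<close>.\<close>

lemma locally_free_restrict:
  assumes E: "locally_free Y E" and W: "zopen_in Y W" shows "locally_free W E"
proof -
  note z = zopen_in_trans[OF W]
  have fr: "local_frame W E V g" if V: "local_frame Y E V g" "V \<subseteq> W" for V g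
  proof -
    obtain r where r: "zopen_in Y V"
      "\<And>y. y \<in> V \<Longrightarrow> rk E y = r" "\<And>y. y \<in> V \<Longrightarrow> g y \<in> carrier_mat r r" "\<And>y. y \<in> V \<Longrightarrow> invertible_mat (g y)"
      "\<And>W. zopen_in Y W \<Longrightarrow> W \<subseteq> V \<Longrightarrow> sec E W = {(\<lambda>y\<in>W. g y *\<^sub>v a y) | a. reg_vec W r a}"
      using V(1) by (rule local_frameE) (rule that; simp)
    show ?thesis by (rule local_frameI[of _ _ _ r]) (use r V(2) in \<open>simp_all add: z\<close>)
  qed
  show ?thesis
    unfolding locally_free_def
  proof (intro conjI)
    show "\<forall>V s. zopen_in W V \<and> s \<in> sec E V \<longrightarrow> s \<in> extensional V \<and> (\<forall>y\<in>V. s y \<in> carrier_vec (rk E y))"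
      by (auto simp: z intro: sec_extensional[OF E] sec_carrier[OF E])
    show "\<forall>V Wa s. zopen_in W V \<and> zopen_in W Wa \<and> Wa \<subseteq> V \<and> s \<in> sec E V \<longrightarrow> restrict s Wa \<in> sec E Wa"
      by (auto simp: z intro: sec_restrict[OF E])
    show "\<forall>\<V> s. (\<forall>V\<in>\<V>. zopen_in W V \<and> restrict s V \<in> sec E V) \<and> s \<in> extensional (\<Union> \<V>) \<longrightarrow> s \<in> sec E (\<Union> \<V>)"
      using locally_freeD(3)[OF E] by (simp add: z)
    show "\<forall>y\<in>W. \<exists>V g. y \<in> V \<and> local_frame W E V g"
    proof
      fix y assume "y \<in> W"
      then obtain V g where "y \<in> V" "V \<subseteq> W" "local_frame Y E V g"
        using locally_free_frame[OF E W] by metis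
      then show "\<exists>V g. y \<in> V \<and> local_frame W E V g" using fr by meson
    qed
  qed
qed

lemma sheaf_mor_restrict:
  "sheaf_mor Y E F p \<Longrightarrow> zopen_in Y W \<Longrightarrow> sheaf_mor W E F p"
  unfolding sheaf_mor_def using zopen_in_trans zopen_in_subset by blast

section \<open>Morphisms of locally free sheaves\<close>

lemma sheaf_morI:
  assumes "\<And>y. y \<in> Y \<Longrightarrow> p y \<in> carrier_mat (rk F y) (rk E y)"
    "\<And>V s. zopen_in Y V \<Longrightarrow> s \<in> sec E V \<Longrightarrow> (\<lambda>y\<in>V. p y *\<^sub>v s y) \<in> sec F V"
  shows "sheaf_mor Y E F p"
  using assms unfolding sheaf_mor_def by simp

lemma sheaf_mor_cong:
  assumes "sheaf_mor Y E F p" "\<And>y. y \<in> Y \<Longrightarrow> p y = q y" shows "sheaf_mor Y E F q"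
proof (rule sheaf_morI)
  fix V s assume V: "zopen_in Y V" "s \<in> sec E V"
  have "(\<lambda>y\<in>V. p y *\<^sub>v s y) = (\<lambda>y\<in>V. q y *\<^sub>v s y)"
    using zopen_in_subset[OF V(1)] assms(2) by (intro restrict_ext) (metis subsetD)
  then show "(\<lambda>y\<in>V. q y *\<^sub>v s y) \<in> sec F V" using sheaf_mor_sec[OF assms(1) V] by simp
qed (use sheaf_mor_carrier[OF assms(1)] assms(2) in auto)

lemma sheaf_mor_id: assumes E: "locally_free Y E" shows "sheaf_mor Y E E (\<lambda>y. 1\<^sub>m (rk E y))"
proof (rule sheaf_morI)
  fix V s assume V: "zopen_in Y V" "s \<in> sec E V"
  have "(\<lambda>y\<in>V. 1\<^sub>m (rk E y) *\<^sub>v s y) = s"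
    using sec_carrier[OF E V] sec_extensional[OF E V] by (intro ext) (auto simp: extensional_def)
  then show "(\<lambda>y\<in>V. 1\<^sub>m (rk E y) *\<^sub>v s y) \<in> sec E V" using V by simp
qed auto

lemma sheaf_mor_zero:
  assumes E: "locally_free Y E" and F: "locally_free Y F"
  shows "sheaf_mor Y E F (\<lambda>y. 0\<^sub>m (rk F y) (rk E y))"
proof (rule sheaf_morI)
  fix V s assume V: "zopen_in Y V" "s \<in> sec E V"
  have "(\<lambda>y\<in>V. 0\<^sub>m (rk F y) (rk E y) *\<^sub>v s y) = (\<lambda>y\<in>V. 0\<^sub>v (rk F y))"
    using sec_carrier[OF E V] by (intro restrict_ext) (auto intro!: eq_vecI)
  then show "(\<lambda>y\<in>V. 0\<^sub>m (rk F y) (rk E y) *\<^sub>v s y) \<in> sec F V" using sec_zero[OF F V(1)] by simp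
qed auto

lemma sheaf_mor_comp:
  assumes E: "locally_free Y E" and p: "sheaf_mor Y E F p" and q: "sheaf_mor Y F G q"
  shows "sheaf_mor Y E G (\<lambda>y. q y * p y)"
proof (rule sheaf_morI)
  fix V s assume V: "zopen_in Y V" "s \<in> sec E V"
  have "(\<lambda>y\<in>V. (q y * p y) *\<^sub>v s y) = (\<lambda>y\<in>V. q y *\<^sub>v (\<lambda>y\<in>V. p y *\<^sub>v s y) y)"
  proof (rule restrict_ext)
    fix y assume y: "y \<in> V"
    then have "y \<in> Y" using zopen_in_subset[OF V(1)] by blast
    then show "(q y * p y) *\<^sub>v s y = q y *\<^sub>v (\<lambda>y\<in>V. p y *\<^sub>v s y) y"
      using y assoc_mult_mat_vec[OF sheaf_mor_carrier[OF q] sheaf_mor_carrier[OF p] sec_carrier[OF E V]] by simp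
  qed
  then show "(\<lambda>y\<in>V. (q y * p y) *\<^sub>v s y) \<in> sec G V"
    using sheaf_mor_sec[OF q V(1) sheaf_mor_sec[OF p V]] by simp
qed (use sheaf_mor_carrier[OF p] sheaf_mor_carrier[OF q] in \<open>auto intro: mult_carrier_mat\<close>)

lemma sheaf_mor_add:
  assumes E: "locally_free Y E" and F: "locally_free Y F" and p: "sheaf_mor Y E F p" and q: "sheaf_mor Y E F q"
  shows "sheaf_mor Y E F (\<lambda>y. p y + q y)"
proof (rule sheaf_morI)
  fix V s assume V: "zopen_in Y V" "s \<in> sec E V"
  have "(\<lambda>y\<in>V. (p y + q y) *\<^sub>v s y) = (\<lambda>y\<in>V. (\<lambda>y\<in>V. p y *\<^sub>v s y) y + (\<lambda>y\<in>V. q y *\<^sub>v s y) y)"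
  proof (rule restrict_ext)
    fix y assume y: "y \<in> V"
    then have "y \<in> Y" using zopen_in_subset[OF V(1)] by blast
    then show "(p y + q y) *\<^sub>v s y = (\<lambda>y\<in>V. p y *\<^sub>v s y) y + (\<lambda>y\<in>V. q y *\<^sub>v s y) y"
      using y add_mult_distrib_mat_vec[OF sheaf_mor_carrier[OF p] sheaf_mor_carrier[OF q] sec_carrier[OF E V]] by simp
  qed
  then show "(\<lambda>y\<in>V. (p y + q y) *\<^sub>v s y) \<in> sec F V"
    using sec_add[OF F V(1) sheaf_mor_sec[OF p V] sheaf_mor_sec[OF q V]] by simp
qed (use sheaf_mor_carrier[OF p] sheaf_mor_carrier[OF q] in \<open>auto intro: add_carrier_mat\<close>)

lemma sheaf_mor_uminus:
  assumes E: "locally_free Y E" and F: "locally_free Y F" and p: "sheaf_mor Y E F p"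
  shows "sheaf_mor Y E F (\<lambda>y. - p y)"
proof (rule sheaf_morI)
  fix V s assume V: "zopen_in Y V" "s \<in> sec E V"
  have "(\<lambda>y\<in>V. - p y *\<^sub>v s y) = (\<lambda>y\<in>V. - (\<lambda>y\<in>V. p y *\<^sub>v s y) y)"
  proof (rule restrict_ext)
    fix y assume y: "y \<in> V"
    then have "y \<in> Y" using zopen_in_subset[OF V(1)] by blast
    then show "- p y *\<^sub>v s y = - (\<lambda>y\<in>V. p y *\<^sub>v s y) y"
      using y carrier_matD[OF sheaf_mor_carrier[OF p]] carrier_vecD[OF sec_carrier[OF E V y]] by simp
  qed
  then show "(\<lambda>y\<in>V. - p y *\<^sub>v s y) \<in> sec F V" using sec_uminus[OF F V(1) sheaf_mor_sec[OF p V]] by simp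
qed (use sheaf_mor_carrier[OF p] in auto)

section \<open>Direct sums and block matrices\<close>

lemma rk_dsum [simp]: "rk (dsum E F) y = rk E y + rk F y"
  by (simp add: dsum_def)

lemma rk_zero_sheaf [simp]: "rk zero_sheaf y = 0"
  by (simp add: zero_sheaf_def)

lemma sec_dsumE:
  assumes "s \<in> sec (dsum E F) V"
  obtains a b where "a \<in> sec E V" "b \<in> sec F V" "s = (\<lambda>y\<in>V. a y @\<^sub>v b y)"
  using assms that by (auto simp: dsum_def)

lemma sec_dsumI: "a \<in> sec E V \<Longrightarrow> b \<in> sec F V \<Longrightarrow> (\<lambda>y\<in>V. a y @\<^sub>v b y) \<in> sec (dsum E F) V"
  by (auto simp: dsum_def)

lemma four_block_invertible:
  assumes "g \<in> carrier_mat r r" "g' \<in> carrier_mat r' r'" "invertible_mat g" "invertible_mat g'"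
  shows "invertible_mat (four_block_mat g (0\<^sub>m r r') (0\<^sub>m r' r) g' :: complex mat)"
proof -
  obtain h where h: "h \<in> carrier_mat r r" "g * h = 1\<^sub>m r" "h * g = 1\<^sub>m r"
    using assms(3,1) by (rule invertible_matE)
  obtain h' where h': "h' \<in> carrier_mat r' r'" "g' * h' = 1\<^sub>m r'" "h' * g' = 1\<^sub>m r'"
    using assms(4,2) by (rule invertible_matE)
  show ?thesis
  proof (rule invertible_matI)
    show "four_block_mat g (0\<^sub>m r r') (0\<^sub>m r' r) g' * four_block_mat h (0\<^sub>m r r') (0\<^sub>m r' r) h' = 1\<^sub>m (r + r')"
      using assms(1,2) h h' by (subst mult_four_block_mat[of _ r r _ r' _ r']) auto
    show "four_block_mat h (0\<^sub>m r r') (0\<^sub>m r' r) h' * four_block_mat g (0\<^sub>m r r') (0\<^sub>m r' r) g' = 1\<^sub>m (r + r')"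
      using assms(1,2) h h' by (subst mult_four_block_mat[of _ r r _ r' _ r']) auto
  qed (use assms h h' in auto)
qed

lemma zero_mat_mult_vec: "v \<in> carrier_vec n \<Longrightarrow> 0\<^sub>m m n *\<^sub>v v = (0\<^sub>v m :: complex Matrix.vec)"
  by (intro eq_vecI) auto

lemma append_vec_empty [simp]: "dim_vec w = 0 \<Longrightarrow> v @\<^sub>v w = v"
  by (intro eq_vecI) auto

text \<open>Coordinates of length \<open>r + r'\<close> are cut into the first \<open>r\<close> and
  the last \<open>r'\<close>; regularity is an entrywise condition, so it survives cutting and
  concatenation.\<close>

lemma local_frame_dsum:
  assumes g: "local_frame Y E V g" and g': "local_frame Y F V g'"
  shows "local_frame Y (dsum E F) V (\<lambda>y. four_block_mat (g y) (0\<^sub>m (rk E y) (rk F y)) (0\<^sub>m (rk F y) (rk E y)) (g' y))"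
    (is "local_frame _ _ _ ?g")
proof -
  obtain r where r: "zopen_in Y V"
    "\<And>y. y \<in> V \<Longrightarrow> rk E y = r" "\<And>y. y \<in> V \<Longrightarrow> g y \<in> carrier_mat r r" "\<And>y. y \<in> V \<Longrightarrow> invertible_mat (g y)"
    "\<And>W. zopen_in Y W \<Longrightarrow> W \<subseteq> V \<Longrightarrow> sec E W = {(\<lambda>y\<in>W. g y *\<^sub>v a y) | a. reg_vec W r a}"
    using g by (rule local_frameE) (rule that; simp)
  obtain r' where r': "zopen_in Y V"
    "\<And>y. y \<in> V \<Longrightarrow> rk F y = r'" "\<And>y. y \<in> V \<Longrightarrow> g' y \<in> carrier_mat r' r'" "\<And>y. y \<in> V \<Longrightarrow> invertible_mat (g' y)"
    "\<And>W. zopen_in Y W \<Longrightarrow> W \<subseteq> V \<Longrightarrow> sec F W = {(\<lambda>y\<in>W. g' y *\<^sub>v a y) | a. reg_vec W r' a}"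
    using g' by (rule local_frameE) (rule that; simp)
  have mult: "?g y *\<^sub>v (a @\<^sub>v b) = g y *\<^sub>v a @\<^sub>v g' y *\<^sub>v b"
    if "y \<in> V" "a \<in> carrier_vec r" "b \<in> carrier_vec r'" for y a b
  proof -
    note c = mult_mat_vec_carrier[OF r(3)[OF that(1)] that(2)] mult_mat_vec_carrier[OF r'(3)[OF that(1)] that(3)]
    show ?thesis
      using four_block_mat_mult_vec[OF r(3)[OF that(1)] zero_carrier_mat zero_carrier_mat r'(3)[OF that(1)] that(2,3)]
        r(2)[OF that(1)] r'(2)[OF that(1)] c
      by (simp add: zero_mat_mult_vec[OF that(2)] zero_mat_mult_vec[OF that(3)])
  qed
  show ?thesis
  proof (rule local_frameI[of _ _ _ "r + r'"])
    fix W assume W: "zopen_in Y W" "W \<subseteq> V"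
    show "sec (dsum E F) W = {(\<lambda>y\<in>W. ?g y *\<^sub>v c y) | c. reg_vec W (r + r') c}"
    proof (intro Set.set_eqI iffI)
      fix s assume "s \<in> sec (dsum E F) W"
      then obtain u v where "u \<in> sec E W" "v \<in> sec F W" "s = (\<lambda>y\<in>W. u y @\<^sub>v v y)" by (rule sec_dsumE)
      then obtain a b where ab: "reg_vec W r a" "reg_vec W r' b"
        "u = (\<lambda>y\<in>W. g y *\<^sub>v a y)" "v = (\<lambda>y\<in>W. g' y *\<^sub>v b y)" "s = (\<lambda>y\<in>W. u y @\<^sub>v v y)"
        using r(5)[OF W] r'(5)[OF W] by auto
      have "s = (\<lambda>y\<in>W. ?g y *\<^sub>v (a y @\<^sub>v b y))"
        unfolding ab(5) using mult[OF _ reg_vecD(1)[OF ab(1)] reg_vecD(1)[OF ab(2)]] W(2)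
        by (intro restrict_ext) (auto simp: ab(3,4))
      then show "s \<in> {(\<lambda>y\<in>W. ?g y *\<^sub>v c y) | c. reg_vec W (r + r') c}"
        using reg_vec_append[OF ab(1,2)] by (intro CollectI exI conjI)
    next
      fix s assume "s \<in> {(\<lambda>y\<in>W. ?g y *\<^sub>v c y) | c. reg_vec W (r + r') c}"
      then obtain c where c: "s = (\<lambda>y\<in>W. ?g y *\<^sub>v c y)" "reg_vec W (r + r') c" by (elim CollectE exE conjE)
      note ab = reg_vec_split[OF c(2)]
      have "s = (\<lambda>y\<in>W. (\<lambda>y\<in>W. g y *\<^sub>v vec_first (c y) r) y @\<^sub>v (\<lambda>y\<in>W. g' y *\<^sub>v vec_last (c y) r') y)"
        unfolding c(1)
      proof (rule restrict_ext)
        fix y assume y: "y \<in> W"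
        have "c y = vec_first (c y) r @\<^sub>v vec_last (c y) r'"
          by (rule vec_first_last_append[symmetric, OF reg_vecD(1)[OF c(2) y]])
        then have "?g y *\<^sub>v c y = ?g y *\<^sub>v (vec_first (c y) r @\<^sub>v vec_last (c y) r')" by simp
        also have "\<dots> = g y *\<^sub>v vec_first (c y) r @\<^sub>v g' y *\<^sub>v vec_last (c y) r'"
          using y W(2) by (intro mult) auto
        finally show "?g y *\<^sub>v c y = (\<lambda>y\<in>W. g y *\<^sub>v vec_first (c y) r) y @\<^sub>v (\<lambda>y\<in>W. g' y *\<^sub>v vec_last (c y) r') y"
          using y by simp
      qed
      moreover have "(\<lambda>y\<in>W. g y *\<^sub>v vec_first (c y) r) \<in> sec E W"
        unfolding r(5)[OF W] using ab(1) by (intro CollectI exI[of _ "\<lambda>y. vec_first (c y) r"] conjI refl)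
      moreover have "(\<lambda>y\<in>W. g' y *\<^sub>v vec_last (c y) r') \<in> sec F W"
        unfolding r'(5)[OF W] using ab(2) by (intro CollectI exI[of _ "\<lambda>y. vec_last (c y) r'"] conjI refl)
      ultimately show "s \<in> sec (dsum E F) W" by (simp only: sec_dsumI)
    qed
  next
    show "invertible_mat (?g y)" if "y \<in> V" for y
      using four_block_invertible[OF r(3) r'(3) r(4) r'(4)] that r(2) r'(2) by simp
  qed (use r r' in auto)
qed

lemma locally_free_dsum:
  assumes E: "locally_free Y E" and F: "locally_free Y F" shows "locally_free Y (dsum E F)"
  unfolding locally_free_def
proof (intro conjI allI impI ballI; (elim conjE)?)
  fix V s assume V: "zopen_in Y V" and s: "s \<in> sec (dsum E F) V"
  obtain a b where ab: "a \<in> sec E V" "b \<in> sec F V" "s = (\<lambda>y\<in>V. a y @\<^sub>v b y)" using s by (rule sec_dsumE)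
  show "s \<in> extensional V" by (simp add: ab(3))
  show "s y \<in> carrier_vec (rk (dsum E F) y)" if "y \<in> V" for y
    using sec_carrier[OF E V ab(1) that] sec_carrier[OF F V ab(2) that] that by (simp add: ab(3) append_carrier_vec)
next
  fix V W s assume V: "zopen_in Y V" and W: "zopen_in Y W" "W \<subseteq> V" and s: "s \<in> sec (dsum E F) V"
  obtain a b where ab: "a \<in> sec E V" "b \<in> sec F V" "s = (\<lambda>y\<in>V. a y @\<^sub>v b y)" using s by (rule sec_dsumE)
  have "restrict s W = (\<lambda>y\<in>W. restrict a W y @\<^sub>v restrict b W y)"
    using W(2) by (intro ext) (auto simp: ab(3))
  then show "restrict s W \<in> sec (dsum E F) W"
    using sec_dsumI[OF sec_restrict[OF E V W ab(1)] sec_restrict[OF F V W ab(2)]] by simp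
next
  fix \<V> s assume VV: "\<forall>V\<in>\<V>. zopen_in Y V \<and> restrict s V \<in> sec (dsum E F) V" and s_ext: "s \<in> extensional (\<Union> \<V>)"
  \<comment> \<open>The components are cut out of \<open>s\<close> by the ranks instead of being
    chosen on each member of the cover, so that they agree on overlaps without further
    argument.\<close>
  define a where "a = (\<lambda>y\<in>\<Union>\<V>. vec_first (s y) (rk E y))"
  define b where "b = (\<lambda>y\<in>\<Union>\<V>. vec_last (s y) (rk F y))"
  have *: "restrict a V \<in> sec E V \<and> restrict b V \<in> sec F V \<and> (\<forall>y\<in>V. s y = a y @\<^sub>v b y)" if V: "V \<in> \<V>" for V
  proof -
    have zV: "zopen_in Y V" using VV V by blast
    have "restrict s V \<in> sec (dsum E F) V" using VV V by blast
    then obtain u v where uv: "u \<in> sec E V" "v \<in> sec F V" "restrict s V = (\<lambda>y\<in>V. u y @\<^sub>v v y)" by (rule sec_dsumE)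
    have sy: "s y = u y @\<^sub>v v y" if "y \<in> V" for y using fun_cong[OF uv(3), of y] that by simp
    note uc = carrier_vecD[OF sec_carrier[OF E zV uv(1)]] and vc = carrier_vecD[OF sec_carrier[OF F zV uv(2)]]
    have ay: "a y = u y" "b y = v y" if y: "y \<in> V" for y
    proof -
      have "y \<in> \<Union>\<V>" using y V by blast
      then show "a y = u y" "b y = v y"
        using uc[OF y] vc[OF y] by (auto simp: a_def b_def sy[OF y] vec_first_def vec_last_def)
    qed
    have "restrict a V = u" "restrict b V = v"
      using ay sec_extensional[OF E zV uv(1)] sec_extensional[OF F zV uv(2)]
      by (auto simp: extensional_def restrict_def)
    then show ?thesis using uv sy ay by simp
  qed
  have "a \<in> sec E (\<Union>\<V>)"
    using locally_freeD(3)[OF E, rule_format, of \<V> a] * VV by (simp add: a_def)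
  moreover have "b \<in> sec F (\<Union>\<V>)"
    using locally_freeD(3)[OF F, rule_format, of \<V> b] * VV by (simp add: b_def)
  moreover have "s = (\<lambda>y\<in>\<Union>\<V>. a y @\<^sub>v b y)"
  proof (rule ext)
    fix y show "s y = (\<lambda>y\<in>\<Union>\<V>. a y @\<^sub>v b y) y"
    proof (cases "y \<in> \<Union>\<V>")
      case True
      then obtain V where "V \<in> \<V>" "y \<in> V" by blast
      then show ?thesis using * True by simp
    next
      case False
      then show ?thesis using s_ext by (simp only: extensional_def mem_Collect_eq restrict_def) simp
    qed
  qed
  ultimately show "s \<in> sec (dsum E F) (\<Union>\<V>)" by (simp only: sec_dsumI)
next
  fix y assume "y \<in> Y"
  then obtain V g where V: "y \<in> V" "zopen_in Y V" "local_frame Y E V g"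
    using locally_free_frame[OF E zopen_in_refl] by metis
  obtain V' g' where V': "y \<in> V'" "V' \<subseteq> V" "zopen_in Y V'" "local_frame Y F V' g'"
    using locally_free_frame[OF F V(2,1)] by metis
  show "\<exists>V g. y \<in> V \<and> local_frame Y (dsum E F) V g"
    by (intro exI conjI) (rule V'(1), rule local_frame_dsum[OF local_frame_subset[OF V(3) V'(3,2)] V'(4)])
qed

text \<open>The empty matrix is a frame of rank 0 over all of \<open>Y\<close>.\<close>

lemma locally_free_zero: "locally_free Y zero_sheaf"
proof -
  have vec0: "(v :: complex Matrix.vec) = 0\<^sub>v 0" if "v \<in> carrier_vec 0" for v using that by auto
  have sec: "sec zero_sheaf V = {\<lambda>y\<in>V. 0\<^sub>v 0 :: complex Matrix.vec}" for V :: "'a cproj set" by (simp add: zero_sheaf_def)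
  have "local_frame Y zero_sheaf Y (\<lambda>_. 1\<^sub>m 0)"
  proof (rule local_frameI[of _ _ _ 0])
    fix W assume "zopen_in Y W" "W \<subseteq> Y"
    have "(\<lambda>y\<in>W. 1\<^sub>m 0 *\<^sub>v a y) = (\<lambda>y\<in>W. 0\<^sub>v 0 :: complex Matrix.vec)" for a
      by (intro restrict_ext eq_vecI) simp_all
    then show "sec zero_sheaf W = {\<lambda>y\<in>W. 1\<^sub>m 0 *\<^sub>v a y |a. reg_vec W 0 a}"
      unfolding sec using reg_vec_const[of "0\<^sub>v 0" 0 W] by auto
  qed (auto intro!: invertible_matI[of _ 0 "1\<^sub>m 0"])
  moreover have "s = (\<lambda>y\<in>\<Union>\<V>. 0\<^sub>v 0)"
    if "\<forall>V\<in>\<V>. zopen_in Y V \<and> restrict s V \<in> sec zero_sheaf V" "s \<in> extensional (\<Union> \<V>)"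
    for \<V> and s :: "'a cproj \<Rightarrow> complex Matrix.vec"
  proof (rule ext)
    fix y show "s y = (\<lambda>y\<in>\<Union>\<V>. 0\<^sub>v 0) y"
    proof (cases "y \<in> \<Union>\<V>")
      case True
      then obtain V where "V \<in> \<V>" "y \<in> V" by blast
      then have "restrict s V = (\<lambda>y\<in>V. 0\<^sub>v 0)" using that(1) sec by blast
      from fun_cong[OF this, of y] show ?thesis using \<open>y \<in> V\<close> True by simp
    next
      case False
      then show ?thesis using that(2) by (simp only: extensional_def mem_Collect_eq restrict_def) simp
    qed
  qed
  ultimately show ?thesis
    unfolding locally_free_def
    apply (intro conjI)
    subgoal by (auto simp: sec)
    subgoal by (auto simp: sec restrict_def fun_eq_iff)
    subgoal unfolding sec by blast
    subgoal by blast
    done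
qed

lemma sheaf_mor_block:
  assumes E: "locally_free Y E" and F: "locally_free Y F" and G: "locally_free Y G" and H: "locally_free Y H"
    and A: "sheaf_mor Y E G A" and B: "sheaf_mor Y F G B" and C: "sheaf_mor Y E H C" and D: "sheaf_mor Y F H D"
  shows "sheaf_mor Y (dsum E F) (dsum G H) (\<lambda>y. four_block_mat (A y) (B y) (C y) (D y))"
proof (rule sheaf_morI)
  fix V s assume V: "zopen_in Y V" and s: "s \<in> sec (dsum E F) V"
  obtain a b where ab: "a \<in> sec E V" "b \<in> sec F V" "s = (\<lambda>y\<in>V. a y @\<^sub>v b y)" using s by (rule sec_dsumE)
  have "(\<lambda>y\<in>V. four_block_mat (A y) (B y) (C y) (D y) *\<^sub>v s y) =
    (\<lambda>y\<in>V. (\<lambda>y\<in>V. (\<lambda>y\<in>V. A y *\<^sub>v a y) y + (\<lambda>y\<in>V. B y *\<^sub>v b y) y) y @\<^sub>v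
       (\<lambda>y\<in>V. (\<lambda>y\<in>V. C y *\<^sub>v a y) y + (\<lambda>y\<in>V. D y *\<^sub>v b y) y) y)"
  proof (rule restrict_ext)
    fix y assume y: "y \<in> V"
    then have yY: "y \<in> Y" using zopen_in_subset[OF V(1)] by blast
    show "four_block_mat (A y) (B y) (C y) (D y) *\<^sub>v s y =
       (\<lambda>y\<in>V. (\<lambda>y\<in>V. A y *\<^sub>v a y) y + (\<lambda>y\<in>V. B y *\<^sub>v b y) y) y @\<^sub>v
       (\<lambda>y\<in>V. (\<lambda>y\<in>V. C y *\<^sub>v a y) y + (\<lambda>y\<in>V. D y *\<^sub>v b y) y) y"
      using four_block_mat_mult_vec[OF sheaf_mor_carrier[OF A yY] sheaf_mor_carrier[OF B yY]
          sheaf_mor_carrier[OF C yY] sheaf_mor_carrier[OF D yY] sec_carrier[OF E V ab(1) y] sec_carrier[OF F V ab(2) y]] y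
      by (simp add: ab(3))
  qed
  then show "(\<lambda>y\<in>V. four_block_mat (A y) (B y) (C y) (D y) *\<^sub>v s y) \<in> sec (dsum G H) V"
    using sec_dsumI[OF sec_add[OF G V sheaf_mor_sec[OF A V ab(1)] sheaf_mor_sec[OF B V ab(2)]]
      sec_add[OF H V sheaf_mor_sec[OF C V ab(1)] sheaf_mor_sec[OF D V ab(2)]]] by simp
qed (use sheaf_mor_carrier[OF A] sheaf_mor_carrier[OF D] in \<open>auto intro: four_block_carrier_mat\<close>)

lemma sheaf_mor_rows:
  assumes E: "locally_free Y E" and A: "sheaf_mor Y E G A" and B: "sheaf_mor Y E H B"
  shows "sheaf_mor Y E (dsum G H) (\<lambda>y. A y @\<^sub>r B y)"
proof (rule sheaf_morI)
  fix V s assume V: "zopen_in Y V" "s \<in> sec E V"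
  have "(\<lambda>y\<in>V. (A y @\<^sub>r B y) *\<^sub>v s y) = (\<lambda>y\<in>V. (\<lambda>y\<in>V. A y *\<^sub>v s y) y @\<^sub>v (\<lambda>y\<in>V. B y *\<^sub>v s y) y)"
  proof (rule restrict_ext)
    fix y assume y: "y \<in> V"
    then have yY: "y \<in> Y" using zopen_in_subset[OF V(1)] by blast
    show "(A y @\<^sub>r B y) *\<^sub>v s y = (\<lambda>y\<in>V. A y *\<^sub>v s y) y @\<^sub>v (\<lambda>y\<in>V. B y *\<^sub>v s y) y"
      using mat_mult_append[OF sheaf_mor_carrier[OF A yY] sheaf_mor_carrier[OF B yY] sec_carrier[OF E V y]] y by simp
  qed
  then show "(\<lambda>y\<in>V. (A y @\<^sub>r B y) *\<^sub>v s y) \<in> sec (dsum G H) V"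
    using sec_dsumI[OF sheaf_mor_sec[OF A V] sheaf_mor_sec[OF B V]] by simp
qed (use sheaf_mor_carrier[OF A] sheaf_mor_carrier[OF B] in \<open>auto intro: carrier_append_rows\<close>)

lemma sheaf_mor_cols:
  assumes E: "locally_free Y E" and F: "locally_free Y F" and G: "locally_free Y G"
    and A: "sheaf_mor Y E G A" and B: "sheaf_mor Y F G B"
  shows "sheaf_mor Y (dsum E F) G (\<lambda>y. four_block_mat (A y) (B y) (0\<^sub>m 0 (rk E y)) (0\<^sub>m 0 (rk F y)))"
proof (rule sheaf_morI)
  fix V s assume V: "zopen_in Y V" and s: "s \<in> sec (dsum E F) V"
  obtain a b where ab: "a \<in> sec E V" "b \<in> sec F V" "s = (\<lambda>y\<in>V. a y @\<^sub>v b y)" using s by (rule sec_dsumE)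
  have "(\<lambda>y\<in>V. four_block_mat (A y) (B y) (0\<^sub>m 0 (rk E y)) (0\<^sub>m 0 (rk F y)) *\<^sub>v s y) =
    (\<lambda>y\<in>V. (\<lambda>y\<in>V. A y *\<^sub>v a y) y + (\<lambda>y\<in>V. B y *\<^sub>v b y) y)"
  proof (rule restrict_ext)
    fix y assume y: "y \<in> V"
    then have yY: "y \<in> Y" using zopen_in_subset[OF V(1)] by blast
    note c = sec_carrier[OF E V ab(1) y] sec_carrier[OF F V ab(2) y]
    show "four_block_mat (A y) (B y) (0\<^sub>m 0 (rk E y)) (0\<^sub>m 0 (rk F y)) *\<^sub>v s y =
       (\<lambda>y\<in>V. A y *\<^sub>v a y) y + (\<lambda>y\<in>V. B y *\<^sub>v b y) y"
      using four_block_mat_mult_vec[OF sheaf_mor_carrier[OF A yY] sheaf_mor_carrier[OF B yY]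
          zero_carrier_mat zero_carrier_mat c, of 0] y
      by (simp add: ab(3) zero_mat_mult_vec[OF c(1)] zero_mat_mult_vec[OF c(2)])
  qed
  then show "(\<lambda>y\<in>V. four_block_mat (A y) (B y) (0\<^sub>m 0 (rk E y)) (0\<^sub>m 0 (rk F y)) *\<^sub>v s y) \<in> sec G V"
    using sec_add[OF G V sheaf_mor_sec[OF A V ab(1)] sheaf_mor_sec[OF B V ab(2)]] by simp
qed (use four_block_carrier_mat[OF sheaf_mor_carrier[OF A] zero_carrier_mat[of 0]] in auto)

section \<open>Cones and totalizations\<close>

lemma mfE_add_even [simp]: "even j \<Longrightarrow> mfE (k + j) E = mfE k E" "even j \<Longrightarrow> mfE (j + k) E = mfE k E"
  by (auto simp: mfE_def)

lemma mfphi_add_even [simp]: "even j \<Longrightarrow> mfphi (k + j) E = mfphi k E" "even j \<Longrightarrow> mfphi (j + k) E = mfphi k E"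
  by (auto simp: mfphi_def)

lemma mfmap_add_even [simp]: "even j \<Longrightarrow> mfmap (k + j) p = mfmap k p" "even j \<Longrightarrow> mfmap (j + k) p = mfmap k p"
  by (auto simp: mfmap_def)

lemma all_parity_iff: "(\<forall>k::int. P (even k)) \<longleftrightarrow> P True \<and> P False"
  by (metis even_zero odd_one)

lemma all_parity_imp_iff: "(\<forall>k::int. (even k \<longrightarrow> P) \<and> (odd k \<longrightarrow> Q)) \<longleftrightarrow> P \<and> Q"
  by (metis even_zero odd_one)

text \<open>Reading the index modulo 2 merges the two halves of each condition into one statement
  about an arbitrary integer \<open>k\<close>; the arguments about cones, totalizations and
  cohomology are then done once, in degree \<open>k\<close>.\<close>

lemma is_mfact_iff:
  "is_mfact Y w E \<longleftrightarrow> (\<forall>k. locally_free Y (mfE k E)) \<and> (\<forall>k. sheaf_mor Y (mfE k E) (mfE (k + 1) E) (mfphi k E)) \<and>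
     (\<forall>k. \<forall>y\<in>Y. mfphi (k + 1) E y * mfphi k E y = w y \<cdot>\<^sub>m 1\<^sub>m (rk (mfE k E) y))"
proof -
  have 1: "(\<forall>k. locally_free Y (mfE k E)) \<longleftrightarrow> locally_free Y (mE0 E) \<and> locally_free Y (mE1 E)"
    unfolding mfE_def by (subst all_parity_iff) simp
  have 2: "(\<forall>k. sheaf_mor Y (mfE k E) (mfE (k + 1) E) (mfphi k E)) \<longleftrightarrow>
      sheaf_mor Y (mE0 E) (mE1 E) (phi0 E) \<and> sheaf_mor Y (mE1 E) (mE0 E) (phi1 E)"
    unfolding mfE_def mfphi_def by (simp add: all_parity_imp_iff)
  have 3: "(\<forall>k. \<forall>y\<in>Y. mfphi (k + 1) E y * mfphi k E y = w y \<cdot>\<^sub>m 1\<^sub>m (rk (mfE k E) y)) \<longleftrightarrow>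
      (\<forall>y\<in>Y. phi1 E y * phi0 E y = w y \<cdot>\<^sub>m 1\<^sub>m (rk (mE0 E) y) \<and> phi0 E y * phi1 E y = w y \<cdot>\<^sub>m 1\<^sub>m (rk (mE1 E) y))"
    unfolding mfE_def mfphi_def by (simp add: all_parity_imp_iff ball_conj_distrib)
  show ?thesis unfolding 1 2 3 is_mfact_def by blast
qed

lemma Z0_hom_iff:
  "p \<in> Z0_hom Y E F \<longleftrightarrow> (\<forall>k. sheaf_mor Y (mfE k E) (mfE k F) (mfmap k p)) \<and>
     (\<forall>k. \<forall>y\<in>Y. mfphi k F y * mfmap k p y = mfmap (k + 1) p y * mfphi k E y)"
proof -
  have 1: "(\<forall>k. sheaf_mor Y (mfE k E) (mfE k F) (mfmap k p)) \<longleftrightarrow>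
      sheaf_mor Y (mE0 E) (mE0 F) (fst p) \<and> sheaf_mor Y (mE1 E) (mE1 F) (snd p)"
    unfolding mfE_def mfmap_def by (simp add: all_parity_imp_iff)
  have 2: "(\<forall>k. \<forall>y\<in>Y. mfphi k F y * mfmap k p y = mfmap (k + 1) p y * mfphi k E y) \<longleftrightarrow>
      (\<forall>y\<in>Y. phi0 F y * fst p y = snd p y * phi0 E y \<and> phi1 F y * snd p y = fst p y * phi1 E y)"
    unfolding mfmap_def mfphi_def by (simp add: all_parity_imp_iff ball_conj_distrib)
  show ?thesis unfolding 1 2 Z0_hom_def by (cases p) simp
qed

lemma homotopic_maps_iff:
  "homotopic_maps Y E F p q \<longleftrightarrow> (\<exists>h. (\<forall>k. sheaf_mor Y (mfE k E) (mfE (k + 1) F) (mfmap k h)) \<and>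
     (\<forall>k. \<forall>y\<in>Y. mfmap k q y = mfmap k p y + (mfphi (k + 1) F y * mfmap k h y + mfmap (k + 1) h y * mfphi k E y)))"
proof -
  have 1: "(\<forall>k. sheaf_mor Y (mfE k E) (mfE (k + 1) F) (mfmap k h)) \<longleftrightarrow>
      sheaf_mor Y (mE0 E) (mE1 F) (fst h) \<and> sheaf_mor Y (mE1 E) (mE0 F) (snd h)" for h
    unfolding mfE_def mfmap_def by (simp add: all_parity_imp_iff)
  have 2: "(\<forall>k. \<forall>y\<in>Y. mfmap k q y = mfmap k p y + (mfphi (k + 1) F y * mfmap k h y + mfmap (k + 1) h y * mfphi k E y)) \<longleftrightarrow>
       (\<forall>y\<in>Y. fst q y = fst p y + (phi1 F y * fst h y + snd h y * phi0 E y) \<and>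
              snd q y = snd p y + (phi0 F y * snd h y + fst h y * phi1 E y))" for h
    unfolding mfmap_def mfphi_def by (simp add: all_parity_imp_iff ball_conj_distrib)
  show ?thesis unfolding 1 2 homotopic_maps_def by (simp add: split_paired_Ex)
qed

lemma mfactD:
  assumes "is_mfact Y w E"
  shows mfact_locally_free: "locally_free Y (mfE k E)"
    and mfact_mor: "sheaf_mor Y (mfE k E) (mfE (k + 1) E) (mfphi k E)"
    and mfact_square: "y \<in> Y \<Longrightarrow> mfphi (k + 1) E y * mfphi k E y = w y \<cdot>\<^sub>m 1\<^sub>m (rk (mfE k E) y)"
    and mfact_carrier: "y \<in> Y \<Longrightarrow> mfphi k E y \<in> carrier_mat (rk (mfE (k + 1) E) y) (rk (mfE k E) y)"
  using assms sheaf_mor_carrier unfolding is_mfact_iff by blast+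

lemma Z0_homD:
  assumes "p \<in> Z0_hom Y E F"
  shows Z0_mor: "sheaf_mor Y (mfE k E) (mfE k F) (mfmap k p)"
    and Z0_comm: "y \<in> Y \<Longrightarrow> mfphi k F y * mfmap k p y = mfmap (k + 1) p y * mfphi k E y"
    and Z0_carrier: "y \<in> Y \<Longrightarrow> mfmap k p y \<in> carrier_mat (rk (mfE k F) y) (rk (mfE k E) y)"
  using assms sheaf_mor_carrier unfolding Z0_hom_iff by blast+

section \<open>Shift and mapping cone\<close>

lemma mfE_shift [simp]: "mfE k (mf_shift E) = mfE (k + 1) E"
  by (auto simp: mfE_def mf_shift_def)

lemma mfphi_shift: "mfphi k (mf_shift E) y = - mfphi (k + 1) E y"
  by (auto simp: mfphi_def mf_shift_def)

lemma mfE_cone [simp]: "mfE k (mf_cone E F p) = dsum (mfE k F) (mfE (k + 1) E)"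
  by (auto simp: mfE_def mf_cone_def)

lemma mfphi_cone: "mfphi k (mf_cone E F p) y = four_block_mat (mfphi k F y) (mfmap (k + 1) p y)
    (0\<^sub>m (rk (mfE k E) y) (rk (mfE k F) y)) (- mfphi (k + 1) E y)"
  by (auto simp: mfphi_def mfE_def mfmap_def mf_cone_def)

lemma mf_shift_mfact:
  assumes E: "is_mfact Y w E" shows "is_mfact Y w (mf_shift E)"
  unfolding is_mfact_iff
proof (intro conjI allI ballI)
  fix k y
  show "locally_free Y (mfE k (mf_shift E))" by (simp add: mfact_locally_free[OF E])
  have "sheaf_mor Y (mfE (k + 1) E) (mfE (k + 1 + 1) E) (\<lambda>y. - mfphi (k + 1) E y)"
    by (intro sheaf_mor_uminus mfact_locally_free[OF E] mfact_mor[OF E])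
  then show "sheaf_mor Y (mfE k (mf_shift E)) (mfE (k + 1) (mf_shift E)) (mfphi k (mf_shift E))"
    by (simp add: mfphi_shift[abs_def])
  assume y: "y \<in> Y"
  show "mfphi (k + 1) (mf_shift E) y * mfphi k (mf_shift E) y = w y \<cdot>\<^sub>m 1\<^sub>m (rk (mfE k (mf_shift E)) y)"
    using mfact_square[OF E y, of "k + 1"] mfact_carrier[OF E y, of "k + 1"] mfact_carrier[OF E y, of "k + 1 + 1"]
    by (simp add: mfphi_shift)
qed

lemma four_block_scalar:
  "four_block_mat (c \<cdot>\<^sub>m 1\<^sub>m m) (0\<^sub>m m n) (0\<^sub>m n m) (c \<cdot>\<^sub>m 1\<^sub>m n) = (c \<cdot>\<^sub>m 1\<^sub>m (m + n) :: complex mat)"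
  by (rule eq_matI) (auto simp: four_block_mat_def Let_def)

text \<open>In the square of the block matrix the upper right block is
  \<open>\<phi>\<^sup>F p - p \<phi>\<^sup>E\<close>, which vanishes because \<open>p\<close> is
  closed; the diagonal blocks are the squares of the structure maps of \<open>F\<close> and
  \<open>E\<close>.\<close>

lemma mf_cone_mfact:
  assumes E: "is_mfact Y w E" and F: "is_mfact Y w F" and p: "p \<in> Z0_hom Y E F"
  shows "is_mfact Y w (mf_cone E F p)"
  unfolding is_mfact_iff
proof (intro conjI allI ballI)
  fix k y
  note lE = mfact_locally_free[OF E] and lF = mfact_locally_free[OF F]
  show "locally_free Y (mfE k (mf_cone E F p))" by (simp add: locally_free_dsum lE lF)
  have "sheaf_mor Y (dsum (mfE k F) (mfE (k + 1) E)) (dsum (mfE (k + 1) F) (mfE k E))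
    (\<lambda>y. four_block_mat (mfphi k F y) (mfmap (k + 1) p y) (0\<^sub>m (rk (mfE k E) y) (rk (mfE k F) y)) (- mfphi (k + 1) E y))"
    using mfact_mor[OF E, of "k + 1"]
    by (intro sheaf_mor_block lE lF mfact_mor[OF F] Z0_mor[OF p] sheaf_mor_zero sheaf_mor_uminus) simp
  then show "sheaf_mor Y (mfE k (mf_cone E F p)) (mfE (k + 1) (mf_cone E F p)) (mfphi k (mf_cone E F p))"
    by (simp add: mfphi_cone[abs_def])
  assume y: "y \<in> Y"
  have cE: "mfphi (k + 1) E y \<in> carrier_mat (rk (mfE k E) y) (rk (mfE (k + 1) E) y)"
    using mfact_carrier[OF E y, of "k + 1"] by simp
  have cE': "mfphi k E y \<in> carrier_mat (rk (mfE (k + 1) E) y) (rk (mfE k E) y)"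
    using mfact_carrier[OF E y, of k] by simp
  have cF: "mfphi (k + 1) F y \<in> carrier_mat (rk (mfE k F) y) (rk (mfE (k + 1) F) y)"
    using mfact_carrier[OF F y, of "k + 1"] by simp
  have cF': "mfphi k F y \<in> carrier_mat (rk (mfE (k + 1) F) y) (rk (mfE k F) y)"
    using mfact_carrier[OF F y, of k] by simp
  note cp = Z0_carrier[OF p y]
  have sE: "mfphi k E y * mfphi (k + 1) E y = w y \<cdot>\<^sub>m 1\<^sub>m (rk (mfE (k + 1) E) y)"
    using mfact_square[OF E y, of "k + 1"] by simp
  note sF = mfact_square[OF F y, of k]
  have c: "mfphi (k + 1) F y * mfmap (k + 1) p y = mfmap k p y * mfphi (k + 1) E y"
    using Z0_comm[OF p y, of "k + 1"] by simp
  have cpE: "mfmap k p y * mfphi (k + 1) E y \<in> carrier_mat (rk (mfE k F) y) (rk (mfE (k + 1) E) y)"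
    by (rule mult_carrier_mat[OF cp cE])
  show "mfphi (k + 1) (mf_cone E F p) y * mfphi k (mf_cone E F p) y = w y \<cdot>\<^sub>m 1\<^sub>m (rk (mfE k (mf_cone E F p)) y)"
    using cE cE' cF cF' cp[of k] cp[of "k + 1"] sE sF c cpE
    by (simp add: mfphi_cone, subst mult_four_block_mat[OF cF cp zero_carrier_mat _ cF' cp zero_carrier_mat])
      (auto simp: four_block_scalar add_uminus_minus_mat[OF cpE cpE] minus_r_inv_mat[OF cpE])
qed

lemma mfmap_cone_incl: "mfmap k (cone_incl E F) y = 1\<^sub>m (rk (mfE k F) y) @\<^sub>r 0\<^sub>m (rk (mfE (k + 1) E) y) (rk (mfE k F) y)"
  by (auto simp: mfmap_def cone_incl_def mfE_def)

lemma mfmap_cone_proj: "mfmap k (cone_proj E F) y =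
    four_block_mat (0\<^sub>m (rk (mfE (k + 1) E) y) (rk (mfE k F) y)) (1\<^sub>m (rk (mfE (k + 1) E) y))
            (0\<^sub>m 0 (rk (mfE k F) y)) (0\<^sub>m 0 (rk (mfE (k + 1) E) y))"
  by (auto simp: mfmap_def cone_proj_def mfE_def)

text \<open>Block identities become readable on vectors \<open>a @\<^sub>v b\<close>; this is how
  the identities for cones, totalizations and their homotopies are verified below.\<close>

lemma mat_eq_on_vecI:
  fixes A B :: "complex mat"
  assumes A: "A \<in> carrier_mat m n" and B: "B \<in> carrier_mat m n"
    and eq: "\<And>v. v \<in> carrier_vec n \<Longrightarrow> A *\<^sub>v v = B *\<^sub>v v"
  shows "A = B"
proof (rule mat_col_eqI)
  fix j assume "j < dim_col B"
  then have j: "j < n" using B by simp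
  have "M *\<^sub>v unit_vec n j = col M j" if "M \<in> carrier_mat m n" for M :: "complex mat"
    using that j by (intro eq_vecI) auto
  then show "col A j = col B j" using eq[of "unit_vec n j"] A B by simp
qed (use A B in auto)

lemma cone_incl_mult:
  assumes "a \<in> carrier_vec (rk (mfE k F) y)"
  shows "mfmap k (cone_incl E F) y *\<^sub>v a = a @\<^sub>v 0\<^sub>v (rk (mfE (k + 1) E) y)"
  unfolding mfmap_cone_incl
  by (subst mat_mult_append[OF one_carrier_mat zero_carrier_mat assms])
    (simp add: assms zero_mat_mult_vec[OF assms])

lemma cone_proj_mult:
  assumes "a \<in> carrier_vec (rk (mfE k F) y)" "b \<in> carrier_vec (rk (mfE (k + 1) E) y)"
  shows "mfmap k (cone_proj E F) y *\<^sub>v (a @\<^sub>v b) = b"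
  unfolding mfmap_cone_proj
  by (subst four_block_mat_mult_vec[OF zero_carrier_mat one_carrier_mat zero_carrier_mat zero_carrier_mat assms])
    (simp add: assms zero_mat_mult_vec[OF assms(1)] zero_mat_mult_vec[OF assms(2)])

lemma cone_mult:
  assumes E: "is_mfact Y w E" and F: "is_mfact Y w F" and p: "p \<in> Z0_hom Y E F" and y: "y \<in> Y"
    and a: "a \<in> carrier_vec (rk (mfE k F) y)" and b: "b \<in> carrier_vec (rk (mfE (k + 1) E) y)"
  shows "mfphi k (mf_cone E F p) y *\<^sub>v (a @\<^sub>v b) =
    (mfphi k F y *\<^sub>v a + mfmap (k + 1) p y *\<^sub>v b) @\<^sub>v - (mfphi (k + 1) E y *\<^sub>v b)"
proof -
  have cE: "mfphi (k + 1) E y \<in> carrier_mat (rk (mfE k E) y) (rk (mfE (k + 1) E) y)"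
    using mfact_carrier[OF E y, of "k + 1"] by simp
  have cb: "mfphi (k + 1) E y *\<^sub>v b \<in> carrier_vec (rk (mfE k E) y)" by (rule mult_mat_vec_carrier[OF cE b])
  show ?thesis
    unfolding mfphi_cone
    by (subst four_block_mat_mult_vec[OF mfact_carrier[OF F y] Z0_carrier[OF p y] zero_carrier_mat _ a b])
      (use cE cb b in \<open>simp_all add: zero_mat_mult_vec[OF a]\<close>)
qed

lemma cone_incl_Z0:
  assumes E: "is_mfact Y w E" and F: "is_mfact Y w F" and p: "p \<in> Z0_hom Y E F"
  shows "cone_incl E F \<in> Z0_hom Y F (mf_cone E F p)"
  unfolding Z0_hom_iff
proof (intro conjI allI ballI)
  fix k y
  note C = mf_cone_mfact[OF E F p]
  show m: "sheaf_mor Y (mfE k F) (mfE k (mf_cone E F p)) (mfmap k (cone_incl E F))" for k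
    unfolding mfmap_cone_incl[abs_def] mfE_cone
    by (intro sheaf_mor_rows sheaf_mor_id sheaf_mor_zero mfact_locally_free[OF E] mfact_locally_free[OF F])
  assume y: "y \<in> Y"
  note c = sheaf_mor_carrier[OF m y] and cC = mfact_carrier[OF C y] and cF = mfact_carrier[OF F y]
  show "mfphi k (mf_cone E F p) y * mfmap k (cone_incl E F) y = mfmap (k + 1) (cone_incl E F) y * mfphi k F y"
  proof (rule mat_eq_on_vecI[OF mult_carrier_mat[OF cC c] mult_carrier_mat[OF c cF]])
    fix v :: "complex Matrix.vec" assume v: "v \<in> carrier_vec (rk (mfE k F) y)"
    have pv: "mfphi k F y *\<^sub>v v \<in> carrier_vec (rk (mfE (k + 1) F) y)" by (rule mult_mat_vec_carrier[OF cF v])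
    have cE: "mfphi (k + 1) E y \<in> carrier_mat (rk (mfE k E) y) (rk (mfE (k + 1) E) y)"
      using mfact_carrier[OF E y, of "k + 1"] by simp
    have z: "M *\<^sub>v 0\<^sub>v n = 0\<^sub>v m" if "M \<in> carrier_mat m n" for M :: "complex mat" and m n
      using that by (intro eq_vecI) auto
    have "(mfphi k (mf_cone E F p) y * mfmap k (cone_incl E F) y) *\<^sub>v v
        = mfphi k F y *\<^sub>v v @\<^sub>v 0\<^sub>v (rk (mfE (k + 1 + 1) E) y)"
      using assoc_mult_mat_vec[OF cC c v] cone_mult[OF E F p y v zero_carrier_vec] cone_incl_mult[OF v] pv
      by (simp add: z[OF cE] z[OF Z0_carrier[OF p y]])
    also have "\<dots> = (mfmap (k + 1) (cone_incl E F) y * mfphi k F y) *\<^sub>v v"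
      using assoc_mult_mat_vec[OF c cF v] cone_incl_mult[OF pv] by simp
    finally show "(mfphi k (mf_cone E F p) y * mfmap k (cone_incl E F) y) *\<^sub>v v
        = (mfmap (k + 1) (cone_incl E F) y * mfphi k F y) *\<^sub>v v" .
  qed
qed

text \<open>The lower right block of the cone is \<open>- \<phi>\<^sup>E\<close>, which is the
  structure map of \<open>E[1]\<close>.\<close>

lemma cone_proj_Z0:
  assumes E: "is_mfact Y w E" and F: "is_mfact Y w F" and p: "p \<in> Z0_hom Y E F"
  shows "cone_proj E F \<in> Z0_hom Y (mf_cone E F p) (mf_shift E)"
  unfolding Z0_hom_iff
proof (intro conjI allI ballI)
  fix k y
  note C = mf_cone_mfact[OF E F p] and S = mf_shift_mfact[OF E]
  show m: "sheaf_mor Y (mfE k (mf_cone E F p)) (mfE k (mf_shift E)) (mfmap k (cone_proj E F))" for k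
    unfolding mfmap_cone_proj[abs_def] mfE_cone mfE_shift
    by (intro sheaf_mor_cols sheaf_mor_id sheaf_mor_zero mfact_locally_free[OF E] mfact_locally_free[OF F])
  assume y: "y \<in> Y"
  note c = sheaf_mor_carrier[OF m y] and cC = mfact_carrier[OF C y] and cS = mfact_carrier[OF S y] and cF = mfact_carrier[OF F y]
  show "mfphi k (mf_shift E) y * mfmap k (cone_proj E F) y = mfmap (k + 1) (cone_proj E F) y * mfphi k (mf_cone E F p) y"
  proof (rule mat_eq_on_vecI[OF mult_carrier_mat[OF cS c] mult_carrier_mat[OF c cC]])
    fix v :: "complex Matrix.vec" assume v: "v \<in> carrier_vec (rk (mfE k (mf_cone E F p)) y)"
    let ?a = "vec_first v (rk (mfE k F) y)" and ?b = "vec_last v (rk (mfE (k + 1) E) y)"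
    have v': "v = ?a @\<^sub>v ?b" using vec_first_last_append[of v "rk (mfE k F) y" "rk (mfE (k + 1) E) y"] v by simp
    have cE: "mfphi (k + 1) E y \<in> carrier_mat (rk (mfE (k + 1 + 1) E) y) (rk (mfE (k + 1) E) y)"
      using mfact_carrier[OF E y, of "k + 1"] by simp
    have b: "- (mfphi (k + 1) E y *\<^sub>v ?b) \<in> carrier_vec (rk (mfE (k + 1 + 1) E) y)"
      using mult_mat_vec_carrier[OF cE, of ?b] by simp
    have a: "mfphi k F y *\<^sub>v ?a + mfmap (k + 1) p y *\<^sub>v ?b \<in> carrier_vec (rk (mfE (k + 1) F) y)"
      using mult_mat_vec_carrier[OF cF, of ?a k] mult_mat_vec_carrier[OF Z0_carrier[OF p y], of ?b "k + 1"] by simp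
    have "(mfphi k (mf_shift E) y * mfmap k (cone_proj E F) y) *\<^sub>v v = mfphi k (mf_shift E) y *\<^sub>v ?b"
      using assoc_mult_mat_vec[OF cS c v] cone_proj_mult[of ?a k F y ?b E] v' by simp
    also have "\<dots> = - (mfphi (k + 1) E y *\<^sub>v ?b)"
      using cE by (simp add: mfphi_shift)
    also have "\<dots> = mfmap (k + 1) (cone_proj E F) y *\<^sub>v (mfphi k (mf_cone E F p) y *\<^sub>v (?a @\<^sub>v ?b))"
      by (subst cone_mult[OF E F p y]) (use cone_proj_mult[OF a b] in simp_all)
    also have "\<dots> = (mfmap (k + 1) (cone_proj E F) y * mfphi k (mf_cone E F p) y) *\<^sub>v v"
      using assoc_mult_mat_vec[OF c cC v] v' by simp
    finally show "(mfphi k (mf_shift E) y * mfmap k (cone_proj E F) y) *\<^sub>v v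
        = (mfmap (k + 1) (cone_proj E F) y * mfphi k (mf_cone E F p) y) *\<^sub>v v" .
  qed
qed

lemma mult_mat_zero_vec: "M \<in> carrier_mat m n \<Longrightarrow> M *\<^sub>v 0\<^sub>v n = (0\<^sub>v m :: complex Matrix.vec)"
  by (intro eq_vecI) auto

lemma mult_mat_uminus_vec:
  "M \<in> carrier_mat m n \<Longrightarrow> v \<in> carrier_vec n \<Longrightarrow> M *\<^sub>v (- v) = (- (M *\<^sub>v v) :: complex Matrix.vec)"
  by (intro eq_vecI) auto

lemma uminus_append_vec: "- (u @\<^sub>v v) = (- u @\<^sub>v - v :: 'a::group_add Matrix.vec)"
  by (intro eq_vecI) auto

lemma vec_split_append:
  fixes v :: "complex Matrix.vec"
  assumes "v \<in> carrier_vec (m + n)"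
  obtains a b where "a \<in> carrier_vec m" "b \<in> carrier_vec n" "v = a @\<^sub>v b"
  using vec_first_last_append[OF assms] vec_first_carrier vec_last_carrier that by metis

section \<open>The totalization of a complex\<close>

lemma tot_sheaf_add_even [simp]: "even j \<Longrightarrow> tot_sheaf (i + j) a l Em = tot_sheaf i a l Em"
proof (induction l arbitrary: a)
  case (Suc l)
  have "mfE (i + j - a) (Em a) = mfE (i - a) (Em a)"
    using mfE_add_even(1)[OF Suc.prems, of "i - a" "Em a"] by (simp add: algebra_simps)
  then show ?case using Suc by simp
qed simp

lemma tot_sheaf_even_add [simp]: "even j \<Longrightarrow> tot_sheaf (j + i) a l Em = tot_sheaf i a l Em"
  using tot_sheaf_add_even[of j i] by (simp add: add.commute)

lemma tot_phi_add_even [simp]: "even j \<Longrightarrow> tot_phi (i + j) a l Em dm y = tot_phi i a l Em dm y"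
proof (induction l arbitrary: a)
  case (Suc l)
  have eq: "mfE (i + j - a) (Em a) = mfE (i - a) (Em a)" "mfE (i + j + 1 - a) (Em a) = mfE (i + 1 - a) (Em a)"
    "mfphi (i + j - a) (Em a) = mfphi (i - a) (Em a)" "mfmap (i + j - a) (dm a) = mfmap (i - a) (dm a)"
    using mfE_add_even(1)[OF Suc.prems, of "i - a" "Em a"] mfE_add_even(1)[OF Suc.prems, of "i + 1 - a" "Em a"]
      mfphi_add_even(1)[OF Suc.prems, of "i - a" "Em a"] mfmap_add_even(1)[OF Suc.prems, of "i - a" "dm a"]
    by (simp_all add: algebra_simps)
  have "i + j + 1 = i + 1 + j" by simp
  then have ts: "tot_sheaf (i + j + 1) b l' Em = tot_sheaf (i + 1) b l' Em" for b l'
    using tot_sheaf_add_even[OF Suc.prems, of "i + 1"] by metis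
  show ?case using Suc by (simp add: eq ts split: nat.split)
qed simp

lemma mfE_totalization [simp]: "mfE k (totalization a l Em dm) = tot_sheaf k a l Em"
proof (cases "even k")
  case True then show ?thesis using tot_sheaf_add_even[of k 0 a l Em] by (simp add: mfE_def totalization_def)
next
  case False then show ?thesis using tot_sheaf_add_even[of "k - 1" 1 a l Em] by (simp add: mfE_def totalization_def)
qed

lemma mfphi_totalization [simp]: "mfphi k (totalization a l Em dm) y = tot_phi k a l Em dm y"
proof (cases "even k")
  case True then show ?thesis using tot_phi_add_even[of k 0 a l Em] by (simp add: mfphi_def totalization_def)
next
  case False then show ?thesis using tot_phi_add_even[of "k - 1" 1 a l Em] by (simp add: mfphi_def totalization_def)
qed

definition par_sgn :: "int \<Rightarrow> complex Matrix.vec \<Rightarrow> complex Matrix.vec" where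
  "par_sgn a v = (if even a then v else - v)"

lemma par_sgn_carrier [simp]: "par_sgn a v \<in> carrier_vec n \<longleftrightarrow> v \<in> carrier_vec n"
  by (simp add: par_sgn_def)

text \<open>Neighbouring summands carry opposite signs; this cancels the mixed terms
  \<open>d \<phi>\<close> and \<open>\<phi> d\<close> in the square of the totalization.\<close>

lemma par_sgn_cancel:
  "c \<in> carrier_vec n \<Longrightarrow> (par_sgn a c @\<^sub>v 0\<^sub>v r) + (par_sgn (a + 1) c @\<^sub>v 0\<^sub>v r) = 0\<^sub>v (n + r)"
  by (intro eq_vecI) (auto simp: par_sgn_def)

declare tot_phi.simps(2) [simp del]

text \<open>For \<open>l = 0\<close> there is no first summand and the value is the empty vector, so
  that the formula of \<open>tot_mult\<close> holds uniformly, also when \<open>a\<close> is the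
  last index of the window.\<close>

definition tot_incl ::
  "int \<Rightarrow> int \<Rightarrow> nat \<Rightarrow> (int \<Rightarrow> 'p mfact) \<Rightarrow> 'p \<Rightarrow> complex Matrix.vec \<Rightarrow> complex Matrix.vec" where
  "tot_incl i a l Em y v =
     (case l of 0 \<Rightarrow> 0\<^sub>v 0 | Suc l' \<Rightarrow> v @\<^sub>v 0\<^sub>v (rk (tot_sheaf i (a + 1) l' Em) y))"

lemma tot_incl_0 [simp]: "tot_incl i a 0 Em y v = 0\<^sub>v 0"
  and tot_incl_Suc [simp]: "tot_incl i a (Suc l) Em y v = v @\<^sub>v 0\<^sub>v (rk (tot_sheaf i (a + 1) l Em) y)"
  by (simp_all add: tot_incl_def)

lemma tot_incl_carrier:
  "v \<in> carrier_vec (rk (mfE (i - a) (Em a)) y) \<Longrightarrow> tot_incl i a l Em y v \<in> carrier_vec (rk (tot_sheaf i a l Em) y)"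
  by (cases l) simp_all

text \<open>The complex runs over all integers, and a totalization uses the window of
  \<open>l\<close> terms from \<open>a\<close> on. A brutal truncation to a smaller window is of the
  same kind, which makes induction on \<open>l\<close> possible.\<close>

locale mf_complex =
  fixes Y :: "'n::finite cproj set" and w :: "'n cproj \<Rightarrow> complex"
    and Em :: "int \<Rightarrow> 'n cproj mfact" and dm :: "int \<Rightarrow> 'n cproj mf_map"
  assumes mf: "is_mfact Y w (Em m)" and dZ: "dm m \<in> Z0_hom Y (Em m) (Em (m + 1))"
    and dd: "y \<in> Y \<Longrightarrow> mfmap k (dm (m + 1)) y * mfmap k (dm m) y
              = 0\<^sub>m (rk (mfE k (Em (m + 2))) y) (rk (mfE k (Em m)) y)"
begin

lemma tot_locally_free: "locally_free Y (tot_sheaf i a l Em)"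
  by (induction l arbitrary: a) (auto intro: locally_free_zero locally_free_dsum mfact_locally_free[OF mf])

lemma phi_mor: "sheaf_mor Y (mfE (i - a) (Em a)) (mfE (i + 1 - a) (Em a)) (mfphi (i - a) (Em a))"
  using mfact_mor[OF mf, of "i - a" a] by (simp add: algebra_simps)

lemma tot_mor: "sheaf_mor Y (tot_sheaf i a l Em) (tot_sheaf (i + 1) a l Em) (tot_phi i a l Em dm)"
proof (induction l arbitrary: a)
  case 0
  have "sheaf_mor Y zero_sheaf zero_sheaf (\<lambda>y. 0\<^sub>m (rk zero_sheaf y) (rk zero_sheaf y))"
    by (intro sheaf_mor_zero locally_free_zero)
  then show ?case by (simp add: fun_eq_iff[symmetric])
next
  case (Suc l)
  note lf = tot_locally_free mfact_locally_free[OF mf]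
  have A: "sheaf_mor Y (mfE (i - a) (Em a)) (mfE (i + 1 - a) (Em a))
      (\<lambda>y. if even a then mfphi (i - a) (Em a) y else - mfphi (i - a) (Em a) y)"
    by (cases "even a") (simp_all add: phi_mor sheaf_mor_uminus[OF lf(2) lf(2) phi_mor])
  have C: "sheaf_mor Y (mfE (i - a) (Em a)) (tot_sheaf (i + 1) (a + 1) l Em)
      (\<lambda>y. case l of 0 \<Rightarrow> 0\<^sub>m 0 (rk (mfE (i - a) (Em a)) y)
      | Suc l' \<Rightarrow> mfmap (i - a) (dm a) y @\<^sub>r
          0\<^sub>m (rk (tot_sheaf (i + 1) (a + 2) l' Em) y) (rk (mfE (i - a) (Em a)) y))"
  proof (cases l)
    case 0
    then show ?thesis using sheaf_mor_zero[OF lf(2)[of "i - a" a] locally_free_zero] by simp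
  next
    case (Suc l')
    have "sheaf_mor Y (mfE (i - a) (Em a)) (mfE (i - a) (Em (a + 1))) (mfmap (i - a) (dm a))"
      by (rule Z0_mor[OF dZ])
    from sheaf_mor_rows[OF lf(2) this sheaf_mor_zero[OF lf(2) lf(1)[of "i + 1" "a + 2" l']]]
    show ?thesis by (simp add: Suc algebra_simps)
  qed
  have "sheaf_mor Y (dsum (mfE (i - a) (Em a)) (tot_sheaf i (a + 1) l Em))
     (dsum (mfE (i + 1 - a) (Em a)) (tot_sheaf (i + 1) (a + 1) l Em)) (\<lambda>y. tot_phi i a (Suc l) Em dm y)"
    unfolding tot_phi.simps by (intro sheaf_mor_block lf A C Suc sheaf_mor_zero)
  then show ?case by simp
qed

context
  fixes y assumes y: "y \<in> Y"
begin

lemma tot_carrier: "tot_phi i a l Em dm y \<in> carrier_mat (rk (tot_sheaf (i + 1) a l Em) y) (rk (tot_sheaf i a l Em) y)"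
  by (rule sheaf_mor_carrier[OF tot_mor y])

lemma phi_carrier: "mfphi (i - a) (Em a) y \<in> carrier_mat (rk (mfE (i + 1 - a) (Em a)) y) (rk (mfE (i - a) (Em a)) y)"
  by (rule sheaf_mor_carrier[OF phi_mor y])

lemma d_carrier: "mfmap k (dm a) y \<in> carrier_mat (rk (mfE k (Em (a + 1))) y) (rk (mfE k (Em a)) y)"
  by (rule Z0_carrier[OF dZ y])

text \<open>The recursion for \<open>tot_phi\<close> on vectors, the form in which the matrix is
  used from now on: the differential feeds the component of index \<open>a\<close> into the first
  summand of the rest.\<close>

lemma tot_mult:
  assumes u: "u \<in> carrier_vec (rk (mfE (i - a) (Em a)) y)" and x: "x \<in> carrier_vec (rk (tot_sheaf i (a + 1) l Em) y)"
  shows "tot_phi i a (Suc l) Em dm y *\<^sub>v (u @\<^sub>v x) = par_sgn a (mfphi (i - a) (Em a) y *\<^sub>v u) @\<^sub>v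
    (tot_incl (i + 1) (a + 1) l Em y (mfmap (i - a) (dm a) y *\<^sub>v u) + tot_phi i (a + 1) l Em dm y *\<^sub>v x)"
proof -
  let ?A = "if even a then mfphi (i - a) (Em a) y else - mfphi (i - a) (Em a) y"
  let ?C = "case l of 0 \<Rightarrow> 0\<^sub>m 0 (rk (mfE (i - a) (Em a)) y)
      | Suc l' \<Rightarrow> mfmap (i - a) (dm a) y @\<^sub>r
          0\<^sub>m (rk (tot_sheaf (i + 1) (a + 2) l' Em) y) (rk (mfE (i - a) (Em a)) y)"
  have A: "?A \<in> carrier_mat (rk (mfE (i + 1 - a) (Em a)) y) (rk (mfE (i - a) (Em a)) y)"
    using phi_carrier by simp
  have eq: "i + 1 - (a + 1) = i - a" by simp
  have C: "?C \<in> carrier_mat (rk (tot_sheaf (i + 1) (a + 1) l Em) y) (rk (mfE (i - a) (Em a)) y)"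
  proof (cases l)
    case (Suc l')
    show ?thesis
      using carrier_append_rows[OF d_carrier[of "i - a" a] zero_carrier_mat[of "rk (tot_sheaf (i + 1) (a + 2) l' Em) y"]]
      by (simp add: Suc add.commute)
  qed simp
  have Au: "?A *\<^sub>v u = par_sgn a (mfphi (i - a) (Em a) y *\<^sub>v u)"
    using u phi_carrier[of i a] by (auto simp: par_sgn_def)
  have Auc: "mfphi (i - a) (Em a) y *\<^sub>v u \<in> carrier_vec (rk (mfE (i + 1 - a) (Em a)) y)"
    by (rule mult_mat_vec_carrier[OF phi_carrier u])
  have Cu: "?C *\<^sub>v u = tot_incl (i + 1) (a + 1) l Em y (mfmap (i - a) (dm a) y *\<^sub>v u)"
  proof (cases l)
    case 0
    then show ?thesis using zero_mat_mult_vec[OF u, of 0] by simp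
  next
    case (Suc l')
    then show ?thesis
      using mat_mult_append[OF d_carrier zero_carrier_mat u] zero_mat_mult_vec[OF u] by (simp add: add.commute)
  qed
  show ?thesis
    unfolding tot_phi.simps
    by (subst four_block_mat_mult_vec[OF A zero_carrier_mat C tot_carrier u x])
      (use Auc in \<open>simp add: Au Cu zero_mat_mult_vec[OF x]\<close>)
qed

text \<open>Induction on the window: the component of index \<open>a\<close> contributes
  \<open>w u\<close>, the rest contributes \<open>w x'\<close> by induction, and nothing passes from
  one to the other.\<close>

lemma tot_square:
  assumes "x \<in> carrier_vec (rk (tot_sheaf i a l Em) y)"
  shows "tot_phi (i + 1) a l Em dm y *\<^sub>v (tot_phi i a l Em dm y *\<^sub>v x) = w y \<cdot>\<^sub>v x"
  using assms
proof (induction l arbitrary: a x)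
  case 0
  then show ?case by (intro eq_vecI) auto
next
  case (Suc l)
  obtain u x' where ux: "u \<in> carrier_vec (rk (mfE (i - a) (Em a)) y)"
    "x' \<in> carrier_vec (rk (tot_sheaf i (a + 1) l Em) y)" "x = u @\<^sub>v x'"
    using Suc.prems by (auto elim: vec_split_append)
  let ?f = "mfphi (i - a) (Em a) y *\<^sub>v u" and ?d = "mfmap (i - a) (dm a) y *\<^sub>v u"
  have fc: "?f \<in> carrier_vec (rk (mfE (i + 1 - a) (Em a)) y)" by (rule mult_mat_vec_carrier[OF phi_carrier ux(1)])
  have dc: "?d \<in> carrier_vec (rk (mfE (i - a) (Em (a + 1))) y)" by (rule mult_mat_vec_carrier[OF d_carrier ux(1)])
  have dc': "?d \<in> carrier_vec (rk (mfE (i + 1 - (a + 1)) (Em (a + 1))) y)" using dc by simp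
  have ic: "tot_incl (i + 1) (a + 1) l Em y ?d \<in> carrier_vec (rk (tot_sheaf (i + 1) (a + 1) l Em) y)"
    by (rule tot_incl_carrier) (use dc in simp)
  have Tc: "tot_phi i (a + 1) l Em dm y *\<^sub>v x' \<in> carrier_vec (rk (tot_sheaf (i + 1) (a + 1) l Em) y)"
    by (rule mult_mat_vec_carrier[OF tot_carrier ux(2)])
  have ff: "mfphi (i + 1 - a) (Em a) y *\<^sub>v ?f = w y \<cdot>\<^sub>v u"
  proof -
    have e: "i + 1 - a = (i - a) + 1" by simp
    have "mfphi ((i - a) + 1) (Em a) y *\<^sub>v ?f = (mfphi ((i - a) + 1) (Em a) y * mfphi (i - a) (Em a) y) *\<^sub>v u"
      using assoc_mult_mat_vec[OF mfact_carrier[OF mf y] mfact_carrier[OF mf y] ux(1)] by simp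
    moreover have "(w y \<cdot>\<^sub>m 1\<^sub>m (rk (mfE (i - a) (Em a)) y)) *\<^sub>v u = w y \<cdot>\<^sub>v u"
      using ux(1) by (intro eq_vecI) (auto simp: smult_scalar_prod_distrib)
    ultimately show ?thesis unfolding e using mfact_square[OF mf y, of "i - a" a] by simp
  qed
  have sf: "par_sgn a (mfphi (i + 1 - a) (Em a) y *\<^sub>v par_sgn a ?f) = w y \<cdot>\<^sub>v u"
  proof (cases "even a")
    case False
    then show ?thesis
      using mult_mat_uminus_vec[OF phi_carrier[of "i + 1" a] fc] ff by (simp add: par_sgn_def)
  qed (use ff in \<open>simp add: par_sgn_def\<close>)
  \<comment> \<open>The mixed terms: the first applies \<open>d\<close> after \<open>\<phi>\<close>
    in index \<open>a\<close>, the second \<open>\<phi>\<close> after \<open>d\<close> in index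
    \<open>a + 1\<close>. They agree up to sign because \<open>d\<close> is a chain map; the
    remaining term \<open>d d\<close> is zero.\<close>
  have z: "tot_incl (i + 1 + 1) (a + 1) l Em y (mfmap (i + 1 - a) (dm a) y *\<^sub>v par_sgn a ?f)
     + tot_phi (i + 1) (a + 1) l Em dm y *\<^sub>v tot_incl (i + 1) (a + 1) l Em y ?d
     = 0\<^sub>v (rk (tot_sheaf i (a + 1) l Em) y)"
  proof (cases l)
    case 0
    then show ?thesis by (intro eq_vecI) auto
  next
    case (Suc l')
    have comm: "mfmap (i + 1 - a) (dm a) y *\<^sub>v ?f = mfphi (i - a) (Em (a + 1)) y *\<^sub>v ?d"
    proof -
      have "i + 1 - a = (i - a) + 1" by simp
      then show ?thesis
        using assoc_mult_mat_vec[OF Z0_carrier[OF dZ y] mfact_carrier[OF mf y] ux(1)]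
          assoc_mult_mat_vec[OF mfact_carrier[OF mf y] Z0_carrier[OF dZ y] ux(1)]
          Z0_comm[OF dZ y, of "i - a" a] by metis
    qed
    have fdc: "mfphi (i - a) (Em (a + 1)) y *\<^sub>v ?d \<in> carrier_vec (rk (mfE (i + 1 - a) (Em (a + 1))) y)"
      using mult_mat_vec_carrier[OF mfact_carrier[OF mf y] dc] by (simp add: algebra_simps)
    have ddu: "mfmap (i - a) (dm (a + 1)) y *\<^sub>v ?d = 0\<^sub>v (rk (mfE (i - a) (Em (a + 1 + 1))) y)"
      using assoc_mult_mat_vec[OF Z0_carrier[OF dZ y] Z0_carrier[OF dZ y] ux(1)] dd[OF y, of "i - a" a]
        zero_mat_mult_vec[OF ux(1)] by (simp add: add.commute)
    let ?r = "rk (tot_sheaf (i + 1 + 1) (a + 1 + 1) l' Em) y"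
    have inc0: "tot_incl (i + 1 + 1) (a + 1 + 1) l' Em y (mfmap (i - a) (dm (a + 1)) y *\<^sub>v ?d) = 0\<^sub>v ?r"
      by (cases l') (auto intro!: eq_vecI simp: ddu)
    have T0: "tot_phi (i + 1) (a + 1 + 1) l' Em dm y *\<^sub>v 0\<^sub>v (rk (tot_sheaf (i + 1) (a + 1 + 1) l' Em) y) = 0\<^sub>v ?r"
      by (rule mult_mat_zero_vec[OF tot_carrier])
    have "tot_phi (i + 1) (a + 1) l Em dm y *\<^sub>v tot_incl (i + 1) (a + 1) l Em y ?d
        = par_sgn (a + 1) (mfphi (i - a) (Em (a + 1)) y *\<^sub>v ?d) @\<^sub>v 0\<^sub>v ?r"
      unfolding Suc tot_incl_Suc
      by (subst tot_mult[OF dc' zero_carrier_vec]) (use inc0 T0 in simp)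
    moreover have "mfmap (i + 1 - a) (dm a) y *\<^sub>v par_sgn a ?f = par_sgn a (mfphi (i - a) (Em (a + 1)) y *\<^sub>v ?d)"
      using mult_mat_uminus_vec[OF d_carrier fc] comm by (simp add: par_sgn_def)
    moreover have "rk (tot_sheaf i (a + 1) l Em) y = rk (mfE (i + 1 - a) (Em (a + 1))) y + ?r"
    proof -
      have "mfE (i - (a + 1)) (Em (a + 1)) = mfE (i + 1 - a) (Em (a + 1))"
        using mfE_add_even(1)[of 2 "i - (a + 1)" "Em (a + 1)"] by (simp add: algebra_simps)
      then show ?thesis using tot_sheaf_add_even[of 2 i "a + 1 + 1" l' Em] by (simp add: Suc)
    qed
    ultimately show ?thesis
      using par_sgn_cancel[OF fdc, of a ?r] by (simp only: Suc tot_incl_Suc)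
  qed
  have T2: "tot_phi (i + 1) (a + 1) l Em dm y *\<^sub>v (tot_phi i (a + 1) l Em dm y *\<^sub>v x') = w y \<cdot>\<^sub>v x'"
    by (rule Suc.IH[OF ux(2)])
  let ?I = "tot_incl (i + 1) (a + 1) l Em y ?d" and ?T = "tot_phi i (a + 1) l Em dm y *\<^sub>v x'"
  let ?T1 = "tot_phi (i + 1) (a + 1) l Em dm y"
  let ?J = "tot_incl (i + 1 + 1) (a + 1) l Em y (mfmap (i + 1 - a) (dm a) y *\<^sub>v par_sgn a ?f)"
  have Jc: "?J \<in> carrier_vec (rk (tot_sheaf i (a + 1) l Em) y)"
  proof -
    have "mfmap (i + 1 - a) (dm a) y *\<^sub>v par_sgn a ?f \<in> carrier_vec (rk (mfE (i + 1 - a) (Em (a + 1))) y)"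
      by (rule mult_mat_vec_carrier[OF d_carrier]) (use fc in simp)
    then show ?thesis using tot_incl_carrier[of _ "i + 1 + 1" "a + 1" Em y l] by (simp add: algebra_simps)
  qed
  have TIc: "?T1 *\<^sub>v ?I \<in> carrier_vec (rk (tot_sheaf i (a + 1) l Em) y)"
    using mult_mat_vec_carrier[OF tot_carrier ic] by simp
  have "tot_phi (i + 1) a (Suc l) Em dm y *\<^sub>v (tot_phi i a (Suc l) Em dm y *\<^sub>v x)
     = tot_phi (i + 1) a (Suc l) Em dm y *\<^sub>v (par_sgn a ?f @\<^sub>v (?I + ?T))"
    unfolding ux(3) by (subst tot_mult[OF ux(1,2)]) simp
  also have "\<dots> = par_sgn a (mfphi (i + 1 - a) (Em a) y *\<^sub>v par_sgn a ?f) @\<^sub>v (?J + ?T1 *\<^sub>v (?I + ?T))"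
    by (rule tot_mult) (use fc ic Tc in simp_all)
  also have "?T1 *\<^sub>v (?I + ?T) = ?T1 *\<^sub>v ?I + w y \<cdot>\<^sub>v x'"
    using mult_add_distrib_mat_vec[OF tot_carrier ic Tc] T2 by simp
  also have "?J + (?T1 *\<^sub>v ?I + w y \<cdot>\<^sub>v x') = w y \<cdot>\<^sub>v x'"
    using assoc_add_vec[OF Jc TIc, of "w y \<cdot>\<^sub>v x'"] z ux(2) by simp
  also have "par_sgn a (mfphi (i + 1 - a) (Em a) y *\<^sub>v par_sgn a ?f) @\<^sub>v w y \<cdot>\<^sub>v x' = w y \<cdot>\<^sub>v x"
    unfolding sf ux(3) by (intro eq_vecI) auto
  finally show ?case .
qed

end

lemma totalization_mfact: "is_mfact Y w (totalization a l Em dm)"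
  unfolding is_mfact_iff
proof (intro conjI allI ballI)
  fix k y
  show "locally_free Y (mfE k (totalization a l Em dm))" by (simp add: tot_locally_free)
  show "sheaf_mor Y (mfE k (totalization a l Em dm)) (mfE (k + 1) (totalization a l Em dm)) (mfphi k (totalization a l Em dm))"
    using tot_mor[of k a l] by (rule_tac sheaf_mor_cong) auto
  assume y: "y \<in> Y"
  note c = tot_carrier[OF y, of "k + 1" a l] tot_carrier[OF y, of k a l]
  have "tot_phi (k + 1) a l Em dm y * tot_phi k a l Em dm y = w y \<cdot>\<^sub>m 1\<^sub>m (rk (tot_sheaf k a l Em) y)"
  proof (rule mat_eq_on_vecI)
    show "tot_phi (k + 1) a l Em dm y * tot_phi k a l Em dm y
      \<in> carrier_mat (rk (tot_sheaf k a l Em) y) (rk (tot_sheaf k a l Em) y)"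
      using mult_carrier_mat[OF c] by simp
    fix v :: "complex Matrix.vec" assume v: "v \<in> carrier_vec (rk (tot_sheaf k a l Em) y)"
    have "(w y \<cdot>\<^sub>m 1\<^sub>m (rk (tot_sheaf k a l Em) y)) *\<^sub>v v = w y \<cdot>\<^sub>v v"
      using v by (intro eq_vecI) (auto simp: smult_scalar_prod_distrib)
    then show "(tot_phi (k + 1) a l Em dm y * tot_phi k a l Em dm y) *\<^sub>v v
      = (w y \<cdot>\<^sub>m 1\<^sub>m (rk (tot_sheaf k a l Em) y)) *\<^sub>v v"
      using assoc_mult_mat_vec[OF c v] tot_square[OF y v] by simp
  qed auto
  then show "mfphi (k + 1) (totalization a l Em dm) y * mfphi k (totalization a l Em dm) y
      = w y \<cdot>\<^sub>m 1\<^sub>m (rk (mfE k (totalization a l Em dm)) y)" by simp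
qed

end

definition acyclic_at :: "'p \<Rightarrow> 'p mfact \<Rightarrow> bool" where
  "acyclic_at y E \<longleftrightarrow> (\<forall>k. \<forall>x\<in>carrier_vec (rk (mfE k E) y). mfphi k E y *\<^sub>v x = 0\<^sub>v (rk (mfE (k + 1) E) y) \<longrightarrow>
     (\<exists>z\<in>carrier_vec (rk (mfE (k + 1) E) y). mfphi (k + 1) E y *\<^sub>v z = x))"

lemma vec_add_eq_zeroD:
  fixes a b :: "'a::group_add Matrix.vec"
  assumes "a \<in> carrier_vec n" "b \<in> carrier_vec n" "a + b = 0\<^sub>v n" shows "b = - a"
proof (rule eq_vecI)
  fix i assume "i < dim_vec (- a)"
  then have i: "i < n" using assms(1) by simp
  have "vec_index a i + vec_index b i = 0"
    using arg_cong[OF assms(3), of "\<lambda>v. vec_index v i"] i assms(1,2) by simp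
  then have "- vec_index a i = vec_index b i" by (rule minus_unique)
  then show "vec_index b i = vec_index (- a) i" using i assms(1) by simp
qed (use assms in simp)

lemma append_vec_eq_iff:
  "v \<in> carrier_vec n \<Longrightarrow> v' \<in> carrier_vec n \<Longrightarrow> v @\<^sub>v u = v' @\<^sub>v u' \<longleftrightarrow> v = v' \<and> u = u'"
  by (rule append_vec_eq)

lemma tot_phi_even_add [simp]: "even j \<Longrightarrow> tot_phi (j + i) a l Em dm y = tot_phi i a l Em dm y"
  using tot_phi_add_even[of j i] by (simp add: add.commute)

lemma tot_sheaf_add2: "tot_sheaf (i + 1 + 1) a l Em = tot_sheaf i a l Em"
  using tot_sheaf_add_even[of 2 i] by simp

context mf_complex begin

context
  fixes y assumes y: "y \<in> Y" and w0: "w y = 0"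
begin

lemma tot_square_zero:
  "x \<in> carrier_vec (rk (tot_sheaf i a l Em) y) \<Longrightarrow>
   tot_phi (i + 1) a l Em dm y *\<^sub>v (tot_phi i a l Em dm y *\<^sub>v x) = 0\<^sub>v (rk (tot_sheaf i a l Em) y)"
  using tot_square[OF y, of x i a l] w0 by (auto intro!: eq_vecI)

text \<open>Cocycles of the brutal truncation at \<open>a\<close> can be pushed into the summand of index \<open>a\<close>,
  by removing the components of higher index one after the other.\<close>

lemma tot_reduce:
  assumes "\<And>m k u. m > a \<Longrightarrow> u \<in> carrier_vec (rk (mfE k (Em m)) y) \<Longrightarrow>
      mfmap k (dm m) y *\<^sub>v u = 0\<^sub>v (rk (mfE k (Em (m + 1))) y) \<Longrightarrow>
      \<exists>t\<in>carrier_vec (rk (mfE k (Em (m - 1))) y). mfmap k (dm (m - 1)) y *\<^sub>v t = u"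
    and "\<And>k. rk (mfE k (Em (a + 1 + int l))) y = 0"
    and "x \<in> carrier_vec (rk (tot_sheaf i a (Suc l) Em) y)" "v \<in> carrier_vec (rk (mfE (i + 1 - a) (Em a)) y)"
    and "tot_phi i a (Suc l) Em dm y *\<^sub>v x = v @\<^sub>v 0\<^sub>v (rk (tot_sheaf (i + 1) (a + 1) l Em) y)"
  shows "\<exists>z\<in>carrier_vec (rk (tot_sheaf (i + 1) a (Suc l) Em) y). \<exists>u\<in>carrier_vec (rk (mfE (i - a) (Em a)) y).
     x = tot_phi (i + 1) a (Suc l) Em dm y *\<^sub>v z + (u @\<^sub>v 0\<^sub>v (rk (tot_sheaf i (a + 1) l Em) y))"
  using assms
proof (induction l arbitrary: a x v)
  case 0
  obtain u x' where ux: "u \<in> carrier_vec (rk (mfE (i - a) (Em a)) y)" "x' \<in> carrier_vec 0" "x = u @\<^sub>v x'"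
    using 0(3) by (intro that[of x "0\<^sub>v 0"]) auto
  have x: "x \<in> carrier_vec (rk (tot_sheaf i a (Suc 0) Em) y)" by (rule 0(3))
  have Tz: "tot_phi (i + 1) a (Suc 0) Em dm y *\<^sub>v 0\<^sub>v (rk (tot_sheaf (i + 1) a (Suc 0) Em) y)
      = 0\<^sub>v (rk (tot_sheaf i a (Suc 0) Em) y)"
    using mult_mat_zero_vec[OF tot_carrier[OF y, of "i + 1" a "Suc 0"]] unfolding tot_sheaf_add2 .
  have "x = u @\<^sub>v 0\<^sub>v (rk (tot_sheaf i (a + 1) 0 Em) y)" unfolding ux(3) using ux(2) by (intro eq_vecI) auto
  then have "x = tot_phi (i + 1) a (Suc 0) Em dm y *\<^sub>v 0\<^sub>v (rk (tot_sheaf (i + 1) a (Suc 0) Em) y)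
      + (u @\<^sub>v 0\<^sub>v (rk (tot_sheaf i (a + 1) 0 Em) y))"
    unfolding Tz using left_zero_vec[OF x] by simp
  then show ?case using ux(1) zero_carrier_vec by blast
next
  case (Suc l)
  obtain u x' where ux: "u \<in> carrier_vec (rk (mfE (i - a) (Em a)) y)"
    "x' \<in> carrier_vec (rk (tot_sheaf i (a + 1) (Suc l) Em) y)" "x = u @\<^sub>v x'"
    using Suc.prems(3) by (auto elim: vec_split_append simp del: tot_sheaf.simps(2) simp: tot_sheaf.simps(2)[of _ _ "Suc l"])
  let ?f = "par_sgn a (mfphi (i - a) (Em a) y *\<^sub>v u)" and ?d = "mfmap (i - a) (dm a) y *\<^sub>v u"
  let ?r = "rk (tot_sheaf (i + 1) (a + 1 + 1) l Em) y"
  have fc: "?f \<in> carrier_vec (rk (mfE (i + 1 - a) (Em a)) y)" using mult_mat_vec_carrier[OF phi_carrier[OF y] ux(1)] by simp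
  have dc: "?d \<in> carrier_vec (rk (mfE (i - a) (Em (a + 1))) y)" by (rule mult_mat_vec_carrier[OF d_carrier[OF y] ux(1)])
  have Tc: "tot_phi i (a + 1) (Suc l) Em dm y *\<^sub>v x' \<in> carrier_vec (rk (mfE (i - a) (Em (a + 1))) y + ?r)"
    using mult_mat_vec_carrier[OF tot_carrier[OF y] ux(2)] by simp
  have "?f @\<^sub>v ((?d @\<^sub>v 0\<^sub>v ?r) + tot_phi i (a + 1) (Suc l) Em dm y *\<^sub>v x')
      = v @\<^sub>v 0\<^sub>v (rk (tot_sheaf (i + 1) (a + 1) (Suc l) Em) y)"
    using Suc.prems(5) tot_mult[OF y ux(1,2)] unfolding ux(3) by (simp only: tot_incl_Suc)
  then have "(?d @\<^sub>v 0\<^sub>v ?r) + tot_phi i (a + 1) (Suc l) Em dm y *\<^sub>v x' = 0\<^sub>v (rk (mfE (i - a) (Em (a + 1))) y + ?r)"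
    unfolding append_vec_eq_iff[OF fc Suc.prems(4)] by simp
  then have Tx': "tot_phi i (a + 1) (Suc l) Em dm y *\<^sub>v x' = - ?d @\<^sub>v 0\<^sub>v ?r"
    using vec_add_eq_zeroD[OF append_carrier_vec[OF dc zero_carrier_vec] Tc] by (simp add: uminus_append_vec)
  \<comment> \<open>Past index \<open>a\<close> the equation says that the tail \<open>x'\<close> is
    mapped to \<open>- d u\<close> in the first of its summands, so the induction hypothesis applies
    to it.\<close>
  have "\<exists>z'\<in>carrier_vec (rk (tot_sheaf (i + 1) (a + 1) (Suc l) Em) y). \<exists>u'\<in>carrier_vec (rk (mfE (i - (a + 1)) (Em (a + 1))) y).
     x' = tot_phi (i + 1) (a + 1) (Suc l) Em dm y *\<^sub>v z' + (u' @\<^sub>v 0\<^sub>v (rk (tot_sheaf i (a + 1 + 1) l Em) y))"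
  proof (rule Suc.IH[OF _ _ ux(2)])
    show "rk (mfE k (Em (a + 1 + 1 + int l))) y = 0" for k
      using Suc.prems(2)[of k] by (simp add: algebra_simps)
    show "- ?d \<in> carrier_vec (rk (mfE (i + 1 - (a + 1)) (Em (a + 1))) y)" using dc by simp
    show "tot_phi i (a + 1) (Suc l) Em dm y *\<^sub>v x' = - ?d @\<^sub>v 0\<^sub>v (rk (tot_sheaf (i + 1) (a + 1 + 1) l Em) y)" by (rule Tx')
  qed (use Suc.prems(1) in simp)
  then obtain z' u' where z': "z' \<in> carrier_vec (rk (tot_sheaf (i + 1) (a + 1) (Suc l) Em) y)"
    and u': "u' \<in> carrier_vec (rk (mfE (i - (a + 1)) (Em (a + 1))) y)"
    and x'eq: "x' = tot_phi (i + 1) (a + 1) (Suc l) Em dm y *\<^sub>v z' + (u' @\<^sub>v 0\<^sub>v (rk (tot_sheaf i (a + 1 + 1) l Em) y))"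
    by blast
  let ?T = "tot_phi i (a + 1) (Suc l) Em dm y" and ?T1 = "tot_phi (i + 1) (a + 1) (Suc l) Em dm y"
  let ?u0 = "u' @\<^sub>v 0\<^sub>v (rk (tot_sheaf i (a + 1 + 1) l Em) y)"
  let ?du' = "mfmap (i - (a + 1)) (dm (a + 1)) y *\<^sub>v u'"
  have u0c: "?u0 \<in> carrier_vec (rk (tot_sheaf i (a + 1) (Suc l) Em) y)" using u' by simp
  have T1c: "?T1 *\<^sub>v z' \<in> carrier_vec (rk (tot_sheaf i (a + 1) (Suc l) Em) y)"
    using mult_mat_vec_carrier[OF tot_carrier[OF y] z'] unfolding tot_sheaf_add2 .
  have T1T: "?T *\<^sub>v (?T1 *\<^sub>v z') = 0\<^sub>v (rk (tot_sheaf (i + 1) (a + 1) (Suc l) Em) y)"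
    using tot_square_zero[OF z'] by simp
  have du'c: "?du' \<in> carrier_vec (rk (mfE (i - (a + 1)) (Em (a + 1 + 1))) y)"
    by (rule mult_mat_vec_carrier[OF d_carrier[OF y] u'])
  \<comment> \<open>\<open>u'\<close> is a cocycle of the original complex: comparing the components
    of index \<open>a + 2\<close> in the image of \<open>x'\<close> leaves only \<open>d u'\<close>.
    For \<open>l = 0\<close> that index lies outside the window, where the rank is 0.\<close>
  have "?du' = 0\<^sub>v (rk (mfE (i - (a + 1)) (Em (a + 1 + 1))) y)"
  proof (cases l)
    case 0
    then have "rk (mfE (i - (a + 1)) (Em (a + 1 + 1))) y = 0" using Suc.prems(2) by simp
    then show ?thesis using du'c by (simp only: carrier_dim_vec vec_of_dim_0)
  next
    case (Suc l')
    have "?T *\<^sub>v x' = ?T *\<^sub>v (?T1 *\<^sub>v z') + ?T *\<^sub>v ?u0"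
      unfolding x'eq by (rule mult_add_distrib_mat_vec[OF tot_carrier[OF y] T1c u0c])
    also have "\<dots> = ?T *\<^sub>v ?u0"
      unfolding T1T by (rule left_zero_vec) (rule mult_mat_vec_carrier[OF tot_carrier[OF y] u0c])
    also have "\<dots> = par_sgn (a + 1) (mfphi (i - (a + 1)) (Em (a + 1)) y *\<^sub>v u') @\<^sub>v
      (tot_incl (i + 1) (a + 1 + 1) l Em y ?du' + tot_phi i (a + 1 + 1) l Em dm y *\<^sub>v 0\<^sub>v (rk (tot_sheaf i (a + 1 + 1) l Em) y))"
      by (rule tot_mult[OF y u' zero_carrier_vec])
    also have "tot_phi i (a + 1 + 1) l Em dm y *\<^sub>v 0\<^sub>v (rk (tot_sheaf i (a + 1 + 1) l Em) y) = 0\<^sub>v ?r"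
      by (rule mult_mat_zero_vec[OF tot_carrier[OF y]])
    finally have "- ?d @\<^sub>v 0\<^sub>v ?r = par_sgn (a + 1) (mfphi (i - (a + 1)) (Em (a + 1)) y *\<^sub>v u') @\<^sub>v
      (tot_incl (i + 1) (a + 1 + 1) l Em y ?du' + 0\<^sub>v ?r)" unfolding Tx' .
    moreover have "- ?d \<in> carrier_vec (rk (mfE (i - a) (Em (a + 1))) y)" using dc by simp
    moreover have "par_sgn (a + 1) (mfphi (i - (a + 1)) (Em (a + 1)) y *\<^sub>v u') \<in> carrier_vec (rk (mfE (i - a) (Em (a + 1))) y)"
      using mult_mat_vec_carrier[OF phi_carrier[OF y] u'] by simp
    ultimately have inc0: "tot_incl (i + 1) (a + 1 + 1) l Em y ?du' + 0\<^sub>v ?r = 0\<^sub>v ?r"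
      using append_vec_eq_iff by metis
    have r: "?r = rk (mfE (i - (a + 1)) (Em (a + 1 + 1))) y + rk (tot_sheaf (i + 1) (a + 1 + 1 + 1) l' Em) y"
      by (simp add: Suc algebra_simps)
    have inc0': "tot_incl (i + 1) (a + 1 + 1) l Em y ?du' = 0\<^sub>v ?r"
    proof -
      have "tot_incl (i + 1) (a + 1 + 1) l Em y ?du' \<in> carrier_vec ?r"
        unfolding r using du'c by (simp add: Suc)
      then show ?thesis using inc0 by simp
    qed
    show ?thesis
    proof (rule eq_vecI)
      fix j assume "j < dim_vec (0\<^sub>v (rk (mfE (i - (a + 1)) (Em (a + 1 + 1))) y) :: complex Matrix.vec)"
      then have j: "j < rk (mfE (i - (a + 1)) (Em (a + 1 + 1))) y" by simp
      have "vec_index (tot_incl (i + 1) (a + 1 + 1) l Em y ?du') j = vec_index ?du' j"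
        unfolding Suc tot_incl_Suc using j carrier_vecD[OF du'c] by (subst index_append_vec(1)) auto
      then show "vec_index ?du' j = vec_index (0\<^sub>v (rk (mfE (i - (a + 1)) (Em (a + 1 + 1))) y)) j"
        unfolding inc0' using j r by simp
    qed (simp only: carrier_vecD[OF du'c] index_zero_vec)
  qed
  \<comment> \<open>Exactness at index \<open>a + 1\<close> writes \<open>u'\<close> as
    \<open>d t\<close>; subtracting the image of \<open>t\<close> moves the remainder into index
    \<open>a\<close>, at the cost of a term \<open>\<phi> t\<close>.\<close>
  then obtain t where t: "t \<in> carrier_vec (rk (mfE (i - (a + 1)) (Em a)) y)" "mfmap (i - (a + 1)) (dm a) y *\<^sub>v t = u'"
    using Suc.prems(1)[of "a + 1" u' "i - (a + 1)"] u' by auto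
  have e: "mfE (i - (a + 1)) (Em a) = mfE (i + 1 - a) (Em a)" "mfmap (i - (a + 1)) (dm a) = mfmap (i + 1 - a) (dm a)"
    using mfE_add_even(1)[of 2 "i - (a + 1)" "Em a"] mfmap_add_even(1)[of 2 "i - (a + 1)" "dm a"]
    by (simp_all add: algebra_simps)
  have t1: "t \<in> carrier_vec (rk (mfE (i + 1 - a) (Em a)) y)" using t(1) unfolding e .
  let ?ft = "par_sgn a (mfphi (i + 1 - a) (Em a) y *\<^sub>v t)"
  have ftc: "?ft \<in> carrier_vec (rk (mfE (i - a) (Em a)) y)"
    using mult_mat_vec_carrier[OF phi_carrier[OF y, of "i + 1" a] t1] mfE_add_even(1)[of 2 "i - a" "Em a"]
    by (simp add: algebra_simps)
  have ts: "tot_sheaf (i + 1 + 1) b l' Em = tot_sheaf i b l' Em" for b l'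
    using tot_sheaf_add_even[of 2 i] by simp
  have Tz: "tot_phi (i + 1) a (Suc (Suc l)) Em dm y *\<^sub>v (t @\<^sub>v z') = ?ft @\<^sub>v (?u0 + ?T1 *\<^sub>v z')"
    by (subst tot_mult[OF y t1 z']) (simp only: tot_incl_Suc t(2)[unfolded e] ts)
  have "x = tot_phi (i + 1) a (Suc (Suc l)) Em dm y *\<^sub>v (t @\<^sub>v z')
      + ((u - ?ft) @\<^sub>v 0\<^sub>v (rk (tot_sheaf i (a + 1) (Suc l) Em) y))"
    unfolding Tz ux(3) x'eq
    using carrier_vecD[OF ux(1)] carrier_vecD[OF ftc] carrier_vecD[OF u0c] carrier_vecD[OF T1c]
    by (intro eq_vecI) (auto simp del: tot_phi.simps)
  moreover have "u - ?ft \<in> carrier_vec (rk (mfE (i - a) (Em a)) y)" using ux(1) ftc by simp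
  moreover have "t @\<^sub>v z' \<in> carrier_vec (rk (tot_sheaf (i + 1) a (Suc (Suc l)) Em) y)" using t1 z' by simp
  ultimately show ?case by blast
qed

text \<open>After \<open>tot_reduce\<close> a cocycle differs from a boundary by some
  \<open>u\<close> in the lowest index \<open>a\<close>. Then \<open>d u = 0\<close>, and exactness
  writes \<open>u\<close> as the image of a vector in index \<open>a - 1\<close>, where the rank is
  0.\<close>

lemma acyclic_at_totalization:
  assumes exact: "\<And>m k u. u \<in> carrier_vec (rk (mfE k (Em m)) y) \<Longrightarrow>
      mfmap k (dm m) y *\<^sub>v u = 0\<^sub>v (rk (mfE k (Em (m + 1))) y) \<Longrightarrow>
      \<exists>t\<in>carrier_vec (rk (mfE k (Em (m - 1))) y). mfmap k (dm (m - 1)) y *\<^sub>v t = u"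
    and zero: "\<And>m k. m < a \<or> m \<ge> a + int l \<Longrightarrow> rk (mfE k (Em m)) y = 0"
  shows "acyclic_at y (totalization a l Em dm)"
  unfolding acyclic_at_def mfE_totalization mfphi_totalization
proof (intro allI ballI impI)
  fix i x assume x: "x \<in> carrier_vec (rk (tot_sheaf i a l Em) y)"
    and Tx: "tot_phi i a l Em dm y *\<^sub>v x = 0\<^sub>v (rk (tot_sheaf (i + 1) a l Em) y)"
  show "\<exists>z\<in>carrier_vec (rk (tot_sheaf (i + 1) a l Em) y). tot_phi (i + 1) a l Em dm y *\<^sub>v z = x"
  proof (cases l)
    case 0
    then show ?thesis using x by (intro bexI[of _ "0\<^sub>v 0"] eq_vecI) auto
  next
    case (Suc l')
    have v: "0\<^sub>v (rk (mfE (i + 1 - a) (Em a)) y) @\<^sub>v 0\<^sub>v (rk (tot_sheaf (i + 1) (a + 1) l' Em) y)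
        = (0\<^sub>v (rk (tot_sheaf (i + 1) a l Em) y) :: complex Matrix.vec)"
      unfolding Suc by (intro eq_vecI) auto
    have "\<exists>z\<in>carrier_vec (rk (tot_sheaf (i + 1) a (Suc l') Em) y). \<exists>u\<in>carrier_vec (rk (mfE (i - a) (Em a)) y).
     x = tot_phi (i + 1) a (Suc l') Em dm y *\<^sub>v z + (u @\<^sub>v 0\<^sub>v (rk (tot_sheaf i (a + 1) l' Em) y))"
    proof (rule tot_reduce)
      show "tot_phi i a (Suc l') Em dm y *\<^sub>v x
          = 0\<^sub>v (rk (mfE (i + 1 - a) (Em a)) y) @\<^sub>v 0\<^sub>v (rk (tot_sheaf (i + 1) (a + 1) l' Em) y)"
        using Tx unfolding v by (simp only: Suc)
      show "x \<in> carrier_vec (rk (tot_sheaf i a (Suc l') Em) y)" using x by (simp only: Suc)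
      show "rk (mfE k (Em (a + 1 + int l'))) y = 0" for k by (rule zero) (simp add: Suc)
    qed (use exact in simp_all)
    then obtain z u where z: "z \<in> carrier_vec (rk (tot_sheaf (i + 1) a l Em) y)"
      and u: "u \<in> carrier_vec (rk (mfE (i - a) (Em a)) y)"
      and xeq: "x = tot_phi (i + 1) a l Em dm y *\<^sub>v z + (u @\<^sub>v 0\<^sub>v (rk (tot_sheaf i (a + 1) l' Em) y))"
      unfolding Suc by blast
    let ?u0 = "u @\<^sub>v 0\<^sub>v (rk (tot_sheaf i (a + 1) l' Em) y)"
    have u0c: "?u0 \<in> carrier_vec (rk (tot_sheaf i a l Em) y)" using u by (simp add: Suc)
    have Tzc: "tot_phi (i + 1) a l Em dm y *\<^sub>v z \<in> carrier_vec (rk (tot_sheaf i a l Em) y)"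
      using mult_mat_vec_carrier[OF tot_carrier[OF y] z] unfolding tot_sheaf_add2 .
    let ?du = "mfmap (i - a) (dm a) y *\<^sub>v u"
    have duc: "?du \<in> carrier_vec (rk (mfE (i - a) (Em (a + 1))) y)" by (rule mult_mat_vec_carrier[OF d_carrier[OF y] u])
    have TTz: "tot_phi i a l Em dm y *\<^sub>v (tot_phi (i + 1) a l Em dm y *\<^sub>v z) = 0\<^sub>v (rk (tot_sheaf (i + 1) a l Em) y)"
      using tot_square_zero[OF z] by simp
    have "tot_phi i a l Em dm y *\<^sub>v x = 0\<^sub>v (rk (tot_sheaf (i + 1) a l Em) y) + tot_phi i a l Em dm y *\<^sub>v ?u0"
      unfolding xeq mult_add_distrib_mat_vec[OF tot_carrier[OF y] Tzc u0c] TTz ..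
    also have "\<dots> = tot_phi i a l Em dm y *\<^sub>v ?u0"
      by (rule left_zero_vec) (rule mult_mat_vec_carrier[OF tot_carrier[OF y] u0c])
    also have "\<dots> = par_sgn a (mfphi (i - a) (Em a) y *\<^sub>v u) @\<^sub>v
      (tot_incl (i + 1) (a + 1) l' Em y ?du + tot_phi i (a + 1) l' Em dm y *\<^sub>v 0\<^sub>v (rk (tot_sheaf i (a + 1) l' Em) y))"
      unfolding Suc by (rule tot_mult[OF y u zero_carrier_vec])
    also have "tot_phi i (a + 1) l' Em dm y *\<^sub>v 0\<^sub>v (rk (tot_sheaf i (a + 1) l' Em) y) = 0\<^sub>v (rk (tot_sheaf (i + 1) (a + 1) l' Em) y)"
      by (rule mult_mat_zero_vec[OF tot_carrier[OF y]])
    finally have "par_sgn a (mfphi (i - a) (Em a) y *\<^sub>v u) @\<^sub>v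
      (tot_incl (i + 1) (a + 1) l' Em y ?du + 0\<^sub>v (rk (tot_sheaf (i + 1) (a + 1) l' Em) y))
       = 0\<^sub>v (rk (mfE (i + 1 - a) (Em a)) y) @\<^sub>v 0\<^sub>v (rk (tot_sheaf (i + 1) (a + 1) l' Em) y)"
      unfolding Tx v ..
    moreover have "par_sgn a (mfphi (i - a) (Em a) y *\<^sub>v u) \<in> carrier_vec (rk (mfE (i + 1 - a) (Em a)) y)"
      using mult_mat_vec_carrier[OF phi_carrier[OF y] u] by simp
    ultimately have inc0: "tot_incl (i + 1) (a + 1) l' Em y ?du + 0\<^sub>v (rk (tot_sheaf (i + 1) (a + 1) l' Em) y)
        = 0\<^sub>v (rk (tot_sheaf (i + 1) (a + 1) l' Em) y)"
      using append_vec_eq_iff zero_carrier_vec by metis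
    have "?du = 0\<^sub>v (rk (mfE (i - a) (Em (a + 1))) y)"
    proof (cases l')
      case 0
      then have "rk (mfE (i - a) (Em (a + 1))) y = 0" by (intro zero) (simp add: Suc)
      then show ?thesis using duc by (simp only: carrier_dim_vec vec_of_dim_0)
    next
      case (Suc l'')
      show ?thesis
      proof (rule eq_vecI)
        fix j assume "j < dim_vec (0\<^sub>v (rk (mfE (i - a) (Em (a + 1))) y) :: complex Matrix.vec)"
        then have j: "j < rk (mfE (i - a) (Em (a + 1))) y" by simp
        have "vec_index (tot_incl (i + 1) (a + 1) l' Em y ?du + 0\<^sub>v (rk (tot_sheaf (i + 1) (a + 1) l' Em) y)) j = vec_index ?du j"
          using j carrier_vecD[OF duc] by (simp add: Suc)
        then show "vec_index ?du j = vec_index (0\<^sub>v (rk (mfE (i - a) (Em (a + 1))) y)) j"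
          unfolding inc0 using j by (simp add: Suc)
      qed (simp only: carrier_vecD[OF duc] index_zero_vec)
    qed
    then obtain t where t: "t \<in> carrier_vec (rk (mfE (i - a) (Em (a - 1))) y)" "mfmap (i - a) (dm (a - 1)) y *\<^sub>v t = u"
      using exact[OF u] by blast
    have r0: "rk (mfE (i - a) (Em (a - 1))) y = 0" by (rule zero) simp
    have "t = 0\<^sub>v (rk (mfE (i - a) (Em (a - 1))) y)" using t(1) by (simp only: r0 carrier_dim_vec vec_of_dim_0)
    then have "u = 0\<^sub>v (rk (mfE (i - a) (Em a)) y)"
      using t(2) mult_mat_zero_vec[OF d_carrier[OF y, of "i - a" "a - 1"]] by simp
    then have "?u0 = 0\<^sub>v (rk (tot_sheaf i a l Em) y)" by (intro eq_vecI) (auto simp: Suc)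
    then have "x = tot_phi (i + 1) a l Em dm y *\<^sub>v z" using xeq right_zero_vec[OF Tzc] by simp
    then show ?thesis using z by blast
  qed
qed

end

end

text \<open>A bounded exact complex of locally free sheaves is locally contractible: the contraction is
  built by descending induction, because the columns of \<open>1 - \<tau> d\<close> are cocycles.\<close>

locale exact_mf_complex = mf_complex Y w Em dm
  for Y :: "'n::finite cproj set" and w and Em dm +
  fixes a :: int and l :: nat
  assumes bdd: "m < a \<or> m \<ge> a + int l \<Longrightarrow> y \<in> Y \<Longrightarrow> rk (mfE k (Em m)) y = 0"
    and exact: "zopen_in Y V \<Longrightarrow> s \<in> sec (mfE k (Em m)) V \<Longrightarrow>
        (\<And>y. y \<in> V \<Longrightarrow> mfmap k (dm m) y *\<^sub>v s y = 0\<^sub>v (rk (mfE k (Em (m + 1))) y)) \<Longrightarrow> y \<in> V \<Longrightarrow>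
        \<exists>W t. zopen_in Y W \<and> y \<in> W \<and> W \<subseteq> V \<and> t \<in> sec (mfE k (Em (m - 1))) W \<and>
           (\<forall>z\<in>W. mfmap k (dm (m - 1)) z *\<^sub>v t z = s z)"
begin

text \<open>The identity \<open>d \<tau> d = d\<close>, which makes \<open>d \<tau>\<close> a
  projection onto the image of \<open>d\<close>, is what the descending induction passes on: it
  follows again in the next lower degree from \<open>d \<sigma> = 1 - \<tau> d\<close> and
  \<open>d d = 0\<close>.\<close>

definition splits :: "int \<Rightarrow> int \<Rightarrow> 'n cproj \<Rightarrow> bool" where
  "splits k m y \<longleftrightarrow> (\<exists>W \<tau>. zopen_in Y W \<and> y \<in> W \<and> sheaf_mor W (mfE k (Em (m + 1))) (mfE k (Em m)) \<tau> \<and>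
     (\<forall>z\<in>W. mfmap k (dm m) z * \<tau> z * mfmap k (dm m) z = mfmap k (dm m) z))"

lemma splits_top:
  assumes "m \<ge> a + int l" "y \<in> Y" shows "splits k m y"
  unfolding splits_def
proof (intro exI conjI ballI)
  show "zopen_in Y Y" "y \<in> Y" using assms by simp_all
  show "sheaf_mor Y (mfE k (Em (m + 1))) (mfE k (Em m)) (\<lambda>y. 0\<^sub>m (rk (mfE k (Em m)) y) (rk (mfE k (Em (m + 1))) y))"
    by (intro sheaf_mor_zero mfact_locally_free[OF mf])
  fix z assume z: "z \<in> Y"
  have "rk (mfE k (Em m)) z = 0" using bdd assms z by blast
  then show "mfmap k (dm m) z * 0\<^sub>m (rk (mfE k (Em m)) z) (rk (mfE k (Em (m + 1))) z) * mfmap k (dm m) z = mfmap k (dm m) z"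
    using d_carrier[OF z, of k m] by (intro eq_matI) auto
qed

text \<open>Exactness is applied to the finitely many columns of \<open>(1 - \<tau> d) g\<close> for
  a local frame \<open>g\<close>; the lifts prescribe \<open>\<sigma>\<close> on the frame.\<close>

lemma splits_step:
  assumes "splits k m y"
  shows "\<exists>W \<sigma> \<tau>. zopen_in Y W \<and> y \<in> W \<and> sheaf_mor W (mfE k (Em m)) (mfE k (Em (m - 1))) \<sigma> \<and>
    sheaf_mor W (mfE k (Em (m + 1))) (mfE k (Em m)) \<tau> \<and>
    (\<forall>z\<in>W. mfmap k (dm (m - 1)) z * \<sigma> z = 1\<^sub>m (rk (mfE k (Em m)) z) + - (\<tau> z * mfmap k (dm m) z))"
proof -
  let ?E = "mfE k (Em m)" and ?F = "mfE k (Em (m + 1))" and ?G = "mfE k (Em (m - 1))"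
  let ?d = "mfmap k (dm m)" and ?d' = "mfmap k (dm (m - 1))"
  obtain W \<tau> where W: "zopen_in Y W" "y \<in> W" and \<tau>: "sheaf_mor W ?F ?E \<tau>"
    and d\<tau>d: "\<And>z. z \<in> W \<Longrightarrow> ?d z * \<tau> z * ?d z = ?d z"
    using assms unfolding splits_def by blast
  have WY: "W \<subseteq> Y" using zopen_in_subset[OF W(1)] .
  have lE: "locally_free Y ?E" and lF: "locally_free Y ?F" and lG: "locally_free Y ?G"
    by (rule mfact_locally_free[OF mf])+
  note lEW = locally_free_restrict[OF lE W(1)] and lFW = locally_free_restrict[OF lF W(1)]
  have dW: "sheaf_mor W ?E ?F ?d" by (rule sheaf_mor_restrict[OF Z0_mor[OF dZ] W(1)])
  define \<pi> where "\<pi> z = 1\<^sub>m (rk ?E z) + - (\<tau> z * ?d z)" for z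
  have \<pi>: "sheaf_mor W ?E ?E \<pi>"
    unfolding \<pi>_def by (intro sheaf_mor_add sheaf_mor_uminus sheaf_mor_id lEW sheaf_mor_comp[OF lEW dW \<tau>])
  have d\<pi>: "?d z * \<pi> z = 0\<^sub>m (rk ?F z) (rk ?E z)" if z: "z \<in> W" for z
  proof -
    note c = sheaf_mor_carrier[OF dW z] and c\<tau> = sheaf_mor_carrier[OF \<tau> z]
    have "?d z * \<pi> z = ?d z * 1\<^sub>m (rk ?E z) + ?d z * - (\<tau> z * ?d z)"
      unfolding \<pi>_def by (rule mult_add_distrib_mat[OF c]) (use c c\<tau> in auto)
    also have "?d z * - (\<tau> z * ?d z) = - (?d z * \<tau> z * ?d z)"
      using c c\<tau> by simp
    also have "\<dots> = - ?d z" by (simp only: d\<tau>d[OF z])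
    finally show ?thesis using c by (simp add: add_uminus_minus_mat[OF c c] minus_r_inv_mat[OF c])
  qed
  obtain V g where V: "y \<in> V" "V \<subseteq> W" "zopen_in Y V" "local_frame Y ?E V g"
    using locally_free_frame[OF lE W] by metis
  obtain r where r: "\<And>y. y \<in> V \<Longrightarrow> rk ?E y = r" "\<And>y. y \<in> V \<Longrightarrow> g y \<in> carrier_mat r r" "\<And>y. y \<in> V \<Longrightarrow> invertible_mat (g y)"
    "\<And>W. zopen_in Y W \<Longrightarrow> W \<subseteq> V \<Longrightarrow> sec ?E W = {(\<lambda>y\<in>W. g y *\<^sub>v a y) | a. reg_vec W r a}"
    using V(4) by (rule local_frameE) (rule that; simp)
  have VW: "zopen_in W V" using zopen_in_trans[OF W(1)] V by blast
  \<comment> \<open>\<open>h\<close> is an inverse chosen point by point, with no regularity claimed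
    for it; \<open>\<sigma> = T h\<close> is nevertheless a morphism because it sends
    \<open>g b\<close> to \<open>T b\<close>.\<close>
  have "\<forall>z\<in>V. \<exists>h. h \<in> carrier_mat r r \<and> g z * h = 1\<^sub>m r \<and> h * g z = 1\<^sub>m r"
    using r(2,3) by (meson invertible_matE)
  from bchoice[OF this] obtain h where h: "\<And>z. z \<in> V \<Longrightarrow> h z \<in> carrier_mat r r"
    "\<And>z. z \<in> V \<Longrightarrow> g z * h z = 1\<^sub>m r" "\<And>z. z \<in> V \<Longrightarrow> h z * g z = 1\<^sub>m r" by auto
  have ex: "\<exists>Wj t. zopen_in Y Wj \<and> y \<in> Wj \<and> Wj \<subseteq> V \<and> t \<in> sec ?G Wj \<and>
           (\<forall>z\<in>Wj. ?d' z *\<^sub>v t z = \<pi> z *\<^sub>v col (g z) j)" if j: "j < r" for j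
  proof -
    have s: "(\<lambda>z\<in>V. \<pi> z *\<^sub>v (\<lambda>z\<in>V. col (g z) j) z) \<in> sec ?E V"
      by (rule sheaf_mor_sec[OF \<pi> VW]) (rule frame_col_sec[OF V(4,3) subset_refl r(1) j])
    have "\<exists>Wj t. zopen_in Y Wj \<and> y \<in> Wj \<and> Wj \<subseteq> V \<and> t \<in> sec ?G Wj \<and>
           (\<forall>z\<in>Wj. ?d' z *\<^sub>v t z = (\<lambda>z\<in>V. \<pi> z *\<^sub>v (\<lambda>z\<in>V. col (g z) j) z) z)"
    proof (rule exact[OF V(3) s _ V(1)])
      fix z assume z: "z \<in> V"
      then have zW: "z \<in> W" using V(2) by blast
      have cg: "col (g z) j \<in> carrier_vec (rk ?E z)" using r(1,2)[OF z] j by simp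
      have "?d z *\<^sub>v (\<pi> z *\<^sub>v col (g z) j) = 0\<^sub>m (rk ?F z) (rk ?E z) *\<^sub>v col (g z) j"
        using assoc_mult_mat_vec[OF sheaf_mor_carrier[OF dW zW] sheaf_mor_carrier[OF \<pi> zW] cg] d\<pi>[OF zW] by simp
      then show "?d z *\<^sub>v (\<lambda>z\<in>V. \<pi> z *\<^sub>v (\<lambda>z\<in>V. col (g z) j) z) z = 0\<^sub>v (rk ?F z)"
        using z zero_mat_mult_vec[OF cg] by simp
    qed
    then obtain Wj t where t: "zopen_in Y Wj" "y \<in> Wj" "Wj \<subseteq> V" "t \<in> sec ?G Wj"
      "\<forall>z\<in>Wj. ?d' z *\<^sub>v t z = (\<lambda>z\<in>V. \<pi> z *\<^sub>v (\<lambda>z\<in>V. col (g z) j) z) z" by blast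
    have "\<forall>z\<in>Wj. ?d' z *\<^sub>v t z = \<pi> z *\<^sub>v col (g z) j"
    proof
      fix z assume z: "z \<in> Wj"
      then have "z \<in> V" using t(3) by blast
      then show "?d' z *\<^sub>v t z = \<pi> z *\<^sub>v col (g z) j" using t(5) z by simp
    qed
    with t show ?thesis by blast
  qed
  then have "\<forall>j\<in>{..<r}. \<exists>Wt. zopen_in Y (fst Wt) \<and> y \<in> fst Wt \<and> fst Wt \<subseteq> V \<and> snd Wt \<in> sec ?G (fst Wt) \<and>
           (\<forall>z\<in>fst Wt. ?d' z *\<^sub>v snd Wt z = \<pi> z *\<^sub>v col (g z) j)"
    by (simp only: split_paired_Ex fst_conv snd_conv lessThan_iff Ball_def) blast
  from bchoice[OF this] obtain Wt where "\<forall>j\<in>{..<r}. zopen_in Y (fst (Wt j)) \<and> y \<in> fst (Wt j) \<and> fst (Wt j) \<subseteq> V \<and>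
      snd (Wt j) \<in> sec ?G (fst (Wt j)) \<and> (\<forall>z\<in>fst (Wt j). ?d' z *\<^sub>v snd (Wt j) z = \<pi> z *\<^sub>v col (g z) j)"
    by (elim exE)
  then have Wt: "\<And>j. j < r \<Longrightarrow> zopen_in Y (fst (Wt j))" "\<And>j. j < r \<Longrightarrow> y \<in> fst (Wt j)"
      "\<And>j. j < r \<Longrightarrow> snd (Wt j) \<in> sec ?G (fst (Wt j))"
      "\<And>j z. j < r \<Longrightarrow> z \<in> fst (Wt j) \<Longrightarrow> ?d' z *\<^sub>v snd (Wt j) z = \<pi> z *\<^sub>v col (g z) j" by simp_all
  \<comment> \<open>Each column lifts on its own neighbourhood of \<open>y\<close>. Finitely many of
    them are intersected, with \<open>V\<close> kept as a factor for the case that there are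
    none.\<close>
  define W' where "W' = V \<inter> (Y \<inter> (\<Inter>j\<in>{..<r}. fst (Wt j)))"
  have W'z: "zopen_in Y W'" unfolding W'_def by (intro zopen_in_Int V(3) zopen_in_INT) (use Wt(1) in auto)
  have yW': "y \<in> W'" unfolding W'_def using V(1) Wt(2) W WY by auto
  have W'V: "W' \<subseteq> V" and W'Wt: "\<And>j. j < r \<Longrightarrow> W' \<subseteq> fst (Wt j)" unfolding W'_def by auto
  have W'W: "W' \<subseteq> W" using W'V V(2) by blast
  define T where "T z = Matrix.mat (rk ?G z) r (\<lambda>(i, j). vec_index (snd (Wt j) z) i)" for z
  have T: "T z \<in> carrier_mat (rk ?G z) r" for z by (simp add: T_def)
  have tc: "snd (Wt j) z \<in> carrier_vec (rk ?G z)" if "j < r" "z \<in> W'" for j z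
    using sec_carrier[OF lG Wt(1) Wt(3)] that W'Wt by blast
  have colT: "col (T z) j = snd (Wt j) z" if "j < r" "z \<in> W'" for j z
    using tc[OF that] that by (auto simp: T_def)
  have d'c: "?d' z \<in> carrier_mat (rk ?E z) (rk ?G z)" if "z \<in> Y" for z
    using d_carrier[OF that, of k "m - 1"] by simp
  have d'T: "?d' z * T z = \<pi> z * g z" if z: "z \<in> W'" for z
  proof -
    have zY: "z \<in> Y" and zV: "z \<in> V" and zW: "z \<in> W" using z W'V W'W WY by auto
    note c = d'c[OF zY] sheaf_mor_carrier[OF \<pi> zW] r(1,2)[OF zV]
    show ?thesis
    proof (rule mat_col_eqI)
      fix j assume "j < dim_col (\<pi> z * g z)"
      then have j: "j < r" using c by simp
      have "col (?d' z * T z) j = ?d' z *\<^sub>v snd (Wt j) z"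
        using colT[OF j z] col_mult2[OF c(1) T j] by simp
      also have "\<dots> = \<pi> z *\<^sub>v col (g z) j" using Wt(4)[OF j] W'Wt[OF j] z by blast
      also have "\<dots> = col (\<pi> z * g z) j"
        using col_mult2[of "\<pi> z" r r "g z" r j] c j by simp
      finally show "col (?d' z * T z) j = col (\<pi> z * g z) j" .
    qed (use c T[of z] in auto)
  qed
  define \<sigma> where "\<sigma> z = T z * h z" for z
  have \<tau>': "sheaf_mor W' ?F ?E \<tau>"
    by (rule sheaf_mor_restrict[OF \<tau>]) (use zopen_in_trans[OF W(1)] W'z W'W in blast)
  have eq': "?d' z * \<sigma> z = 1\<^sub>m (rk ?E z) + - (\<tau> z * ?d z)" if z: "z \<in> W'" for z
  proof -
    have zY: "z \<in> Y" and zV: "z \<in> V" and zW: "z \<in> W" using z W'V W'W WY by auto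
    note c = d'c[OF zY] sheaf_mor_carrier[OF \<pi> zW] r(1,2)[OF zV] h[OF zV]
    have "?d' z * \<sigma> z = (?d' z * T z) * h z" unfolding \<sigma>_def by (rule assoc_mult_mat[symmetric, OF c(1) T c(5)])
    also have "\<dots> = (\<pi> z * g z) * h z" unfolding d'T[OF z] ..
    also have "\<dots> = \<pi> z * (g z * h z)" using c by (intro assoc_mult_mat) auto
    also have "\<dots> = \<pi> z" using c by simp
    finally show ?thesis unfolding \<pi>_def .
  qed
  have \<sigma>': "sheaf_mor W' ?E ?G \<sigma>"
  proof (rule sheaf_morI)
    show "\<sigma> z \<in> carrier_mat (rk ?G z) (rk ?E z)" if "z \<in> W'" for z
      unfolding \<sigma>_def using mult_carrier_mat[OF T h(1)] r(1) that W'V by auto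
    fix V' s assume "zopen_in W' V'" and s: "s \<in> sec ?E V'"
    then have V': "zopen_in Y V'" "V' \<subseteq> W'" using zopen_in_trans[OF W'z] by auto
    have V'V: "V' \<subseteq> V" using V'(2) W'V by blast
    from s obtain b where b: "s = (\<lambda>z\<in>V'. g z *\<^sub>v b z)" "reg_vec V' r b"
      unfolding r(4)[OF V'(1) V'V] by blast
    have "(\<lambda>z\<in>V'. T z *\<^sub>v b z) \<in> sec ?G V'"
    proof (rule sec_mult_reg[OF lG V'(1) T _ b(2)])
      fix j assume j: "j < r"
      have V'Wt: "V' \<subseteq> fst (Wt j)" using V'(2) W'Wt[OF j] by blast
      have "(\<lambda>z\<in>V'. col (T z) j) = restrict (snd (Wt j)) V'"
        using V'(2) colT[OF j] by (intro restrict_ext) auto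
      then show "(\<lambda>z\<in>V'. col (T z) j) \<in> sec ?G V'"
        using sec_restrict[OF lG Wt(1)[OF j] V'(1) V'Wt Wt(3)[OF j]] by simp
    qed
    moreover have "(\<lambda>z\<in>V'. \<sigma> z *\<^sub>v s z) = (\<lambda>z\<in>V'. T z *\<^sub>v b z)"
    proof (rule restrict_ext)
      fix z assume z: "z \<in> V'"
      then have zV: "z \<in> V" using V'V by blast
      note c = r(2)[OF zV] h[OF zV] reg_vecD(1)[OF b(2) z]
      have "\<sigma> z *\<^sub>v s z = T z *\<^sub>v (h z *\<^sub>v (g z *\<^sub>v b z))"
        unfolding \<sigma>_def b(1) using z assoc_mult_mat_vec[OF T c(2) mult_mat_vec_carrier[OF c(1,5)]] by simp
      also have "h z *\<^sub>v (g z *\<^sub>v b z) = (h z * g z) *\<^sub>v b z"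
        by (rule assoc_mult_mat_vec[symmetric, OF c(2,1,5)])
      finally show "\<sigma> z *\<^sub>v s z = T z *\<^sub>v b z" using c by simp
    qed
    ultimately show "(\<lambda>z\<in>V'. \<sigma> z *\<^sub>v s z) \<in> sec ?G V'" by simp
  qed
  show ?thesis
    by (intro exI[of _ W'] exI[of _ \<sigma>] exI[of _ \<tau>] conjI ballI W'z yW' \<sigma>' \<tau>' eq')
qed

text \<open>The induction descends from \<open>a + l\<close>, from where on all ranks are 0.\<close>

lemma splits_all:
  assumes y: "y \<in> Y" shows "splits k (a + int l - int n) y"
proof (induction n)
  case 0
  then show ?case using splits_top y by simp
next
  case (Suc n)
  let ?m = "a + int l - int n"
  have m: "a + int l - int (Suc n) = ?m - 1" by simp
  obtain W \<sigma> \<tau> where W: "zopen_in Y W" "y \<in> W" and \<sigma>: "sheaf_mor W (mfE k (Em ?m)) (mfE k (Em (?m - 1))) \<sigma>"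
    and \<tau>: "sheaf_mor W (mfE k (Em (?m + 1))) (mfE k (Em ?m)) \<tau>"
    and eq: "\<And>z. z \<in> W \<Longrightarrow> mfmap k (dm (?m - 1)) z * \<sigma> z = 1\<^sub>m (rk (mfE k (Em ?m)) z) + - (\<tau> z * mfmap k (dm ?m) z)"
    using splits_step[OF Suc] by (elim exE conjE) (rule that; (assumption | erule (1) bspec))
  have "mfmap k (dm (?m - 1)) z * \<sigma> z * mfmap k (dm (?m - 1)) z = mfmap k (dm (?m - 1)) z" if z: "z \<in> W" for z
  proof -
    have zY: "z \<in> Y" using z zopen_in_subset[OF W(1)] by blast
    have c: "mfmap k (dm (?m - 1)) z \<in> carrier_mat (rk (mfE k (Em ?m)) z) (rk (mfE k (Em (?m - 1))) z)"
      using d_carrier[OF zY, of k "?m - 1"] by simp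
    have c': "mfmap k (dm ?m) z \<in> carrier_mat (rk (mfE k (Em (?m + 1))) z) (rk (mfE k (Em ?m)) z)"
      using d_carrier[OF zY, of k "?m"] by simp
    note c\<tau> = sheaf_mor_carrier[OF \<tau> z]
    have "mfmap k (dm ?m) z * mfmap k (dm (?m - 1)) z = 0\<^sub>m (rk (mfE k (Em (?m + 1))) z) (rk (mfE k (Em (?m - 1))) z)"
      using dd[OF zY, of k "?m - 1"] by (simp add: algebra_simps)
    then have "(\<tau> z * mfmap k (dm ?m) z) * mfmap k (dm (?m - 1)) z = 0\<^sub>m (rk (mfE k (Em ?m)) z) (rk (mfE k (Em (?m - 1))) z)"
      using assoc_mult_mat[OF c\<tau> c' c] right_mult_zero_mat[OF c\<tau>] by simp
    moreover have "- 0\<^sub>m m n = (0\<^sub>m m n :: complex mat)" for m n by (intro eq_matI) auto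
    ultimately show ?thesis
      unfolding eq[OF z]
      using add_mult_distrib_mat[OF one_carrier_mat uminus_carrier_mat[OF mult_carrier_mat[OF c\<tau> c']] c] c c\<tau> c' by simp
  qed
  then show ?case unfolding m splits_def using W \<sigma> by (intro exI[of _ W] exI[of _ \<sigma>]) simp
qed

text \<open>A kernel vector in one fibre need not extend to a section that is a cocycle, so
  exactness of sheaves cannot be evaluated directly. The local splitting can: at \<open>y\<close> it
  reads \<open>u = d \<sigma> u + \<tau> d u\<close>, and \<open>d u = 0\<close>.\<close>

lemma fibre_exact:
  assumes y: "y \<in> Y" and u: "u \<in> carrier_vec (rk (mfE k (Em m)) y)"
    and du: "mfmap k (dm m) y *\<^sub>v u = 0\<^sub>v (rk (mfE k (Em (m + 1))) y)"
  shows "\<exists>t\<in>carrier_vec (rk (mfE k (Em (m - 1))) y). mfmap k (dm (m - 1)) y *\<^sub>v t = u"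
proof -
  have "splits k m y"
  proof (cases "m \<ge> a + int l")
    case True then show ?thesis using splits_top y by simp
  next
    case False then show ?thesis using splits_all[OF y, of k "nat (a + int l - m)"] by simp
  qed
  from splits_step[OF this] obtain W \<sigma> \<tau> where W: "zopen_in Y W" "y \<in> W" and \<sigma>: "sheaf_mor W (mfE k (Em m)) (mfE k (Em (m - 1))) \<sigma>"
    and \<tau>: "sheaf_mor W (mfE k (Em (m + 1))) (mfE k (Em m)) \<tau>"
    and eq: "\<And>z. z \<in> W \<Longrightarrow> mfmap k (dm (m - 1)) z * \<sigma> z = 1\<^sub>m (rk (mfE k (Em m)) z) + - (\<tau> z * mfmap k (dm m) z)"
    by (elim exE conjE) (rule that; (assumption | erule (1) bspec))
  note c = sheaf_mor_carrier[OF \<sigma> W(2)] sheaf_mor_carrier[OF \<tau> W(2)] d_carrier[OF y, of k m]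
  have c': "mfmap k (dm (m - 1)) y \<in> carrier_mat (rk (mfE k (Em m)) y) (rk (mfE k (Em (m - 1))) y)"
    using d_carrier[OF y, of k "m - 1"] by simp
  note ct = mult_carrier_mat[OF c(2,3)]
  have "mfmap k (dm (m - 1)) y *\<^sub>v (\<sigma> y *\<^sub>v u) = (mfmap k (dm (m - 1)) y * \<sigma> y) *\<^sub>v u"
    by (rule assoc_mult_mat_vec[symmetric, OF c' c(1) u])
  also have "\<dots> = u + - ((\<tau> y * mfmap k (dm m) y) *\<^sub>v u)"
    unfolding eq[OF W(2)] using u ct by (subst add_mult_distrib_mat_vec[OF one_carrier_mat _ u]) auto
  also have "(\<tau> y * mfmap k (dm m) y) *\<^sub>v u = 0\<^sub>v (rk (mfE k (Em m)) y)"
    using assoc_mult_mat_vec[OF c(2,3) u] du mult_mat_zero_vec[OF c(2)] by simp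
  finally have "mfmap k (dm (m - 1)) y *\<^sub>v (\<sigma> y *\<^sub>v u) = u" using u by simp
  then show ?thesis using mult_mat_vec_carrier[OF c(1) u] by blast
qed

end

lemma exact_mf_complexI:
  assumes "bounded_exact_complex Y w a l Em dm" shows "exact_mf_complex Y w Em dm a l"
proof -
  note B = assms[unfolded bounded_exact_complex_def]
  note B1 = conjunct1[OF B] and B2 = conjunct1[OF conjunct2[OF B]]
    and B3 = conjunct1[OF conjunct2[OF conjunct2[OF B]]] and B4 = conjunct2[OF conjunct2[OF conjunct2[OF B]]]
  show ?thesis
  proof unfold_locales
    fix m show "is_mfact Y w (Em m)" "dm m \<in> Z0_hom Y (Em m) (Em (m + 1))" using B1 by simp_all
  next
    fix y k m assume "y \<in> Y"
    then show "mfmap k (dm (m + 1)) y * mfmap k (dm m) y = 0\<^sub>m (rk (mfE k (Em (m + 2))) y) (rk (mfE k (Em m)) y)"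
      using B2 by simp
  next
    fix m y k assume "m < a \<or> m \<ge> a + int l" "y \<in> Y"
    then show "rk (mfE k (Em m)) y = 0" using B3 by blast
  next
    fix V s k m y
    assume "zopen_in Y V" "s \<in> sec (mfE k (Em m)) V" "y \<in> V"
      "\<And>y. y \<in> V \<Longrightarrow> mfmap k (dm m) y *\<^sub>v s y = 0\<^sub>v (rk (mfE k (Em (m + 1))) y)"
    then show "\<exists>W t. zopen_in Y W \<and> y \<in> W \<and> W \<subseteq> V \<and> t \<in> sec (mfE k (Em (m - 1))) W \<and>
           (\<forall>z\<in>W. mfmap k (dm (m - 1)) z *\<^sub>v t z = s z)"
      using spec[OF spec[OF spec[OF spec[OF B4, of m], of k], of V], of s] by simp
  qed
qed

section \<open>Fibrewise cohomology of matrix factorizations\<close>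

text \<open>At a point of the zero fibre the structure maps compose to zero, and a matrix factorization
  has two cohomology spaces there. We represent cohomology classes as cosets of the boundaries.\<close>

definition cyc :: "'p \<Rightarrow> int \<Rightarrow> 'p mfact \<Rightarrow> complex Matrix.vec set" where
  "cyc y k E = {x \<in> carrier_vec (rk (mfE k E) y). mfphi k E y *\<^sub>v x = 0\<^sub>v (rk (mfE (k + 1) E) y)}"

definition bnd :: "'p \<Rightarrow> int \<Rightarrow> 'p mfact \<Rightarrow> complex Matrix.vec set" where
  "bnd y k E = (\<lambda>z. mfphi (k + 1) E y *\<^sub>v z) ` carrier_vec (rk (mfE (k + 1) E) y)"

definition cls :: "'p \<Rightarrow> int \<Rightarrow> 'p mfact \<Rightarrow> complex Matrix.vec \<Rightarrow> complex Matrix.vec set" where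
  "cls y k E x = (\<lambda>b. x + b) ` bnd y k E"

definition Coh :: "'p \<Rightarrow> int \<Rightarrow> 'p mfact \<Rightarrow> complex Matrix.vec set set" where
  "Coh y k E = cls y k E ` cyc y k E"

text \<open>A union over representatives, so that no choice enters; by \<open>act_cls\<close> all
  members of the class of a cocycle give the same coset.\<close>

definition act :: "'p \<Rightarrow> int \<Rightarrow> 'p mfact \<Rightarrow> 'p mf_map \<Rightarrow> complex Matrix.vec set \<Rightarrow> complex Matrix.vec set" where
  "act y k F p S = (\<Union>x\<in>S. cls y k F (mfmap k p y *\<^sub>v x))"

lemma zero_append_vec: "0\<^sub>v (m + n) = (0\<^sub>v m @\<^sub>v 0\<^sub>v n :: 'a::zero Matrix.vec)"
  by (intro eq_vecI) auto

locale mf_point =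
  fixes Y :: "'n::finite cproj set" and w :: "'n cproj \<Rightarrow> complex" and y :: "'n cproj"
  assumes y: "y \<in> Y" and w0: "w y = 0"
begin

context
  fixes E assumes E: "is_mfact Y w E"
begin

lemma mat: "mfphi k E y \<in> carrier_mat (rk (mfE (k + 1) E) y) (rk (mfE k E) y)"
  by (rule mfact_carrier[OF E y])

lemma mat': "mfphi (k + 1) E y \<in> carrier_mat (rk (mfE k E) y) (rk (mfE (k + 1) E) y)"
  using mat[of "k + 1"] by simp

lemma square_zero:
  assumes "x \<in> carrier_vec (rk (mfE k E) y)"
  shows "mfphi (k + 1) E y *\<^sub>v (mfphi k E y *\<^sub>v x) = 0\<^sub>v (rk (mfE k E) y)"
proof -
  have "mfphi (k + 1) E y *\<^sub>v (mfphi k E y *\<^sub>v x) = (0 \<cdot>\<^sub>m 1\<^sub>m (rk (mfE k E) y)) *\<^sub>v x"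
    using assoc_mult_mat_vec[OF mat' mat assms] mfact_square[OF E y, of k] w0 by simp
  also have "\<dots> = 0\<^sub>v (rk (mfE k E) y)" using assms by (intro eq_vecI) (auto simp: smult_scalar_prod_distrib)
  finally show ?thesis .
qed

lemma cyc_carrier: "x \<in> cyc y k E \<Longrightarrow> x \<in> carrier_vec (rk (mfE k E) y)"
  by (simp add: cyc_def)

lemma bnd_carrier: "b \<in> bnd y k E \<Longrightarrow> b \<in> carrier_vec (rk (mfE k E) y)"
  using mult_mat_vec_carrier[OF mat'] by (auto simp: bnd_def)

lemma bnd_cyc: "b \<in> bnd y k E \<Longrightarrow> b \<in> cyc y k E"
proof -
  assume b: "b \<in> bnd y k E"
  then obtain z where z: "z \<in> carrier_vec (rk (mfE (k + 1) E) y)" "b = mfphi (k + 1) E y *\<^sub>v z" by (auto simp: bnd_def)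
  have "mfphi (k + 1 + 1) E y *\<^sub>v b = 0\<^sub>v (rk (mfE (k + 1) E) y)" unfolding z(2) by (rule square_zero[OF z(1)])
  then show ?thesis using bnd_carrier[OF b] by (simp add: cyc_def)
qed

lemma bnd_zero: "0\<^sub>v (rk (mfE k E) y) \<in> bnd y k E"
  unfolding bnd_def using mult_mat_zero_vec[OF mat', of k]
  by (intro image_eqI[of _ _ "0\<^sub>v (rk (mfE (k + 1) E) y)"]) auto

lemma bnd_add: "b \<in> bnd y k E \<Longrightarrow> c \<in> bnd y k E \<Longrightarrow> b + c \<in> bnd y k E"
proof -
  assume "b \<in> bnd y k E" "c \<in> bnd y k E"
  then obtain u v where "u \<in> carrier_vec (rk (mfE (k + 1) E) y)" "b = mfphi (k + 1) E y *\<^sub>v u"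
    "v \<in> carrier_vec (rk (mfE (k + 1) E) y)" "c = mfphi (k + 1) E y *\<^sub>v v" by (auto simp: bnd_def)
  then show ?thesis unfolding bnd_def
    by (intro image_eqI[of _ _ "u + v"]) (simp_all add: mult_add_distrib_mat_vec[OF mat'])
qed

lemma bnd_uminus: "b \<in> bnd y k E \<Longrightarrow> - b \<in> bnd y k E"
proof -
  assume "b \<in> bnd y k E"
  then obtain u where "u \<in> carrier_vec (rk (mfE (k + 1) E) y)" "b = mfphi (k + 1) E y *\<^sub>v u" by (auto simp: bnd_def)
  then show ?thesis unfolding bnd_def
    by (intro image_eqI[of _ _ "- u"]) (simp_all add: mult_mat_uminus_vec[OF mat'])
qed

lemma cyc_add: "x \<in> cyc y k E \<Longrightarrow> x' \<in> cyc y k E \<Longrightarrow> x + x' \<in> cyc y k E"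
  using mult_add_distrib_mat_vec[OF mat] by (auto simp: cyc_def)

lemma cyc_uminus: "x \<in> cyc y k E \<Longrightarrow> - x \<in> cyc y k E"
  using mult_mat_uminus_vec[OF mat] by (auto simp: cyc_def)

lemma cyc_zero: "0\<^sub>v (rk (mfE k E) y) \<in> cyc y k E"
  by (rule bnd_cyc[OF bnd_zero])

lemma cls_eq_iff:
  assumes x: "x \<in> carrier_vec (rk (mfE k E) y)" and x': "x' \<in> carrier_vec (rk (mfE k E) y)"
  shows "cls y k E x = cls y k E x' \<longleftrightarrow> x + - x' \<in> bnd y k E"
proof
  assume "cls y k E x = cls y k E x'"
  moreover have "x \<in> cls y k E x" unfolding cls_def using bnd_zero x by (intro image_eqI[of _ _ "0\<^sub>v (rk (mfE k E) y)"]) auto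
  ultimately obtain b where b: "b \<in> bnd y k E" "x = x' + b" by (auto simp: cls_def)
  have "x + - x' = b" using bnd_carrier[OF b(1)] x x' b(2) by (auto intro!: eq_vecI)
  then show "x + - x' \<in> bnd y k E" using b by simp
next
  have sub: "cls y k E u \<subseteq> cls y k E v"
    if u: "u \<in> carrier_vec (rk (mfE k E) y)" and v: "v \<in> carrier_vec (rk (mfE k E) y)" and b: "u + - v \<in> bnd y k E" for u v
  proof
    fix t assume "t \<in> cls y k E u"
    then obtain c where c: "c \<in> bnd y k E" "t = u + c" by (auto simp: cls_def)
    have "t = v + ((u + - v) + c)" using u v bnd_carrier[OF c(1)] c(2) by (auto intro!: eq_vecI)
    then show "t \<in> cls y k E v" unfolding cls_def using bnd_add[OF b c(1)] by blast
  qed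
  assume b: "x + - x' \<in> bnd y k E"
  have "x' + - x = - (x + - x')" using x x' by (auto intro!: eq_vecI)
  then have "x' + - x \<in> bnd y k E" using bnd_uminus[OF b] by simp
  then show "cls y k E x = cls y k E x'" using sub[OF x x' b] sub[OF x' x] by blast
qed

lemma cls_add_bnd:
  assumes "x \<in> carrier_vec (rk (mfE k E) y)" "b \<in> bnd y k E" shows "cls y k E (x + b) = cls y k E x"
proof -
  have "x + b + - x = b" using assms(1) bnd_carrier[OF assms(2)] by (intro eq_vecI) auto
  then show ?thesis using assms bnd_carrier by (simp add: cls_eq_iff)
qed

lemma cls_zero: "x \<in> carrier_vec (rk (mfE k E) y) \<Longrightarrow> cls y k E x = cls y k E (0\<^sub>v (rk (mfE k E) y)) \<longleftrightarrow> x \<in> bnd y k E"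
  by (simp add: cls_eq_iff)

lemma cls_ex: "S \<in> Coh y k E \<Longrightarrow> \<exists>x\<in>cyc y k E. S = cls y k E x"
  by (auto simp: Coh_def)

lemma cls_Coh: "x \<in> cyc y k E \<Longrightarrow> cls y k E x \<in> Coh y k E"
  by (simp add: Coh_def)

lemma acyclic_at_iff: "acyclic_at y E \<longleftrightarrow> (\<forall>k. cyc y k E \<subseteq> bnd y k E)"
  unfolding acyclic_at_def cyc_def bnd_def by (auto simp: image_iff subset_iff)

text \<open>Formulated as a property of the bare set of classes, vanishing of cohomology transfers
  along any bijection.\<close>

lemma acyclic_at_iff_Coh: "acyclic_at y E \<longleftrightarrow> (\<forall>k. \<exists>c. Coh y k E = {c})"
proof
  assume A: "acyclic_at y E"
  show "\<forall>k. \<exists>c. Coh y k E = {c}"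
  proof
    fix k
    have "S = cls y k E (0\<^sub>v (rk (mfE k E) y))" if "S \<in> Coh y k E" for S
    proof -
      obtain x where x: "x \<in> cyc y k E" "S = cls y k E x" using cls_ex[OF \<open>S \<in> Coh y k E\<close>] by blast
      then have "x \<in> bnd y k E" using A unfolding acyclic_at_iff by blast
      then show ?thesis using cls_zero[OF cyc_carrier[OF x(1)]] x(2) by simp
    qed
    then show "\<exists>c. Coh y k E = {c}" using cls_Coh[OF cyc_zero] by blast
  qed
next
  assume S: "\<forall>k. \<exists>c. Coh y k E = {c}"
  show "acyclic_at y E" unfolding acyclic_at_iff
  proof (intro allI subsetI)
    fix k x assume x: "x \<in> cyc y k E"
    obtain c where "Coh y k E = {c}" using S by blast
    then have "cls y k E x = cls y k E (0\<^sub>v (rk (mfE k E) y))" using cls_Coh[OF x] cls_Coh[OF cyc_zero, of k] by simp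
    then show "x \<in> bnd y k E" using cls_zero[OF cyc_carrier[OF x]] by simp
  qed
qed

end

context
  fixes E F p assumes E: "is_mfact Y w E" and F: "is_mfact Y w F" and p: "p \<in> Z0_hom Y E F"
begin

lemma pmat: "mfmap k p y \<in> carrier_mat (rk (mfE k F) y) (rk (mfE k E) y)"
  by (rule Z0_carrier[OF p y])

lemma map_comm:
  assumes x: "x \<in> carrier_vec (rk (mfE k E) y)"
  shows "mfphi k F y *\<^sub>v (mfmap k p y *\<^sub>v x) = mfmap (k + 1) p y *\<^sub>v (mfphi k E y *\<^sub>v x)"
  using assoc_mult_mat_vec[OF mat[OF F] pmat x] assoc_mult_mat_vec[OF pmat mat[OF E] x] Z0_comm[OF p y, of k] by simp

lemma map_carrier: "x \<in> carrier_vec (rk (mfE k E) y) \<Longrightarrow> mfmap k p y *\<^sub>v x \<in> carrier_vec (rk (mfE k F) y)"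
  by (rule mult_mat_vec_carrier[OF pmat])

lemma map_cyc: "x \<in> cyc y k E \<Longrightarrow> mfmap k p y *\<^sub>v x \<in> cyc y k F"
  using map_comm map_carrier mult_mat_zero_vec[OF pmat] unfolding cyc_def by simp

lemma map_bnd: "b \<in> bnd y k E \<Longrightarrow> mfmap k p y *\<^sub>v b \<in> bnd y k F"
proof -
  assume "b \<in> bnd y k E"
  then obtain z where z: "z \<in> carrier_vec (rk (mfE (k + 1) E) y)" "b = mfphi (k + 1) E y *\<^sub>v z" by (auto simp: bnd_def)
  have "mfmap k p y *\<^sub>v b = mfphi (k + 1) F y *\<^sub>v (mfmap (k + 1) p y *\<^sub>v z)"
    unfolding z(2) using map_comm[OF z(1)] by simp
  then show ?thesis unfolding bnd_def using map_carrier[OF z(1)] by blast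
qed

lemma act_cls:
  assumes x: "x \<in> cyc y k E" shows "act y k F p (cls y k E x) = cls y k F (mfmap k p y *\<^sub>v x)"
proof -
  note xc = cyc_carrier[OF E x]
  have "cls y k F (mfmap k p y *\<^sub>v t) = cls y k F (mfmap k p y *\<^sub>v x)" if t: "t \<in> cls y k E x" for t
  proof -
    obtain b where b: "b \<in> bnd y k E" "t = x + b" using t by (auto simp: cls_def)
    have "mfmap k p y *\<^sub>v t = mfmap k p y *\<^sub>v x + mfmap k p y *\<^sub>v b"
      unfolding b(2) by (rule mult_add_distrib_mat_vec[OF pmat xc bnd_carrier[OF E b(1)]])
    then show ?thesis using cls_add_bnd[OF F map_carrier[OF xc] map_bnd[OF b(1)]] by simp
  qed
  moreover have "x \<in> cls y k E x"
    unfolding cls_def using bnd_zero[OF E, of k] xc by (intro image_eqI[of _ _ "0\<^sub>v (rk (mfE k E) y)"]) auto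
  ultimately show ?thesis unfolding act_def by blast
qed

lemma act_Coh: "S \<in> Coh y k E \<Longrightarrow> act y k F p S \<in> Coh y k F"
  using cls_ex[OF E] act_cls map_cyc cls_Coh[OF F] by metis

text \<open>The usual kernel criterion; cohomology is a mere set of cosets here, so the difference
  of two classes is taken on representatives.\<close>

lemma act_inj_iff:
  "inj_on (act y k F p) (Coh y k E) \<longleftrightarrow> (\<forall>x\<in>cyc y k E. mfmap k p y *\<^sub>v x \<in> bnd y k F \<longrightarrow> x \<in> bnd y k E)"
proof
  assume inj: "inj_on (act y k F p) (Coh y k E)"
  show "\<forall>x\<in>cyc y k E. mfmap k p y *\<^sub>v x \<in> bnd y k F \<longrightarrow> x \<in> bnd y k E"
  proof (intro ballI impI)
    fix x assume x: "x \<in> cyc y k E" and px: "mfmap k p y *\<^sub>v x \<in> bnd y k F"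
    let ?o = "0\<^sub>v (rk (mfE k E) y)"
    have "act y k F p (cls y k E x) = act y k F p (cls y k E ?o)"
      unfolding act_cls[OF x] act_cls[OF cyc_zero[OF E]] mult_mat_zero_vec[OF pmat]
      using cls_zero[OF F map_carrier[OF cyc_carrier[OF E x]]] px by simp
    then have "cls y k E x = cls y k E ?o"
      using inj cls_Coh[OF E x] cls_Coh[OF E cyc_zero[OF E]] by (meson inj_onD)
    then show "x \<in> bnd y k E" using cls_zero[OF E cyc_carrier[OF E x]] by simp
  qed
next
  assume ker: "\<forall>x\<in>cyc y k E. mfmap k p y *\<^sub>v x \<in> bnd y k F \<longrightarrow> x \<in> bnd y k E"
  show "inj_on (act y k F p) (Coh y k E)"
  proof (rule inj_onI)
    fix S S' assume S: "S \<in> Coh y k E" "S' \<in> Coh y k E" and eq: "act y k F p S = act y k F p S'"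
    obtain x x' where x: "x \<in> cyc y k E" "S = cls y k E x" and x': "x' \<in> cyc y k E" "S' = cls y k E x'"
      using cls_ex[OF E] S by metis
    note c = cyc_carrier[OF E x(1)] cyc_carrier[OF E x'(1)]
    have "mfmap k p y *\<^sub>v (x + - x') = mfmap k p y *\<^sub>v x + - (mfmap k p y *\<^sub>v x')"
      using mult_add_distrib_mat_vec[OF pmat c(1), of "- x'"] mult_mat_uminus_vec[OF pmat c(2)] c by simp
    moreover have "mfmap k p y *\<^sub>v x + - (mfmap k p y *\<^sub>v x') \<in> bnd y k F"
      using eq unfolding x(2) x'(2) act_cls[OF x(1)] act_cls[OF x'(1)]
      using cls_eq_iff[OF F map_carrier[OF c(1)] map_carrier[OF c(2)]] by simp
    ultimately have "x + - x' \<in> bnd y k E" using ker cyc_add[OF E x(1) cyc_uminus[OF E x'(1)]] by simp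
    then show "S = S'" unfolding x x' using cls_eq_iff[OF E c] by simp
  qed
qed

lemma act_surj_iff:
  "act y k F p ` Coh y k E = Coh y k F \<longleftrightarrow>
   (\<forall>c\<in>cyc y k F. \<exists>e\<in>cyc y k E. c + - (mfmap k p y *\<^sub>v e) \<in> bnd y k F)"
proof
  assume im: "act y k F p ` Coh y k E = Coh y k F"
  show "\<forall>c\<in>cyc y k F. \<exists>e\<in>cyc y k E. c + - (mfmap k p y *\<^sub>v e) \<in> bnd y k F"
  proof
    fix c assume c: "c \<in> cyc y k F"
    then obtain S where S: "S \<in> Coh y k E" "act y k F p S = cls y k F c" using im cls_Coh[OF F c] by (metis imageE)
    then obtain e where e: "e \<in> cyc y k E" "S = cls y k E e" using cls_ex[OF E] by blast
    have "cls y k F c = cls y k F (mfmap k p y *\<^sub>v e)" using S(2) unfolding e(2) act_cls[OF e(1)] by simp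
    then show "\<exists>e\<in>cyc y k E. c + - (mfmap k p y *\<^sub>v e) \<in> bnd y k F"
      using cls_eq_iff[OF F cyc_carrier[OF F c] map_carrier[OF cyc_carrier[OF E e(1)]]] e(1) by blast
  qed
next
  assume s: "\<forall>c\<in>cyc y k F. \<exists>e\<in>cyc y k E. c + - (mfmap k p y *\<^sub>v e) \<in> bnd y k F"
  show "act y k F p ` Coh y k E = Coh y k F"
  proof
    show "act y k F p ` Coh y k E \<subseteq> Coh y k F" using act_Coh by blast
    show "Coh y k F \<subseteq> act y k F p ` Coh y k E"
    proof
      fix S assume "S \<in> Coh y k F"
      then obtain c where c: "c \<in> cyc y k F" "S = cls y k F c" using cls_ex[OF F] by blast
      then obtain e where e: "e \<in> cyc y k E" "c + - (mfmap k p y *\<^sub>v e) \<in> bnd y k F" using s by blast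
      have "S = act y k F p (cls y k E e)"
        unfolding c(2) act_cls[OF e(1)]
        using cls_eq_iff[OF F cyc_carrier[OF F c(1)] map_carrier[OF cyc_carrier[OF E e(1)]]] e(2) by simp
      then show "S \<in> act y k F p ` Coh y k E" using cls_Coh[OF E e(1)] by blast
    qed
  qed
qed

text \<open>The long exact sequence by hand: cocycles of the cone are pairs \<open>(a, b)\<close>
  with \<open>\<phi> b = 0\<close> and \<open>p b = - \<phi> a\<close>. Testing on pairs of a
  special form gives the two halves of bijectivity; conversely the two halves allow one to solve for
  a preimage of any pair.\<close>

lemma cone_acyclic_iff:
  "acyclic_at y (mf_cone E F p) \<longleftrightarrow> (\<forall>k. bij_betw (act y k F p) (Coh y k E) (Coh y k F))"
proof
  note C = mf_cone_mfact[OF E F p]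
  note cm = cone_mult[OF E F p y]
  assume A: "acyclic_at y (mf_cone E F p)"
  have ex: "\<exists>a'\<in>carrier_vec (rk (mfE (k + 1) F) y). \<exists>b'\<in>carrier_vec (rk (mfE k E) y).
      a = mfphi (k + 1) F y *\<^sub>v a' + mfmap k p y *\<^sub>v b' \<and> b = - (mfphi k E y *\<^sub>v b')"
    if a: "a \<in> carrier_vec (rk (mfE k F) y)" and b: "b \<in> carrier_vec (rk (mfE (k + 1) E) y)"
      and 1: "mfphi k F y *\<^sub>v a + mfmap (k + 1) p y *\<^sub>v b = 0\<^sub>v (rk (mfE (k + 1) F) y)"
      and 2: "mfphi (k + 1) E y *\<^sub>v b = 0\<^sub>v (rk (mfE k E) y)" for k a b
  proof -
    have "mfphi k (mf_cone E F p) y *\<^sub>v (a @\<^sub>v b) = 0\<^sub>v (rk (mfE (k + 1) (mf_cone E F p)) y)"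
      unfolding cm[OF a b] 1 2 by (intro eq_vecI) auto
    moreover have "a @\<^sub>v b \<in> carrier_vec (rk (mfE k (mf_cone E F p)) y)" using a b by simp
    ultimately obtain z where z: "z \<in> carrier_vec (rk (mfE (k + 1) (mf_cone E F p)) y)"
      "mfphi (k + 1) (mf_cone E F p) y *\<^sub>v z = a @\<^sub>v b" using A unfolding acyclic_at_def by blast
    then have "z \<in> carrier_vec (rk (mfE (k + 1) F) y + rk (mfE (k + 1 + 1) E) y)" by simp
    then obtain a' b' where ab: "a' \<in> carrier_vec (rk (mfE (k + 1) F) y)" "b' \<in> carrier_vec (rk (mfE (k + 1 + 1) E) y)"
      "z = a' @\<^sub>v b'" by (rule vec_split_append)
    have c1: "mfphi (k + 1) F y *\<^sub>v a' + mfmap (k + 1 + 1) p y *\<^sub>v b' \<in> carrier_vec (rk (mfE k F) y)"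
      using mult_mat_vec_carrier[OF mat'[OF F] ab(1)] mult_mat_vec_carrier[OF pmat[of "k + 1 + 1"] ab(2)] by simp
    have "(mfphi (k + 1) F y *\<^sub>v a' + mfmap (k + 1 + 1) p y *\<^sub>v b') @\<^sub>v - (mfphi (k + 1 + 1) E y *\<^sub>v b') = a @\<^sub>v b"
      using z(2) unfolding ab(3) cm[OF ab(1,2)] .
    then have "mfphi (k + 1) F y *\<^sub>v a' + mfmap k p y *\<^sub>v b' = a" "- (mfphi k E y *\<^sub>v b') = b"
      unfolding append_vec_eq_iff[OF c1 a] by simp_all
    then show ?thesis using ab by auto
  qed
  show "\<forall>k. bij_betw (act y k F p) (Coh y k E) (Coh y k F)"
    unfolding bij_betw_def act_inj_iff act_surj_iff
  proof (intro allI conjI ballI impI)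
    fix k x assume x: "x \<in> cyc y k E" and px: "mfmap k p y *\<^sub>v x \<in> bnd y k F"
    then obtain z where z: "z \<in> carrier_vec (rk (mfE (k + 1) F) y)" "mfmap k p y *\<^sub>v x = mfphi (k + 1) F y *\<^sub>v z"
      by (auto simp: bnd_def)
    note xc = cyc_carrier[OF E x]
    \<comment> \<open>If \<open>p x = \<phi> z\<close>, then \<open>(- z, x)\<close> is a cocycle of
      the cone in degree \<open>k + 1\<close>; the second component of a preimage exhibits
      \<open>x\<close> as a boundary.\<close>
    have 1: "mfphi (k + 1) F y *\<^sub>v - z + mfmap (k + 1 + 1) p y *\<^sub>v x = 0\<^sub>v (rk (mfE (k + 1 + 1) F) y)"
      using mult_mat_uminus_vec[OF mat'[OF F] z(1)] z(2) mult_mat_vec_carrier[OF mat'[OF F] z(1)] by simp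
    have 2: "mfphi (k + 1 + 1) E y *\<^sub>v x = 0\<^sub>v (rk (mfE (k + 1) E) y)" using x by (simp add: cyc_def)
    have xc': "x \<in> carrier_vec (rk (mfE (k + 1 + 1) E) y)" using xc by simp
    obtain b' where b': "b' \<in> carrier_vec (rk (mfE (k + 1) E) y)" "x = - (mfphi (k + 1) E y *\<^sub>v b')"
      using ex[OF _ xc' 1 2] z(1) by auto
    have "mfphi (k + 1) E y *\<^sub>v b' \<in> bnd y k E" using b'(1) by (auto simp: bnd_def)
    then show "x \<in> bnd y k E" unfolding b'(2) by (rule bnd_uminus[OF E])
  next
    fix k c assume c: "c \<in> cyc y k F"
    note cc = cyc_carrier[OF F c]
    \<comment> \<open>For surjectivity the pair is \<open>(c, 0)\<close>: a preimage
      \<open>(a', b')\<close> has \<open>b'\<close> a cocycle with \<open>p b'\<close> cohomologous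
      to \<open>c\<close>.\<close>
    have 1: "mfphi k F y *\<^sub>v c + mfmap (k + 1) p y *\<^sub>v 0\<^sub>v (rk (mfE (k + 1) E) y) = 0\<^sub>v (rk (mfE (k + 1) F) y)"
      using c mult_mat_zero_vec[OF pmat[of "k + 1"]] by (simp add: cyc_def)
    have 2: "mfphi (k + 1) E y *\<^sub>v 0\<^sub>v (rk (mfE (k + 1) E) y) = 0\<^sub>v (rk (mfE k E) y)"
      by (rule mult_mat_zero_vec[OF mat'[OF E]])
    obtain a' b' where ab: "a' \<in> carrier_vec (rk (mfE (k + 1) F) y)" "b' \<in> carrier_vec (rk (mfE k E) y)"
      "c = mfphi (k + 1) F y *\<^sub>v a' + mfmap k p y *\<^sub>v b'" "0\<^sub>v (rk (mfE (k + 1) E) y) = - (mfphi k E y *\<^sub>v b')"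
      using ex[OF cc zero_carrier_vec 1 2] by blast
    have "mfphi k E y *\<^sub>v b' = 0\<^sub>v (rk (mfE (k + 1) E) y)"
      using ab(4) uminus_uminus_vec[of "mfphi k E y *\<^sub>v b'"] uminus_zero_vec[of "rk (mfE (k + 1) E) y"] by metis
    then have b'c: "b' \<in> cyc y k E" using ab(2) by (simp add: cyc_def)
    note c1 = mult_mat_vec_carrier[OF mat'[OF F] ab(1)] and c2 = map_carrier[OF ab(2)]
    have "c + - (mfmap k p y *\<^sub>v b') = mfphi (k + 1) F y *\<^sub>v a'"
      unfolding ab(3) using carrier_vecD[OF c1] carrier_vecD[OF c2] by (intro eq_vecI) auto
    then show "\<exists>e\<in>cyc y k E. c + - (mfmap k p y *\<^sub>v e) \<in> bnd y k F"
      using b'c ab(1) unfolding bnd_def by blast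
  qed
next
  note C = mf_cone_mfact[OF E F p]
  note cm = cone_mult[OF E F p y]
  assume "\<forall>k. bij_betw (act y k F p) (Coh y k E) (Coh y k F)"
  then have inj: "\<And>k x. x \<in> cyc y k E \<Longrightarrow> mfmap k p y *\<^sub>v x \<in> bnd y k F \<Longrightarrow> x \<in> bnd y k E"
    and surj: "\<And>k c. c \<in> cyc y k F \<Longrightarrow> \<exists>e\<in>cyc y k E. c + - (mfmap k p y *\<^sub>v e) \<in> bnd y k F"
    unfolding bij_betw_def act_inj_iff act_surj_iff by blast+
  show "acyclic_at y (mf_cone E F p)"
    unfolding acyclic_at_def
  proof (intro allI ballI impI)
    fix k v assume "v \<in> carrier_vec (rk (mfE k (mf_cone E F p)) y)"
      and v0: "mfphi k (mf_cone E F p) y *\<^sub>v v = 0\<^sub>v (rk (mfE (k + 1) (mf_cone E F p)) y)"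
    then have "v \<in> carrier_vec (rk (mfE k F) y + rk (mfE (k + 1) E) y)" by simp
    then obtain a b where a: "a \<in> carrier_vec (rk (mfE k F) y)" and b: "b \<in> carrier_vec (rk (mfE (k + 1) E) y)"
      and v: "v = a @\<^sub>v b" by (rule vec_split_append)
    note pa = mult_mat_vec_carrier[OF mat[OF F] a] and pb = map_carrier[OF b] and fb = mult_mat_vec_carrier[OF mat'[OF E] b]
    have "(mfphi k F y *\<^sub>v a + mfmap (k + 1) p y *\<^sub>v b) @\<^sub>v - (mfphi (k + 1) E y *\<^sub>v b)
      = 0\<^sub>v (rk (mfE (k + 1) F) y) @\<^sub>v 0\<^sub>v (rk (mfE k E) y)"
      using v0 unfolding v cm[OF a b] by (simp add: zero_append_vec)
    then have 1: "mfphi k F y *\<^sub>v a + mfmap (k + 1) p y *\<^sub>v b = 0\<^sub>v (rk (mfE (k + 1) F) y)"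
      and 2: "- (mfphi (k + 1) E y *\<^sub>v b) = 0\<^sub>v (rk (mfE k E) y)"
      using append_vec_eq_iff[OF add_carrier_vec[OF pa pb] zero_carrier_vec] by blast+
    have 2: "mfphi (k + 1) E y *\<^sub>v b = 0\<^sub>v (rk (mfE k E) y)"
      using 2 uminus_uminus_vec[of "mfphi (k + 1) E y *\<^sub>v b"] uminus_zero_vec[of "rk (mfE k E) y"] by metis
    have bc: "b \<in> cyc y (k + 1) E" using b 2 by (simp add: cyc_def)
    have pbeq: "mfmap (k + 1) p y *\<^sub>v b = mfphi k F y *\<^sub>v (- a)"
      using vec_add_eq_zeroD[OF pa pb 1] mult_mat_uminus_vec[OF mat[OF F] a] by simp
    have "mfmap (k + 1) p y *\<^sub>v b \<in> bnd y (k + 1) F"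
      unfolding pbeq bnd_def using a by (auto intro!: imageI)
    then have "b \<in> bnd y (k + 1) E" by (rule inj[OF bc])
    then obtain e0 where e0: "e0 \<in> carrier_vec (rk (mfE k E) y)" "b = mfphi k E y *\<^sub>v e0" by (auto simp: bnd_def)
    \<comment> \<open>Injectivity gave \<open>b = \<phi> e0\<close>, which makes
      \<open>a + p e0\<close> a cocycle; surjectivity compares it with some \<open>p e\<close>. The
      preimage of \<open>(a, b)\<close> will be \<open>(a', e - e0)\<close>.\<close>
    have "mfphi k F y *\<^sub>v (a + mfmap k p y *\<^sub>v e0) = mfphi k F y *\<^sub>v a + mfmap (k + 1) p y *\<^sub>v b"
      unfolding e0(2) using mult_add_distrib_mat_vec[OF mat[OF F] a map_carrier[OF e0(1)]] map_comm[OF e0(1)] by simp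
    then have "a + mfmap k p y *\<^sub>v e0 \<in> cyc y k F" using 1 a map_carrier[OF e0(1)] by (simp add: cyc_def)
    then obtain e where e: "e \<in> cyc y k E" "a + mfmap k p y *\<^sub>v e0 + - (mfmap k p y *\<^sub>v e) \<in> bnd y k F"
      using surj by blast
    then obtain a' where a': "a' \<in> carrier_vec (rk (mfE (k + 1) F) y)"
      "a + mfmap k p y *\<^sub>v e0 + - (mfmap k p y *\<^sub>v e) = mfphi (k + 1) F y *\<^sub>v a'" by (auto simp: bnd_def)
    note ec = cyc_carrier[OF E e(1)]
    let ?b' = "e + - e0"
    have b'c: "?b' \<in> carrier_vec (rk (mfE (k + 1 + 1) E) y)" using ec e0 by simp
    have p1: "mfmap k p y *\<^sub>v ?b' = mfmap k p y *\<^sub>v e + - (mfmap k p y *\<^sub>v e0)"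
      using mult_add_distrib_mat_vec[OF pmat ec, of "- e0"] mult_mat_uminus_vec[OF pmat e0(1)] e0(1) by simp
    have p2: "mfphi k E y *\<^sub>v ?b' = - b"
    proof -
      have "mfphi k E y *\<^sub>v ?b' = mfphi k E y *\<^sub>v e + - (mfphi k E y *\<^sub>v e0)"
        using mult_add_distrib_mat_vec[OF mat[OF E] ec, of "- e0"] mult_mat_uminus_vec[OF mat[OF E] e0(1)] e0(1) by simp
      then show ?thesis using e(1) b unfolding e0(2) by (simp add: cyc_def)
    qed
    note ce = map_carrier[OF ec] and ce0 = map_carrier[OF e0(1)]
    have "mfphi (k + 1) F y *\<^sub>v a' + mfmap (k + 1 + 1) p y *\<^sub>v ?b' = a"
      using p1 unfolding a'(2)[symmetric]
      using carrier_vecD[OF ce] carrier_vecD[OF ce0] carrier_vecD[OF a] by (intro eq_vecI) auto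
    then have "mfphi (k + 1) (mf_cone E F p) y *\<^sub>v (a' @\<^sub>v ?b') = v"
      unfolding cm[OF a'(1) b'c] v using p2 by simp
    moreover have "a' @\<^sub>v ?b' \<in> carrier_vec (rk (mfE (k + 1) (mf_cone E F p)) y)" using a'(1) b'c by simp
    ultimately show "\<exists>z\<in>carrier_vec (rk (mfE (k + 1) (mf_cone E F p)) y). mfphi (k + 1) (mf_cone E F p) y *\<^sub>v z = v"
      by blast
  qed
qed

end

text \<open>On a cocycle the term \<open>h \<phi>\<close> of the homotopy vanishes and the term
  \<open>\<phi> h\<close> is a boundary.\<close>

lemma act_homotopic:
  assumes E: "is_mfact Y w E" and F: "is_mfact Y w F" and p: "p \<in> Z0_hom Y E F" and q: "q \<in> Z0_hom Y E F"
    and h: "homotopic_maps Y E F p q" and S: "S \<in> Coh y k E"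
  shows "act y k F q S = act y k F p S"
proof -
  obtain x where x: "x \<in> cyc y k E" "S = cls y k E x" using cls_ex[OF E S] by blast
  note xc = cyc_carrier[OF E x(1)]
  obtain h where hm: "\<And>k. sheaf_mor Y (mfE k E) (mfE (k + 1) F) (mfmap k h)"
    and heq: "\<And>k. mfmap k q y = mfmap k p y + (mfphi (k + 1) F y * mfmap k h y + mfmap (k + 1) h y * mfphi k E y)"
    using h y unfolding homotopic_maps_iff by blast
  note hc = sheaf_mor_carrier[OF hm y]
  have hc': "mfmap (k + 1) h y \<in> carrier_mat (rk (mfE k F) y) (rk (mfE (k + 1) E) y)" using hc[of "k + 1"] by simp
  note fc = mat'[OF F] and ec = mat[OF E] and pc = pmat[OF E F p]
  note c1 = mult_carrier_mat[OF fc hc] and c2 = mult_carrier_mat[OF hc' ec]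
  have hx: "mfmap k h y *\<^sub>v x \<in> carrier_vec (rk (mfE (k + 1) F) y)" by (rule mult_mat_vec_carrier[OF hc xc])
  have "mfmap k q y *\<^sub>v x = mfmap k p y *\<^sub>v x +
      ((mfphi (k + 1) F y * mfmap k h y) *\<^sub>v x + (mfmap (k + 1) h y * mfphi k E y) *\<^sub>v x)"
    unfolding heq using add_mult_distrib_mat_vec[OF pc add_carrier_mat[OF c2] xc] add_mult_distrib_mat_vec[OF c1 c2 xc] by simp
  also have "(mfmap (k + 1) h y * mfphi k E y) *\<^sub>v x = 0\<^sub>v (rk (mfE k F) y)"
    using assoc_mult_mat_vec[OF hc' ec xc] x(1) mult_mat_zero_vec[OF hc'] by (simp add: cyc_def)
  also have "(mfphi (k + 1) F y * mfmap k h y) *\<^sub>v x = mfphi (k + 1) F y *\<^sub>v (mfmap k h y *\<^sub>v x)"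
    by (rule assoc_mult_mat_vec[OF fc hc xc])
  finally have "mfmap k q y *\<^sub>v x = mfmap k p y *\<^sub>v x + mfphi (k + 1) F y *\<^sub>v (mfmap k h y *\<^sub>v x)"
    using mult_mat_vec_carrier[OF fc hx] by simp
  moreover have "mfphi (k + 1) F y *\<^sub>v (mfmap k h y *\<^sub>v x) \<in> bnd y k F" using hx by (auto simp: bnd_def)
  ultimately show ?thesis
    unfolding x(2) act_cls[OF E F p x(1)] act_cls[OF E F q x(1)]
    using cls_add_bnd[OF F map_carrier[OF E F p xc]] by simp
qed

lemma act_comp:
  assumes E: "is_mfact Y w E" and F: "is_mfact Y w F" and G: "is_mfact Y w G"
    and p: "p \<in> Z0_hom Y E F" and q: "q \<in> Z0_hom Y F G" and qp: "mf_comp q p \<in> Z0_hom Y E G" and S: "S \<in> Coh y k E"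
  shows "act y k G (mf_comp q p) S = act y k G q (act y k F p S)"
proof -
  obtain x where x: "x \<in> cyc y k E" "S = cls y k E x" using cls_ex[OF E S] by blast
  have "mfmap k (mf_comp q p) y = mfmap k q y * mfmap k p y" by (simp add: mfmap_def mf_comp_def)
  then have "mfmap k (mf_comp q p) y *\<^sub>v x = mfmap k q y *\<^sub>v (mfmap k p y *\<^sub>v x)"
    using assoc_mult_mat_vec[OF pmat[OF F G q] pmat[OF E F p] cyc_carrier[OF E x(1)]] by simp
  then show ?thesis
    unfolding x(2) act_cls[OF E F p x(1)] act_cls[OF E G qp x(1)] act_cls[OF F G q map_cyc[OF E F p x(1)]] by simp
qed

lemma act_id:
  assumes E: "is_mfact Y w E" and i: "mf_id E \<in> Z0_hom Y E E" and S: "S \<in> Coh y k E"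
  shows "act y k E (mf_id E) S = S"
proof -
  obtain x where x: "x \<in> cyc y k E" "S = cls y k E x" using cls_ex[OF E S] by blast
  have "mfmap k (mf_id E) y *\<^sub>v x = x"
    using cyc_carrier[OF E x(1)] by (auto simp: mfmap_def mf_id_def mfE_def split: if_splits)
  then show ?thesis unfolding x(2) act_cls[OF E E i x(1)] by simp
qed

end

section \<open>The homotopy category\<close>

lemma mfE_add2: "mfE (k + 1 + 1) E = mfE k E"
  by simp

lemma mfmap_comp: "mfmap k (mf_comp q p) y = mfmap k q y * mfmap k p y"
  by (simp add: mfmap_def mf_comp_def)

lemma mfmap_id: "mfmap k (mf_id E) y = 1\<^sub>m (rk (mfE k E) y)"
  by (simp add: mfmap_def mf_id_def mfE_def)

definition mf_zero :: "'p mfact \<Rightarrow> 'p mfact \<Rightarrow> 'p mf_map" where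
  "mf_zero E F = (\<lambda>y. 0\<^sub>m (rk (mE0 F) y) (rk (mE0 E) y), \<lambda>y. 0\<^sub>m (rk (mE1 F) y) (rk (mE1 E) y))"

lemma mfmap_zero: "mfmap k (mf_zero E F) y = 0\<^sub>m (rk (mfE k F) y) (rk (mfE k E) y)"
  by (simp add: mfmap_def mf_zero_def mfE_def)

lemma mfmap_pair:
  assumes "\<And>k j. even j \<Longrightarrow> h (k + j) = h k"
  shows "mfmap k (h 0, h 1) = h k"
proof (cases "even k")
  case True then show ?thesis using assms[of k 0] by (simp add: mfmap_def)
next
  case False then show ?thesis using assms[of "k - 1" 1] by (simp add: mfmap_def)
qed

text \<open>A family indexed by all integers is easier to write down than a pair of maps;
  periodicity guarantees that it comes from one.\<close>

lemma homotopic_mapsI: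
  assumes "\<And>k j. even j \<Longrightarrow> h (k + j) = h k"
    and "\<And>k. sheaf_mor Y (mfE k E) (mfE (k + 1) F) (h k)"
    and "\<And>k y. y \<in> Y \<Longrightarrow> mfmap k q y = mfmap k p y + (mfphi (k + 1) F y * h k y + h (k + 1) y * mfphi k E y)"
  shows "homotopic_maps Y E F p q"
  unfolding homotopic_maps_iff
  by (intro exI[of _ "(h 0, h 1)"]) (simp add: mfmap_pair[of h, OF assms(1)] assms(2,3))

lemma homotopic_mapsE:
  assumes "homotopic_maps Y E F p q"
  obtains h where "\<And>k. sheaf_mor Y (mfE k E) (mfE (k + 1) F) (mfmap k h)"
    "\<And>k y. y \<in> Y \<Longrightarrow> mfmap k q y = mfmap k p y + (mfphi (k + 1) F y * mfmap k h y + mfmap (k + 1) h y * mfphi k E y)"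
  using assms unfolding homotopic_maps_iff by blast

lemma Z0_id: assumes E: "is_mfact Y w E" shows "mf_id E \<in> Z0_hom Y E E"
  unfolding Z0_hom_iff
proof (intro conjI allI ballI)
  show "sheaf_mor Y (mfE k E) (mfE k E) (mfmap k (mf_id E))" for k
    unfolding mfmap_id[abs_def] by (intro sheaf_mor_id mfact_locally_free[OF E])
  show "mfphi k E y * mfmap k (mf_id E) y = mfmap (k + 1) (mf_id E) y * mfphi k E y" if "y \<in> Y" for k y
    using mfact_carrier[OF E that, of k] by (simp add: mfmap_id)
qed

lemma Z0_zero: assumes E: "is_mfact Y w E" and F: "is_mfact Y w F" shows "mf_zero E F \<in> Z0_hom Y E F"
  unfolding Z0_hom_iff
proof (intro conjI allI ballI)
  show "sheaf_mor Y (mfE k E) (mfE k F) (mfmap k (mf_zero E F))" for k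
    unfolding mfmap_zero[abs_def] by (intro sheaf_mor_zero mfact_locally_free[OF E] mfact_locally_free[OF F])
  show "mfphi k F y * mfmap k (mf_zero E F) y = mfmap (k + 1) (mf_zero E F) y * mfphi k E y" if "y \<in> Y" for k y
    using mfact_carrier[OF E that, of k] mfact_carrier[OF F that, of k] by (simp add: mfmap_zero)
qed

lemma Z0_comp:
  assumes E: "is_mfact Y w E" and F: "is_mfact Y w F" and G: "is_mfact Y w G"
    and p: "p \<in> Z0_hom Y E F" and q: "q \<in> Z0_hom Y F G"
  shows "mf_comp q p \<in> Z0_hom Y E G"
  unfolding Z0_hom_iff
proof (intro conjI allI ballI)
  show "sheaf_mor Y (mfE k E) (mfE k G) (mfmap k (mf_comp q p))" for k
    unfolding mfmap_comp[abs_def] by (rule sheaf_mor_comp[OF mfact_locally_free[OF E] Z0_mor[OF p] Z0_mor[OF q]])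
  fix k y assume y: "y \<in> Y"
  note c = Z0_carrier[OF p y] Z0_carrier[OF q y] mfact_carrier[OF E y] mfact_carrier[OF F y] mfact_carrier[OF G y]
  have "mfphi k G y * mfmap k (mf_comp q p) y = (mfphi k G y * mfmap k q y) * mfmap k p y"
    unfolding mfmap_comp using assoc_mult_mat[OF c(5,2,1)] by simp
  also have "\<dots> = (mfmap (k + 1) q y * mfphi k F y) * mfmap k p y" using Z0_comm[OF q y] by simp
  also have "\<dots> = mfmap (k + 1) q y * (mfphi k F y * mfmap k p y)" using assoc_mult_mat[OF c(2,4,1)] by simp
  also have "\<dots> = mfmap (k + 1) q y * (mfmap (k + 1) p y * mfphi k E y)" using Z0_comm[OF p y] by simp
  also have "\<dots> = mfmap (k + 1) (mf_comp q p) y * mfphi k E y"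
    unfolding mfmap_comp using assoc_mult_mat[OF c(2,1,3)] by simp
  finally show "mfphi k G y * mfmap k (mf_comp q p) y = mfmap (k + 1) (mf_comp q p) y * mfphi k E y" .
qed

lemma homotopic_refl:
  assumes E: "is_mfact Y w E" and F: "is_mfact Y w F" and p: "p \<in> Z0_hom Y E F"
  shows "homotopic_maps Y E F p p"
proof (rule homotopic_mapsI)
  let ?h = "\<lambda>k y. 0\<^sub>m (rk (mfE (k + 1) F) y) (rk (mfE k E) y) :: complex mat"
  show "?h (k + j) = ?h k" if "even j" for k j
    using mfE_add_even(1)[OF that, of "k + 1" F] mfE_add_even(1)[OF that, of k E] by (simp add: algebra_simps)
  show "sheaf_mor Y (mfE k E) (mfE (k + 1) F) (?h k)" for k
    by (intro sheaf_mor_zero mfact_locally_free[OF E] mfact_locally_free[OF F])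
  fix k y assume y: "y \<in> Y"
  note c = Z0_carrier[OF p y, of k] mfact_carrier[OF E y, of k] mfact_carrier[OF F y, of "k + 1"]
  show "mfmap k p y = mfmap k p y + (mfphi (k + 1) F y * ?h k y + ?h (k + 1) y * mfphi k E y)"
    using c by (auto intro!: eq_matI)
qed

lemma mat_solve:
  fixes p q P Q :: "complex mat"
  assumes "p \<in> carrier_mat m n" "P \<in> carrier_mat m n" "Q \<in> carrier_mat m n" "q = p + (P + Q)"
  shows "p = q + (- P + - Q)"
  using assms by (auto intro!: eq_matI)

lemma mat_shuffle:
  fixes p q P Q P' Q' :: "complex mat"
  assumes "p \<in> carrier_mat m n" "P \<in> carrier_mat m n" "Q \<in> carrier_mat m n"
    "P' \<in> carrier_mat m n" "Q' \<in> carrier_mat m n"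
  shows "p + (P + Q) + (P' + Q') = p + ((P + P') + (Q + Q'))"
  using assms by (auto intro!: eq_matI)

lemma homotopic_sym:
  assumes E: "is_mfact Y w E" and F: "is_mfact Y w F" and p: "p \<in> Z0_hom Y E F"
    and h: "homotopic_maps Y E F p q"
  shows "homotopic_maps Y E F q p"
proof -
  obtain h where hm: "\<And>k. sheaf_mor Y (mfE k E) (mfE (k + 1) F) (mfmap k h)"
    and eq: "\<And>k y. y \<in> Y \<Longrightarrow> mfmap k q y = mfmap k p y + (mfphi (k + 1) F y * mfmap k h y + mfmap (k + 1) h y * mfphi k E y)"
    using h by (rule homotopic_mapsE) blast
  show ?thesis
  proof (rule homotopic_mapsI)
    show "(\<lambda>y. - mfmap (k + j) h y) = (\<lambda>y. - mfmap k h y)" if "even j" for k j using that by simp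
    show "sheaf_mor Y (mfE k E) (mfE (k + 1) F) (\<lambda>y. - mfmap k h y)" for k
      by (intro sheaf_mor_uminus mfact_locally_free[OF E] mfact_locally_free[OF F] hm)
    fix k y assume y: "y \<in> Y"
    note hc = sheaf_mor_carrier[OF hm y]
    have hc': "mfmap (k + 1) h y \<in> carrier_mat (rk (mfE k F) y) (rk (mfE (k + 1) E) y)" using hc[of "k + 1"] by simp
    have fc: "mfphi (k + 1) F y \<in> carrier_mat (rk (mfE k F) y) (rk (mfE (k + 1) F) y)"
      using mfact_carrier[OF F y, of "k + 1"] by simp
    note ec = mfact_carrier[OF E y, of k]
    from mat_solve[OF Z0_carrier[OF p y] mult_carrier_mat[OF fc hc] mult_carrier_mat[OF hc' ec] eq[OF y]]
    show "mfmap k p y = mfmap k q y + (mfphi (k + 1) F y * - mfmap k h y + - mfmap (k + 1) h y * mfphi k E y)"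
      using carrier_matD[OF hc] carrier_matD[OF hc'] carrier_matD[OF fc] carrier_matD[OF ec] by simp
  qed
qed

lemma homotopic_trans:
  assumes E: "is_mfact Y w E" and F: "is_mfact Y w F" and p: "p \<in> Z0_hom Y E F"
    and h: "homotopic_maps Y E F p q" and h': "homotopic_maps Y E F q r"
  shows "homotopic_maps Y E F p r"
proof -
  obtain h where hm: "\<And>k. sheaf_mor Y (mfE k E) (mfE (k + 1) F) (mfmap k h)"
    and eq: "\<And>k y. y \<in> Y \<Longrightarrow> mfmap k q y = mfmap k p y + (mfphi (k + 1) F y * mfmap k h y + mfmap (k + 1) h y * mfphi k E y)"
    using h by (rule homotopic_mapsE) blast
  obtain g where gm: "\<And>k. sheaf_mor Y (mfE k E) (mfE (k + 1) F) (mfmap k g)"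
    and eq': "\<And>k y. y \<in> Y \<Longrightarrow> mfmap k r y = mfmap k q y + (mfphi (k + 1) F y * mfmap k g y + mfmap (k + 1) g y * mfphi k E y)"
    using h' by (rule homotopic_mapsE) blast
  show ?thesis
  proof (rule homotopic_mapsI)
    show "(\<lambda>y. mfmap (k + j) h y + mfmap (k + j) g y) = (\<lambda>y. mfmap k h y + mfmap k g y)" if "even j" for k j using that by simp
    show "sheaf_mor Y (mfE k E) (mfE (k + 1) F) (\<lambda>y. mfmap k h y + mfmap k g y)" for k
      by (intro sheaf_mor_add mfact_locally_free[OF E] mfact_locally_free[OF F] hm gm)
    fix k y assume y: "y \<in> Y"
    note hc = sheaf_mor_carrier[OF hm y] and gc = sheaf_mor_carrier[OF gm y]
    have hc': "mfmap (k + 1) h y \<in> carrier_mat (rk (mfE k F) y) (rk (mfE (k + 1) E) y)" using hc[of "k + 1"] by simp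
    have gc': "mfmap (k + 1) g y \<in> carrier_mat (rk (mfE k F) y) (rk (mfE (k + 1) E) y)" using gc[of "k + 1"] by simp
    have fc: "mfphi (k + 1) F y \<in> carrier_mat (rk (mfE k F) y) (rk (mfE (k + 1) F) y)"
      using mfact_carrier[OF F y, of "k + 1"] by simp
    note ec = mfact_carrier[OF E y, of k]
    show "mfmap k r y = mfmap k p y + (mfphi (k + 1) F y * (mfmap k h y + mfmap k g y)
        + (mfmap (k + 1) h y + mfmap (k + 1) g y) * mfphi k E y)"
      unfolding eq'[OF y] eq[OF y] mult_add_distrib_mat[OF fc hc gc] add_mult_distrib_mat[OF hc' gc' ec]
      by (rule mat_shuffle[OF Z0_carrier[OF p y] mult_carrier_mat[OF fc hc] mult_carrier_mat[OF hc' ec]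
            mult_carrier_mat[OF fc gc] mult_carrier_mat[OF gc' ec]])
  qed
qed

lemma homotopic_comp_left:
  assumes E: "is_mfact Y w E" and F: "is_mfact Y w F" and G: "is_mfact Y w G"
    and p: "p \<in> Z0_hom Y E F" and q: "q \<in> Z0_hom Y F G" and h: "homotopic_maps Y E F p p'"
  shows "homotopic_maps Y E G (mf_comp q p) (mf_comp q p')"
proof -
  obtain h where hm: "\<And>k. sheaf_mor Y (mfE k E) (mfE (k + 1) F) (mfmap k h)"
    and eq: "\<And>k y. y \<in> Y \<Longrightarrow> mfmap k p' y = mfmap k p y + (mfphi (k + 1) F y * mfmap k h y + mfmap (k + 1) h y * mfphi k E y)"
    using h by (rule homotopic_mapsE) blast
  show ?thesis
  proof (rule homotopic_mapsI)
    show "(\<lambda>y. mfmap (k + j + 1) q y * mfmap (k + j) h y) = (\<lambda>y. mfmap (k + 1) q y * mfmap k h y)" if "even j" for k j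
      using that mfmap_add_even(1)[OF that, of "k + 1" q] by (simp add: algebra_simps)
    show "sheaf_mor Y (mfE k E) (mfE (k + 1) G) (\<lambda>y. mfmap (k + 1) q y * mfmap k h y)" for k
      by (rule sheaf_mor_comp[OF mfact_locally_free[OF E] hm Z0_mor[OF q]])
    fix k y assume y: "y \<in> Y"
    note hc = sheaf_mor_carrier[OF hm y]
    have hc': "mfmap (k + 1) h y \<in> carrier_mat (rk (mfE k F) y) (rk (mfE (k + 1) E) y)" using hc[of "k + 1"] by simp
    have fc: "mfphi (k + 1) F y \<in> carrier_mat (rk (mfE k F) y) (rk (mfE (k + 1) F) y)"
      using mfact_carrier[OF F y, of "k + 1"] by simp
    have gc: "mfphi (k + 1) G y \<in> carrier_mat (rk (mfE k G) y) (rk (mfE (k + 1) G) y)"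
      using mfact_carrier[OF G y, of "k + 1"] by simp
    note ec = mfact_carrier[OF E y, of k] and pc = Z0_carrier[OF p y] and qc = Z0_carrier[OF q y]
    have qf: "mfmap k q y * mfphi (k + 1) F y = mfphi (k + 1) G y * mfmap (k + 1) q y"
      using Z0_comm[OF q y, of "k + 1"] by simp
    have q2: "mfmap (k + 1 + 1) q y = mfmap k q y" by simp
    have "mfmap k q y * mfmap k p' y = mfmap k q y * mfmap k p y +
        (mfmap k q y * (mfphi (k + 1) F y * mfmap k h y) + mfmap k q y * (mfmap (k + 1) h y * mfphi k E y))"
      unfolding eq[OF y]
      using mult_add_distrib_mat[OF qc pc add_carrier_mat[OF mult_carrier_mat[OF hc' ec]]]
        mult_add_distrib_mat[OF qc mult_carrier_mat[OF fc hc] mult_carrier_mat[OF hc' ec]] by simp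
    also have "mfmap k q y * (mfphi (k + 1) F y * mfmap k h y) = mfphi (k + 1) G y * (mfmap (k + 1) q y * mfmap k h y)"
      using assoc_mult_mat[OF qc fc hc] assoc_mult_mat[OF gc qc hc] qf by simp
    also have "mfmap k q y * (mfmap (k + 1) h y * mfphi k E y) = (mfmap (k + 1 + 1) q y * mfmap (k + 1) h y) * mfphi k E y"
      unfolding q2 by (rule assoc_mult_mat[OF qc hc' ec, symmetric])
    finally show "mfmap k (mf_comp q p') y = mfmap k (mf_comp q p) y +
        (mfphi (k + 1) G y * (mfmap (k + 1) q y * mfmap k h y) + mfmap (k + 1 + 1) q y * mfmap (k + 1) h y * mfphi k E y)"
      unfolding mfmap_comp .
  qed
qed

lemma homotopic_comp_right:
  assumes E: "is_mfact Y w E" and F: "is_mfact Y w F" and G: "is_mfact Y w G"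
    and p: "p \<in> Z0_hom Y E F" and q: "q \<in> Z0_hom Y F G" and h: "homotopic_maps Y F G q q'"
  shows "homotopic_maps Y E G (mf_comp q p) (mf_comp q' p)"
proof -
  obtain h where hm: "\<And>k. sheaf_mor Y (mfE k F) (mfE (k + 1) G) (mfmap k h)"
    and eq: "\<And>k y. y \<in> Y \<Longrightarrow> mfmap k q' y = mfmap k q y + (mfphi (k + 1) G y * mfmap k h y + mfmap (k + 1) h y * mfphi k F y)"
    using h by (rule homotopic_mapsE) blast
  show ?thesis
  proof (rule homotopic_mapsI)
    show "(\<lambda>y. mfmap (k + j) h y * mfmap (k + j) p y) = (\<lambda>y. mfmap k h y * mfmap k p y)" if "even j" for k j using that by simp
    show "sheaf_mor Y (mfE k E) (mfE (k + 1) G) (\<lambda>y. mfmap k h y * mfmap k p y)" for k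
      by (rule sheaf_mor_comp[OF mfact_locally_free[OF E] Z0_mor[OF p] hm])
    fix k y assume y: "y \<in> Y"
    note hc = sheaf_mor_carrier[OF hm y]
    have hc': "mfmap (k + 1) h y \<in> carrier_mat (rk (mfE k G) y) (rk (mfE (k + 1) F) y)" using hc[of "k + 1"] by simp
    have gc: "mfphi (k + 1) G y \<in> carrier_mat (rk (mfE k G) y) (rk (mfE (k + 1) G) y)"
      using mfact_carrier[OF G y, of "k + 1"] by simp
    note ec = mfact_carrier[OF E y, of k] and fc = mfact_carrier[OF F y, of k] and pc = Z0_carrier[OF p y] and qc = Z0_carrier[OF q y]
    note c1 = mult_carrier_mat[OF gc hc] and c2 = mult_carrier_mat[OF hc' fc]
    have "mfmap k q' y * mfmap k p y = mfmap k q y * mfmap k p y +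
        ((mfphi (k + 1) G y * mfmap k h y) * mfmap k p y + (mfmap (k + 1) h y * mfphi k F y) * mfmap k p y)"
      unfolding eq[OF y]
      using add_mult_distrib_mat[OF qc add_carrier_mat[OF c2] pc] add_mult_distrib_mat[OF c1 c2 pc] by simp
    also have "(mfphi (k + 1) G y * mfmap k h y) * mfmap k p y = mfphi (k + 1) G y * (mfmap k h y * mfmap k p y)"
      by (rule assoc_mult_mat[OF gc hc pc])
    also have "(mfmap (k + 1) h y * mfphi k F y) * mfmap k p y = (mfmap (k + 1) h y * mfmap (k + 1) p y) * mfphi k E y"
      using assoc_mult_mat[OF hc' fc pc] assoc_mult_mat[OF hc' pc ec] Z0_comm[OF p y, of k] by simp
    finally show "mfmap k (mf_comp q' p) y = mfmap k (mf_comp q p) y +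
        (mfphi (k + 1) G y * (mfmap k h y * mfmap k p y) + mfmap (k + 1) h y * mfmap (k + 1) p y * mfphi k E y)"
      unfolding mfmap_comp .
  qed
qed

lemma H0_class_eqI:
  assumes E: "is_mfact Y w E" and F: "is_mfact Y w F" and p: "p \<in> Z0_hom Y E F" and q: "q \<in> Z0_hom Y E F"
    and h: "homotopic_maps Y E F p q"
  shows "H0_class Y E F p = H0_class Y E F q"
  unfolding H0_class_def
  using homotopic_trans[OF E F p h] homotopic_trans[OF E F q homotopic_sym[OF E F p h]] by blast

lemma H0_class_self:
  assumes "is_mfact Y w E" "is_mfact Y w F" "p \<in> Z0_hom Y E F" shows "p \<in> H0_class Y E F p"
  unfolding H0_class_def using homotopic_refl[OF assms] assms(3) by blast

lemma H0_class_cong: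
  assumes "\<And>y. y \<in> Y \<Longrightarrow> fst p y = fst q y \<and> snd p y = snd q y"
  shows "H0_class Y E F p = H0_class Y E F q"
  unfolding H0_class_def homotopic_maps_def using assms by (intro Collect_cong conj_cong refl ex_cong1 ball_cong) auto

lemma H0_class_cong':
  assumes "\<And>k y. y \<in> Y \<Longrightarrow> mfmap k p y = mfmap k q y"
  shows "H0_class Y E F p = H0_class Y E F q"
  by (rule H0_class_cong) (use assms[of _ 0] assms[of _ 1] in \<open>auto simp: mfmap_def\<close>)

section \<open>Composition, identities and triangles of the homotopy category\<close>

lemma with_triangles_simps [simp]:
  "ob (with_triangles T S) = ob T" "mor (with_triangles T S) = mor T" "idm (with_triangles T S) = idm T"
  "cmp (with_triangles T S) = cmp T" "sh_ob (with_triangles T S) = sh_ob T" "sh_mor (with_triangles T S) = sh_mor T"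
  "tri (with_triangles T S) = {t \<in> candidate_triangles T. \<exists>t'\<in>S. tri_iso T t t'}"
  by (simp_all add: with_triangles_def shift_cat.extend_def)

lemma H0_simps [simp]:
  "ob (H0_Fact Y w) = {E. is_mfact Y w E}" "mor (H0_Fact Y w) E F = H0_class Y E F ` Z0_hom Y E F"
  "idm (H0_Fact Y w) E = H0_class Y E E (mf_id E)" "sh_ob (H0_Fact Y w) = mf_shift"
  by (simp_all add: H0_Fact_def H0_base_def)

text \<open>Composition is a union over representatives; homotopies can be composed with maps on
  either side, so all pairs contribute the same class.\<close>

lemma H0_cmp:
  assumes E: "is_mfact Y w E" and F: "is_mfact Y w F" and G: "is_mfact Y w G"
    and p: "p \<in> Z0_hom Y E F" and q: "q \<in> Z0_hom Y F G"
  shows "cmp (H0_Fact Y w) E F G (H0_class Y F G q) (H0_class Y E F p) = H0_class Y E G (mf_comp q p)"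
proof -
  have "H0_class Y E G (mf_comp g f) = H0_class Y E G (mf_comp q p)"
    if g: "g \<in> H0_class Y F G q" and f: "f \<in> H0_class Y E F p" for g f
  proof -
    have gf: "g \<in> Z0_hom Y F G" "homotopic_maps Y F G q g" "f \<in> Z0_hom Y E F" "homotopic_maps Y E F p f"
      using g f by (auto simp: H0_class_def)
    have "H0_class Y E G (mf_comp q p) = H0_class Y E G (mf_comp q f)"
      by (intro H0_class_eqI[OF E G] Z0_comp[OF E F G] homotopic_comp_left[OF E F G] p q gf)
    also have "\<dots> = H0_class Y E G (mf_comp g f)"
      by (intro H0_class_eqI[OF E G] Z0_comp[OF E F G] homotopic_comp_right[OF E F G] p q gf)
    finally show ?thesis ..
  qed
  moreover have "cmp (H0_Fact Y w) E F G (H0_class Y F G q) (H0_class Y E F p)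
     = (\<Union>g\<in>H0_class Y F G q. \<Union>f\<in>H0_class Y E F p. H0_class Y E G (mf_comp g f))"
    by (simp add: H0_Fact_def H0_base_def)
  ultimately show ?thesis using H0_class_self[OF E F p] H0_class_self[OF F G q] by blast
qed

lemma H0_cmp_id_right:
  assumes E: "is_mfact Y w E" and F: "is_mfact Y w F" and u: "u \<in> mor (H0_Fact Y w) E F"
  shows "cmp (H0_Fact Y w) E E F u (idm (H0_Fact Y w) E) = u"
proof -
  obtain p where p: "p \<in> Z0_hom Y E F" "u = H0_class Y E F p" using u by auto
  show ?thesis
    unfolding p(2) H0_simps H0_cmp[OF E E F Z0_id[OF E] p(1)]
    by (rule H0_class_cong') (simp add: mfmap_comp mfmap_id right_mult_one_mat[OF Z0_carrier[OF p(1)]])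
qed

lemma H0_cmp_id_left:
  assumes E: "is_mfact Y w E" and F: "is_mfact Y w F" and u: "u \<in> mor (H0_Fact Y w) E F"
  shows "cmp (H0_Fact Y w) E F F (idm (H0_Fact Y w) F) u = u"
proof -
  obtain p where p: "p \<in> Z0_hom Y E F" "u = H0_class Y E F p" using u by auto
  show ?thesis
    unfolding p(2) H0_simps H0_cmp[OF E F F p(1) Z0_id[OF F]]
    by (rule H0_class_cong') (simp add: mfmap_comp mfmap_id left_mult_one_mat[OF Z0_carrier[OF p(1)]])
qed

lemma H0_cmp_mor:
  assumes E: "is_mfact Y w E" and F: "is_mfact Y w F" and G: "is_mfact Y w G"
    and u: "u \<in> mor (H0_Fact Y w) E F" and v: "v \<in> mor (H0_Fact Y w) F G"
  shows "cmp (H0_Fact Y w) E F G v u \<in> mor (H0_Fact Y w) E G"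
  using u v H0_cmp[OF E F G] Z0_comp[OF E F G] by auto

lemma H0_id_mor: "is_mfact Y w E \<Longrightarrow> idm (H0_Fact Y w) E \<in> mor (H0_Fact Y w) E E"
  using Z0_id by auto

text \<open>Wanted for the last square when a standard triangle is compared with itself. The
  structure maps change sign under the shift, and so does the chosen homotopy, which leaves the
  homotopy formula as it was.\<close>

lemma H0_sh_id:
  assumes E: "is_mfact Y w E"
  shows "sh_mor (H0_Fact Y w) E E (idm (H0_Fact Y w) E) = idm (H0_Fact Y w) (mf_shift E)"
proof -
  note S = mf_shift_mfact[OF E]
  have swap: "mfmap k (snd p, fst p) = mfmap (k + 1) p" for k and p :: "'a cproj mf_map" by (simp add: mfmap_def)
  have sid: "(snd (mf_id E), fst (mf_id E)) = mf_id (mf_shift E)" by (simp add: mf_id_def mf_shift_def)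
  have "H0_class Y (mf_shift E) (mf_shift E) (snd p, fst p) = H0_class Y (mf_shift E) (mf_shift E) (mf_id (mf_shift E))"
    if p: "p \<in> H0_class Y E E (mf_id E)" for p
  proof -
    have pZ: "p \<in> Z0_hom Y E E" and hp: "homotopic_maps Y E E (mf_id E) p" using p by (auto simp: H0_class_def)
    obtain h where hm: "\<And>k. sheaf_mor Y (mfE k E) (mfE (k + 1) E) (mfmap k h)"
      and eq: "\<And>k y. y \<in> Y \<Longrightarrow> mfmap k p y = mfmap k (mf_id E) y + (mfphi (k + 1) E y * mfmap k h y + mfmap (k + 1) h y * mfphi k E y)"
      using hp by (rule homotopic_mapsE) blast
    have "homotopic_maps Y (mf_shift E) (mf_shift E) (mf_id (mf_shift E)) (snd p, fst p)"
    proof (rule homotopic_mapsI)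
      show "(\<lambda>y. - mfmap (k + j + 1) h y) = (\<lambda>y. - mfmap (k + 1) h y)" if "even j" for k j
        using mfmap_add_even(1)[OF that, of "k + 1" h] by (simp add: algebra_simps)
      show "sheaf_mor Y (mfE k (mf_shift E)) (mfE (k + 1) (mf_shift E)) (\<lambda>y. - mfmap (k + 1) h y)" for k
        unfolding mfE_shift by (intro sheaf_mor_uminus mfact_locally_free[OF E] hm)
      fix k y assume y: "y \<in> Y"
      have c: "mfmap (k + 1) h y \<in> carrier_mat (rk (mfE k E) y) (rk (mfE (k + 1) E) y)"
        "mfmap (k + 1 + 1) h y \<in> carrier_mat (rk (mfE (k + 1) E) y) (rk (mfE k E) y)"
        "mfphi (k + 1) E y \<in> carrier_mat (rk (mfE k E) y) (rk (mfE (k + 1) E) y)"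
        "mfphi (k + 1 + 1) E y \<in> carrier_mat (rk (mfE (k + 1) E) y) (rk (mfE k E) y)"
        using sheaf_mor_carrier[OF hm y, of "k + 1"] sheaf_mor_carrier[OF hm y, of "k + 1 + 1"]
          mfact_carrier[OF E y, of "k + 1"] mfact_carrier[OF E y, of "k + 1 + 1"] unfolding mfE_add2 by simp_all
      have neg: "(- A) * (- B) = A * B" if "A \<in> carrier_mat m n" "B \<in> carrier_mat n r" for A B :: "complex mat" and m n r
        using that by simp
      show "mfmap k (snd p, fst p) y = mfmap k (mf_id (mf_shift E)) y
         + (mfphi (k + 1) (mf_shift E) y * - mfmap (k + 1) h y + - mfmap (k + 1 + 1) h y * mfphi k (mf_shift E) y)"
        unfolding swap eq[OF y] mfphi_shift neg[OF c(4,1)] neg[OF c(2,3)] mfmap_id mfE_shift ..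
    qed
    moreover have "(snd p, fst p) \<in> Z0_hom Y (mf_shift E) (mf_shift E)"
      unfolding Z0_hom_iff swap
    proof (intro conjI allI ballI)
      show "sheaf_mor Y (mfE k (mf_shift E)) (mfE k (mf_shift E)) (mfmap (k + 1) p)" for k
        using Z0_mor[OF pZ, of "k + 1"] by simp
      show "mfphi k (mf_shift E) y * mfmap (k + 1) p y = mfmap (k + 1 + 1) p y * mfphi k (mf_shift E) y" if y: "y \<in> Y" for k y
        using Z0_comm[OF pZ y, of "k + 1"] Z0_carrier[OF pZ y, of "k + 1"] Z0_carrier[OF pZ y, of "k + 1 + 1"]
          mfact_carrier[OF E y, of "k + 1"] by (simp add: mfphi_shift)
    qed
    ultimately show ?thesis using H0_class_eqI[OF S S Z0_id[OF S]] by simp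
  qed
  moreover have "sh_mor (H0_Fact Y w) E E (idm (H0_Fact Y w) E)
     = (\<Union>p\<in>H0_class Y E E (mf_id E). H0_class Y (mf_shift E) (mf_shift E) (snd p, fst p))"
    by (simp add: H0_Fact_def H0_base_def)
  ultimately show ?thesis using H0_class_self[OF E E Z0_id[OF E]] by auto
qed

lemma H0_is_iso_id: "is_mfact Y w E \<Longrightarrow> is_iso (H0_Fact Y w) E E (idm (H0_Fact Y w) E)"
  unfolding is_iso_def using H0_id_mor H0_cmp_id_left[OF _ _ H0_id_mor] by blast

text \<open>Triangles are the candidates isomorphic to a standard one, so membership of a standard
  triangle itself asks for the identity as an isomorphism of triangles.\<close>

lemma H0_standard_triangle:
  assumes E: "is_mfact Y w E" and F: "is_mfact Y w F" and p: "p \<in> Z0_hom Y E F"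
  shows "(E, F, mf_cone E F p, H0_class Y E F p, H0_class Y F (mf_cone E F p) (cone_incl E F),
        H0_class Y (mf_cone E F p) (mf_shift E) (cone_proj E F)) \<in> tri (H0_Fact Y w)" (is "?t \<in> _")
proof -
  note C = mf_cone_mfact[OF E F p] and S = mf_shift_mfact[OF E]
  let ?T = "H0_Fact Y w"
  have m: "H0_class Y E F p \<in> mor ?T E F" "H0_class Y F (mf_cone E F p) (cone_incl E F) \<in> mor ?T F (mf_cone E F p)"
    "H0_class Y (mf_cone E F p) (mf_shift E) (cone_proj E F) \<in> mor ?T (mf_cone E F p) (mf_shift E)"
    using p cone_incl_Z0[OF E F p] cone_proj_Z0[OF E F p] by auto
  have cand: "?t \<in> candidate_triangles ?T"
    unfolding candidate_triangles_def using E F C m by simp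
  moreover have "tri_iso ?T ?t ?t"
    unfolding tri_iso.simps
  proof (intro exI conjI)
    show "is_iso ?T E E (idm ?T E)" "is_iso ?T F F (idm ?T F)" "is_iso ?T (mf_cone E F p) (mf_cone E F p) (idm ?T (mf_cone E F p))"
      using H0_is_iso_id E F C by blast+
    show "cmp ?T E F F (idm ?T F) (H0_class Y E F p) = cmp ?T E E F (H0_class Y E F p) (idm ?T E)"
      using H0_cmp_id_left[OF E F m(1)] H0_cmp_id_right[OF E F m(1)] by simp
    show "cmp ?T F (mf_cone E F p) (mf_cone E F p) (idm ?T (mf_cone E F p)) (H0_class Y F (mf_cone E F p) (cone_incl E F))
       = cmp ?T F F (mf_cone E F p) (H0_class Y F (mf_cone E F p) (cone_incl E F)) (idm ?T F)"
      using H0_cmp_id_left[OF F C m(2)] H0_cmp_id_right[OF F C m(2)] by simp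
    show "cmp ?T (mf_cone E F p) (sh_ob ?T E) (sh_ob ?T E) (sh_mor ?T E E (idm ?T E)) (H0_class Y (mf_cone E F p) (mf_shift E) (cone_proj E F))
      = cmp ?T (mf_cone E F p) (mf_cone E F p) (sh_ob ?T E) (H0_class Y (mf_cone E F p) (mf_shift E) (cone_proj E F)) (idm ?T (mf_cone E F p))"
      using H0_cmp_id_left[OF C S m(3)] H0_cmp_id_right[OF C S m(3)] H0_sh_id[OF E] by simp
  qed
  ultimately have ex: "\<exists>t'\<in>{(E, F, mf_cone E F p, H0_class Y E F p, H0_class Y F (mf_cone E F p) (cone_incl E F),
        H0_class Y (mf_cone E F p) (mf_shift E) (cone_proj E F)) | E F p.
        is_mfact Y w E \<and> is_mfact Y w F \<and> p \<in> Z0_hom Y E F}. tri_iso ?T ?t t'"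
    using E F p by blast
  \<comment> \<open>The relation inside \<open>with_triangles\<close> refers to the category before
    triangles were attached; it reads only fields that both records share.\<close>
  have eq: "tri_iso ?T = tri_iso (H0_base Y w)" "candidate_triangles ?T = candidate_triangles (H0_base Y w)"
    unfolding H0_Fact_def by (auto simp: fun_eq_iff candidate_triangles_def is_iso_def)
  note cand' = cand[unfolded eq] and ex' = ex[unfolded eq]
  show ?thesis
    unfolding H0_Fact_def with_triangles_simps(7) by (intro CollectI conjI cand' ex')
qed

text \<open>Of the isomorphism of triangles the first square is kept, because it is the one that
  compares \<open>u\<close> with the closed map \<open>p\<close> of the standard cone.\<close>

lemma H0_triE:
  assumes "(A, B, C, u, v, x) \<in> tri (H0_Fact Y w)"
  obtains E F p a b c where "is_mfact Y w A" "is_mfact Y w B" "is_mfact Y w C"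
    "u \<in> mor (H0_Fact Y w) A B" "v \<in> mor (H0_Fact Y w) B C" "x \<in> mor (H0_Fact Y w) C (mf_shift A)"
    "is_mfact Y w E" "is_mfact Y w F" "p \<in> Z0_hom Y E F"
    "is_iso (H0_Fact Y w) A E a" "is_iso (H0_Fact Y w) B F b" "is_iso (H0_Fact Y w) C (mf_cone E F p) c"
    "cmp (H0_Fact Y w) A B F b u = cmp (H0_Fact Y w) A E F (H0_class Y E F p) a"
proof -
  have iso: "is_iso (H0_base Y w) = is_iso (H0_Fact Y w)" "cmp (H0_base Y w) = cmp (H0_Fact Y w)"
    "mor (H0_base Y w) = mor (H0_Fact Y w)" "ob (H0_base Y w) = ob (H0_Fact Y w)" "sh_ob (H0_base Y w) = sh_ob (H0_Fact Y w)"
    unfolding H0_Fact_def by (auto simp: fun_eq_iff is_iso_def)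
  have "(A, B, C, u, v, x) \<in> candidate_triangles (H0_base Y w)"
    using assms unfolding H0_Fact_def by simp
  then have cand: "is_mfact Y w A" "is_mfact Y w B" "is_mfact Y w C"
    "u \<in> mor (H0_Fact Y w) A B" "v \<in> mor (H0_Fact Y w) B C" "x \<in> mor (H0_Fact Y w) C (mf_shift A)"
    unfolding candidate_triangles_def iso by auto
  obtain E F p where EFp: "is_mfact Y w E" "is_mfact Y w F" "p \<in> Z0_hom Y E F"
    "tri_iso (H0_base Y w) (A, B, C, u, v, x) (E, F, mf_cone E F p, H0_class Y E F p, H0_class Y F (mf_cone E F p) (cone_incl E F),
        H0_class Y (mf_cone E F p) (mf_shift E) (cone_proj E F))"
    using assms unfolding H0_Fact_def with_triangles_simps by blast
  then show ?thesis using that cand unfolding tri_iso.simps iso by metis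
qed

text \<open>The cone of the identity is contractible, via the homotopy \<open>(a, b) \<mapsto> (0, a)\<close>.\<close>

lemma cone_id_contractible:
  assumes A: "is_mfact Y w A"
  shows "homotopic_maps Y (mf_cone A A (mf_id A)) (mf_cone A A (mf_id A))
    (mf_zero (mf_cone A A (mf_id A)) (mf_cone A A (mf_id A))) (mf_id (mf_cone A A (mf_id A)))"
proof (rule homotopic_mapsI)
  note iZ = Z0_id[OF A] and lA = mfact_locally_free[OF A]
  let ?Z = "mf_cone A A (mf_id A)"
  note Z = mf_cone_mfact[OF A A iZ]
  let ?h = "\<lambda>k y. four_block_mat (0\<^sub>m (rk (mfE (k + 1) A) y) (rk (mfE k A) y)) (0\<^sub>m (rk (mfE (k + 1) A) y) (rk (mfE (k + 1) A) y))
     (1\<^sub>m (rk (mfE k A) y)) (0\<^sub>m (rk (mfE k A) y) (rk (mfE (k + 1) A) y)) :: complex mat"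
  show "?h (k + j) = ?h k" if "even j" for k j
    using mfE_add_even(1)[OF that, of k A] mfE_add_even(1)[OF that, of "k + 1" A] by (simp add: algebra_simps)
  show hm: "sheaf_mor Y (mfE k ?Z) (mfE (k + 1) ?Z) (?h k)" for k
  proof -
    have "mfE (k + 1 + 1) A = mfE k A" by simp
    then show ?thesis unfolding mfE_cone by (simp only:) (intro sheaf_mor_block sheaf_mor_zero sheaf_mor_id lA)
  qed
  fix k y assume y: "y \<in> Y"
  have hmult: "?h k y *\<^sub>v (a @\<^sub>v b) = 0\<^sub>v (rk (mfE (k + 1) A) y) @\<^sub>v a"
    if a: "a \<in> carrier_vec (rk (mfE k A) y)" and b: "b \<in> carrier_vec (rk (mfE (k + 1) A) y)" for k a b
    by (subst four_block_mat_mult_vec[OF zero_carrier_mat zero_carrier_mat one_carrier_mat zero_carrier_mat a b])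
      (use a b in \<open>simp add: zero_mat_mult_vec[OF a] zero_mat_mult_vec[OF b]\<close>)
  note hc = sheaf_mor_carrier[OF hm y] and Zc = mfact_carrier[OF Z y]
  have hc': "?h (k + 1) y \<in> carrier_mat (rk (mfE k ?Z) y) (rk (mfE (k + 1) ?Z) y)"
    using hc[of "k + 1"] unfolding mfE_add2 .
  have Zc': "mfphi (k + 1) ?Z y \<in> carrier_mat (rk (mfE k ?Z) y) (rk (mfE (k + 1) ?Z) y)"
    using Zc[of "k + 1"] unfolding mfE_add2 .
  let ?n = "rk (mfE k ?Z) y"
  have "1\<^sub>m ?n = mfphi (k + 1) ?Z y * ?h k y + ?h (k + 1) y * mfphi k ?Z y"
  proof (rule mat_eq_on_vecI[OF one_carrier_mat])
    show c: "mfphi (k + 1) ?Z y * ?h k y + ?h (k + 1) y * mfphi k ?Z y \<in> carrier_mat ?n ?n"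
      by (intro add_carrier_mat mult_carrier_mat[OF hc' Zc])
    fix v :: "complex Matrix.vec" assume v: "v \<in> carrier_vec ?n"
    then have "v \<in> carrier_vec (rk (mfE k A) y + rk (mfE (k + 1) A) y)" by simp
    then obtain a b where a: "a \<in> carrier_vec (rk (mfE k A) y)" and b: "b \<in> carrier_vec (rk (mfE (k + 1) A) y)"
      and vab: "v = a @\<^sub>v b" by (rule vec_split_append)
    have a2: "a \<in> carrier_vec (rk (mfE (k + 1 + 1) A) y)" using a by simp
    have fa: "mfphi k A y *\<^sub>v a \<in> carrier_vec (rk (mfE (k + 1) A) y)" by (rule mult_mat_vec_carrier[OF mfact_carrier[OF A y] a])
    have fb: "mfphi (k + 1) A y *\<^sub>v b \<in> carrier_vec (rk (mfE (k + 1 + 1) A) y)" by (rule mult_mat_vec_carrier[OF mfact_carrier[OF A y] b])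
    have z: "mfphi (k + 1) A y *\<^sub>v 0\<^sub>v (rk (mfE (k + 1) A) y) = 0\<^sub>v (rk (mfE k A) y)"
      using mult_mat_zero_vec[OF mfact_carrier[OF A y, of "k + 1"]] by simp
    have 1: "mfphi (k + 1) ?Z y *\<^sub>v (0\<^sub>v (rk (mfE (k + 1) A) y) @\<^sub>v a) = a @\<^sub>v - (mfphi k A y *\<^sub>v a)"
      using cone_mult[OF A A iZ y zero_carrier_vec a2] a by (simp add: mfmap_id z)
    have ce: "mfphi k A y *\<^sub>v a + b \<in> carrier_vec (rk (mfE (k + 1) A) y)" using fa b by simp
    have cf: "- (mfphi (k + 1) A y *\<^sub>v b) \<in> carrier_vec (rk (mfE (k + 1 + 1) A) y)" using fb by simp
    have 2: "?h (k + 1) y *\<^sub>v (mfphi k ?Z y *\<^sub>v (a @\<^sub>v b)) = 0\<^sub>v (rk (mfE k A) y) @\<^sub>v (mfphi k A y *\<^sub>v a + b)"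
      using cone_mult[OF A A iZ y a b] hmult[OF ce cf] b by (simp add: mfmap_id)
    have "(mfphi (k + 1) ?Z y * ?h k y + ?h (k + 1) y * mfphi k ?Z y) *\<^sub>v v
       = mfphi (k + 1) ?Z y *\<^sub>v (?h k y *\<^sub>v v) + ?h (k + 1) y *\<^sub>v (mfphi k ?Z y *\<^sub>v v)"
      using add_mult_distrib_mat_vec[OF mult_carrier_mat[OF Zc' hc] mult_carrier_mat[OF hc' Zc] v]
        assoc_mult_mat_vec[OF Zc' hc v] assoc_mult_mat_vec[OF hc' Zc v] by simp
    also have "\<dots> = (a @\<^sub>v - (mfphi k A y *\<^sub>v a)) + (0\<^sub>v (rk (mfE k A) y) @\<^sub>v (mfphi k A y *\<^sub>v a + b))"
      unfolding vab hmult[OF a b] 1 2 ..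
    also have "\<dots> = v"
      unfolding vab using carrier_vecD[OF a] carrier_vecD[OF b] carrier_vecD[OF fa] by (intro eq_vecI) auto
    finally show "1\<^sub>m ?n *\<^sub>v v = (mfphi (k + 1) ?Z y * ?h k y + ?h (k + 1) y * mfphi k ?Z y) *\<^sub>v v"
      using v by simp
  qed
  moreover have "1\<^sub>m ?n = 0\<^sub>m ?n ?n + (1\<^sub>m ?n :: complex mat)" by simp
  ultimately show "mfmap k (mf_id ?Z) y = mfmap k (mf_zero ?Z ?Z) y + (mfphi (k + 1) ?Z y * ?h k y + ?h (k + 1) y * mfphi k ?Z y)"
    unfolding mfmap_id mfmap_zero by metis
qed

text \<open>If the identity of \<open>Z\<close> is null-homotopic, composing with it shows that
  every map into or out of \<open>Z\<close> is homotopic to zero.\<close>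

lemma contractible_zero_object:
  assumes Z: "is_mfact Y w Z" and c: "homotopic_maps Y Z Z (mf_zero Z Z) (mf_id Z)"
  shows "zero_object (H0_Fact Y w) Z"
proof -
  have 1: "H0_class Y A Z p = H0_class Y A Z (mf_zero A Z)" if A: "is_mfact Y w A" and p: "p \<in> Z0_hom Y A Z" for A p
  proof -
    have "H0_class Y A Z (mf_comp (mf_zero Z Z) p) = H0_class Y A Z (mf_comp (mf_id Z) p)"
      by (intro H0_class_eqI[OF A Z] Z0_comp[OF A Z Z] homotopic_comp_right[OF A Z Z] p Z0_zero[OF Z Z] Z0_id[OF Z] c)
    moreover have "H0_class Y A Z (mf_comp (mf_zero Z Z) p) = H0_class Y A Z (mf_zero A Z)"
      by (rule H0_class_cong') (simp add: mfmap_comp mfmap_zero left_mult_zero_mat[OF Z0_carrier[OF p]]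
        right_mult_zero_mat[OF Z0_carrier[OF p]])
    moreover have "H0_class Y A Z (mf_comp (mf_id Z) p) = H0_class Y A Z p"
      by (rule H0_class_cong') (simp add: mfmap_comp mfmap_id left_mult_one_mat[OF Z0_carrier[OF p]]
        right_mult_one_mat[OF Z0_carrier[OF p]])
    ultimately show ?thesis by simp
  qed
  have 2: "H0_class Y Z A p = H0_class Y Z A (mf_zero Z A)" if A: "is_mfact Y w A" and p: "p \<in> Z0_hom Y Z A" for A p
  proof -
    have "H0_class Y Z A (mf_comp p (mf_zero Z Z)) = H0_class Y Z A (mf_comp p (mf_id Z))"
      by (intro H0_class_eqI[OF Z A] Z0_comp[OF Z Z A] homotopic_comp_left[OF Z Z A] p Z0_zero[OF Z Z] Z0_id[OF Z] c)
    moreover have "H0_class Y Z A (mf_comp p (mf_zero Z Z)) = H0_class Y Z A (mf_zero Z A)"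
      by (rule H0_class_cong') (simp add: mfmap_comp mfmap_zero left_mult_zero_mat[OF Z0_carrier[OF p]]
        right_mult_zero_mat[OF Z0_carrier[OF p]])
    moreover have "H0_class Y Z A (mf_comp p (mf_id Z)) = H0_class Y Z A p"
      by (rule H0_class_cong') (simp add: mfmap_comp mfmap_id left_mult_one_mat[OF Z0_carrier[OF p]]
        right_mult_one_mat[OF Z0_carrier[OF p]])
    ultimately show ?thesis by simp
  qed
  show ?thesis
    unfolding zero_object_def H0_simps
  proof (intro conjI ballI)
    fix A assume "A \<in> {E. is_mfact Y w E}"
    then have A: "is_mfact Y w A" by simp
    show "\<exists>!f. f \<in> H0_class Y A Z ` Z0_hom Y A Z" using 1[OF A] Z0_zero[OF A Z] by blast
    show "\<exists>!f. f \<in> H0_class Y Z A ` Z0_hom Y Z A" using 2[OF A] Z0_zero[OF Z A] by blast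
  qed (use Z in simp)
qed

lemma zero_object_cone_id: "is_mfact Y w A \<Longrightarrow> zero_object (H0_Fact Y w) (mf_cone A A (mf_id A))"
  using contractible_zero_object mf_cone_mfact cone_id_contractible Z0_id by blast

section \<open>Fibrewise quasi-isomorphisms\<close>

definition Hact :: "'p \<Rightarrow> int \<Rightarrow> 'p mfact \<Rightarrow> 'p mf_map set \<Rightarrow> complex Matrix.vec set \<Rightarrow> complex Matrix.vec set" where
  "Hact y k F M S = (\<Union>p\<in>M. act y k F p S)"

text \<open>Injectivity and surjectivity are followed separately: each of the two equations for an
  isomorphism in a Verdier quotient will give one of them for the numerator of some roof, and the
  two roofs may differ.\<close>

definition coh_inj :: "'n::finite cproj set \<Rightarrow> ('n cproj \<Rightarrow> complex) \<Rightarrow> 'n cproj mfact \<Rightarrow> 'n cproj mfact \<Rightarrow> 'n cproj mf_map set \<Rightarrow> bool" where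
  "coh_inj Y w E F M \<longleftrightarrow> (\<forall>y\<in>zero_fibre Y w. \<forall>k. inj_on (Hact y k F M) (Coh y k E))"

definition coh_surj :: "'n::finite cproj set \<Rightarrow> ('n cproj \<Rightarrow> complex) \<Rightarrow> 'n cproj mfact \<Rightarrow> 'n cproj mfact \<Rightarrow> 'n cproj mf_map set \<Rightarrow> bool" where
  "coh_surj Y w E F M \<longleftrightarrow> (\<forall>y\<in>zero_fibre Y w. \<forall>k. Hact y k F M ` Coh y k E = Coh y k F)"

text \<open>The fibrewise counterpart of \<open>Acyc\<close>: it will turn out to be thick and to
  contain the totalizations, and hence to contain \<open>Acyc\<close>.\<close>

definition acyc_objs :: "'n::finite cproj set \<Rightarrow> ('n cproj \<Rightarrow> complex) \<Rightarrow> 'n cproj mfact set" where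
  "acyc_objs Y w = {E. is_mfact Y w E \<and> (\<forall>y\<in>zero_fibre Y w. acyclic_at y E)}"

lemma zero_fibre_point: "y \<in> zero_fibre Y w \<Longrightarrow> mf_point Y w y"
  by unfold_locales (auto simp: zero_fibre_def)

context
  fixes Y :: "'n::finite cproj set" and w :: "'n cproj \<Rightarrow> complex"
begin

declare H0_simps(2,3) [simp del]

private abbreviation "HT \<equiv> H0_Fact Y w"

text \<open>Homotopic maps act alike, so the union over a homotopy class reduces to the action of
  any representative.\<close>

lemma Hact_class:
  assumes yX: "y \<in> zero_fibre Y w" and E: "is_mfact Y w E" and F: "is_mfact Y w F" and p: "p \<in> Z0_hom Y E F"
    and S: "S \<in> Coh y k E"
  shows "Hact y k F (H0_class Y E F p) S = act y k F p S"
proof -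
  interpret mf_point Y w y by (rule zero_fibre_point[OF yX])
  have "act y k F q S = act y k F p S" if "q \<in> H0_class Y E F p" for q
    using that act_homotopic[OF E F p _ _ S] by (auto simp: H0_class_def)
  then show ?thesis unfolding Hact_def using H0_class_self[OF E F p] by blast
qed

lemma Hact_Coh:
  assumes yX: "y \<in> zero_fibre Y w" and E: "is_mfact Y w E" and F: "is_mfact Y w F" and u: "u \<in> mor HT E F"
    and S: "S \<in> Coh y k E"
  shows "Hact y k F u S \<in> Coh y k F"
proof -
  interpret mf_point Y w y by (rule zero_fibre_point[OF yX])
  obtain p where p: "p \<in> Z0_hom Y E F" "u = H0_class Y E F p" using u unfolding H0_simps by auto
  show ?thesis unfolding p(2) Hact_class[OF yX E F p(1) S] by (rule act_Coh[OF E F p(1) S])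
qed

lemma Hact_comp:
  assumes yX: "y \<in> zero_fibre Y w" and E: "is_mfact Y w E" and F: "is_mfact Y w F" and G: "is_mfact Y w G"
    and u: "u \<in> mor HT E F" and v: "v \<in> mor HT F G" and S: "S \<in> Coh y k E"
  shows "Hact y k G (cmp HT E F G v u) S = Hact y k G v (Hact y k F u S)"
proof -
  interpret mf_point Y w y by (rule zero_fibre_point[OF yX])
  obtain p where p: "p \<in> Z0_hom Y E F" "u = H0_class Y E F p" using u unfolding H0_simps by auto
  obtain q where q: "q \<in> Z0_hom Y F G" "v = H0_class Y F G q" using v unfolding H0_simps by auto
  note qp = Z0_comp[OF E F G p(1) q(1)]
  show ?thesis
    unfolding p(2) q(2) H0_cmp[OF E F G p(1) q(1)] Hact_class[OF yX E F p(1) S] Hact_class[OF yX E G qp S]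
      Hact_class[OF yX F G q(1) act_Coh[OF E F p(1) S]]
    by (rule act_comp[OF E F G p(1) q(1) qp S])
qed

lemma Hact_id:
  assumes yX: "y \<in> zero_fibre Y w" and E: "is_mfact Y w E" and S: "S \<in> Coh y k E"
  shows "Hact y k E (idm HT E) S = S"
proof -
  interpret mf_point Y w y by (rule zero_fibre_point[OF yX])
  show ?thesis
    unfolding H0_simps Hact_class[OF yX E E Z0_id[OF E] S] by (rule act_id[OF E Z0_id[OF E] S])
qed

context
  fixes E F G u v
  assumes E: "is_mfact Y w E" and F: "is_mfact Y w F" and G: "is_mfact Y w G"
    and u: "u \<in> mor HT E F" and v: "v \<in> mor HT F G"
begin

lemma Hact_comp_image: "y \<in> zero_fibre Y w \<Longrightarrow>
  Hact y k G (cmp HT E F G v u) ` Coh y k E = Hact y k G v ` Hact y k F u ` Coh y k E"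
  by (auto simp: image_image Hact_comp[OF _ E F G u v])

lemma Hact_comp_inj: "y \<in> zero_fibre Y w \<Longrightarrow>
  inj_on (Hact y k G (cmp HT E F G v u)) (Coh y k E) \<longleftrightarrow> inj_on (Hact y k G v \<circ> Hact y k F u) (Coh y k E)"
  by (rule inj_on_cong) (simp add: Hact_comp[OF _ E F G u v])

lemma Hact_into: "y \<in> zero_fibre Y w \<Longrightarrow> Hact y k F u ` Coh y k E \<subseteq> Coh y k F"
  "y \<in> zero_fibre Y w \<Longrightarrow> Hact y k G v ` Coh y k F \<subseteq> Coh y k G"
  using Hact_Coh[OF _ E F u] Hact_Coh[OF _ F G v] by blast+

lemma coh_inj_comp:
  assumes "coh_inj Y w E F u" "coh_inj Y w F G v" shows "coh_inj Y w E G (cmp HT E F G v u)"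
  unfolding coh_inj_def
proof (intro ballI allI)
  fix y k assume yX: "y \<in> zero_fibre Y w"
  have "inj_on (Hact y k F u) (Coh y k E)" "inj_on (Hact y k G v) (Coh y k F)"
    using assms yX unfolding coh_inj_def by simp_all
  then show "inj_on (Hact y k G (cmp HT E F G v u)) (Coh y k E)"
    unfolding Hact_comp_inj[OF yX] using inj_on_subset[OF _ Hact_into(1)[OF yX]] by (intro comp_inj_on) auto
qed

lemma coh_surj_comp: "coh_surj Y w E F u \<Longrightarrow> coh_surj Y w F G v \<Longrightarrow> coh_surj Y w E G (cmp HT E F G v u)"
  unfolding coh_surj_def by (simp add: Hact_comp_image)

lemma coh_inj_compD:
  assumes "coh_inj Y w E G (cmp HT E F G v u)" shows "coh_inj Y w E F u"
  unfolding coh_inj_def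
proof (intro ballI allI)
  fix y k assume yX: "y \<in> zero_fibre Y w"
  have "inj_on (Hact y k G v \<circ> Hact y k F u) (Coh y k E)"
    using assms yX unfolding coh_inj_def by (simp add: Hact_comp_inj)
  then show "inj_on (Hact y k F u) (Coh y k E)" by (rule inj_on_imageI2)
qed

lemma coh_surj_compD:
  assumes "coh_surj Y w E G (cmp HT E F G v u)" shows "coh_surj Y w F G v"
  unfolding coh_surj_def
proof (intro ballI allI)
  fix y k assume yX: "y \<in> zero_fibre Y w"
  have "Hact y k G v ` Hact y k F u ` Coh y k E = Coh y k G"
    using assms yX unfolding coh_surj_def by (simp add: Hact_comp_image)
  then show "Hact y k G v ` Coh y k F = Coh y k G"
    using Hact_into[OF yX, of k] image_mono[of _ _ "Hact y k G v"] by (metis subset_antisym)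
qed

text \<open>With its dual below and the rules for composites above, this is two-out-of-three for
  bijections, split into halves.\<close>

lemma coh_inj_cancel:
  assumes "coh_inj Y w E G (cmp HT E F G v u)" "coh_surj Y w E F u" shows "coh_inj Y w F G v"
  unfolding coh_inj_def
proof (intro ballI allI)
  fix y k assume yX: "y \<in> zero_fibre Y w"
  have "inj_on (Hact y k G v \<circ> Hact y k F u) (Coh y k E)"
    using assms yX unfolding coh_inj_def by (simp add: Hact_comp_inj)
  then have "inj_on (Hact y k G v) (Hact y k F u ` Coh y k E)" by (rule inj_on_imageI)
  then show "inj_on (Hact y k G v) (Coh y k F)" using assms(2) yX unfolding coh_surj_def by simp
qed

lemma coh_surj_cancel:
  assumes "coh_surj Y w E G (cmp HT E F G v u)" "coh_inj Y w F G v" shows "coh_surj Y w E F u"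
  unfolding coh_surj_def
proof (intro ballI allI)
  fix y k assume yX: "y \<in> zero_fibre Y w"
  have "coh_surj Y w F G v" using assms(1) by (rule coh_surj_compD)
  then have "Hact y k G v ` Hact y k F u ` Coh y k E = Hact y k G v ` Coh y k F"
    using assms(1) yX unfolding coh_surj_def by (simp add: Hact_comp_image)
  moreover have "inj_on (Hact y k G v) (Coh y k F)" using assms(2) yX unfolding coh_inj_def by blast
  ultimately show "Hact y k F u ` Coh y k E = Coh y k F"
    using Hact_into(1)[OF yX] by (metis inj_on_image_eq_iff order_refl)
qed

end

definition coh_bij where "coh_bij E F u \<longleftrightarrow> coh_inj Y w E F u \<and> coh_surj Y w E F u"

lemma coh_bij_id: "is_mfact Y w E \<Longrightarrow> coh_bij E E (idm HT E)"
  unfolding coh_bij_def coh_inj_def coh_surj_def by (simp add: Hact_id inj_on_def)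

lemma coh_bij_iff: "coh_bij E F u \<longleftrightarrow> (\<forall>y\<in>zero_fibre Y w. \<forall>k. bij_betw (Hact y k F u) (Coh y k E) (Coh y k F))"
  unfolding coh_bij_def coh_inj_def coh_surj_def bij_betw_def by blast

lemma coh_bij_iso:
  assumes E: "is_mfact Y w E" and F: "is_mfact Y w F" and u: "is_iso HT E F u"
  shows "coh_bij E F u"
proof -
  obtain v where uv: "u \<in> mor HT E F" "v \<in> mor HT F E" "cmp HT E F E v u = idm HT E" "cmp HT F E F u v = idm HT F"
    using u unfolding is_iso_def by blast
  then show ?thesis
    using coh_bij_id[OF E] coh_bij_id[OF F] coh_inj_compD[OF E F E uv(1,2)] coh_surj_compD[OF F E F uv(2,1)]
    unfolding coh_bij_def by simp
qed

text \<open>Through this equivalence a statement about the cone, an object, becomes one about the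
  map, where composition and cancellation are available.\<close>

lemma coh_bij_class_iff:
  assumes E: "is_mfact Y w E" and F: "is_mfact Y w F" and p: "p \<in> Z0_hom Y E F"
  shows "coh_bij E F (H0_class Y E F p) \<longleftrightarrow> mf_cone E F p \<in> acyc_objs Y w"
proof -
  have "(\<forall>k. bij_betw (Hact y k F (H0_class Y E F p)) (Coh y k E) (Coh y k F)) \<longleftrightarrow> acyclic_at y (mf_cone E F p)"
    if yX: "y \<in> zero_fibre Y w" for y
  proof -
    interpret mf_point Y w y by (rule zero_fibre_point[OF yX])
    have "bij_betw (Hact y k F (H0_class Y E F p)) (Coh y k E) (Coh y k F) \<longleftrightarrow>
      bij_betw (act y k F p) (Coh y k E) (Coh y k F)" for k
      by (rule bij_betw_cong) (rule Hact_class[OF yX E F p])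
    then show ?thesis using cone_acyclic_iff[OF E F p] by simp
  qed
  then show ?thesis unfolding coh_bij_iff acyc_objs_def using mf_cone_mfact[OF E F p] by blast
qed

section \<open>Fibrewise exact objects as a thick subcategory\<close>

lemma acyc_objs_iff:
  assumes "is_mfact Y w E"
  shows "E \<in> acyc_objs Y w \<longleftrightarrow> (\<forall>y\<in>zero_fibre Y w. \<forall>k. \<exists>c. Coh y k E = {c})"
  unfolding acyc_objs_def using mf_point.acyclic_at_iff_Coh[OF zero_fibre_point assms] assms by auto

lemma coh_bij_acyc_iff:
  assumes E: "is_mfact Y w E" and F: "is_mfact Y w F" and u: "coh_bij E F u"
  shows "E \<in> acyc_objs Y w \<longleftrightarrow> F \<in> acyc_objs Y w"
proof -
  \<comment> \<open>Being a singleton is detected by cardinality, which a bijection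
    preserves.\<close>
  have "(\<exists>c. A = {c}) \<longleftrightarrow> (\<exists>c. B = {c})" if "bij_betw f A B" for A B and f :: "complex Matrix.vec set \<Rightarrow> complex Matrix.vec set"
    using bij_betw_same_card[OF that] by (metis card_1_singleton_iff One_nat_def)
  then show ?thesis unfolding acyc_objs_iff[OF E] acyc_objs_iff[OF F] using u unfolding coh_bij_iff by meson
qed

lemma coh_bij_trivial:
  assumes E: "E \<in> acyc_objs Y w" and F: "F \<in> acyc_objs Y w" and u: "u \<in> mor HT E F"
  shows "coh_bij E F u"
  unfolding coh_bij_iff
proof (intro ballI allI)
  fix y k assume yX: "y \<in> zero_fibre Y w"
  have mf: "is_mfact Y w E" "is_mfact Y w F" using E F unfolding acyc_objs_def by auto
  obtain c d where "Coh y k E = {c}" "Coh y k F = {d}"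
    using E F yX acyc_objs_iff[OF mf(1)] acyc_objs_iff[OF mf(2)] by meson
  moreover have "Hact y k F u c \<in> Coh y k F" by (rule Hact_Coh[OF yX mf u]) (simp add: \<open>Coh y k E = {c}\<close>)
  ultimately show "bij_betw (Hact y k F u) (Coh y k E) (Coh y k F)" by (simp add: bij_betw_def)
qed

text \<open>Isomorphisms act bijectively on cohomology, so the square \<open>b u = p a\<close> makes
  \<open>u\<close> and \<open>p\<close> bijective at the same time, and \<open>C\<close> may be
  replaced by the cone of \<open>p\<close>, where \<open>coh_bij_class_iff\<close> applies.\<close>

lemma tri_acyc_iff:
  assumes t: "(A, B, C, u, v, x) \<in> tri HT"
  shows "coh_bij A B u \<longleftrightarrow> C \<in> acyc_objs Y w"
proof -
  obtain E F p a b c where A: "is_mfact Y w A" "is_mfact Y w B" "is_mfact Y w C" and u: "u \<in> mor HT A B"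
    and E: "is_mfact Y w E" "is_mfact Y w F" "p \<in> Z0_hom Y E F"
    and iso: "is_iso HT A E a" "is_iso HT B F b" "is_iso HT C (mf_cone E F p) c"
    and eq: "cmp HT A B F b u = cmp HT A E F (H0_class Y E F p) a"
    using t by (rule H0_triE) (rule that; assumption)
  have a: "coh_bij A E a" and b: "coh_bij B F b" and c: "coh_bij C (mf_cone E F p) c"
    using coh_bij_iso A E iso mf_cone_mfact[OF E] by blast+
  have m: "a \<in> mor HT A E" "b \<in> mor HT B F" "H0_class Y E F p \<in> mor HT E F"
    using iso E(3) unfolding is_iso_def H0_simps(2) by auto
  have "coh_bij A B u \<longleftrightarrow> coh_bij A F (cmp HT A B F b u)"
    using b coh_inj_comp[OF A(1,2) E(2) u m(2)] coh_surj_comp[OF A(1,2) E(2) u m(2)]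
      coh_inj_compD[OF A(1,2) E(2) u m(2)] coh_surj_cancel[OF A(1,2) E(2) u m(2)] unfolding coh_bij_def by blast
  also have "\<dots> \<longleftrightarrow> coh_bij E F (H0_class Y E F p)"
    unfolding eq
    using a coh_inj_comp[OF A(1) E(1,2) m(1,3)] coh_surj_comp[OF A(1) E(1,2) m(1,3)]
      coh_inj_cancel[OF A(1) E(1,2) m(1,3)] coh_surj_compD[OF A(1) E(1,2) m(1,3)] unfolding coh_bij_def by blast
  also have "\<dots> \<longleftrightarrow> C \<in> acyc_objs Y w"
    unfolding coh_bij_class_iff[OF E] using coh_bij_acyc_iff[OF A(3) mf_cone_mfact[OF E] c] by simp
  finally show ?thesis .
qed

text \<open>On a zero object the identity and the zero map have the same homotopy class, so every
  cohomology class equals that of 0.\<close>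

lemma acyc_zero_object:
  assumes Z: "zero_object HT Z" shows "Z \<in> acyc_objs Y w"
proof -
  have mf: "is_mfact Y w Z" using Z unfolding zero_object_def by simp
  have eq: "H0_class Y Z Z (mf_id Z) = H0_class Y Z Z (mf_zero Z Z)"
  proof -
    have zo: "\<forall>A\<in>ob HT. (\<exists>!f. f \<in> mor HT A Z) \<and> (\<exists>!f. f \<in> mor HT Z A)" using Z unfolding zero_object_def by (rule conjunct2)
    have "Z \<in> ob HT" using mf by simp
    have "\<exists>!f. f \<in> mor HT Z Z" by (rule conjunct1[OF bspec[OF zo \<open>Z \<in> ob HT\<close>]])
    moreover have "H0_class Y Z Z (mf_id Z) \<in> mor HT Z Z" "H0_class Y Z Z (mf_zero Z Z) \<in> mor HT Z Z"
      using Z0_id[OF mf] Z0_zero[OF mf mf] unfolding H0_simps(2) by auto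
    ultimately show ?thesis by blast
  qed
  show ?thesis
    unfolding acyc_objs_iff[OF mf]
  proof (intro ballI allI)
    fix y k assume yX: "y \<in> zero_fibre Y w"
    interpret mf_point Y w y by (rule zero_fibre_point[OF yX])
    have "S = cls y k Z (0\<^sub>v (rk (mfE k Z) y))" if S: "S \<in> Coh y k Z" for S
    proof -
      obtain x where x: "x \<in> cyc y k Z" "S = cls y k Z x" using cls_ex[OF mf S] by blast
      have "S = Hact y k Z (H0_class Y Z Z (mf_id Z)) S" using Hact_id[OF yX mf S] unfolding H0_simps(3) by simp
      also have "\<dots> = act y k Z (mf_zero Z Z) S"
        unfolding eq by (rule Hact_class[OF yX mf mf Z0_zero[OF mf mf] S])
      also have "\<dots> = cls y k Z (mfmap k (mf_zero Z Z) y *\<^sub>v x)"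
        unfolding x(2) by (rule act_cls[OF mf mf Z0_zero[OF mf mf] x(1)])
      also have "\<dots> = cls y k Z (0\<^sub>v (rk (mfE k Z) y))"
        unfolding mfmap_zero using zero_mat_mult_vec[OF cyc_carrier[OF mf x(1)]] by simp
      finally show ?thesis .
    qed
    then show "\<exists>c. Coh y k Z = {c}" using cls_Coh[OF mf cyc_zero[OF mf]] by blast
  qed
qed

text \<open>The sign of the shifted maps changes neither kernels nor images, and the degree moves by
  one.\<close>

lemma acyclic_at_shift:
  assumes yX: "y \<in> zero_fibre Y w" and E: "is_mfact Y w E"
  shows "acyclic_at y (mf_shift E) \<longleftrightarrow> acyclic_at y E"
proof -
  interpret mf_point Y w y by (rule zero_fibre_point[OF yX])
  note S = mf_shift_mfact[OF E]
  have mc: "mfphi k E y \<in> carrier_mat (rk (mfE (k + 1) E) y) (rk (mfE k E) y)" for k by (rule mat[OF E])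
  have neg: "mfphi k (mf_shift E) y *\<^sub>v v = - (mfphi (k + 1) E y *\<^sub>v v)"
    if "v \<in> carrier_vec (rk (mfE (k + 1) E) y)" for k v
    using mc[of "k + 1"] that by (simp add: mfphi_shift)
  have un: "- v = 0\<^sub>v n \<longleftrightarrow> v = 0\<^sub>v n" for v :: "complex Matrix.vec" and n
    by (metis uminus_uminus_vec uminus_zero_vec)
  have cyc: "cyc y k (mf_shift E) = cyc y (k + 1) E" for k
    unfolding cyc_def mfE_shift using neg un by (intro Collect_cong conj_cong) auto
  have bnd: "bnd y k (mf_shift E) = bnd y (k + 1) E" for k
  proof -
    have *: "(\<lambda>z. - (M *\<^sub>v z)) ` carrier_vec n = (\<lambda>z. M *\<^sub>v z) ` carrier_vec n"
      if M: "M \<in> carrier_mat m n" for M :: "complex mat" and m n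
    proof (intro equalityI image_subsetI)
      fix z :: "complex Matrix.vec" assume z: "z \<in> carrier_vec n"
      have "- (M *\<^sub>v z) = M *\<^sub>v (- z)" "M *\<^sub>v z = - (M *\<^sub>v (- z))"
        using mult_mat_uminus_vec[OF M z] by simp_all
      then show "- (M *\<^sub>v z) \<in> (\<lambda>z. M *\<^sub>v z) ` carrier_vec n" "M *\<^sub>v z \<in> (\<lambda>z. - (M *\<^sub>v z)) ` carrier_vec n"
        using z by (simp_all add: image_iff) (metis uminus_carrier_vec)+
    qed
    have "(\<lambda>z. mfphi (k + 1) (mf_shift E) y *\<^sub>v z) ` carrier_vec (rk (mfE (k + 1 + 1) E) y)
        = (\<lambda>z. - (mfphi (k + 1 + 1) E y *\<^sub>v z)) ` carrier_vec (rk (mfE (k + 1 + 1) E) y)"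
      by (rule image_cong[OF refl neg])
    then show ?thesis unfolding bnd_def mfE_shift using *[OF mc[of "k + 1 + 1"]] by simp
  qed
  have "(\<forall>k. cyc y (k + 1) E \<subseteq> bnd y (k + 1) E) \<longleftrightarrow> (\<forall>k. cyc y k E \<subseteq> bnd y k E)"
    by (metis diff_add_cancel)
  then show ?thesis unfolding acyclic_at_iff[OF E] acyclic_at_iff[OF S] cyc bnd .
qed

lemma acyc_objs_shift:
  assumes E: "is_mfact Y w E" shows "mf_shift E \<in> acyc_objs Y w \<longleftrightarrow> E \<in> acyc_objs Y w"
  unfolding acyc_objs_def using acyclic_at_shift[OF _ E] E mf_shift_mfact[OF E] by auto

text \<open>The coproduct property for the identity of \<open>A\<close> and the zero map from
  \<open>A'\<close> provides a retraction \<open>h\<close> of \<open>i\<close>. Each class of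
  \<open>A\<close> is therefore the image under \<open>h\<close> of the single class of
  \<open>B\<close>.\<close>

lemma acyc_summand:
  assumes A: "is_mfact Y w A" and A': "is_mfact Y w A'" and B: "B \<in> acyc_objs Y w" and i: "is_coproduct HT A A' B i j"
  shows "A \<in> acyc_objs Y w"
proof -
  have mfB: "is_mfact Y w B" using B unfolding acyc_objs_def by simp
  have im: "i \<in> mor HT A B" using i unfolding is_coproduct_def by blast
  have id: "idm HT A \<in> mor HT A A" by (rule H0_id_mor[OF A])
  have z: "H0_class Y A' A (mf_zero A' A) \<in> mor HT A' A" using Z0_zero[OF A' A] unfolding H0_simps(2) by simp
  have univ: "\<forall>Z\<in>ob HT. \<forall>f\<in>mor HT A Z. \<forall>g\<in>mor HT A' Z. \<exists>!h. h \<in> mor HT B Z \<and> cmp HT A B Z h i = f \<and> cmp HT A' B Z h j = g"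
    using i unfolding is_coproduct_def by (elim conjE)
  have "A \<in> ob HT" using A by simp
  from bspec[OF bspec[OF bspec[OF univ this] id] z]
  have "\<exists>h. h \<in> mor HT B A \<and> cmp HT A B A h i = idm HT A" by (elim ex1E) blast
  then obtain h where h: "h \<in> mor HT B A" "cmp HT A B A h i = idm HT A" by blast
  show ?thesis
    unfolding acyc_objs_iff[OF A]
  proof (intro ballI allI)
    fix y k assume yX: "y \<in> zero_fibre Y w"
    interpret mf_point Y w y by (rule zero_fibre_point[OF yX])
    obtain c where c: "Coh y k B = {c}" using B yX unfolding acyc_objs_iff[OF mfB] by blast
    have "S = Hact y k A h c" if S: "S \<in> Coh y k A" for S
    proof -
      have "S = Hact y k A h (Hact y k B i S)"
        using Hact_id[OF yX A S] Hact_comp[OF yX A mfB A im h(1) S] h(2) by simp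
      moreover have "Hact y k B i S = c" using Hact_Coh[OF yX A mfB im S] c by simp
      ultimately show ?thesis by simp
    qed
    then show "\<exists>c. Coh y k A = {c}" using cls_Coh[OF A cyc_zero[OF A]] by blast
  qed
qed

text \<open>\<open>Acyc\<close> is the intersection of the thick sets that contain the
  totalizations, so one such set bounds it from above. The closure under triangles comes from
  \<open>tri_acyc_iff\<close>: \<open>C\<close> is fibrewise exact iff \<open>u\<close> is
  bijective, and a bijection makes \<open>A\<close> and \<open>B\<close> fibrewise exact
  together.\<close>

lemma thick_acyc_objs: "thick HT (acyc_objs Y w)"
  unfolding thick_def
proof (intro conjI allI ballI impI)
  show "acyc_objs Y w \<subseteq> ob HT" by (auto simp: acyc_objs_def)
  show "Z \<in> acyc_objs Y w" if "zero_object HT Z" for Z by (rule acyc_zero_object[OF that])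
  show "sh_ob HT A \<in> acyc_objs Y w \<longleftrightarrow> A \<in> acyc_objs Y w" if "A \<in> ob HT" for A
    using acyc_objs_shift that by simp
  fix A B C u v x assume t: "(A, B, C, u, v, x) \<in> tri HT"
  have A: "is_mfact Y w A" by (rule H0_triE[OF t])
  have B: "is_mfact Y w B" by (rule H0_triE[OF t])
  have u: "u \<in> mor HT A B" by (rule H0_triE[OF t])
  note mf = A B
  show "C \<in> acyc_objs Y w" if "A \<in> acyc_objs Y w \<and> B \<in> acyc_objs Y w"
    using coh_bij_trivial[of A B, OF _ _ u] that tri_acyc_iff[OF t] by blast
  show "B \<in> acyc_objs Y w" if "A \<in> acyc_objs Y w \<and> C \<in> acyc_objs Y w"
    using coh_bij_acyc_iff[OF mf] that tri_acyc_iff[OF t] by blast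
  show "A \<in> acyc_objs Y w" if "B \<in> acyc_objs Y w \<and> C \<in> acyc_objs Y w"
    using coh_bij_acyc_iff[OF mf] that tri_acyc_iff[OF t] by blast
next
  fix A A' B i j assume "A \<in> ob HT" "A' \<in> ob HT" "B \<in> acyc_objs Y w" "is_coproduct HT A A' B i j"
  then show "A \<in> acyc_objs Y w" by (intro acyc_summand[of A A' B i j]) (simp_all only: H0_simps mem_Collect_eq)
qed

text \<open>Exactness of sheaves becomes exactness in the fibre by \<open>fibre_exact\<close>, and
  the totalization inherits it.\<close>

lemma totalization_acyc:
  assumes "bounded_exact_complex Y w a l Em dm" shows "totalization a l Em dm \<in> acyc_objs Y w"
proof -
  interpret exact_mf_complex Y w Em dm a l by (rule exact_mf_complexI[OF assms])
  have "acyclic_at y (totalization a l Em dm)" if yX: "y \<in> zero_fibre Y w" for y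
  proof -
    have y': "y \<in> Y" "w y = 0" using yX by (auto simp: zero_fibre_def)
    show ?thesis by (rule acyclic_at_totalization[OF y' fibre_exact[OF y'(1)] bdd[OF _ y'(1)]])
  qed
  then show ?thesis unfolding acyc_objs_def using totalization_mfact by blast
qed

lemma Acyc_subset: "Acyc Y w \<subseteq> acyc_objs Y w"
  unfolding Acyc_def thick_closure_def using thick_acyc_objs totalization_acyc by blast

lemma zero_object_Acyc: "zero_object HT Z \<Longrightarrow> Z \<in> Acyc Y w"
  unfolding Acyc_def thick_closure_def thick_def by blast

text \<open>This makes the denominators of roofs invisible to cohomology: a cone in
  \<open>Acyc\<close> is fibrewise exact.\<close>

lemma cone_in_coh_bij: "cone_in HT (Acyc Y w) G A s \<Longrightarrow> coh_bij G A s"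
  unfolding cone_in_def using tri_acyc_iff Acyc_subset by blast

text \<open>The cone of an identity is a zero object, and every thick set contains the zero
  objects.\<close>

lemma cone_in_id:
  assumes A: "is_mfact Y w A" shows "cone_in HT (Acyc Y w) A A (idm HT A)"
  unfolding cone_in_def
  using zero_object_Acyc[OF zero_object_cone_id[OF A]] H0_standard_triangle[OF A A Z0_id[OF A]] unfolding H0_simps by blast

section \<open>Isomorphisms in the Verdier quotient\<close>

private abbreviation "N \<equiv> Acyc Y w"

lemma MF_simps:
  "ob (MF Y w) = {E. is_mfact Y w E}" "mor (MF Y w) A B = roof_class HT N A B ` roofs HT N A B"
  "idm (MF Y w) A = roof_class HT N A A (A, idm HT A, idm HT A)" "cmp (MF Y w) = roof_comp HT N"
  by (simp_all add: MF_def verdier_quotient_def verdier_base_def)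

lemma roofsD:
  assumes "(G, s, f) \<in> roofs HT N A B"
  shows "is_mfact Y w G" "s \<in> mor HT G A" "coh_bij G A s" "f \<in> mor HT G B"
  using assms cone_in_coh_bij unfolding roofs_def by auto

text \<open>The denominators \<open>s\<close>, \<open>s'\<close> and the denominator of the common
  roof \<open>H\<close> act bijectively, hence so do \<open>u\<close> and \<open>u'\<close>; the
  numerators therefore share injectivity and surjectivity with the common composite out of
  \<open>H\<close>.\<close>

lemma roof_eq_coh:
  assumes A: "is_mfact Y w A" and B: "is_mfact Y w B"
    and r: "(G, s, f) \<in> roofs HT N A B" and r': "(G', s', f') \<in> roofs HT N A B"
    and eq: "roof_eq HT N A B (G, s, f) (G', s', f')"
  shows "coh_inj Y w G B f \<longleftrightarrow> coh_inj Y w G' B f'" "coh_surj Y w G B f \<longleftrightarrow> coh_surj Y w G' B f'"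
proof -
  note R = roofsD[OF r] and R' = roofsD[OF r']
  obtain H u u' where H: "is_mfact Y w H" and u: "u \<in> mor HT H G" and u': "u' \<in> mor HT H G'"
    and su: "cmp HT H G A s u = cmp HT H G' A s' u'" and fu: "cmp HT H G B f u = cmp HT H G' B f' u'"
    and c: "coh_bij H A (cmp HT H G A s u)"
    using eq cone_in_coh_bij by auto
  have bu: "coh_bij H G u"
    using c R(3) coh_inj_compD[OF H R(1) A u R(2)] coh_surj_cancel[OF H R(1) A u R(2)] unfolding coh_bij_def by blast
  have bu': "coh_bij H G' u'"
    using c[unfolded su] R'(3) coh_inj_compD[OF H R'(1) A u' R'(2)] coh_surj_cancel[OF H R'(1) A u' R'(2)]
    unfolding coh_bij_def by blast
  have "coh_inj Y w G B f \<longleftrightarrow> coh_inj Y w H B (cmp HT H G B f u)" "coh_surj Y w G B f \<longleftrightarrow> coh_surj Y w H B (cmp HT H G B f u)"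
    using bu coh_inj_comp[OF H R(1) B u R(4)] coh_inj_cancel[OF H R(1) B u R(4)]
      coh_surj_comp[OF H R(1) B u R(4)] coh_surj_compD[OF H R(1) B u R(4)] unfolding coh_bij_def by blast+
  moreover have "coh_inj Y w G' B f' \<longleftrightarrow> coh_inj Y w H B (cmp HT H G' B f' u')"
     "coh_surj Y w G' B f' \<longleftrightarrow> coh_surj Y w H B (cmp HT H G' B f' u')"
    using bu' coh_inj_comp[OF H R'(1) B u' R'(4)] coh_inj_cancel[OF H R'(1) B u' R'(4)]
      coh_surj_comp[OF H R'(1) B u' R'(4)] coh_surj_compD[OF H R'(1) B u' R'(4)] unfolding coh_bij_def by blast+
  ultimately show "coh_inj Y w G B f \<longleftrightarrow> coh_inj Y w G' B f'" "coh_surj Y w G B f \<longleftrightarrow> coh_surj Y w G' B f'"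
    unfolding fu by simp_all
qed

lemma roof_id:
  assumes A: "is_mfact Y w A"
  shows "(A, idm HT A, idm HT A) \<in> idm (MF Y w) A"
proof -
  note id = H0_id_mor[OF A]
  have r: "(A, idm HT A, idm HT A) \<in> roofs HT N A A"
    unfolding roofs_def using A id cone_in_id[OF A] by simp
  moreover have "roof_eq HT N A A (A, idm HT A, idm HT A) (A, idm HT A, idm HT A)"
    unfolding roof_eq.simps
  proof (intro bexI conjI)
    show "cone_in HT N A A (cmp HT A A A (idm HT A) (idm HT A))"
      unfolding H0_cmp_id_left[OF A A id] by (rule cone_in_id[OF A])
  qed (use A id in simp_all)
  ultimately show ?thesis unfolding MF_simps roof_class_def by blast
qed

text \<open>The identity roof lies in the union that defines the composite, so one completed square
  over \<open>H\<close> represents the identity. There \<open>g f'\<close> is bijective, which makes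
  \<open>g\<close> surjective and \<open>f'\<close> injective; the equation
  \<open>f t' = t f'\<close> with bijective \<open>t\<close> and \<open>t'\<close> passes
  injectivity on to \<open>f\<close>.\<close>

lemma roof_comp_id_coh:
  assumes A: "is_mfact Y w A" and B: "is_mfact Y w B"
    and L: "L \<in> mor (MF Y w) A B" and M: "M \<in> mor (MF Y w) B A"
    and eq: "cmp (MF Y w) A B A M L = idm (MF Y w) A"
  shows "\<exists>(G, s, f)\<in>L. coh_inj Y w G B f" "\<exists>(G', t, g)\<in>M. coh_surj Y w G' A g"
proof -
  have Lr: "L \<subseteq> roofs HT N A B" and Mr: "M \<subseteq> roofs HT N B A"
    using L M unfolding MF_simps roof_class_def by auto
  have "(A, idm HT A, idm HT A) \<in> roof_comp HT N A B A M L" using roof_id[OF A] eq unfolding MF_simps by simp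
  then obtain G s f G' t g H t' f' where r: "(G, s, f) \<in> L" and r': "(G', t, g) \<in> M" and H: "is_mfact Y w H"
    and t': "t' \<in> mor HT H G" "cone_in HT N H G t'" and f': "f' \<in> mor HT H G'"
    and sq: "cmp HT H G B f t' = cmp HT H G' B t f'"
    and cl: "(A, idm HT A, idm HT A) \<in> roof_class HT N A A (H, cmp HT H G A s t', cmp HT H G' A g f')"
    unfolding roof_comp_def by auto
  have rr: "(G, s, f) \<in> roofs HT N A B" "(G', t, g) \<in> roofs HT N B A" using r r' Lr Mr by auto
  note R = roofsD[OF rr(1)] and R' = roofsD[OF rr(2)]
  have bt': "coh_bij H G t'" by (rule cone_in_coh_bij[OF t'(2)])
  note st = H0_cmp_mor[OF H R(1) A t'(1) R(2)] and gf = H0_cmp_mor[OF H R'(1) A f' R'(4)]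
  have "roof_eq HT N A A (H, cmp HT H G A s t', cmp HT H G' A g f') (A, idm HT A, idm HT A)"
    using cl unfolding roof_class_def by blast
  then obtain K u u' where K: "is_mfact Y w K" and u: "u \<in> mor HT K H" and u': "u' \<in> mor HT K A"
    and e1: "cmp HT K H A (cmp HT H G A s t') u = cmp HT K A A (idm HT A) u'"
    and e2: "cmp HT K H A (cmp HT H G' A g f') u = cmp HT K A A (idm HT A) u'"
    and c: "coh_bij K A (cmp HT K H A (cmp HT H G A s t') u)"
    using cone_in_coh_bij by auto
  have bst: "coh_bij H A (cmp HT H G A s t')"
    using bt' R(3) coh_inj_comp[OF H R(1) A t'(1) R(2)] coh_surj_comp[OF H R(1) A t'(1) R(2)] unfolding coh_bij_def by blast
  have bu: "coh_bij K H u"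
    using c bst coh_inj_compD[OF K H A u st] coh_surj_cancel[OF K H A u st] unfolding coh_bij_def by blast
  have bgf: "coh_bij H A (cmp HT H G' A g f')"
    using c bu coh_inj_cancel[OF K H A u gf] coh_surj_compD[OF K H A u gf] unfolding e1 e2[symmetric] coh_bij_def by blast
  have "coh_surj Y w G' A g" using bgf coh_surj_compD[OF H R'(1) A f' R'(4)] unfolding coh_bij_def by blast
  then show "\<exists>(G', t, g)\<in>M. coh_surj Y w G' A g" using r' by blast
  have "coh_inj Y w H G' f'" using bgf coh_inj_compD[OF H R'(1) A f' R'(4)] unfolding coh_bij_def by blast
  then have "coh_inj Y w H B (cmp HT H G' B t f')"
    using R'(3) coh_inj_comp[OF H R'(1) B f' R'(2)] unfolding coh_bij_def by blast
  then have "coh_inj Y w G B f"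
    using bt' coh_inj_cancel[OF H R(1) B t'(1) R(4)] unfolding sq[symmetric] coh_bij_def by blast
  then show "\<exists>(G, s, f)\<in>L. coh_inj Y w G B f" using r by blast
qed

text \<open>One equation gives a roof of \<open>L\<close> with injective numerator, the other a roof
  of \<open>L\<close> with surjective numerator. They may differ, but both represent
  \<open>L\<close>, and \<open>roof_eq_coh\<close> carries surjectivity over to the first.\<close>

lemma MF_iso_roof:
  assumes A: "is_mfact Y w A" and B: "is_mfact Y w B" and L: "is_iso (MF Y w) A B L"
  shows "\<exists>G s f. is_mfact Y w G \<and> s \<in> mor HT G A \<and> f \<in> mor HT G B \<and> coh_bij G A s \<and> coh_bij G B f"
proof -
  obtain M where LM: "L \<in> mor (MF Y w) A B" "M \<in> mor (MF Y w) B A"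
    "cmp (MF Y w) A B A M L = idm (MF Y w) A" "cmp (MF Y w) B A B L M = idm (MF Y w) B"
    using L unfolding is_iso_def by blast
  obtain G s f where r: "(G, s, f) \<in> L" and i: "coh_inj Y w G B f" using roof_comp_id_coh(1)[OF A B LM(1-3)] by blast
  obtain G' s' f' where r': "(G', s', f') \<in> L" and su: "coh_surj Y w G' B f'"
    using roof_comp_id_coh(2)[OF B A LM(2,1,4)] by blast
  obtain G0 s0 f0 where r0: "(G0, s0, f0) \<in> roofs HT N A B" and L0: "L = roof_class HT N A B (G0, s0, f0)"
    using LM(1) unfolding MF_simps by auto
  have rr: "(G, s, f) \<in> roofs HT N A B" "roof_eq HT N A B (G0, s0, f0) (G, s, f)"
    "(G', s', f') \<in> roofs HT N A B" "roof_eq HT N A B (G0, s0, f0) (G', s', f')"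
    using r r' unfolding L0 roof_class_def by blast+
  have "coh_surj Y w G B f"
    using su roof_eq_coh(2)[OF A B r0 rr(1,2)] roof_eq_coh(2)[OF A B r0 rr(3,4)] by simp
  then have "coh_bij G B f" using i unfolding coh_bij_def by blast
  then show ?thesis using roofsD[OF rr(1)] by blast
qed

text \<open>A relation of the Grothendieck group sees only the objects of a triangle, so the
  isomorphism of triangles is kept as three isomorphisms of objects.\<close>

lemma MF_triE:
  assumes "(A, B, C, u, v, x) \<in> tri (MF Y w)"
  obtains A' B' C' u' v' x' a b c where "is_mfact Y w A" "is_mfact Y w B" "is_mfact Y w C"
    "(A', B', C', u', v', x') \<in> tri HT"
    "is_iso (MF Y w) A A' a" "is_iso (MF Y w) B B' b" "is_iso (MF Y w) C C' c"
proof -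
  have iso: "is_iso (verdier_base HT N) = is_iso (MF Y w)"
    unfolding MF_def verdier_quotient_def by (auto simp: fun_eq_iff is_iso_def)
  have "(A, B, C, u, v, x) \<in> candidate_triangles (verdier_base HT N)"
    using assms unfolding MF_def verdier_quotient_def by simp
  then have m: "is_mfact Y w A" "is_mfact Y w B" "is_mfact Y w C"
    unfolding candidate_triangles_def verdier_base_def by auto
  obtain A' B' C' u' v' x' where t: "(A', B', C', u', v', x') \<in> tri HT"
    "tri_iso (verdier_base HT N) (A, B, C, u, v, x) (A', B', C', verdier_image HT N A' B' u', verdier_image HT N B' C' v',
       verdier_image HT N C' (sh_ob HT A') x')"
    using assms unfolding MF_def verdier_quotient_def with_triangles_simps by blast
  then show ?thesis using that[OF m t(1)] unfolding tri_iso.simps iso by blast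
qed

end

section \<open>Partitions of unity on subsets of projective space\<close>

text \<open>A line is determined by the orthogonal projection onto it; this embeds projective space
  into a Euclidean space and makes its subsets paracompact.\<close>

definition line_projection :: "complex^'n::finite \<Rightarrow> complex^'n^'n" where
  "line_projection v = (\<chi> i j. vec_nth v i * cnj (vec_nth v j) / of_real ((norm v)\<^sup>2))"

definition cproj_emb :: "'n::finite cproj \<Rightarrow> complex^'n^'n" where
  "cproj_emb p = line_projection (SOME v. v \<noteq> 0 \<and> proj v = p)"

lemma norm_vector_smult_complex: "norm (c *s v) = cmod c * norm (v :: complex^'n::finite)"
proof -
  have "L2_set (\<lambda>i. norm (vec_nth (c *s v) i)) UNIV = L2_set (\<lambda>i. cmod c * norm (vec_nth v i)) UNIV"
    by (simp add: norm_mult)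
  also have "\<dots> = cmod c * L2_set (\<lambda>i. norm (vec_nth v i)) UNIV"
    using L2_set_right_distrib[of "cmod c" "\<lambda>i. norm (vec_nth v i)" UNIV] by simp
  finally show ?thesis unfolding norm_vec_def .
qed

lemma line_projection_scale:
  assumes "c \<noteq> 0" shows "line_projection (c *s v) = line_projection v"
proof -
  have "c * vec_nth v i * (cnj c * cnj (vec_nth v j)) / of_real ((cmod c * norm v)\<^sup>2)
      = vec_nth v i * cnj (vec_nth v j) / of_real ((norm v)\<^sup>2)" for i j
  proof -
    have "c * cnj c = of_real ((cmod c)\<^sup>2)" by (metis complex_norm_square of_real_power)
    then have "c * vec_nth v i * (cnj c * cnj (vec_nth v j)) = of_real ((cmod c)\<^sup>2) * (vec_nth v i * cnj (vec_nth v j))"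
      by (simp add: algebra_simps)
    then show ?thesis unfolding power_mult_distrib of_real_mult
      by (simp only:) (rule mult_divide_mult_cancel_left, use assms in simp)
  qed
  then show ?thesis unfolding line_projection_def norm_vector_smult_complex by (simp add: Finite_Cartesian_Product.vec_eq_iff)
qed

lemma cproj_emb_proj: "v \<noteq> 0 \<Longrightarrow> cproj_emb (proj v) = line_projection v"
proof -
  assume v: "v \<noteq> 0"
  let ?u = "SOME u. u \<noteq> 0 \<and> proj u = proj v"
  have "?u \<noteq> 0 \<and> proj ?u = proj v" by (rule someI[of _ v]) (simp add: v)
  then obtain c where "c \<noteq> 0" "v = c *s ?u" using proj_eq_iff[of ?u v] v by auto
  then have "line_projection v = line_projection ?u" using line_projection_scale[of c ?u] by simp
  then show ?thesis unfolding cproj_emb_def by simp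
qed

lemma continuous_cproj_emb: "continuous_on A (cproj_emb :: 'n::finite cproj \<Rightarrow> _)"
proof -
  have "continuous_on (UNIV :: 'n cproj set) cproj_emb"
  proof (rule continuous_on_cproj_iff)
    fix v0 :: "complex^'n" assume "v0 \<noteq> 0" "proj v0 \<in> UNIV"
    have "continuous_on (- {0 :: complex^'n}) line_projection"
      unfolding line_projection_def by (intro continuous_intros continuous_on_vec_lambda) auto
    then show "\<exists>U F. open U \<and> v0 \<in> U \<and> 0 \<notin> U \<and> continuous_on U F \<and> (\<forall>v\<in>U. proj v \<in> UNIV \<longrightarrow> cproj_emb (proj v) = F v)"
      using \<open>v0 \<noteq> 0\<close> by (intro exI[of _ "- {0}"] exI[of _ line_projection]) (auto simp: cproj_emb_proj)
  qed
  then show ?thesis by (rule continuous_on_subset) simp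
qed

lemma inj_cproj_emb: "inj cproj_emb"
proof (rule injI)
  fix p q :: "'a cproj" assume eq: "cproj_emb p = cproj_emb q"
  obtain v u where v: "v \<noteq> 0" "proj v = p" and u: "u \<noteq> 0" "proj u = q" by (metis proj_surj)
  have "line_projection v = line_projection u" using eq cproj_emb_proj v u by metis
  then have ij: "vec_nth v i * cnj (vec_nth v j) / of_real ((norm v)\<^sup>2) = vec_nth u i * cnj (vec_nth u j) / of_real ((norm u)\<^sup>2)" for i j
  proof -
    from arg_cong[OF \<open>line_projection v = line_projection u\<close>, of "\<lambda>M. vec_nth (vec_nth M i) j"]
    show ?thesis unfolding line_projection_def by simp
  qed
  obtain j where j: "vec_nth u j \<noteq> 0" using u(1) by (auto simp: Finite_Cartesian_Product.vec_eq_iff)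
  \<comment> \<open>Column \<open>j\<close> of the common projection matrix is a multiple both of
    \<open>u\<close> and of \<open>v\<close>; \<open>c\<close> is the ratio of the two factors, with
    \<open>j\<close> chosen such that the factor of \<open>u\<close> is nonzero.\<close>
  define c where "c = cnj (vec_nth v j) * of_real ((norm u)\<^sup>2) / (of_real ((norm v)\<^sup>2) * cnj (vec_nth u j))"
  have "vec_nth u i = c * vec_nth v i" for i
    using ij[of i j] j u(1) v(1) unfolding c_def by (simp add: field_simps)
  then have uc: "u = c *s v" by (simp add: Finite_Cartesian_Product.vec_eq_iff)
  then have "c \<noteq> 0" using u(1) by auto
  then show "p = q" using uc proj_eq_iff[OF v(1) u(1)] v u by auto
qed

lemma continuous_proj: "continuous_on (- {0}) (proj :: complex^'n::finite \<Rightarrow> _)"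
proof -
  have "open (proj -` B \<inter> - {0 :: complex^'n})" if "open B" for B :: "'n cproj set"
  proof -
    have "proj -` B \<inter> - {0 :: complex^'n} = {v. v \<noteq> 0 \<and> proj v \<in> B}" by auto
    then show ?thesis using that by (simp add: open_cproj_def)
  qed
  then show ?thesis by (subst continuous_on_open_vimage) auto
qed

text \<open>Every line contains a unit vector. Compactness turns the injective continuous map
  \<open>cproj_emb\<close> into a homeomorphism onto its image.\<close>

lemma compact_cproj: "compact (UNIV :: 'n::finite cproj set)"
proof -
  have "p \<in> proj ` sphere (0 :: complex^'n) 1" for p :: "'n cproj"
  proof -
    obtain v where v: "v \<noteq> 0" "proj v = p" by (rule proj_surj)
    let ?c = "of_real (inverse (norm v)) :: complex"
    have "?c \<noteq> 0" using v by simp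
    moreover have "norm (?c *s v) = 1" using v by (simp add: norm_vector_smult_complex norm_inverse)
    moreover from this have "?c *s v \<noteq> 0" by auto
    ultimately have "proj (?c *s v) = p" using proj_eq_iff[OF v(1), of "?c *s v"] v(2) by metis
    then show ?thesis using \<open>norm (?c *s v) = 1\<close> by (intro image_eqI[of _ _ "?c *s v"]) auto
  qed
  then have "UNIV = proj ` sphere (0 :: complex^'n) 1" by auto
  moreover have "compact (proj ` sphere (0 :: complex^'n) 1)"
    by (intro compact_continuous_image continuous_on_subset[OF continuous_proj] compact_sphere) auto
  ultimately show ?thesis by simp
qed

lemma openin_local_continuous:
  assumes "\<And>y. y \<in> B \<Longrightarrow> \<exists>N. openin (top_of_set B) N \<and> y \<in> N \<and> continuous_on N f"
  shows "continuous_on B f"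
  unfolding continuous_on_topological
proof (intro ballI allI impI)
  fix y T assume y: "y \<in> B" "open T" "f y \<in> T"
  obtain N where N: "openin (top_of_set B) N" "y \<in> N" "continuous_on N f" using assms y by blast
  obtain O' where O': "open O'" "N = B \<inter> O'" using N(1) unfolding openin_open by blast
  obtain A where "open A" "y \<in> A" "\<forall>z\<in>N. z \<in> A \<longrightarrow> f z \<in> T"
    using N(2,3) y unfolding continuous_on_topological by metis
  then show "\<exists>A. open A \<and> y \<in> A \<and> (\<forall>z\<in>B. z \<in> A \<longrightarrow> f z \<in> T)"
    using O' N(2) by (intro exI[of _ "A \<inter> O'"]) auto
qed

text \<open>At each point some weight is positive, but the weights are not normalized: a positive
  combination of positive forms is positive in any case. Condition \<open>subord\<close> demands
  vanishing near each point outside \<open>V (c U)\<close>, so that a function known only on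
  \<open>V (c U)\<close> can be cut off and extended by zero.\<close>

locale subordinate_partition =
  fixes A :: "'a::topological_space set" and V :: "'a \<Rightarrow> 'a set" and C :: "'i set" and c :: "'i \<Rightarrow> 'a"
    and \<rho> :: "'i \<Rightarrow> 'a \<Rightarrow> real"
  assumes centre: "U \<in> C \<Longrightarrow> c U \<in> A"
    and cont: "U \<in> C \<Longrightarrow> continuous_on A (\<rho> U)"
    and nonneg: "U \<in> C \<Longrightarrow> y \<in> A \<Longrightarrow> \<rho> U y \<ge> 0"
    and subord: "U \<in> C \<Longrightarrow> y \<in> A \<Longrightarrow> y \<notin> V (c U) \<Longrightarrow> \<exists>N. openin (top_of_set A) N \<and> y \<in> N \<and> (\<forall>z\<in>N. \<rho> U z = 0)"
    and open_V: "x \<in> A \<Longrightarrow> openin (top_of_set A) (V x)"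
    and loc_fin: "y \<in> A \<Longrightarrow> \<exists>N. openin (top_of_set A) N \<and> y \<in> N \<and> finite {U \<in> C. \<exists>z\<in>N. \<rho> U z \<noteq> 0}"
    and positive: "y \<in> A \<Longrightarrow> \<exists>U\<in>C. \<rho> U y > 0"
begin

definition active where "active y = {U \<in> C. \<rho> U y \<noteq> 0}"

lemma finite_active: assumes y: "y \<in> A" shows "finite (active y)"
proof -
  obtain N where N: "y \<in> N" "finite {U \<in> C. \<exists>z\<in>N. \<rho> U z \<noteq> 0}" using loc_fin[OF y] by blast
  show ?thesis by (rule finite_subset[OF _ N(2)]) (use N(1) in \<open>auto simp: active_def\<close>)
qed

lemma activeD: assumes "U \<in> active y" "y \<in> A" shows "U \<in> C" "y \<in> V (c U)" "\<rho> U y > 0"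
proof -
  show U: "U \<in> C" using assms unfolding active_def by simp
  show "y \<in> V (c U)" using subord[OF U assms(2)] assms unfolding active_def by blast
  show "\<rho> U y > 0" using nonneg[OF U assms(2)] assms unfolding active_def by auto
qed

text \<open>Each term is continuous near points of \<open>V (c U)\<close> because \<open>H U\<close>
  is, and near the other points because its weight vanishes there. Local finiteness then replaces
  the varying index set \<open>active y\<close> by a fixed finite one on a neighbourhood.\<close>

lemma continuous_weighted_sum:
  fixes H :: "'i \<Rightarrow> 'a \<Rightarrow> complex"
  assumes B: "B \<subseteq> A" and H: "\<And>U. U \<in> C \<Longrightarrow> continuous_on (B \<inter> V (c U)) (H U)"
  shows "continuous_on B (\<lambda>y. \<Sum>U\<in>active y. of_real (\<rho> U y) * H U y)"
proof -
  have openB: "openin (top_of_set B) (B \<inter> N)" if "openin (top_of_set A) N" for N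
    using that B unfolding openin_open by blast
  have one: "continuous_on B (\<lambda>y. of_real (\<rho> U y) * H U y)" if U: "U \<in> C" for U
  proof (rule openin_local_continuous)
    fix y assume y: "y \<in> B"
    then have yA: "y \<in> A" using B by blast
    show "\<exists>N. openin (top_of_set B) N \<and> y \<in> N \<and> continuous_on N (\<lambda>y. of_real (\<rho> U y) * H U y)"
    proof (cases "y \<in> V (c U)")
      case True
      have "continuous_on (B \<inter> V (c U)) (\<lambda>y. of_real (\<rho> U y) * H U y)"
        by (intro continuous_intros H U continuous_on_subset[OF cont[OF U]]) (use B in auto)
      then show ?thesis using openB[OF open_V[OF centre[OF U]]] y True by blast
    next
      case False
      then obtain N where N: "openin (top_of_set A) N" "y \<in> N" "\<forall>z\<in>N. \<rho> U z = 0" using subord[OF U yA] by blast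
      have "continuous_on (B \<inter> N) (\<lambda>y. of_real (\<rho> U y) * H U y)"
        by (rule continuous_on_eq[of _ "\<lambda>_. 0"]) (use N(3) in auto)
      then show ?thesis using openB[OF N(1)] y N(2) by blast
    qed
  qed
  show ?thesis
  proof (rule openin_local_continuous)
    fix y assume y: "y \<in> B"
    then obtain N where N: "openin (top_of_set A) N" "y \<in> N" "finite {U \<in> C. \<exists>z\<in>N. \<rho> U z \<noteq> 0}"
      using loc_fin B by blast
    let ?K = "{U \<in> C. \<exists>z\<in>N. \<rho> U z \<noteq> 0}"
    have "continuous_on (B \<inter> N) (\<lambda>y. \<Sum>U\<in>?K. of_real (\<rho> U y) * H U y)"
      by (intro continuous_on_sum continuous_on_subset[OF one]) auto
    moreover have "(\<Sum>U\<in>?K. of_real (\<rho> U z) * H U z) = (\<Sum>U\<in>active z. of_real (\<rho> U z) * H U z)" if "z \<in> B \<inter> N" for z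
      by (rule sum.mono_neutral_right[OF N(3)]) (use that in \<open>auto simp: active_def\<close>)
    ultimately have "continuous_on (B \<inter> N) (\<lambda>y. \<Sum>U\<in>active y. of_real (\<rho> U y) * H U y)"
      by (rule continuous_on_eq)
    then show "\<exists>N. openin (top_of_set B) N \<and> y \<in> N \<and> continuous_on N (\<lambda>y. \<Sum>U\<in>active y. of_real (\<rho> U y) * H U y)"
      using openB[OF N(1)] y N(2) by blast
  qed
qed

end

text \<open>The cover is carried along the embedding to a subset of a Euclidean space, which is
  paracompact; a partition of unity is chosen there for a refinement by balls and pulled
  back.\<close>

lemma subordinate_partition_exists:
  fixes A :: "'n::finite cproj set"
  assumes V: "\<And>y. y \<in> A \<Longrightarrow> y \<in> V y" "\<And>y. y \<in> A \<Longrightarrow> openin (top_of_set A) (V y)"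
  shows "\<exists>(C :: (complex^'n^'n) set set) c \<rho>. subordinate_partition A V C c \<rho>"
proof -
  let ?e = "cproj_emb :: 'n cproj \<Rightarrow> complex^'n^'n"
  obtain g where g: "homeomorphism UNIV (range ?e) ?e g"
    using homeomorphism_compact[OF compact_cproj continuous_cproj_emb refl inj_cproj_emb] by blast
  have ge: "g (?e y) = y" for y using g by (simp add: homeomorphism_def)
  define S where "S = ?e ` A"
  have gS: "continuous_on S g" "g ` S = A"
    using g continuous_on_subset[of "range ?e" g S] unfolding S_def homeomorphism_def by (auto simp: image_image)
  have "\<exists>T. open T \<and> {s \<in> S. g s \<in> V y} = S \<inter> T" if y: "y \<in> A" for y
  proof -
    have "openin (top_of_set S) (S \<inter> g -` V y)"
      using continuous_on_open[of S g] gS V(2)[OF y] by simp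
    moreover have "S \<inter> g -` V y = {s \<in> S. g s \<in> V y}" by auto
    ultimately show ?thesis unfolding openin_open by auto
  qed
  then have "\<forall>y\<in>A. \<exists>T. open T \<and> {s \<in> S. g s \<in> V y} = S \<inter> T" by blast
  then obtain T where "\<forall>y\<in>A. open (T y) \<and> {s \<in> S. g s \<in> V y} = S \<inter> T y" by (rule bchoice[THEN exE])
  then have T: "\<And>y. y \<in> A \<Longrightarrow> open (T y)" "\<And>y. y \<in> A \<Longrightarrow> {s \<in> S. g s \<in> V y} = S \<inter> T y" by blast+
  \<comment> \<open>Closed balls inside \<open>T y\<close> leave room: a weight that vanishes
    outside the open ball vanishes near every point outside \<open>T y\<close>, as
    \<open>subord\<close> requires.\<close>
  have "\<exists>e>0. cball (?e y) e \<subseteq> T y" if y: "y \<in> A" for y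
  proof -
    have "?e y \<in> {s \<in> S. g s \<in> V y}" using y V(1)[OF y] ge by (auto simp: S_def)
    then have "?e y \<in> T y" unfolding T(2)[OF y] by blast
    then show ?thesis using T(1)[OF y] open_contains_cball by blast
  qed
  then have "\<forall>y\<in>A. \<exists>e>0. cball (?e y) e \<subseteq> T y" by blast
  then obtain e where "\<forall>y\<in>A. e y > 0 \<and> cball (?e y) (e y) \<subseteq> T y" by (rule bchoice[THEN exE])
  then have e: "\<And>y. y \<in> A \<Longrightarrow> e y > 0" "\<And>y. y \<in> A \<Longrightarrow> cball (?e y) (e y) \<subseteq> T y" by blast+
  let ?B = "(\<lambda>y. ball (?e y) (e y)) ` A"
  have cov: "S \<subseteq> \<Union>?B" using e(1) by (force simp: S_def)
  have op: "open D" if "D \<in> ?B" for D using that by auto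
  obtain C where C: "S \<subseteq> \<Union>C" "\<And>U. U \<in> C \<Longrightarrow> open U \<and> (\<exists>D. D \<in> ?B \<and> U \<subseteq> D)"
    "\<And>x. x \<in> S \<Longrightarrow> \<exists>D. open D \<and> x \<in> D \<and> finite {U. U \<in> C \<and> (U \<inter> D \<noteq> {})}"
  proof (rule paracompact[OF cov op])
    fix C assume "S \<subseteq> \<Union>C" "\<And>U. U \<in> C \<Longrightarrow> open U \<and> (\<exists>D. D \<in> ?B \<and> U \<subseteq> D)"
      "\<And>x. x \<in> S \<Longrightarrow> \<exists>D. open D \<and> x \<in> D \<and> finite {U. U \<in> C \<and> (U \<inter> D \<noteq> {})}"
    then show thesis by (rule that)
  qed
  obtain F :: "(complex^'n^'n) set \<Rightarrow> complex^'n^'n \<Rightarrow> real" where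
    F: "\<And>U. U \<in> C \<Longrightarrow> continuous_on S (F U) \<and> (\<forall>x\<in>S. 0 \<le> F U x)"
      "\<And>x U. \<lbrakk>U \<in> C; x \<in> S; x \<notin> U\<rbrakk> \<Longrightarrow> F U x = 0"
      "\<And>x. x \<in> S \<Longrightarrow> supp_sum (\<lambda>W. F W x) C = 1"
      "\<And>x. x \<in> S \<Longrightarrow> \<exists>D. open D \<and> x \<in> D \<and> finite {U \<in> C. \<exists>x\<in>D. F U x \<noteq> 0}"
  proof (rule subordinate_partition_of_unity[OF C(1)])
    show "open T" if "T \<in> C" for T using C(2)[OF that] by blast
    show "\<exists>D. open D \<and> x \<in> D \<and> finite {U \<in> C. U \<inter> D \<noteq> {}}" if "x \<in> S" for x by (rule C(3)[OF that])
    fix F :: "(complex^'n^'n) set \<Rightarrow> complex^'n^'n \<Rightarrow> real"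
    assume "\<And>U. U \<in> C \<Longrightarrow> continuous_on S (F U) \<and> (\<forall>x\<in>S. 0 \<le> F U x)"
      "\<And>x U. \<lbrakk>U \<in> C; x \<in> S; x \<notin> U\<rbrakk> \<Longrightarrow> F U x = 0"
      "\<And>x. x \<in> S \<Longrightarrow> supp_sum (\<lambda>W. F W x) C = 1"
      "\<And>x. x \<in> S \<Longrightarrow> \<exists>D. open D \<and> x \<in> D \<and> finite {U \<in> C. \<exists>x\<in>D. F U x \<noteq> 0}"
    then show thesis by (rule that)
  qed
  have "\<forall>U\<in>C. \<exists>y\<in>A. U \<subseteq> ball (?e y) (e y)" using C(2) by blast
  then have "\<forall>U\<in>C. \<exists>y. y \<in> A \<and> U \<subseteq> ball (?e y) (e y)" by blast
  then obtain c where "\<forall>U\<in>C. c U \<in> A \<and> U \<subseteq> ball (?e (c U)) (e (c U))" by (rule bchoice[THEN exE])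
  then have c: "\<And>U. U \<in> C \<Longrightarrow> c U \<in> A" "\<And>U. U \<in> C \<Longrightarrow> U \<subseteq> ball (?e (c U)) (e (c U))" by blast+
  have eS: "?e y \<in> S" if "y \<in> A" for y using that by (simp add: S_def)
  have oA: "openin (top_of_set A) {z \<in> A. ?e z \<in> D}" if "open D" for D
  proof -
    have "open (?e -` D)" by (rule open_vimage[OF that continuous_cproj_emb])
    moreover have "{z \<in> A. ?e z \<in> D} = A \<inter> ?e -` D" by auto
    ultimately show ?thesis unfolding openin_open by blast
  qed
  have "subordinate_partition A V C c (\<lambda>U y. F U (?e y))"
  proof
    show "c U \<in> A" if "U \<in> C" for U by (rule c(1)[OF that])
    show "continuous_on A (\<lambda>y. F U (?e y))" if "U \<in> C" for U
      by (rule continuous_on_compose2[of S "F U"]) (use F(1)[OF that] continuous_cproj_emb eS in auto)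
    show "F U (?e y) \<ge> 0" if "U \<in> C" "y \<in> A" for U y using F(1)[OF that(1)] eS[OF that(2)] by blast
    show "openin (top_of_set A) (V x)" if "x \<in> A" for x by (rule V(2)[OF that])
    show "\<exists>N. openin (top_of_set A) N \<and> y \<in> N \<and> (\<forall>z\<in>N. F U (?e z) = 0)" if U: "U \<in> C" and y: "y \<in> A" "y \<notin> V (c U)" for U y
    proof -
      let ?D = "- cball (?e (c U)) (e (c U))"
      have "?e y \<notin> {s \<in> S. g s \<in> V (c U)}" using y(2) ge by auto
      then have "?e y \<in> ?D" unfolding T(2)[OF c(1)[OF U]] using e(2)[OF c(1)[OF U]] eS[OF y(1)] by blast
      moreover have "F U (?e z) = 0" if "z \<in> A" "?e z \<in> ?D" for z
      proof -
        have "?e z \<notin> U" using c(2)[OF U] that(2) by (metis ComplD ball_subset_cball subsetD)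
        then show ?thesis using F(2)[OF U eS[OF that(1)]] by blast
      qed
      ultimately show ?thesis using oA[of ?D] y(1) by (intro exI[of _ "{z \<in> A. ?e z \<in> ?D}"]) (auto simp: open_Compl)
    qed
    show "\<exists>N. openin (top_of_set A) N \<and> y \<in> N \<and> finite {U \<in> C. \<exists>z\<in>N. F U (?e z) \<noteq> 0}" if y: "y \<in> A" for y
    proof -
      obtain D where D: "open D" "?e y \<in> D" "finite {U \<in> C. \<exists>x\<in>D. F U x \<noteq> 0}" using F(4)[OF eS[OF y]] by blast
      have "finite {U \<in> C. \<exists>z\<in>{z \<in> A. ?e z \<in> D}. F U (?e z) \<noteq> 0}"
        by (rule finite_subset[OF _ D(3)]) blast
      then show ?thesis using oA[OF D(1)] D(2) y by blast
    qed
    show "\<exists>U\<in>C. F U (?e y) > 0" if y: "y \<in> A" for y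
    proof (rule ccontr)
      assume "\<not> (\<exists>U\<in>C. F U (?e y) > 0)"
      then have "F U (?e y) = 0" if "U \<in> C" for U using F(1)[OF that] eS[OF y] that by fastforce
      then have "supp_sum (\<lambda>W. F W (?e y)) C = 0" unfolding supp_sum_def support_on_def by (intro sum.neutral) auto
      then show False using F(3)[OF eS[OF y]] by simp
    qed
  qed
  then show ?thesis by blast
qed

section \<open>Continuous matrix functions\<close>

lemma entry_mat: "M \<in> carrier_mat r c \<Longrightarrow> entry M i j = (if i < r \<and> j < c then M $$ (i, j) else 0)"
  unfolding entry_def by auto

lemma continuous_mat_onI:
  assumes "\<And>y. y \<in> B \<Longrightarrow> f y \<in> carrier_mat r c"
    and "\<And>i j. i < r \<Longrightarrow> j < c \<Longrightarrow> continuous_on B (\<lambda>y. f y $$ (i, j))"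
  shows "continuous_mat_on B f"
  unfolding continuous_mat_on_def
proof (intro allI)
  fix i j
  show "continuous_on B (\<lambda>y. entry (f y) i j)"
  proof (cases "i < r \<and> j < c")
    case True
    then show ?thesis
      by (intro continuous_on_eq[OF assms(2)[of i j]]) (simp_all add: entry_mat[OF assms(1)])
  next
    case False
    then show ?thesis
      by (intro continuous_on_eq[OF continuous_on_const[of B 0]]) (auto simp: entry_mat[OF assms(1)])
  qed
qed

lemma continuous_mat_onD:
  assumes f: "continuous_mat_on B f" and c: "\<And>y. y \<in> B \<Longrightarrow> f y \<in> carrier_mat r c" and ij: "i < r" "j < c"
  shows "continuous_on B (\<lambda>y. f y $$ (i, j))"
proof (rule continuous_on_eq)
  show "continuous_on B (\<lambda>y. entry (f y) i j)" using f unfolding continuous_mat_on_def by blast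
  show "entry (f y) i j = f y $$ (i, j)" if "y \<in> B" for y using entry_mat[OF c[OF that]] ij by simp
qed

lemma continuous_mat_on_cong:
  assumes "continuous_mat_on B f" "\<And>y. y \<in> B \<Longrightarrow> f y = g y" shows "continuous_mat_on B g"
  unfolding continuous_mat_on_def
proof (intro allI)
  fix i j
  show "continuous_on B (\<lambda>y. entry (g y) i j)"
    by (rule continuous_on_eq[of _ "\<lambda>y. entry (f y) i j"]) (use assms in \<open>auto simp: continuous_mat_on_def\<close>)
qed

lemma continuous_mat_on_subset: "continuous_mat_on B f \<Longrightarrow> D \<subseteq> B \<Longrightarrow> continuous_mat_on D f"
  unfolding continuous_mat_on_def using continuous_on_subset by blast

lemma continuous_mat_on_compose:
  assumes "continuous_mat_on B f" "continuous_on D q" "q ` D \<subseteq> B"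
  shows "continuous_mat_on D (\<lambda>z. f (q z))"
  using assms continuous_on_compose2[of B "\<lambda>y. entry (f y) _ _" D q] unfolding continuous_mat_on_def by blast

lemma continuous_mat_on_mult:
  assumes f: "continuous_mat_on B f" "\<And>y. y \<in> B \<Longrightarrow> f y \<in> carrier_mat r k"
    and g: "continuous_mat_on B g" "\<And>y. y \<in> B \<Longrightarrow> g y \<in> carrier_mat k c"
  shows "continuous_mat_on B (\<lambda>y. f y * g y)"
proof (rule continuous_mat_onI)
  show "f y * g y \<in> carrier_mat r c" if "y \<in> B" for y using f(2)[OF that] g(2)[OF that] by simp
  fix i j assume ij: "i < r" "j < c"
  have "continuous_on B (\<lambda>y. \<Sum>l = 0..<k. f y $$ (i, l) * g y $$ (l, j))"
    by (intro continuous_intros continuous_mat_onD[OF f] continuous_mat_onD[OF g] ij) auto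
  then show "continuous_on B (\<lambda>y. (f y * g y) $$ (i, j))"
  proof (rule continuous_on_eq)
    fix y assume "y \<in> B"
    note fg = carrier_matD[OF f(2)[OF this]] carrier_matD[OF g(2)[OF this]]
    show "(\<Sum>l = 0..<k. f y $$ (i, l) * g y $$ (l, j)) = (f y * g y) $$ (i, j)"
      using fg ij by (simp add: scalar_prod_def)
  qed
qed

lemma continuous_mat_on_minus_smult:
  assumes f: "continuous_mat_on B f" "\<And>y. y \<in> B \<Longrightarrow> f y \<in> carrier_mat r c"
    and g: "continuous_mat_on B g" "\<And>y. y \<in> B \<Longrightarrow> g y \<in> carrier_mat r c"
    and s: "continuous_on B (s :: _ \<Rightarrow> complex)"
  shows "continuous_mat_on B (\<lambda>y. f y - s y \<cdot>\<^sub>m g y)"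
proof (rule continuous_mat_onI)
  show "f y - s y \<cdot>\<^sub>m g y \<in> carrier_mat r c" if "y \<in> B" for y using f(2)[OF that] g(2)[OF that] by auto
  fix i j assume ij: "i < r" "j < c"
  have "continuous_on B (\<lambda>y. f y $$ (i, j) - s y * g y $$ (i, j))"
    by (intro continuous_intros continuous_mat_onD[OF f] continuous_mat_onD[OF g] ij s)
  then show "continuous_on B (\<lambda>y. (f y - s y \<cdot>\<^sub>m g y) $$ (i, j))"
  proof (rule continuous_on_eq)
    fix y assume "y \<in> B"
    note fg = carrier_matD[OF f(2)[OF this]] carrier_matD[OF g(2)[OF this]]
    show "f y $$ (i, j) - s y * g y $$ (i, j) = (f y - s y \<cdot>\<^sub>m g y) $$ (i, j)"
      using fg ij by simp
  qed
qed

lemma continuous_on_det: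
  assumes f: "continuous_mat_on B f" "\<And>y. y \<in> B \<Longrightarrow> f y \<in> carrier_mat r r"
  shows "continuous_on B (\<lambda>y. det (f y))"
proof (rule continuous_on_eq)
  show "continuous_on B (\<lambda>y. \<Sum>p | p permutes {0..<r}. signof p * (\<Prod>i = 0..<r. f y $$ (i, p i)))"
    by (intro continuous_intros continuous_mat_onD[OF f]) (auto simp: permutes_in_image)
  show "(\<Sum>p | p permutes {0..<r}. signof p * (\<Prod>i = 0..<r. f y $$ (i, p i))) = det (f y)" if "y \<in> B" for y
    using det_def'[OF f(2)[OF that]] by simp
qed

text \<open>The conjugate transpose, not the adjugate.\<close>

definition adj :: "complex mat \<Rightarrow> complex mat" where
  "adj M = mat (dim_col M) (dim_row M) (\<lambda>(i, j). cnj (M $$ (j, i)))"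

text \<open>The standard hermitian product, conjugate-linear in the first argument.\<close>

definition hdot :: "complex Matrix.vec \<Rightarrow> complex Matrix.vec \<Rightarrow> complex" where
  "hdot x u = (\<Sum>i = 0..<dim_vec x. cnj (vec_index x i) * vec_index u i)"

lemma adj_carrier [simp]: "M \<in> carrier_mat r c \<Longrightarrow> adj M \<in> carrier_mat c r"
  unfolding adj_def by auto

lemma adj_adj: "adj (adj M) = M"
  unfolding adj_def by (rule eq_matI) auto

lemma adj_mult:
  assumes "M \<in> carrier_mat r k" "N \<in> carrier_mat k c" shows "adj (M * N) = adj N * adj M"
  using assms unfolding adj_def by (intro eq_matI) (auto simp: scalar_prod_def mult.commute)

lemma continuous_mat_on_adj:
  assumes f: "continuous_mat_on B f" "\<And>y. y \<in> B \<Longrightarrow> f y \<in> carrier_mat r c"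
  shows "continuous_mat_on B (\<lambda>y. adj (f y))"
proof (rule continuous_mat_onI)
  show "adj (f y) \<in> carrier_mat c r" if "y \<in> B" for y using f(2)[OF that] by simp
  fix i j assume ij: "i < c" "j < r"
  have "continuous_on B (\<lambda>y. cnj (f y $$ (j, i)))" by (intro continuous_intros continuous_mat_onD[OF f] ij)
  then show "continuous_on B (\<lambda>y. adj (f y) $$ (i, j))"
  proof (rule continuous_on_eq)
    fix y assume "y \<in> B"
    then show "cnj (f y $$ (j, i)) = adj (f y) $$ (i, j)"
      using carrier_matD[OF f(2)] ij unfolding adj_def by auto
  qed
qed

lemma hdot_adj:
  assumes M: "M \<in> carrier_mat r c" and x: "x \<in> carrier_vec c" and u: "u \<in> carrier_vec r"
  shows "hdot (M *\<^sub>v x) u = hdot x (adj M *\<^sub>v u)"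
proof -
  have "hdot (M *\<^sub>v x) u = (\<Sum>i = 0..<r. \<Sum>j = 0..<c. cnj (M $$ (i, j)) * cnj (vec_index x j) * vec_index u i)"
    unfolding hdot_def using carrier_matD[OF M] carrier_vecD[OF x]
    by (auto intro!: sum.cong simp: scalar_prod_def sum_distrib_right)
  also have "\<dots> = (\<Sum>j = 0..<c. \<Sum>i = 0..<r. cnj (M $$ (i, j)) * cnj (vec_index x j) * vec_index u i)"
    by (rule sum.swap)
  also have "\<dots> = hdot x (adj M *\<^sub>v u)"
    unfolding hdot_def adj_def using carrier_matD[OF M] carrier_vecD[OF x] carrier_vecD[OF u]
    by (auto intro!: sum.cong simp: scalar_prod_def sum_distrib_left mult_ac)
  finally show ?thesis .
qed

lemma hdot_commute: "dim_vec x = dim_vec u \<Longrightarrow> hdot u x = cnj (hdot x u)"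
  unfolding hdot_def by (simp add: mult.commute)

lemma hdot_smult_right: "dim_vec u = dim_vec x \<Longrightarrow> hdot x (c \<cdot>\<^sub>v u) = c * hdot x u"
  unfolding hdot_def by (simp add: sum_distrib_left mult_ac)

lemma hdot_zero_right: "dim_vec x = n \<Longrightarrow> hdot x (0\<^sub>v n) = 0"
  unfolding hdot_def by simp

lemma hdot_self: "hdot x x = of_real (\<Sum>i = 0..<dim_vec x. (cmod (vec_index x i))\<^sup>2)"
  unfolding hdot_def of_real_sum by (intro sum.cong refl) (metis complex_norm_square mult.commute of_real_power)

lemma hdot_self_zero:
  assumes "(\<Sum>i = 0..<dim_vec x. (cmod (vec_index x i))\<^sup>2) = 0" shows "x = 0\<^sub>v (dim_vec x)"
proof (rule eq_vecI)
  show "vec_index x i = vec_index (0\<^sub>v (dim_vec x)) i" if "i < dim_vec (0\<^sub>v (dim_vec x) :: complex Matrix.vec)" for i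
  proof -
    have "(cmod (vec_index x i))\<^sup>2 = 0"
      by (rule sum_nonneg_0[OF _ _ assms]) (use that in auto)
    then show ?thesis using that by simp
  qed
qed simp

lemma smult_mat_mult_vec:
  assumes "(M :: complex mat) \<in> carrier_mat r c" "x \<in> carrier_vec c"
  shows "(a \<cdot>\<^sub>m M) *\<^sub>v x = a \<cdot>\<^sub>v (M *\<^sub>v x)"
  using assms by (intro eq_vecI) (auto simp: scalar_prod_def sum_distrib_left mult.assoc)

text \<open>Over the complex numbers, real values of the quadratic form already force
  \<open>m\<close> to be hermitian, so symmetry is not listed separately. The witness
  \<open>c\<close> records reality and sign of the value at once.\<close>

definition posdef :: "nat \<Rightarrow> complex mat \<Rightarrow> bool" where
  "posdef r m \<longleftrightarrow> m \<in> carrier_mat r r \<and>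
     (\<forall>x\<in>carrier_vec r. \<exists>c\<ge>0. hdot x (m *\<^sub>v x) = of_real c \<and> (c = 0 \<longrightarrow> x = 0\<^sub>v r))"

lemma posdef_carrier: "posdef r m \<Longrightarrow> m \<in> carrier_mat r r" unfolding posdef_def by simp

lemma posdefE:
  assumes "posdef r m" "x \<in> carrier_vec r"
  obtains c where "c \<ge> 0" "hdot x (m *\<^sub>v x) = of_real c" "c = 0 \<longrightarrow> x = 0\<^sub>v r"
  using assms unfolding posdef_def by blast

lemma posdef_one: "posdef r (1\<^sub>m r)"
  unfolding posdef_def
proof (intro conjI ballI)
  fix x :: "complex Matrix.vec" assume x: "x \<in> carrier_vec r"
  have "0 \<le> (\<Sum>i = 0..<dim_vec x. (cmod (vec_index x i))\<^sup>2)" by (simp add: sum_nonneg)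
  moreover have "hdot x (1\<^sub>m r *\<^sub>v x) = of_real (\<Sum>i = 0..<dim_vec x. (cmod (vec_index x i))\<^sup>2)"
    unfolding one_mult_mat_vec[OF x] by (rule hdot_self)
  moreover note hdot_self_zero[of x, unfolded carrier_vecD[OF x]]
  ultimately show "\<exists>c\<ge>0. hdot x (1\<^sub>m r *\<^sub>v x) = of_real c \<and> (c = 0 \<longrightarrow> x = 0\<^sub>v r)"
    using carrier_vecD[OF x] by metis
qed simp

text \<open>With more columns than rows, padding by zero rows gives a singular square matrix: each
  product in the Leibniz formula meets the zero row \<open>m - 1\<close>. A kernel vector of the
  padded matrix is one of \<open>M\<close>.\<close>

lemma inj_mat_dim:
  assumes M: "(M :: complex mat) \<in> carrier_mat n m" and inj: "\<And>x. x \<in> carrier_vec m \<Longrightarrow> M *\<^sub>v x = 0\<^sub>v n \<Longrightarrow> x = 0\<^sub>v m"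
  shows "m \<le> n"
proof (rule ccontr)
  assume "\<not> m \<le> n"
  let ?N = "mat m m (\<lambda>(i, j). if i < n then M $$ (i, j) else 0)"
  have N: "?N \<in> carrier_mat m m" by simp
  have "det ?N = 0" unfolding det_def'[OF N]
  proof (intro sum.neutral ballI)
    fix p assume "p \<in> {p. p permutes {0..<m}}"
    moreover have "m - 1 \<in> {0..<m}" using \<open>\<not> m \<le> n\<close> by auto
    ultimately have "p (m - 1) < m" using permutes_in_image[of p "{0..<m}" "m - 1"] by auto
    then have "?N $$ (m - 1, p (m - 1)) = 0" using \<open>\<not> m \<le> n\<close> by simp
    then have "(\<Prod>i = 0..<m. ?N $$ (i, p i)) = 0"
      using \<open>m - 1 \<in> {0..<m}\<close> by (intro prod_zero) auto
    then show "signof p * (\<Prod>i = 0..<m. ?N $$ (i, p i)) = 0" by simp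
  qed
  then obtain x where x: "x \<in> carrier_vec m" "x \<noteq> 0\<^sub>v m" "?N *\<^sub>v x = 0\<^sub>v m"
    using det_0_iff_vec_prod_zero[OF N] by blast
  have "M *\<^sub>v x = 0\<^sub>v n"
  proof (rule eq_vecI)
    fix i assume "i < dim_vec (0\<^sub>v n :: complex Matrix.vec)"
    then have i: "i < n" "i < m" using \<open>\<not> m \<le> n\<close> by auto
    have "row ?N i = row M i" using i carrier_matD[OF M] by (intro eq_vecI) auto
    then have "vec_index (M *\<^sub>v x) i = vec_index (?N *\<^sub>v x) i" using i carrier_matD[OF M] by simp
    then show "vec_index (M *\<^sub>v x) i = vec_index (0\<^sub>v n) i" using x(3) i by simp
  qed (use carrier_matD[OF M] in auto)
  with inj x show False by blast
qed

lemma inj_mat_surj: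
  assumes M: "(M :: complex mat) \<in> carrier_mat n n" and inj: "\<And>x. x \<in> carrier_vec n \<Longrightarrow> M *\<^sub>v x = 0\<^sub>v n \<Longrightarrow> x = 0\<^sub>v n"
  shows "mat_range M = carrier_vec n"
proof -
  have "det M \<noteq> 0" using det_0_iff_vec_prod_zero[OF M] inj by blast
  from det_non_zero_imp_unit[OF M this, of "()"] obtain N where N: "N \<in> carrier_mat n n" "M * N = 1\<^sub>m n"
    unfolding Units_def by (auto simp: ring_mat_def)
  have "u \<in> mat_range M" if u: "u \<in> carrier_vec n" for u
  proof -
    have "M *\<^sub>v (N *\<^sub>v u) = u" using assoc_mult_mat_vec[OF M N(1) u] N(2) u by simp
    then show ?thesis unfolding mat_range_def using carrier_matD[OF M] N(1) u
      by (intro image_eqI[of _ _ "N *\<^sub>v u"]) auto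
  qed
  then show ?thesis using M unfolding mat_range_def by auto
qed

text \<open>Pairing \<open>w x = \<phi>\<^sub>0 \<phi>\<^sub>1 x = s \<phi>\<^sub>0 \<psi> x\<close> with \<open>m x\<close> gives \<open>w \<parallel>x\<parallel>\<^sup>2 = s \<parallel>\<phi>\<^sub>0\<^sup>* m x\<parallel>\<^sup>2\<close>, so that
  \<open>w\<close> is nonnegative whenever \<open>\<phi>\<^sub>1 - s \<psi>\<close> has a kernel.\<close>

lemma perturbed_injective:
  assumes f0: "f0 \<in> carrier_mat r1 r0" and f1: "f1 \<in> carrier_mat r0 r1"
    and ff: "f0 * f1 = w \<cdot>\<^sub>m 1\<^sub>m r1" and m: "posdef r1 m" and n: "posdef r0 n" and s: "s \<ge> (0::real)"
    and w: "Re w < 0 \<or> w = 0 \<and> s > 0 \<and> (\<forall>x\<in>carrier_vec r1. f1 *\<^sub>v x = 0\<^sub>v r0 \<longrightarrow> (\<exists>z\<in>carrier_vec r0. x = f0 *\<^sub>v z))"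
    and x: "x \<in> carrier_vec r1" and ker: "(f1 - of_real s \<cdot>\<^sub>m (n * adj f0 * m)) *\<^sub>v x = 0\<^sub>v r0"
  shows "x = 0\<^sub>v r1"
proof -
  note mc = posdef_carrier[OF m] and nc = posdef_carrier[OF n]
  define u where "u = adj f0 *\<^sub>v (m *\<^sub>v x)"
  have mx: "m *\<^sub>v x \<in> carrier_vec r1" using mc x by simp
  have uc: "u \<in> carrier_vec r0" unfolding u_def by (rule mult_mat_vec_carrier[OF adj_carrier[OF f0] mx])
  have nu: "n *\<^sub>v u \<in> carrier_vec r0" using nc uc by simp
  have psi: "(n * adj f0 * m) *\<^sub>v x = n *\<^sub>v u"
    unfolding u_def assoc_mult_mat_vec[OF mult_carrier_mat[OF nc adj_carrier[OF f0]] mc x]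
    by (rule assoc_mult_mat_vec[OF nc adj_carrier[OF f0] mx])
  have psic: "n * adj f0 * m \<in> carrier_mat r0 r1" using nc adj_carrier[OF f0] mc by simp
  have "(f1 - of_real s \<cdot>\<^sub>m (n * adj f0 * m)) *\<^sub>v x = f1 *\<^sub>v x - of_real s \<cdot>\<^sub>v (n *\<^sub>v u)"
    using minus_mult_distrib_mat_vec[OF f1 smult_carrier_mat[OF psic] x] psi psic x
    by (simp add: smult_mat_mult_vec[OF psic x])
  then have "f1 *\<^sub>v x - of_real s \<cdot>\<^sub>v (n *\<^sub>v u) = 0\<^sub>v r0" using ker by simp
  then have f1x: "f1 *\<^sub>v x = of_real s \<cdot>\<^sub>v (n *\<^sub>v u)"
  proof -
    assume a: "f1 *\<^sub>v x - of_real s \<cdot>\<^sub>v (n *\<^sub>v u) = 0\<^sub>v r0"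
    show ?thesis
    proof (rule eq_vecI)
      fix i assume "i < dim_vec (of_real s \<cdot>\<^sub>v (n *\<^sub>v u))"
      then have i: "i < r0" using carrier_vecD[OF nu] by simp
      have "vec_index (f1 *\<^sub>v x - of_real s \<cdot>\<^sub>v (n *\<^sub>v u)) i = 0" unfolding a using i by simp
      then show "vec_index (f1 *\<^sub>v x) i = vec_index (of_real s \<cdot>\<^sub>v (n *\<^sub>v u)) i"
        using i carrier_vecD[OF nu] by (subst (asm) index_minus_vec) auto
    qed (use f1 carrier_vecD[OF nu] in auto)
  qed
  have wx: "w \<cdot>\<^sub>v x = of_real s \<cdot>\<^sub>v (f0 *\<^sub>v (n *\<^sub>v u))"
  proof -
    have "w \<cdot>\<^sub>v x = f0 *\<^sub>v (f1 *\<^sub>v x)"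
      using assoc_mult_mat_vec[OF f0 f1 x] ff x by (simp add: smult_mat_mult_vec[of _ r1 r1])
    then show ?thesis unfolding f1x using mult_mat_vec[OF f0 nu] by simp
  qed
  obtain q1 where q1: "q1 \<ge> 0" "hdot x (m *\<^sub>v x) = of_real q1" "q1 = 0 \<longrightarrow> x = 0\<^sub>v r1" by (rule posdefE[OF m x])
  obtain q0 where q0: "q0 \<ge> 0" "hdot u (n *\<^sub>v u) = of_real q0" "q0 = 0 \<longrightarrow> u = 0\<^sub>v r0" by (rule posdefE[OF n uc])
  have "w * of_real q1 = of_real s * of_real q0"
  proof -
    have "hdot (m *\<^sub>v x) (w \<cdot>\<^sub>v x) = w * of_real q1"
      using hdot_smult_right[of x "m *\<^sub>v x" w] hdot_commute[of x "m *\<^sub>v x"] carrier_vecD[OF x] carrier_vecD[OF mx] q1(2) by simp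
    moreover have "hdot (m *\<^sub>v x) (f0 *\<^sub>v (n *\<^sub>v u)) = of_real q0"
      using hdot_adj[OF adj_carrier[OF f0] mx nu] q0(2) unfolding adj_adj u_def[symmetric] by simp
    moreover have "dim_vec (f0 *\<^sub>v (n *\<^sub>v u)) = dim_vec (m *\<^sub>v x)" using f0 carrier_vecD[OF mx] by simp
    ultimately show ?thesis using wx hdot_smult_right[of "f0 *\<^sub>v (n *\<^sub>v u)" "m *\<^sub>v x" "of_real s"] by simp
  qed
  then have eq: "w * of_real q1 = of_real (s * q0)" by simp
  from w show ?thesis
  proof
    assume neg: "Re w < 0"
    have "Re w * q1 = s * q0" using arg_cong[OF eq, of Re] by simp
    then have "Re w * q1 \<ge> 0" using s q0(1) by simp
    then have "q1 = 0" using neg q1(1) by (simp add: zero_le_mult_iff)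
    then show ?thesis using q1(3) by simp
  next
    \<comment> \<open>Now \<open>w = 0\<close> and \<open>s > 0\<close> give \<open>q0 = 0\<close>,
      hence \<open>u = 0\<close> and \<open>f1 x = 0\<close>. Exactness provides
      \<open>x = f0 z\<close>, and then \<open>q1\<close> is the product of \<open>z\<close> with
      \<open>u\<close>, which is 0.\<close>
    assume z: "w = 0 \<and> s > 0 \<and> (\<forall>x\<in>carrier_vec r1. f1 *\<^sub>v x = 0\<^sub>v r0 \<longrightarrow> (\<exists>z\<in>carrier_vec r0. x = f0 *\<^sub>v z))"
    then have "q0 = 0" using eq by simp
    then have u0: "u = 0\<^sub>v r0" using q0(3) by simp
    then have "n *\<^sub>v u = 0\<^sub>v r0" using nc by (intro eq_vecI) auto
    then have "f1 *\<^sub>v x = 0\<^sub>v r0" unfolding f1x by (intro eq_vecI) auto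
    then obtain z where zc: "z \<in> carrier_vec r0" "x = f0 *\<^sub>v z" using z x by blast
    have "hdot x (m *\<^sub>v x) = hdot z u" unfolding u_def using hdot_adj[OF f0 zc(1) mx] zc(2) by simp
    then have "q1 = 0" using q1(2) u0 hdot_zero_right[OF carrier_vecD[OF zc(1)]] by simp
    then show ?thesis using q1(3) by simp
  qed
qed

text \<open>At \<open>s = 1\<close> and with standard metrics the perturbed maps are injective in
  both directions, since the hypotheses are symmetric in \<open>f0\<close> and \<open>f1\<close>.
  This compares dimensions for \<open>Re w < 0\<close> and for exact fibres over
  \<open>w = 0\<close> by one argument.\<close>

lemma acyclic_ranks_eq:
  assumes f0: "f0 \<in> carrier_mat r1 r0" and f1: "f1 \<in> carrier_mat r0 r1"
    and ff: "f0 * f1 = w \<cdot>\<^sub>m 1\<^sub>m r1" "f1 * f0 = w \<cdot>\<^sub>m 1\<^sub>m r0"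
    and w: "Re w < 0 \<or> w = 0 \<and> (\<forall>x\<in>carrier_vec r1. f1 *\<^sub>v x = 0\<^sub>v r0 \<longrightarrow> (\<exists>z\<in>carrier_vec r0. x = f0 *\<^sub>v z))
      \<and> (\<forall>x\<in>carrier_vec r0. f0 *\<^sub>v x = 0\<^sub>v r1 \<longrightarrow> (\<exists>z\<in>carrier_vec r1. x = f1 *\<^sub>v z))"
  shows "r1 = r0"
proof (rule antisym)
  show "r1 \<le> r0"
    by (rule inj_mat_dim[of "f1 - of_real 1 \<cdot>\<^sub>m (1\<^sub>m r0 * adj f0 * 1\<^sub>m r1)"])
      (use f0 f1 w perturbed_injective[OF f0 f1 ff(1) posdef_one posdef_one, of 1] in auto)
  show "r0 \<le> r1"
    by (rule inj_mat_dim[of "f0 - of_real 1 \<cdot>\<^sub>m (1\<^sub>m r1 * adj f1 * 1\<^sub>m r0)"])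
      (use f0 f1 w perturbed_injective[OF f1 f0 ff(2) posdef_one posdef_one, of 1] in auto)
qed

section \<open>Vector bundles and two-term complexes\<close>

text \<open>The local condition shared by transition functions and bundle maps: \<open>h\<close> is
  the coordinate matrix of \<open>F\<close> in the frame \<open>G\<close>. Continuity is asked of
  \<open>h\<close> alone, because the identifications of the fibres with standard spaces vary
  arbitrarily from point to point.\<close>

definition factors_on :: "'a::topological_space set \<Rightarrow> ('a \<Rightarrow> nat) \<Rightarrow> ('a \<Rightarrow> nat) \<Rightarrow> ('a \<Rightarrow> complex mat) \<Rightarrow> ('a \<Rightarrow> complex mat) \<Rightarrow> bool" where
  "factors_on W r c F G \<longleftrightarrow> (\<exists>h. continuous_mat_on W h \<and> (\<forall>y\<in>W. h y \<in> carrier_mat (r y) (c y) \<and> F y = G y * h y))"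

definition frame_on :: "'a::topological_space set \<Rightarrow> 'a vbundle \<Rightarrow> 'a set \<Rightarrow> ('a \<Rightarrow> complex mat) \<Rightarrow> bool" where
  "frame_on A E V g \<longleftrightarrow> openin (top_of_set A) (A \<inter> V) \<and>
     (\<exists>r. \<forall>y\<in>A \<inter> V. vrank E y = r \<and> g y \<in> carrier_mat r r \<and> invertible_mat (g y))"

lemma vbundle_on_iff:
  "vbundle_on A E \<longleftrightarrow> (\<forall>V g. (V, g) \<in> frames E \<longrightarrow> frame_on A E V g) \<and>
     (\<forall>V g V' g'. (V, g) \<in> frames E \<longrightarrow> (V', g') \<in> frames E \<longrightarrow> factors_on (A \<inter> V \<inter> V') (vrank E) (vrank E) g' g) \<and>
     (\<forall>y\<in>A. \<exists>V g. (V, g) \<in> frames E \<and> y \<in> V)"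
  unfolding vbundle_on_def frame_on_def factors_on_def by (simp only: Ball_def Bex_def split_paired_All split_paired_Ex case_prod_conv) blast

lemma vbundle_map_iff:
  "vbundle_map A E F p \<longleftrightarrow> (\<forall>y\<in>A. p y \<in> carrier_mat (vrank F y) (vrank E y)) \<and>
     (\<forall>V g V' g'. (V, g) \<in> frames E \<longrightarrow> (V', g') \<in> frames F \<longrightarrow>
        factors_on (A \<inter> V \<inter> V') (vrank F) (vrank E) (\<lambda>y. p y * g y) g')"
  unfolding vbundle_map_def factors_on_def by (simp only: Ball_def split_paired_All case_prod_conv) blast

lemmas vbundle_onI = vbundle_on_iff[THEN iffD2, OF conjI[OF _ conjI], rule_format]
  and vbundle_mapI = vbundle_map_iff[THEN iffD2, OF conjI, rule_format]

lemma vbundle_onD: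
  assumes "vbundle_on A E"
  shows vbundle_on_frame: "(V, g) \<in> frames E \<Longrightarrow> frame_on A E V g"
    and vbundle_on_factors: "(V, g) \<in> frames E \<Longrightarrow> (V', g') \<in> frames E \<Longrightarrow> factors_on (A \<inter> V \<inter> V') (vrank E) (vrank E) g' g"
    and vbundle_on_cover: "y \<in> A \<Longrightarrow> (\<And>V g. (V, g) \<in> frames E \<Longrightarrow> y \<in> V \<Longrightarrow> thesis) \<Longrightarrow> thesis"
  using assms unfolding vbundle_on_iff by blast+

lemma vbundle_mapD:
  assumes "vbundle_map A E F p"
  shows vbundle_map_carrier: "y \<in> A \<Longrightarrow> p y \<in> carrier_mat (vrank F y) (vrank E y)"
    and vbundle_map_factors: "(V, g) \<in> frames E \<Longrightarrow> (V', g') \<in> frames F \<Longrightarrow>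
      factors_on (A \<inter> V \<inter> V') (vrank F) (vrank E) (\<lambda>y. p y * g y) g'"
  using assms unfolding vbundle_map_iff by blast+

lemma factors_onI:
  assumes "continuous_mat_on W h" "\<And>y. y \<in> W \<Longrightarrow> h y \<in> carrier_mat (r y) (c y)" "\<And>y. y \<in> W \<Longrightarrow> F y = G y * h y"
  shows "factors_on W r c F G"
  using assms unfolding factors_on_def by blast

lemma factors_onE:
  assumes "factors_on W r c F G"
  obtains h where "continuous_mat_on W h" "\<And>y. y \<in> W \<Longrightarrow> h y \<in> carrier_mat (r y) (c y)" "\<And>y. y \<in> W \<Longrightarrow> F y = G y * h y"
  using assms unfolding factors_on_def by blast

text \<open>Slices and cylinders are pullbacks along a continuous \<open>q\<close>; continuity of
  coordinates is transported here once for both.\<close>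

lemma factors_on_pullback:
  assumes "factors_on W r c F G" "continuous_on D q" "q ` D \<subseteq> W"
  shows "factors_on D (\<lambda>y. r (q y)) (\<lambda>y. c (q y)) (\<lambda>y. F (q y)) (\<lambda>y. G (q y))"
proof -
  obtain h where h: "continuous_mat_on W h" "\<And>y. y \<in> W \<Longrightarrow> h y \<in> carrier_mat (r y) (c y)" "\<And>y. y \<in> W \<Longrightarrow> F y = G y * h y"
    using assms(1) by (rule factors_onE) blast
  show ?thesis
    by (rule factors_onI[of _ "\<lambda>y. h (q y)"])
      (use h(2,3) assms(3) continuous_mat_on_compose[OF h(1) assms(2,3)] in auto)
qed

lemma factors_on_subset: "factors_on W r c F G \<Longrightarrow> D \<subseteq> W \<Longrightarrow> factors_on D r c F G"
  unfolding factors_on_def using continuous_mat_on_subset by blast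

lemma frame_on_pullback:
  assumes "frame_on A E V g" "continuous_on D q" "q ` D \<subseteq> A" "vrank E' = (\<lambda>y. vrank E (q y))" "V' = q -` V"
  shows "frame_on D E' V' (\<lambda>y. g (q y))"
proof -
  have D: "D \<inter> V' = D \<inter> q -` (A \<inter> V)" using assms(3,5) by blast
  have "openin (top_of_set D) (D \<inter> V')"
    unfolding D by (rule continuous_openin_preimage[OF assms(2) _ assms(1)[unfolded frame_on_def, THEN conjunct1]])
      (use assms(3) in blast)
  then show ?thesis using assms(1,3-5) unfolding frame_on_def by (simp add: image_subset_iff) blast
qed

lemmas vbundle_on_openin = vbundle_on_frame[unfolded frame_on_def, THEN conjunct1]

lemma vbundle_on_rank:
  assumes "vbundle_on A E" "(V, g) \<in> frames E"
  obtains r where "\<And>y. y \<in> A \<inter> V \<Longrightarrow> vrank E y = r" "\<And>y. y \<in> A \<inter> V \<Longrightarrow> g y \<in> carrier_mat r r"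
    "\<And>y. y \<in> A \<inter> V \<Longrightarrow> invertible_mat (g y)"
  using vbundle_on_frame[OF assms] unfolding frame_on_def by blast

lemma vbundle_on_frame_carrier:
  assumes "vbundle_on A E" "(V, g) \<in> frames E" "y \<in> A" "y \<in> V"
  shows "g y \<in> carrier_mat (vrank E y) (vrank E y)" "invertible_mat (g y)"
  using vbundle_on_frame[OF assms(1,2)] assms(3,4) unfolding frame_on_def by auto

lemma vbundle_on_subset:
  assumes E: "vbundle_on A E" and B: "B \<subseteq> A" shows "vbundle_on B E"
proof (rule vbundle_onI)
  show "frame_on B E V g" if "(V, g) \<in> frames E" for V g
    using frame_on_pullback[OF vbundle_on_frame[OF E that] continuous_on_id, of B E V] B by simp
  show "factors_on (B \<inter> V \<inter> V') (vrank E) (vrank E) g' g" if "(V, g) \<in> frames E" "(V', g') \<in> frames E" for V g V' g'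
    by (rule factors_on_subset[OF vbundle_on_factors[OF E that]]) (use B in blast)
  show "\<exists>V g. (V, g) \<in> frames E \<and> y \<in> V" if "y \<in> B" for y
    using that B by (auto intro: vbundle_on_cover[OF E, of y])
qed

lemma vbundle_map_subset:
  assumes p: "vbundle_map A E F p" and B: "B \<subseteq> A" shows "vbundle_map B E F p"
proof (rule vbundle_mapI)
  show "p y \<in> carrier_mat (vrank F y) (vrank E y)" if "y \<in> B" for y
    using vbundle_map_carrier[OF p] that B by blast
  show "factors_on (B \<inter> V \<inter> V') (vrank F) (vrank E) (\<lambda>y. p y * g y) g'" if "(V, g) \<in> frames E" "(V', g') \<in> frames F" for V g V' g'
    by (rule factors_on_subset[OF vbundle_map_factors[OF p that]]) (use B in blast)
qed

lemma vbundle_map_zero: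
  assumes E: "vbundle_on A E" and F: "vbundle_on A F"
  shows "vbundle_map A E F (\<lambda>y. 0\<^sub>m (vrank F y) (vrank E y))"
proof (rule vbundle_mapI)
  fix V g V' g' assume Vg: "(V, g) \<in> frames E" "(V', g') \<in> frames F"
  show "factors_on (A \<inter> V \<inter> V') (vrank F) (vrank E) (\<lambda>y. 0\<^sub>m (vrank F y) (vrank E y) * g y) g'"
  proof (rule factors_onI[of _ "\<lambda>y. 0\<^sub>m (vrank F y) (vrank E y)"])
    show "continuous_mat_on (A \<inter> V \<inter> V') (\<lambda>y. 0\<^sub>m (vrank F y) (vrank E y))"
      unfolding continuous_mat_on_def
      by (intro allI continuous_on_eq[OF continuous_on_const[of _ 0]]) (simp add: entry_def)
    fix y assume "y \<in> A \<inter> V \<inter> V'"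
    then have "g y \<in> carrier_mat (vrank E y) (vrank E y)" "g' y \<in> carrier_mat (vrank F y) (vrank F y)"
      using vbundle_on_frame_carrier(1)[OF E Vg(1)] vbundle_on_frame_carrier(1)[OF F Vg(2)] by auto
    then show "0\<^sub>m (vrank F y) (vrank E y) * g y = g' y * 0\<^sub>m (vrank F y) (vrank E y)"
      using left_mult_zero_mat right_mult_zero_mat by metis
  qed simp
qed simp

lemma vbundle_on_zero_bundle: "vbundle_on A zero_bundle"
proof (rule vbundle_onI)
  have "invertible_mat (1\<^sub>m 0 :: complex mat)" by (rule invertible_matI[of _ 0 "1\<^sub>m 0"]) simp_all
  then show "frame_on A zero_bundle V g" if "(V, g) \<in> frames zero_bundle" for V g
    using that unfolding frame_on_def zero_bundle_def by simp
  show "factors_on (A \<inter> V \<inter> V') (vrank zero_bundle) (vrank zero_bundle) g' g"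
    if "(V, g) \<in> frames zero_bundle" "(V', g') \<in> frames zero_bundle" for V g V' g'
    by (rule factors_onI[of _ "\<lambda>y. 1\<^sub>m 0"]) (use that in \<open>auto simp: zero_bundle_def continuous_mat_on_def entry_def\<close>)
qed (simp add: zero_bundle_def)

lemma vrank_zero_bundle [simp]: "vrank zero_bundle y = 0" by (simp add: zero_bundle_def)

definition two_term_bundle :: "'a vbundle \<Rightarrow> 'a vbundle \<Rightarrow> int \<Rightarrow> 'a vbundle" where
  "two_term_bundle B1 B0 i = (if i = -1 then B1 else if i = 0 then B0 else zero_bundle)"

text \<open>Besides \<open>an_complex\<close> this form covers the complexes on cylinders and the
  perturbed complexes, so that exactness and slices are treated in general.\<close>

definition two_term :: "'a vbundle \<Rightarrow> 'a vbundle \<Rightarrow> ('a \<Rightarrow> complex mat) \<Rightarrow> 'a vcomplex" where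
  "two_term B1 B0 d = \<lparr>cbun = two_term_bundle B1 B0,
     cdiff = (\<lambda>i y. if i = -1 then d y
       else 0\<^sub>m (vrank (two_term_bundle B1 B0 (i + 1)) y) (vrank (two_term_bundle B1 B0 i) y))\<rparr>"

lemma an_complex_two_term: "an_complex Y E = two_term (an_bundle Y (mE1 E)) (an_bundle Y (mE0 E)) (phi1 E)"
  unfolding an_complex_def two_term_def an_complex_bundle_def[abs_def] two_term_bundle_def[abs_def] ..

lemma cbun_two_term [simp]: "cbun (two_term B1 B0 d) = two_term_bundle B1 B0"
  by (simp add: two_term_def)

lemma vbundle_on_two_term_bundle: "vbundle_on A B1 \<Longrightarrow> vbundle_on A B0 \<Longrightarrow> vbundle_on A (two_term_bundle B1 B0 i)"
  unfolding two_term_bundle_def using vbundle_on_zero_bundle[of A] by simp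

lemma cdiff_two_term: "cdiff (two_term B1 B0 d) i = (if i = -1 then d
    else (\<lambda>y. 0\<^sub>m (vrank (two_term_bundle B1 B0 (i + 1)) y) (vrank (two_term_bundle B1 B0 i) y)))"
  by (rule ext) (simp add: two_term_def)

lemma vbundle_map_two_term:
  assumes "vbundle_on A B1" "vbundle_on A B0" "vbundle_map A B1 B0 d"
  shows "vbundle_map A (two_term_bundle B1 B0 i) (two_term_bundle B1 B0 (i + 1)) (cdiff (two_term B1 B0 d) i)"
proof (cases "i = -1")
  case True
  then show ?thesis using assms(3) by (simp add: two_term_bundle_def cdiff_two_term)
next
  case False
  then show ?thesis using vbundle_map_zero[OF vbundle_on_two_term_bundle[OF assms(1,2), of i] vbundle_on_two_term_bundle[OF assms(1,2), of "i + 1"]]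
    by (simp add: cdiff_two_term)
qed

lemma complex_on_two_term:
  assumes "vbundle_on A B1" "vbundle_on A B0" "vbundle_map A B1 B0 d"
  shows "complex_on A (two_term B1 B0 d)"
  unfolding complex_on_def cbun_two_term
proof (intro conjI allI ballI vbundle_on_two_term_bundle[OF assms(1,2)] vbundle_map_two_term[OF assms])
  fix i y assume y: "y \<in> A"
  have c: "cdiff (two_term B1 B0 d) i y \<in> carrier_mat (vrank (two_term_bundle B1 B0 (i + 1)) y) (vrank (two_term_bundle B1 B0 i) y)" for i
    by (rule vbundle_map_carrier[OF vbundle_map_two_term[OF assms] y])
  have c': "cdiff (two_term B1 B0 d) (i + 1) y \<in> carrier_mat (vrank (two_term_bundle B1 B0 (i + 2)) y) (vrank (two_term_bundle B1 B0 (i + 1)) y)"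
    using c[of "i + 1"] by (simp add: add.commute)
  show "cdiff (two_term B1 B0 d) (i + 1) y * cdiff (two_term B1 B0 d) i y
      = 0\<^sub>m (vrank (two_term_bundle B1 B0 (i + 2)) y) (vrank (two_term_bundle B1 B0 i) y)"
  \<comment> \<open>Of two consecutive differentials one is always a zero matrix, since only the one
    in degree -1 is given by \<open>d\<close>.\<close>
  proof (cases "i = -1")
    case True
    then have "cdiff (two_term B1 B0 d) (i + 1) y = 0\<^sub>m (vrank (two_term_bundle B1 B0 (i + 2)) y) (vrank (two_term_bundle B1 B0 (i + 1)) y)"
      by (simp add: cdiff_two_term)
    then show ?thesis using c[of i] by simp
  next
    case False
    then have "cdiff (two_term B1 B0 d) i y = 0\<^sub>m (vrank (two_term_bundle B1 B0 (i + 1)) y) (vrank (two_term_bundle B1 B0 i) y)"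
      by (simp add: cdiff_two_term)
    then show ?thesis using c' by simp
  qed
next
  show "\<exists>N. \<forall>i. \<bar>i\<bar> > N \<longrightarrow> (\<forall>y\<in>A. vrank (two_term_bundle B1 B0 i) y = 0)"
    by (rule exI[of _ 1]) (auto simp: two_term_bundle_def)
qed

lemma mat_ker_zero: "mat_ker (0\<^sub>m r c) = carrier_vec c"
  unfolding mat_ker_def by (auto intro!: eq_vecI)

lemma mat_range_zero: "mat_range (0\<^sub>m r c) = {0\<^sub>v r}"
proof -
  have "0\<^sub>m r c *\<^sub>v x = (0\<^sub>v r :: complex Matrix.vec)" if "x \<in> carrier_vec c" for x
    using that by (intro eq_vecI) auto
  moreover have "0\<^sub>v c \<in> carrier_vec c" by simp
  ultimately show ?thesis unfolding mat_range_def by (auto intro!: image_eqI[of _ _ "0\<^sub>v c"])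
qed

lemma carrier_vec_0: "carrier_vec 0 = {0\<^sub>v 0 :: complex Matrix.vec}"
  by (auto intro!: eq_vecI)

lemma mat_ker_carrier: "M \<in> carrier_mat r c \<Longrightarrow> mat_ker M = {x \<in> carrier_vec c. M *\<^sub>v x = 0\<^sub>v r}"
  unfolding mat_ker_def by auto

lemma exact_on_two_term:
  assumes "\<And>y. y \<in> B \<Longrightarrow> mat_ker (d y) = {0\<^sub>v (vrank B1 y)}" "\<And>y. y \<in> B \<Longrightarrow> mat_range (d y) = carrier_vec (vrank B0 y)"
  shows "exact_on B (two_term B1 B0 d)"
  unfolding exact_on_def
proof (intro ballI allI)
  fix y and i :: int assume y: "y \<in> B"
  \<comment> \<open>Injectivity of \<open>d\<close> is exactness in degree -1 and surjectivity is
    exactness in degree 0; elsewhere all spaces are zero.\<close>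
  consider "i = -1" | "i = 0" | "i \<noteq> -1" "i \<noteq> 0" by blast
  then show "mat_ker (cdiff (two_term B1 B0 d) i y) = mat_range (cdiff (two_term B1 B0 d) (i - 1) y)"
  proof cases
    case 1
    then show ?thesis using assms(1)[OF y] by (simp add: cdiff_two_term two_term_bundle_def mat_range_zero)
  next
    case 2
    then show ?thesis using assms(2)[OF y] by (simp add: cdiff_two_term two_term_bundle_def mat_ker_zero)
  next
    case 3
    then have "i - 1 \<noteq> -1" by simp
    then show ?thesis using 3 by (simp add: cdiff_two_term two_term_bundle_def mat_range_zero mat_ker_zero carrier_vec_0)
  qed
qed

lemma exact_on_two_term_inj:
  assumes c: "\<And>y. y \<in> B \<Longrightarrow> d y \<in> carrier_mat (vrank B0 y) (vrank B1 y)"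
    and r: "\<And>y. y \<in> B \<Longrightarrow> vrank B1 y = vrank B0 y"
    and inj: "\<And>y x. y \<in> B \<Longrightarrow> x \<in> carrier_vec (vrank B1 y) \<Longrightarrow> d y *\<^sub>v x = 0\<^sub>v (vrank B0 y) \<Longrightarrow> x = 0\<^sub>v (vrank B1 y)"
  shows "exact_on B (two_term B1 B0 d)"
proof (rule exact_on_two_term)
  fix y assume y: "y \<in> B"
  have "d y *\<^sub>v 0\<^sub>v (vrank B1 y) = 0\<^sub>v (vrank B0 y)" using c[OF y] by (intro eq_vecI) auto
  then show "mat_ker (d y) = {0\<^sub>v (vrank B1 y)}" unfolding mat_ker_carrier[OF c[OF y]] using inj[OF y] by auto
  show "mat_range (d y) = carrier_vec (vrank B0 y)"
    by (rule inj_mat_surj) (use c[OF y] r[OF y] inj[OF y] in simp_all)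
qed

lemma short_exact_two_term:
  assumes B: "vbundle_on A B1" "vbundle_on A B0" and C: "vbundle_on A C1" "vbundle_on A C0" and D: "vbundle_on A D1" "vbundle_on A D0"
    and f: "vbundle_map A B1 C1 f1" "vbundle_map A B0 C0 f0" and g: "vbundle_map A C1 D1 g1" "vbundle_map A C0 D0 g0"
    and d: "vbundle_map A B1 B0 dB" "vbundle_map A C1 C0 dC" "vbundle_map A D1 D0 dD"
    and comm: "\<And>y. y \<in> A \<Longrightarrow> f0 y * dB y = dC y * f1 y" "\<And>y. y \<in> A \<Longrightarrow> g0 y * dC y = dD y * g1 y"
    and ex1: "\<And>y. y \<in> A \<Longrightarrow> mat_ker (f1 y) = {0\<^sub>v (vrank B1 y)} \<and> mat_ker (g1 y) = mat_range (f1 y) \<and> mat_range (g1 y) = carrier_vec (vrank D1 y)"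
    and ex0: "\<And>y. y \<in> A \<Longrightarrow> mat_ker (f0 y) = {0\<^sub>v (vrank B0 y)} \<and> mat_ker (g0 y) = mat_range (f0 y) \<and> mat_range (g0 y) = carrier_vec (vrank D0 y)"
  shows "short_exact A (two_term B1 B0 dB) (two_term C1 C0 dC) (two_term D1 D0 dD)"
proof -
  \<comment> \<open>Outside the degrees -1 and 0 both complexes have rank 0, so the components there
    are empty matrices.\<close>
  define m where "m f1 f0 = (\<lambda>i. if i = -1 then f1 else if i = (0 :: int) then f0 else (\<lambda>y. 0\<^sub>m 0 0))"
    for f1 f0 :: "'a \<Rightarrow> complex mat"
  have cm: "complex_map A (two_term B1 B0 dB) (two_term C1 C0 dC) (m f1 f0)"
    if B: "vbundle_on A B1" "vbundle_on A B0" and C: "vbundle_on A C1" "vbundle_on A C0"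
      and f: "vbundle_map A B1 C1 f1" "vbundle_map A B0 C0 f0"
      and d: "vbundle_map A B1 B0 dB" "vbundle_map A C1 C0 dC" and comm: "\<And>y. y \<in> A \<Longrightarrow> f0 y * dB y = dC y * f1 y"
    for B1 B0 C1 C0 f1 f0 dB dC
  proof -
    have z: "vbundle_map A zero_bundle zero_bundle (\<lambda>y. 0\<^sub>m 0 0)"
      using vbundle_map_zero[OF vbundle_on_zero_bundle vbundle_on_zero_bundle, of A] by simp
    have mm: "vbundle_map A (two_term_bundle B1 B0 i) (two_term_bundle C1 C0 i) (m f1 f0 i)" for i
      unfolding two_term_bundle_def m_def using f z by simp
    have "m f1 f0 (i + 1) y * cdiff (two_term B1 B0 dB) i y = cdiff (two_term C1 C0 dC) i y * m f1 f0 i y" if y: "y \<in> A" for i y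
    proof -
    note c = vbundle_map_carrier[OF mm y] and dc = vbundle_map_carrier[OF vbundle_map_two_term[OF B d(1)] y]
      vbundle_map_carrier[OF vbundle_map_two_term[OF C d(2)] y]
    show ?thesis
    proof (cases "i = -1")
      case True
      then show ?thesis using comm[OF y] by (simp add: m_def cdiff_two_term)
    next
      case False
      then show ?thesis using c[of i] c[of "i + 1"] by (simp add: cdiff_two_term)
    qed
    qed
    then show ?thesis unfolding complex_map_def cbun_two_term using mm by blast
  qed
  show ?thesis
    unfolding short_exact_def cbun_two_term
  proof (rule exI[of _ "m f1 f0"], rule exI[of _ "m g1 g0"], intro conjI)
    show "complex_map A (two_term B1 B0 dB) (two_term C1 C0 dC) (m f1 f0)" by (rule cm[OF B C f d(1,2) comm(1)])
    show "complex_map A (two_term C1 C0 dC) (two_term D1 D0 dD) (m g1 g0)" by (rule cm[OF C D g d(2,3) comm(2)])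
    have "mat_ker (m f1 f0 i y) = {0\<^sub>v (vrank (two_term_bundle B1 B0 i) y)} \<and> mat_ker (m g1 g0 i y) = mat_range (m f1 f0 i y)
      \<and> mat_range (m g1 g0 i y) = carrier_vec (vrank (two_term_bundle D1 D0 i) y)" if "y \<in> A" for i y
      using ex1[OF that] ex0[OF that] by (auto simp: m_def two_term_bundle_def mat_ker_zero mat_range_zero carrier_vec_0)
    then show "\<forall>i. \<forall>y\<in>A. mat_ker (m f1 f0 i y) = {0\<^sub>v (vrank (two_term_bundle B1 B0 i) y)} \<and> mat_ker (m g1 g0 i y) = mat_range (m f1 f0 i y)
      \<and> mat_range (m g1 g0 i y) = carrier_vec (vrank (two_term_bundle D1 D0 i) y)" by blast
  qed
qed

section \<open>Slices and cylinders\<close>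

lemma frames_slice: "(V, g) \<in> frames (slice_bundle t E) \<longleftrightarrow> (\<exists>V' g'. (V', g') \<in> frames E \<and> V = {y. (y, t) \<in> V'} \<and> g = (\<lambda>y. g' (y, t)))"
  unfolding slice_bundle_def by auto

lemma vrank_slice [simp]: "vrank (slice_bundle t E) y = vrank E (y, t)" by (simp add: slice_bundle_def)

lemma continuous_on_slice: "continuous_on D (\<lambda>y. (y, t))" by (intro continuous_intros)

lemma vbundle_on_slice:
  assumes E: "vbundle_on (A \<times> I) E" and t: "t \<in> I" shows "vbundle_on A (slice_bundle t E)"
proof (rule vbundle_onI)
  show "frame_on A (slice_bundle t E) V g" if "(V, g) \<in> frames (slice_bundle t E)" for V g
  proof -
    obtain V0 g0 where Vg: "(V0, g0) \<in> frames E" "V = {y. (y, t) \<in> V0}" "g = (\<lambda>y. g0 (y, t))"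
      using \<open>(V, g) \<in> _\<close> unfolding frames_slice by blast
    show ?thesis unfolding Vg(3)
      by (rule frame_on_pullback[OF vbundle_on_frame[OF E Vg(1)] continuous_on_slice]) (use t in \<open>auto simp: Vg(2)\<close>)
  qed
  show "factors_on (A \<inter> V \<inter> V') (vrank (slice_bundle t E)) (vrank (slice_bundle t E)) g' g"
    if "(V, g) \<in> frames (slice_bundle t E)" "(V', g') \<in> frames (slice_bundle t E)" for V g V' g'
  proof -
    obtain V0 g0 V1 g1 where Vg: "(V0, g0) \<in> frames E" "V = {y. (y, t) \<in> V0}" "g = (\<lambda>y. g0 (y, t))"
      "(V1, g1) \<in> frames E" "V' = {y. (y, t) \<in> V1}" "g' = (\<lambda>y. g1 (y, t))"
      using \<open>(V, g) \<in> _\<close> \<open>(V', g') \<in> _\<close> unfolding frames_slice by blast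
    show ?thesis unfolding Vg(3,6) slice_bundle_def vbundle.simps
      by (rule factors_on_pullback[OF vbundle_on_factors[OF E Vg(1,4)] continuous_on_slice]) (use t in \<open>auto simp: Vg(2,5)\<close>)
  qed
  show "\<exists>V g. (V, g) \<in> frames (slice_bundle t E) \<and> y \<in> V" if "y \<in> A" for y
  proof -
    have "(y, t) \<in> A \<times> I" using that t by simp
    then obtain V g where "(V, g) \<in> frames E" "(y, t) \<in> V" by (rule vbundle_on_cover[OF E])
    then show ?thesis unfolding frames_slice by blast
  qed
qed

lemma vbundle_map_slice:
  assumes p: "vbundle_map (A \<times> I) E F p" and t: "t \<in> I"
  shows "vbundle_map A (slice_bundle t E) (slice_bundle t F) (\<lambda>y. p (y, t))"
proof (rule vbundle_mapI)
  show "p (y, t) \<in> carrier_mat (vrank (slice_bundle t F) y) (vrank (slice_bundle t E) y)" if "y \<in> A" for y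
    using vbundle_map_carrier[OF p, of "(y, t)"] that t by simp
  fix V g V' g' assume "(V, g) \<in> frames (slice_bundle t E)" "(V', g') \<in> frames (slice_bundle t F)"
  then obtain V0 g0 V1 g1 where Vg: "(V0, g0) \<in> frames E" "V = {y. (y, t) \<in> V0}" "g = (\<lambda>y. g0 (y, t))"
    "(V1, g1) \<in> frames F" "V' = {y. (y, t) \<in> V1}" "g' = (\<lambda>y. g1 (y, t))" unfolding frames_slice by blast
  show "factors_on (A \<inter> V \<inter> V') (vrank (slice_bundle t F)) (vrank (slice_bundle t E)) (\<lambda>y. p (y, t) * g y) g'"
    unfolding Vg(3,6) slice_bundle_def vbundle.simps
    by (rule factors_on_pullback[OF vbundle_map_factors[OF p Vg(1,4)] continuous_on_slice]) (use t in \<open>auto simp: Vg(2,5)\<close>)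
qed

lemma slice_rel_complexes:
  assumes C: "C \<in> rel_complexes (A \<times> I) (B \<times> I)" and t: "t \<in> I" shows "slice t C \<in> rel_complexes A B"
proof -
  have co: "complex_on (A \<times> I) C" and ex: "exact_on (B \<times> I) C" using C unfolding rel_complexes_def by simp_all
  have bun: "\<And>i. vbundle_on (A \<times> I) (cbun C i)" "\<And>i. vbundle_map (A \<times> I) (cbun C i) (cbun C (i + 1)) (cdiff C i)"
    using co unfolding complex_on_def by blast+
  have sq: "cdiff C (i + 1) z * cdiff C i z = 0\<^sub>m (vrank (cbun C (i + 2)) z) (vrank (cbun C i) z)" if "z \<in> A \<times> I" for i z
    using co that unfolding complex_on_def by blast
  obtain n where n: "\<forall>i. \<bar>i\<bar> > n \<longrightarrow> (\<forall>z\<in>A \<times> I. vrank (cbun C i) z = 0)" using co unfolding complex_on_def by blast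
  have s: "cbun (slice t C) = (\<lambda>i. slice_bundle t (cbun C i))" "cdiff (slice t C) = (\<lambda>i y. cdiff C i (y, t))"
    unfolding slice_def by simp_all
  have "complex_on A (slice t C)"
    unfolding complex_on_def s
  proof (intro conjI allI ballI)
    show "vbundle_on A (slice_bundle t (cbun C i))" for i by (rule vbundle_on_slice[OF bun(1) t])
    show "vbundle_map A (slice_bundle t (cbun C i)) (slice_bundle t (cbun C (i + 1))) (\<lambda>y. cdiff C i (y, t))" for i
      by (rule vbundle_map_slice[OF bun(2) t])
    show "cdiff C (i + 1) (y, t) * cdiff C i (y, t) = 0\<^sub>m (vrank (slice_bundle t (cbun C (i + 2))) y) (vrank (slice_bundle t (cbun C i)) y)"
      if "y \<in> A" for i y using sq[of "(y, t)" i] that t by simp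
    show "\<exists>N. \<forall>i. \<bar>i\<bar> > N \<longrightarrow> (\<forall>y\<in>A. vrank (slice_bundle t (cbun C i)) y = 0)"
      by (rule exI[of _ n]) (use n t in simp)
  qed
  moreover have "exact_on B (slice t C)" using ex t unfolding exact_on_def s by simp
  ultimately show ?thesis unfolding rel_complexes_def by simp
qed

definition cyl_bundle :: "'a vbundle \<Rightarrow> ('a \<times> real) vbundle" where
  "cyl_bundle E = \<lparr>vrank = (\<lambda>z. vrank E (fst z)), frames = {(V \<times> UNIV, \<lambda>z. g (fst z)) | V g. (V, g) \<in> frames E}\<rparr>"

lemma frames_cyl: "(V, g) \<in> frames (cyl_bundle E) \<longleftrightarrow> (\<exists>V' g'. (V', g') \<in> frames E \<and> V = V' \<times> UNIV \<and> g = (\<lambda>z. g' (fst z)))"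
  unfolding cyl_bundle_def by auto

lemma vrank_cyl [simp]: "vrank (cyl_bundle E) z = vrank E (fst z)" by (simp add: cyl_bundle_def)

text \<open>An equality of records is wanted and not just an isomorphism: the homotopy relation of
  \<open>Ktop\<close> involves the very generators \<open>slice 0 C\<close> and
  \<open>slice 1 C\<close>.\<close>

lemma slice_cyl: "slice_bundle t (cyl_bundle E) = E"
proof -
  have "frames (slice_bundle t (cyl_bundle E)) = frames E"
  proof (intro Set.set_eqI iffI)
    fix p assume "p \<in> frames (slice_bundle t (cyl_bundle E))"
    then show "p \<in> frames E" by (cases p) (auto simp: frames_slice frames_cyl)
  next
    fix p assume p: "p \<in> frames E"
    obtain V g where Vg: "p = (V, g)" by (cases p)
    have "(V \<times> UNIV, \<lambda>z. g (fst z)) \<in> frames (cyl_bundle E)" unfolding frames_cyl using p Vg by blast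
    then show "p \<in> frames (slice_bundle t (cyl_bundle E))" unfolding Vg frames_slice
      by (intro exI[of _ "V \<times> UNIV"] exI[of _ "\<lambda>z. g (fst z)"]) simp
  qed
  moreover have "vrank (slice_bundle t (cyl_bundle E)) = vrank E" by (rule ext) simp
  ultimately show ?thesis by (simp add: slice_bundle_def)
qed

lemma slice_zero_bundle: "slice_bundle t zero_bundle = zero_bundle"
  unfolding slice_bundle_def zero_bundle_def by simp

lemma slice_two_term: "slice t (two_term B1 B0 d) = two_term (slice_bundle t B1) (slice_bundle t B0) (\<lambda>y. d (y, t))"
proof -
  have b: "slice_bundle t (two_term_bundle B1 B0 i) = two_term_bundle (slice_bundle t B1) (slice_bundle t B0) i" for i
    unfolding two_term_bundle_def by (simp add: slice_zero_bundle)
  have r: "vrank (two_term_bundle (slice_bundle t B1) (slice_bundle t B0) i) y = vrank (two_term_bundle B1 B0 i) (y, t)" for i y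
    unfolding b[symmetric] by simp
  show ?thesis unfolding slice_def two_term_def by (auto simp: fun_eq_iff b r)
qed

lemma vbundle_on_cyl:
  assumes E: "vbundle_on A E" shows "vbundle_on (A \<times> I) (cyl_bundle E)"
proof (rule vbundle_onI)
  have c: "continuous_on D fst" for D :: "('a \<times> real) set" by (rule continuous_on_fst[OF continuous_on_id])
  show "frame_on (A \<times> I) (cyl_bundle E) V g" if "(V, g) \<in> frames (cyl_bundle E)" for V g
  proof -
    obtain V0 g0 where Vg: "(V0, g0) \<in> frames E" "V = V0 \<times> UNIV" "g = (\<lambda>z. g0 (fst z))"
      using \<open>(V, g) \<in> _\<close> unfolding frames_cyl by blast
    show ?thesis unfolding Vg(3)
      by (rule frame_on_pullback[OF vbundle_on_frame[OF E Vg(1)] c]) (auto simp: Vg(2))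
  qed
  show "factors_on ((A \<times> I) \<inter> V \<inter> V') (vrank (cyl_bundle E)) (vrank (cyl_bundle E)) g' g"
    if "(V, g) \<in> frames (cyl_bundle E)" "(V', g') \<in> frames (cyl_bundle E)" for V g V' g'
  proof -
    obtain V0 g0 V1 g1 where Vg: "(V0, g0) \<in> frames E" "V = V0 \<times> UNIV" "g = (\<lambda>z. g0 (fst z))"
      "(V1, g1) \<in> frames E" "V' = V1 \<times> UNIV" "g' = (\<lambda>z. g1 (fst z))"
      using \<open>(V, g) \<in> _\<close> \<open>(V', g') \<in> _\<close> unfolding frames_cyl by blast
    show ?thesis unfolding Vg(3,6) cyl_bundle_def vbundle.simps
      by (rule factors_on_pullback[OF vbundle_on_factors[OF E Vg(1,4)] c]) (auto simp: Vg(2,5))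
  qed
  show "\<exists>V g. (V, g) \<in> frames (cyl_bundle E) \<and> z \<in> V" if "z \<in> A \<times> I" for z
  proof -
    have "fst z \<in> A" using that by auto
    then obtain V g where "(V, g) \<in> frames E" "fst z \<in> V" by (rule vbundle_on_cover[OF E])
    then show ?thesis unfolding frames_cyl
      by (intro exI[of _ "V \<times> UNIV"] exI[of _ "\<lambda>z. g (fst z)"]) (auto simp: mem_Times_iff)
  qed
qed

text \<open>In frames the map is \<open>h - s k\<close>, jointly continuous in the point and in
  \<open>s\<close>. \<open>d\<close> is prescribed over \<open>A \<times> I\<close> only; its values
  elsewhere stay free for an exact match of records at \<open>s = 0\<close>.\<close>

lemma vbundle_map_cyl_minus:
  assumes E: "vbundle_on A E" and F: "vbundle_on A F" and p: "vbundle_map A E F p" and q: "vbundle_map A E F q"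
    and d: "\<And>y s. y \<in> A \<Longrightarrow> s \<in> I \<Longrightarrow> d (y, s) = p y - of_real s \<cdot>\<^sub>m q y"
  shows "vbundle_map (A \<times> I) (cyl_bundle E) (cyl_bundle F) d"
proof (rule vbundle_mapI)
  show "d z \<in> carrier_mat (vrank (cyl_bundle F) z) (vrank (cyl_bundle E) z)" if "z \<in> A \<times> I" for z
    using that vbundle_map_carrier[OF p, of "fst z"] vbundle_map_carrier[OF q, of "fst z"] by (cases z) (auto simp: d)
  fix V g V' g' assume "(V, g) \<in> frames (cyl_bundle E)" "(V', g') \<in> frames (cyl_bundle F)"
  then obtain V0 g0 V1 g1 where Vg: "(V0, g0) \<in> frames E" "V = V0 \<times> UNIV" "g = (\<lambda>z. g0 (fst z))"
    "(V1, g1) \<in> frames F" "V' = V1 \<times> UNIV" "g' = (\<lambda>z. g1 (fst z))" unfolding frames_cyl by blast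
  let ?W = "A \<inter> V0 \<inter> V1"
  let ?D = "(A \<times> I) \<inter> V \<inter> V'"
  obtain h where h: "continuous_mat_on ?W h"
    "\<And>y. y \<in> ?W \<Longrightarrow> h y \<in> carrier_mat (vrank F y) (vrank E y)" "\<And>y. y \<in> ?W \<Longrightarrow> p y * g0 y = g1 y * h y"
    using vbundle_map_factors[OF p Vg(1,4)] by (rule factors_onE) (rule that; simp)
  obtain k where k: "continuous_mat_on ?W k"
    "\<And>y. y \<in> ?W \<Longrightarrow> k y \<in> carrier_mat (vrank F y) (vrank E y)" "\<And>y. y \<in> ?W \<Longrightarrow> q y * g0 y = g1 y * k y"
    using vbundle_map_factors[OF q Vg(1,4)] by (rule factors_onE) (rule that; simp)
  obtain r where r: "\<And>y. y \<in> A \<inter> V0 \<Longrightarrow> vrank E y = r" "\<And>y. y \<in> A \<inter> V0 \<Longrightarrow> g0 y \<in> carrier_mat r r"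
    by (rule vbundle_on_rank[OF E Vg(1)]) (rule that; simp)
  obtain r' where r': "\<And>y. y \<in> A \<inter> V1 \<Longrightarrow> vrank F y = r'" "\<And>y. y \<in> A \<inter> V1 \<Longrightarrow> g1 y \<in> carrier_mat r' r'"
    by (rule vbundle_on_rank[OF F Vg(4)]) (rule that; simp)
  have W: "fst z \<in> ?W" if "z \<in> ?D" for z using that unfolding Vg(2,5) by auto
  have hk: "h (fst z) \<in> carrier_mat r' r" "k (fst z) \<in> carrier_mat r' r" if "z \<in> ?D" for z
    using h(2)[OF W[OF that]] k(2)[OF W[OF that]] r(1)[of "fst z"] r'(1)[of "fst z"] W[OF that] by auto
  show "factors_on ?D (vrank (cyl_bundle F)) (vrank (cyl_bundle E)) (\<lambda>z. d z * g z) g'"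
  proof (rule factors_onI[of _ "\<lambda>z. h (fst z) - of_real (snd z) \<cdot>\<^sub>m k (fst z)"])
    have fst: "continuous_on ?D fst" "fst ` ?D \<subseteq> ?W" using W by (auto intro: continuous_on_fst)
    show "continuous_mat_on ?D (\<lambda>z. h (fst z) - of_real (snd z) \<cdot>\<^sub>m k (fst z))"
      by (rule continuous_mat_on_minus_smult[OF continuous_mat_on_compose[OF h(1) fst] hk(1) continuous_mat_on_compose[OF k(1) fst] hk(2)])
        (assumption+, intro continuous_intros)
    show "h (fst z) - of_real (snd z) \<cdot>\<^sub>m k (fst z) \<in> carrier_mat (vrank (cyl_bundle F) z) (vrank (cyl_bundle E) z)" if z: "z \<in> ?D" for z
      using hk[OF z] W[OF z] r(1)[of "fst z"] r'(1)[of "fst z"] by auto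
    show "d z * g z = g' z * (h (fst z) - of_real (snd z) \<cdot>\<^sub>m k (fst z))" if z: "z \<in> ?D" for z
  proof -
    obtain y s where ys: "z = (y, s)" by (cases z)
    have y: "y \<in> A" "y \<in> V0" "y \<in> V1" "s \<in> I" using z unfolding ys Vg(2,5) by auto
    have c: "p y \<in> carrier_mat r' r" "q y \<in> carrier_mat r' r" "g0 y \<in> carrier_mat r r" "g1 y \<in> carrier_mat r' r'"
        "h y \<in> carrier_mat r' r" "k y \<in> carrier_mat r' r" "vrank E y = r" "vrank F y = r'"
      using vbundle_map_carrier[OF p y(1)] vbundle_map_carrier[OF q y(1)] r[of y] r'[of y] y hk[OF z] ys by auto
    let ?s = "of_real s :: complex"
    have "(p y - ?s \<cdot>\<^sub>m q y) * g0 y = p y * g0 y - (?s \<cdot>\<^sub>m q y) * g0 y"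
      by (rule minus_mult_distrib_mat[OF c(1) smult_carrier_mat[OF c(2)] c(3)])
    also have "(?s \<cdot>\<^sub>m q y) * g0 y = ?s \<cdot>\<^sub>m (q y * g0 y)" by (rule mult_smult_assoc_mat[OF c(2,3)])
    also have "p y * g0 y - ?s \<cdot>\<^sub>m (q y * g0 y) = g1 y * h y - ?s \<cdot>\<^sub>m (g1 y * k y)" using h(3) k(3) y by simp
    also have "?s \<cdot>\<^sub>m (g1 y * k y) = g1 y * (?s \<cdot>\<^sub>m k y)" using mult_smult_distrib[OF c(4,6)] by simp
    also have "g1 y * h y - g1 y * (?s \<cdot>\<^sub>m k y) = g1 y * (h y - ?s \<cdot>\<^sub>m k y)"
      by (rule mult_minus_distrib_mat[OF c(4,5) smult_carrier_mat[OF c(6)], symmetric])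
    finally show ?thesis unfolding ys Vg(3,6) using d[OF y(1,4)] by simp
  qed
  qed
qed

section \<open>Hermitian metrics\<close>

context subordinate_partition
begin

text \<open>Entrywise, with the size \<open>r\<close> as an argument: matrices of varying sizes form
  no additive monoid in which the sum could be taken directly.\<close>

definition wsum :: "nat \<Rightarrow> ('i \<Rightarrow> complex mat) \<Rightarrow> 'a \<Rightarrow> complex mat" where
  "wsum r M y = mat r r (\<lambda>(i, j). \<Sum>U\<in>active y. of_real (\<rho> U y) * M U $$ (i, j))"

lemma wsum_carrier [simp]: "wsum r M y \<in> carrier_mat r r"
  by (simp add: wsum_def)

lemma wsum_cong: "(\<And>U. U \<in> active y \<Longrightarrow> M U = M' U) \<Longrightarrow> wsum r M y = wsum r M' y"
  unfolding wsum_def by (intro eq_matI) (auto intro!: sum.cong)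

lemma wsum_left:
  assumes P: "P \<in> carrier_mat r r" and M: "\<And>U. U \<in> active y \<Longrightarrow> M U \<in> carrier_mat r r"
  shows "P * wsum r M y = wsum r (\<lambda>U. P * M U) y"
proof (rule eq_matI)
  fix i j assume "i < dim_row (wsum r (\<lambda>U. P * M U) y)" "j < dim_col (wsum r (\<lambda>U. P * M U) y)"
  then have ij: "i < r" "j < r" by (simp_all add: wsum_def)
  have "(P * wsum r M y) $$ (i, j) = (\<Sum>k = 0..<r. P $$ (i, k) * (\<Sum>U\<in>active y. of_real (\<rho> U y) * M U $$ (k, j)))"
    using ij carrier_matD[OF P] unfolding wsum_def by (simp add: scalar_prod_def)
  also have "\<dots> = (\<Sum>U\<in>active y. \<Sum>k = 0..<r. of_real (\<rho> U y) * (P $$ (i, k) * M U $$ (k, j)))"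
    unfolding sum_distrib_left by (subst sum.swap) (simp add: mult_ac)
  also have "\<dots> = (\<Sum>U\<in>active y. of_real (\<rho> U y) * (P * M U) $$ (i, j))"
  proof (rule sum.cong[OF refl])
    fix U assume "U \<in> active y"
    note MU = carrier_matD[OF M[OF this]]
    show "(\<Sum>k = 0..<r. of_real (\<rho> U y) * (P $$ (i, k) * M U $$ (k, j))) = of_real (\<rho> U y) * (P * M U) $$ (i, j)"
      using ij carrier_matD[OF P] MU by (simp add: scalar_prod_def sum_distrib_left)
  qed
  finally show "(P * wsum r M y) $$ (i, j) = wsum r (\<lambda>U. P * M U) y $$ (i, j)" using ij by (simp add: wsum_def)
qed (use P in \<open>auto simp: wsum_def\<close>)

lemma wsum_right:
  assumes P: "P \<in> carrier_mat r r" and M: "\<And>U. U \<in> active y \<Longrightarrow> M U \<in> carrier_mat r r"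
  shows "wsum r M y * P = wsum r (\<lambda>U. M U * P) y"
proof (rule eq_matI)
  fix i j assume "i < dim_row (wsum r (\<lambda>U. M U * P) y)" "j < dim_col (wsum r (\<lambda>U. M U * P) y)"
  then have ij: "i < r" "j < r" by (simp_all add: wsum_def)
  have "(wsum r M y * P) $$ (i, j) = (\<Sum>k = 0..<r. (\<Sum>U\<in>active y. of_real (\<rho> U y) * M U $$ (i, k)) * P $$ (k, j))"
    using ij carrier_matD[OF P] unfolding wsum_def by (simp add: scalar_prod_def)
  also have "\<dots> = (\<Sum>U\<in>active y. \<Sum>k = 0..<r. of_real (\<rho> U y) * (M U $$ (i, k) * P $$ (k, j)))"
    unfolding sum_distrib_right by (subst sum.swap) (simp add: mult_ac)
  also have "\<dots> = (\<Sum>U\<in>active y. of_real (\<rho> U y) * (M U * P) $$ (i, j))"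
  proof (rule sum.cong[OF refl])
    fix U assume "U \<in> active y"
    note MU = carrier_matD[OF M[OF this]]
    show "(\<Sum>k = 0..<r. of_real (\<rho> U y) * (M U $$ (i, k) * P $$ (k, j))) = of_real (\<rho> U y) * (M U * P) $$ (i, j)"
      using ij carrier_matD[OF P] MU by (simp add: scalar_prod_def sum_distrib_left)
  qed
  finally show "(wsum r M y * P) $$ (i, j) = wsum r (\<lambda>U. M U * P) y $$ (i, j)" using ij by (simp add: wsum_def)
qed (use P in \<open>auto simp: wsum_def\<close>)

lemma continuous_wsum:
  assumes B: "B \<subseteq> A" and M: "\<And>U. U \<in> C \<Longrightarrow> continuous_mat_on (B \<inter> V (c U)) (M U)"
    and Mc: "\<And>U y. U \<in> C \<Longrightarrow> y \<in> B \<inter> V (c U) \<Longrightarrow> M U y \<in> carrier_mat r r"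
  shows "continuous_mat_on B (\<lambda>y. wsum r (\<lambda>U. M U y) y)"
proof (rule continuous_mat_onI)
  show "wsum r (\<lambda>U. M U y) y \<in> carrier_mat r r" for y by simp
  fix i j assume ij: "i < r" "j < r"
  have "continuous_on B (\<lambda>y. \<Sum>U\<in>active y. of_real (\<rho> U y) * M U y $$ (i, j))"
    by (rule continuous_weighted_sum[OF B]) (rule continuous_mat_onD[OF M Mc ij])
  then show "continuous_on B (\<lambda>y. wsum r (\<lambda>U. M U y) y $$ (i, j))" using ij by (simp add: wsum_def)
qed

text \<open>The quadratic form is the sum of the weights times the squared norms of
  \<open>P U x\<close>. If it vanishes, so does every term, and a single \<open>P U\<close> of
  positive weight already forces \<open>x = 0\<close>.\<close>

lemma posdef_wsum:
  assumes y: "y \<in> A" and P: "\<And>U. U \<in> active y \<Longrightarrow> P U \<in> carrier_mat r r"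
    and inj: "\<And>U x. U \<in> active y \<Longrightarrow> x \<in> carrier_vec r \<Longrightarrow> P U *\<^sub>v x = 0\<^sub>v r \<Longrightarrow> x = 0\<^sub>v r"
  shows "posdef r (wsum r (\<lambda>U. adj (P U) * P U) y)"
  unfolding posdef_def
proof (intro conjI ballI)
  fix x :: "complex Matrix.vec" assume x: "x \<in> carrier_vec r"
  let ?M = "\<lambda>U. adj (P U) * P U"
  let ?q = "\<lambda>U. \<Sum>i = 0..<dim_vec (P U *\<^sub>v x). (cmod (vec_index (P U *\<^sub>v x) i))\<^sup>2"
  let ?c = "\<Sum>U\<in>active y. \<rho> U y * ?q U"
  have Mc: "?M U \<in> carrier_mat r r" if "U \<in> active y" for U
    by (rule mult_carrier_mat[OF adj_carrier[OF P[OF that]] P[OF that]])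
  have "hdot x (wsum r ?M y *\<^sub>v x) = (\<Sum>i = 0..<r. cnj (vec_index x i) *
      (\<Sum>j = 0..<r. (\<Sum>U\<in>active y. of_real (\<rho> U y) * ?M U $$ (i, j)) * vec_index x j))"
    using carrier_vecD[OF x] unfolding hdot_def wsum_def by (simp add: scalar_prod_def)
  also have "\<dots> = (\<Sum>i = 0..<r. \<Sum>U\<in>active y. of_real (\<rho> U y) * (cnj (vec_index x i) * (\<Sum>j = 0..<r. ?M U $$ (i, j) * vec_index x j)))"
  proof (rule sum.cong[OF refl])
    fix i
    have "(\<Sum>j = 0..<r. (\<Sum>U\<in>active y. of_real (\<rho> U y) * ?M U $$ (i, j)) * vec_index x j)
        = (\<Sum>U\<in>active y. of_real (\<rho> U y) * (\<Sum>j = 0..<r. ?M U $$ (i, j) * vec_index x j))"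
      unfolding sum_distrib_right sum_distrib_left by (subst sum.swap) (simp add: mult.assoc)
    then show "cnj (vec_index x i) * (\<Sum>j = 0..<r. (\<Sum>U\<in>active y. of_real (\<rho> U y) * ?M U $$ (i, j)) * vec_index x j)
      = (\<Sum>U\<in>active y. of_real (\<rho> U y) * (cnj (vec_index x i) * (\<Sum>j = 0..<r. ?M U $$ (i, j) * vec_index x j)))"
      by (simp only: sum_distrib_left mult.left_commute)
  qed
  also have "\<dots> = (\<Sum>U\<in>active y. \<Sum>i = 0..<r. of_real (\<rho> U y) * (cnj (vec_index x i) * (\<Sum>j = 0..<r. ?M U $$ (i, j) * vec_index x j)))"
    by (rule sum.swap)
  also have "\<dots> = (\<Sum>U\<in>active y. of_real (\<rho> U y) * hdot x (?M U *\<^sub>v x))"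
  proof (rule sum.cong[OF refl])
    fix U assume "U \<in> active y"
    note MU = carrier_matD[OF Mc[OF this]]
    have "vec_index (?M U *\<^sub>v x) i = (\<Sum>j = 0..<r. ?M U $$ (i, j) * vec_index x j)" if "i \<in> {0..<r}" for i
      using that MU carrier_vecD[OF x] by (simp add: scalar_prod_def del: index_mult_mat(1))
    then have "hdot x (?M U *\<^sub>v x) = (\<Sum>i = 0..<r. cnj (vec_index x i) * (\<Sum>j = 0..<r. ?M U $$ (i, j) * vec_index x j))"
      unfolding hdot_def carrier_vecD[OF x] by (intro sum.cong) auto
    then show "(\<Sum>i = 0..<r. of_real (\<rho> U y) * (cnj (vec_index x i) * (\<Sum>j = 0..<r. ?M U $$ (i, j) * vec_index x j)))
        = of_real (\<rho> U y) * hdot x (?M U *\<^sub>v x)" by (simp only: sum_distrib_left)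
  qed
  also have "\<dots> = (\<Sum>U\<in>active y. of_real (\<rho> U y * ?q U))"
  proof (rule sum.cong[OF refl])
    fix U assume U: "U \<in> active y"
    have "hdot x (?M U *\<^sub>v x) = hdot (P U *\<^sub>v x) (P U *\<^sub>v x)"
      using hdot_adj[OF P[OF U] x mult_mat_vec_carrier[OF P[OF U] x]]
        assoc_mult_mat_vec[OF adj_carrier[OF P[OF U]] P[OF U] x] by simp
    then show "of_real (\<rho> U y) * hdot x (?M U *\<^sub>v x) = of_real (\<rho> U y * ?q U)" unfolding hdot_self by (simp only: of_real_mult)
  qed
  also have "\<dots> = of_real ?c" by (simp only: of_real_sum)
  finally have eq: "hdot x (wsum r ?M y *\<^sub>v x) = of_real ?c" .
  have q: "?q U \<ge> 0" for U by (intro sum_nonneg) simp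
  have nn: "0 \<le> \<rho> U y * ?q U" if "U \<in> active y" for U
    by (rule mult_nonneg_nonneg) (use activeD(3)[OF that y] q in \<open>simp_all only: less_imp_le\<close>)
  have "x = 0\<^sub>v r" if "?c = 0"
  proof -
    obtain U where U: "U \<in> C" "\<rho> U y > 0" using positive[OF y] by blast
    then have Ua: "U \<in> active y" unfolding active_def by simp
    have "\<rho> U y * ?q U = 0" by (rule sum_nonneg_0[OF finite_active[OF y] nn that Ua])
    then have "?q U = 0" using U(2) by simp
    from hdot_self_zero[OF this] have "P U *\<^sub>v x = 0\<^sub>v r" using carrier_matD[OF P[OF Ua]] by simp
    then show ?thesis by (rule inj[OF Ua x])
  qed
  moreover have "?c \<ge> 0" by (rule sum_nonneg[OF nn])
  ultimately show "\<exists>c\<ge>0. hdot x (wsum r ?M y *\<^sub>v x) = of_real c \<and> (c = 0 \<longrightarrow> x = 0\<^sub>v r)" using eq by blast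
qed simp

end

text \<open>\<open>m\<close> is a metric, read in a frame as \<open>adj g * m * g\<close>;
  \<open>n\<close> is a positive form on the dual bundle, read as \<open>g * h * adj g\<close>. Both
  are glued from chosen frames \<open>k\<close>: \<open>m\<close> from the metrics that make
  \<open>k\<close> orthonormal, \<open>n\<close> from their inverses \<open>k * adj k\<close>.
  Building \<open>n\<close> directly spares the continuity of matrix inversion.\<close>

lemma hermitian_metrics_exist:
  fixes A :: "'n::finite cproj set"
  assumes E: "vbundle_on A E"
  obtains m n where "\<And>y. y \<in> A \<Longrightarrow> posdef (vrank E y) (m y)" "\<And>y. y \<in> A \<Longrightarrow> posdef (vrank E y) (n y)"
    "\<And>V g. (V, g) \<in> frames E \<Longrightarrow> continuous_mat_on (A \<inter> V) (\<lambda>y. adj (g y) * m y * g y)"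
    "\<And>V g. (V, g) \<in> frames E \<Longrightarrow> \<exists>h. continuous_mat_on (A \<inter> V) h \<and>
      (\<forall>y\<in>A \<inter> V. h y \<in> carrier_mat (vrank E y) (vrank E y) \<and> n y = g y * h y * adj (g y))"
proof -
  have "\<forall>x\<in>A. \<exists>p. p \<in> frames E \<and> x \<in> fst p"
  proof
    fix x assume "x \<in> A"
    then obtain V g where "(V, g) \<in> frames E" "x \<in> V" by (rule vbundle_on_cover[OF E])
    then show "\<exists>p. p \<in> frames E \<and> x \<in> fst p" by (intro exI[of _ "(V, g)"]) simp
  qed
  then obtain F where F: "\<forall>x\<in>A. F x \<in> frames E \<and> x \<in> fst (F x)" by (rule bchoice[THEN exE])
  define V where "V x = A \<inter> fst (F x)" for x
  define k where "k x = snd (F x)" for x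
  have Fk: "(fst (F x), k x) \<in> frames E" if "x \<in> A" for x using F that by (simp add: k_def)
  have kc: "k x y \<in> carrier_mat (vrank E y) (vrank E y)" "invertible_mat (k x y)" if "x \<in> A" "y \<in> V x" for x y
    using vbundle_on_frame_carrier[OF E Fk[OF that(1)]] that(2) unfolding V_def by auto
  \<comment> \<open>\<open>L\<close> inverts the frame \<open>k\<close> point by point, and no
    continuity is claimed for it; what will be continuous is \<open>L * g\<close>, the coordinate
    matrix of another frame \<open>g\<close> in the frame \<open>k\<close>.\<close>
  define L where "L x y = (SOME R. R \<in> carrier_mat (vrank E y) (vrank E y) \<and> R * k x y = 1\<^sub>m (vrank E y))" for x y
  have L: "L x y \<in> carrier_mat (vrank E y) (vrank E y)" "L x y * k x y = 1\<^sub>m (vrank E y)" if xy: "x \<in> A" "y \<in> V x" for x y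
  proof -
    obtain R where "R \<in> carrier_mat (vrank E y) (vrank E y)" "R * k x y = 1\<^sub>m (vrank E y)"
      by (rule invertible_matE[OF kc(2,1)[OF xy]]) (rule that)
    then have "\<exists>R. R \<in> carrier_mat (vrank E y) (vrank E y) \<and> R * k x y = 1\<^sub>m (vrank E y)" by blast
    then have "L x y \<in> carrier_mat (vrank E y) (vrank E y) \<and> L x y * k x y = 1\<^sub>m (vrank E y)"
      unfolding L_def by (rule someI_ex)
    then show "L x y \<in> carrier_mat (vrank E y) (vrank E y)" "L x y * k x y = 1\<^sub>m (vrank E y)" by simp_all
  qed
  have Vy: "y \<in> V y" if "y \<in> A" for y using F that unfolding V_def by simp
  have Vo: "openin (top_of_set A) (V y)" if "y \<in> A" for y
    unfolding V_def by (rule vbundle_on_openin[OF E Fk[OF that]])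
  have "\<exists>(C :: (complex^'n^'n) set set) c \<rho>. subordinate_partition A V C c \<rho>"
    by (rule subordinate_partition_exists) (erule Vy, erule Vo)
  then obtain C :: "(complex^'n^'n) set set" and c \<rho> where "subordinate_partition A V C c \<rho>" by blast
  then interpret subordinate_partition A V C c \<rho> .
  have cA: "c U \<in> A" "y \<in> V (c U)" if "U \<in> active y" "y \<in> A" for U y
    using centre activeD[OF that] by simp_all
  define m where "m y = wsum (vrank E y) (\<lambda>U. adj (L (c U) y) * L (c U) y) y" for y
  define n where "n y = wsum (vrank E y) (\<lambda>U. k (c U) y * adj (k (c U) y)) y" for y
  show thesis
  proof (rule that[of m n])
    fix y assume y: "y \<in> A"
    let ?r = "vrank E y"
    show "posdef ?r (m y)" unfolding m_def
    proof (rule posdef_wsum[OF y])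
      fix U assume U: "U \<in> active y"
      note cU = cA[OF U y]
      show LU: "L (c U) y \<in> carrier_mat ?r ?r" by (rule L[OF cU])
      fix x assume x: "x \<in> carrier_vec ?r" "L (c U) y *\<^sub>v x = 0\<^sub>v ?r"
      have "k (c U) y * L (c U) y = 1\<^sub>m ?r" by (rule mat_mult_left_right_inverse[OF LU kc(1)[OF cU] L(2)[OF cU]])
      then have "x = k (c U) y *\<^sub>v (L (c U) y *\<^sub>v x)"
        using assoc_mult_mat_vec[OF kc(1)[OF cU] LU x(1)] x(1) by simp
      also have "\<dots> = 0\<^sub>v ?r" unfolding x(2) using kc(1)[OF cU] by (intro eq_vecI) auto
      finally show "x = 0\<^sub>v ?r" .
    qed
    have "posdef ?r (wsum ?r (\<lambda>U. adj (adj (k (c U) y)) * adj (k (c U) y)) y)"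
    proof (rule posdef_wsum[OF y])
      fix U assume U: "U \<in> active y"
      note cU = cA[OF U y]
      note ka = adj_carrier[OF kc(1)[OF cU]] and La = adj_carrier[OF L(1)[OF cU]]
      show "adj (k (c U) y) \<in> carrier_mat ?r ?r" by (rule ka)
      fix x assume x: "x \<in> carrier_vec ?r" "adj (k (c U) y) *\<^sub>v x = 0\<^sub>v ?r"
      have "adj (1\<^sub>m ?r) = 1\<^sub>m ?r" unfolding adj_def by (rule eq_matI) auto
      moreover have "k (c U) y * L (c U) y = 1\<^sub>m ?r" by (rule mat_mult_left_right_inverse[OF L(1)[OF cU] kc(1)[OF cU] L(2)[OF cU]])
      ultimately have "adj (L (c U) y) * adj (k (c U) y) = 1\<^sub>m ?r" using adj_mult[OF kc(1)[OF cU] L(1)[OF cU]] by simp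
      then have "x = adj (L (c U) y) *\<^sub>v (adj (k (c U) y) *\<^sub>v x)"
        using assoc_mult_mat_vec[OF La ka x(1)] x(1) by simp
      also have "\<dots> = 0\<^sub>v ?r" unfolding x(2) using La by (intro eq_vecI) auto
      finally show "x = 0\<^sub>v ?r" .
    qed
    then show "posdef ?r (n y)" unfolding n_def adj_adj .
  next
    fix V' g assume Vg: "(V', g) \<in> frames E"
    let ?B = "A \<inter> V'"
    have BA: "?B \<subseteq> A" by blast
    obtain r where r: "\<And>y. y \<in> ?B \<Longrightarrow> vrank E y = r" "\<And>y. y \<in> ?B \<Longrightarrow> g y \<in> carrier_mat r r"
      by (rule vbundle_on_rank[OF E Vg]) (rule that; simp)
    have sub: "?B \<inter> V x = A \<inter> fst (F x) \<inter> V'" "?B \<inter> V x = A \<inter> V' \<inter> fst (F x)" for x unfolding V_def by blast+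
    have "\<forall>U\<in>C. \<exists>h. continuous_mat_on (?B \<inter> V (c U)) h \<and> (\<forall>y\<in>?B \<inter> V (c U). h y \<in> carrier_mat r r \<and> g y = k (c U) y * h y)"
    proof
      fix U assume U: "U \<in> C"
      obtain h where h: "continuous_mat_on (A \<inter> fst (F (c U)) \<inter> V') h"
        "\<And>y. y \<in> A \<inter> fst (F (c U)) \<inter> V' \<Longrightarrow> h y \<in> carrier_mat (vrank E y) (vrank E y)"
        "\<And>y. y \<in> A \<inter> fst (F (c U)) \<inter> V' \<Longrightarrow> g y = k (c U) y * h y"
        using vbundle_on_factors[OF E Fk[OF centre[OF U]] Vg] by (rule factors_onE) (rule that; simp)
      show "\<exists>h. continuous_mat_on (?B \<inter> V (c U)) h \<and> (\<forall>y\<in>?B \<inter> V (c U). h y \<in> carrier_mat r r \<and> g y = k (c U) y * h y)"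
        unfolding sub(1) by (intro exI[of _ h] conjI h(1)) (use h(2,3) r(1) in auto)
    qed
    then obtain h where h: "\<forall>U\<in>C. continuous_mat_on (?B \<inter> V (c U)) (h U) \<and> (\<forall>y\<in>?B \<inter> V (c U). h U y \<in> carrier_mat r r \<and> g y = k (c U) y * h U y)"
      by (rule bchoice[THEN exE])
    have hc: "h U y \<in> carrier_mat r r" "g y = k (c U) y * h U y" if "U \<in> C" "y \<in> ?B \<inter> V (c U)" for U y
      using h that by blast+
    have "continuous_mat_on ?B (\<lambda>y. wsum r (\<lambda>U. adj (h U y) * h U y) y)"
    proof (rule continuous_wsum[OF BA])
      fix U assume U: "U \<in> C"
      have hU: "continuous_mat_on (?B \<inter> V (c U)) (h U)" using h U by blast
      show "continuous_mat_on (?B \<inter> V (c U)) (\<lambda>y. adj (h U y) * h U y)"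
        by (rule continuous_mat_on_mult[OF continuous_mat_on_adj[OF hU hc(1)[OF U]] adj_carrier[OF hc(1)[OF U]] hU hc(1)[OF U]])
      show "adj (h U y) * h U y \<in> carrier_mat r r" if "y \<in> ?B \<inter> V (c U)" for y
        by (rule mult_carrier_mat[OF adj_carrier[OF hc(1)[OF U that]] hc(1)[OF U that]])
    qed
    then show "continuous_mat_on ?B (\<lambda>y. adj (g y) * m y * g y)"
    proof (rule continuous_mat_on_cong)
      fix y assume y: "y \<in> ?B"
      then have yA: "y \<in> A" by blast
      note gy = r(2)[OF y] and ga = adj_carrier[OF r(2)[OF y]]
      have Lc: "L (c U) y \<in> carrier_mat r r" and kcr: "k (c U) y \<in> carrier_mat r r" and Lh: "L (c U) y * g y = h U y" if U: "U \<in> active y" for U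
      proof -
        note cU = cA[OF U yA]
        show 1: "L (c U) y \<in> carrier_mat r r" and 2: "k (c U) y \<in> carrier_mat r r" using L(1)[OF cU] kc(1)[OF cU] r(1)[OF y] by simp_all
        have y': "y \<in> ?B \<inter> V (c U)" using y cU by blast
        note hU = hc[OF activeD(1)[OF U yA] y']
        show "L (c U) y * g y = h U y"
          unfolding hU(2) using assoc_mult_mat[OF 1 2 hU(1)] L(2)[OF cU] r(1)[OF y] hU(1) by simp
      qed
      have "adj (g y) * m y * g y = wsum r (\<lambda>U. adj (g y) * (adj (L (c U) y) * L (c U) y)) y * g y"
        unfolding m_def r(1)[OF y] by (subst wsum_left[OF ga]) (rule mult_carrier_mat[OF adj_carrier[OF Lc] Lc], simp_all)
      also have "\<dots> = wsum r (\<lambda>U. adj (g y) * (adj (L (c U) y) * L (c U) y) * g y) y"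
        by (rule wsum_right[OF gy]) (rule mult_carrier_mat[OF ga mult_carrier_mat[OF adj_carrier[OF Lc] Lc]])
      also have "\<dots> = wsum r (\<lambda>U. adj (h U y) * h U y) y"
      proof (rule wsum_cong)
        fix U assume U: "U \<in> active y"
        note La = adj_carrier[OF Lc[OF U]] and LL = Lc[OF U]
        have "adj (g y) * (adj (L (c U) y) * L (c U) y) * g y = adj (g y) * (adj (L (c U) y) * L (c U) y * g y)"
          by (rule assoc_mult_mat[OF ga mult_carrier_mat[OF La LL] gy])
        also have "\<dots> = adj (g y) * (adj (L (c U) y) * (L (c U) y * g y))"
          unfolding assoc_mult_mat[OF La LL gy] ..
        also have "\<dots> = adj (g y) * adj (L (c U) y) * (L (c U) y * g y)"
          by (rule assoc_mult_mat[OF ga La mult_carrier_mat[OF LL gy], symmetric])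
        also have "\<dots> = adj (L (c U) y * g y) * (L (c U) y * g y)" unfolding adj_mult[OF LL gy] ..
        finally show "adj (g y) * (adj (L (c U) y) * L (c U) y) * g y = adj (h U y) * h U y" unfolding Lh[OF U] .
      qed
      finally show "wsum r (\<lambda>U. adj (h U y) * h U y) y = adj (g y) * m y * g y" by simp
    qed
    \<comment> \<open>For \<open>n\<close> the frames are compared in the other direction:
      \<open>k\<close> is expressed through \<open>g\<close>, because \<open>k * adj k\<close> has
      to take the form \<open>g * h * adj g\<close>.\<close>
    have "\<forall>U\<in>C. \<exists>h. continuous_mat_on (?B \<inter> V (c U)) h \<and> (\<forall>y\<in>?B \<inter> V (c U). h y \<in> carrier_mat r r \<and> k (c U) y = g y * h y)"
    proof
      fix U assume U: "U \<in> C"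
      obtain h where h: "continuous_mat_on (A \<inter> V' \<inter> fst (F (c U))) h"
        "\<And>y. y \<in> A \<inter> V' \<inter> fst (F (c U)) \<Longrightarrow> h y \<in> carrier_mat (vrank E y) (vrank E y)"
        "\<And>y. y \<in> A \<inter> V' \<inter> fst (F (c U)) \<Longrightarrow> k (c U) y = g y * h y"
        using vbundle_on_factors[OF E Vg Fk[OF centre[OF U]]] by (rule factors_onE) (rule that; simp)
      show "\<exists>h. continuous_mat_on (?B \<inter> V (c U)) h \<and> (\<forall>y\<in>?B \<inter> V (c U). h y \<in> carrier_mat r r \<and> k (c U) y = g y * h y)"
        unfolding sub(2) by (intro exI[of _ h] conjI h(1)) (use h(2,3) r(1) in auto)
    qed
    then obtain l where l: "\<forall>U\<in>C. continuous_mat_on (?B \<inter> V (c U)) (l U) \<and> (\<forall>y\<in>?B \<inter> V (c U). l U y \<in> carrier_mat r r \<and> k (c U) y = g y * l U y)"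
      by (rule bchoice[THEN exE])
    have lc: "l U y \<in> carrier_mat r r" "k (c U) y = g y * l U y" if "U \<in> C" "y \<in> ?B \<inter> V (c U)" for U y
      using l that by blast+
    have "continuous_mat_on ?B (\<lambda>y. wsum r (\<lambda>U. l U y * adj (l U y)) y)"
    proof (rule continuous_wsum[OF BA])
      fix U assume U: "U \<in> C"
      have lU: "continuous_mat_on (?B \<inter> V (c U)) (l U)" using l U by blast
      show "continuous_mat_on (?B \<inter> V (c U)) (\<lambda>y. l U y * adj (l U y))"
        by (rule continuous_mat_on_mult[OF lU lc(1)[OF U] continuous_mat_on_adj[OF lU lc(1)[OF U]] adj_carrier[OF lc(1)[OF U]]])
      show "l U y * adj (l U y) \<in> carrier_mat r r" if "y \<in> ?B \<inter> V (c U)" for y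
        by (rule mult_carrier_mat[OF lc(1)[OF U that] adj_carrier[OF lc(1)[OF U that]]])
    qed
    moreover have "n y = g y * wsum r (\<lambda>U. l U y * adj (l U y)) y * adj (g y)" if y: "y \<in> ?B" for y
    proof -
      have yA: "y \<in> A" using y by blast
      note gy = r(2)[OF y] and ga = adj_carrier[OF r(2)[OF y]]
      have lcr: "l U y \<in> carrier_mat r r" and lk: "k (c U) y = g y * l U y" if U: "U \<in> active y" for U
      proof -
        have y': "y \<in> ?B \<inter> V (c U)" using y cA[OF U yA] by blast
        show "l U y \<in> carrier_mat r r" "k (c U) y = g y * l U y" by (rule lc[OF activeD(1)[OF U yA] y'])+
      qed
      have "g y * wsum r (\<lambda>U. l U y * adj (l U y)) y * adj (g y) = wsum r (\<lambda>U. g y * (l U y * adj (l U y))) y * adj (g y)"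
        by (subst wsum_left[OF gy]) (rule mult_carrier_mat[OF lcr adj_carrier[OF lcr]], simp_all)
      also have "\<dots> = wsum r (\<lambda>U. g y * (l U y * adj (l U y)) * adj (g y)) y"
        by (rule wsum_right[OF ga]) (rule mult_carrier_mat[OF gy mult_carrier_mat[OF lcr adj_carrier[OF lcr]]])
      also have "\<dots> = wsum r (\<lambda>U. k (c U) y * adj (k (c U) y)) y"
      proof (rule wsum_cong)
        fix U assume U: "U \<in> active y"
        note ll = lcr[OF U] and la = adj_carrier[OF lcr[OF U]]
        have "g y * (l U y * adj (l U y)) * adj (g y) = g y * l U y * adj (l U y) * adj (g y)"
          unfolding assoc_mult_mat[OF gy ll la] ..
        also have "\<dots> = g y * l U y * (adj (l U y) * adj (g y))"
          by (rule assoc_mult_mat[OF mult_carrier_mat[OF gy ll] la ga])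
        also have "\<dots> = g y * l U y * adj (g y * l U y)" unfolding adj_mult[OF gy ll] ..
        finally show "g y * (l U y * adj (l U y)) * adj (g y) = k (c U) y * adj (k (c U) y)" unfolding lk[OF U] .
      qed
      finally show ?thesis unfolding n_def r(1)[OF y] ..
    qed
    ultimately show "\<exists>h. continuous_mat_on ?B h \<and> (\<forall>y\<in>?B. h y \<in> carrier_mat (vrank E y) (vrank E y) \<and> n y = g y * h y * adj (g y))"
      by (intro exI[of _ "\<lambda>y. wsum r (\<lambda>U. l U y * adj (l U y)) y"]) (use r(1) in simp)
  qed
qed

section \<open>Vanishing on acyclic factorizations\<close>

text \<open>If \<open>a\<close> is the matrix of \<open>f\<close> in the two frames, then
  \<open>n * adj f * m\<close> sends a frame \<open>g\<close> of \<open>F\<close> to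
  \<open>g' * (h * adj a * (adj g * m * g))\<close>; the local shapes demanded of \<open>m\<close>
  and \<open>n\<close> are those that make the coordinate matrix continuous. With \<open>n\<close>
  read as an inverse metric on \<open>E\<close>, the map is the adjoint of \<open>f\<close>.\<close>

lemma vbundle_map_adjoint:
  assumes E: "vbundle_on A E" and F: "vbundle_on A F" and f: "vbundle_map A E F f"
    and m: "\<And>y. y \<in> A \<Longrightarrow> m y \<in> carrier_mat (vrank F y) (vrank F y)"
      "\<And>V g. (V, g) \<in> frames F \<Longrightarrow> continuous_mat_on (A \<inter> V) (\<lambda>y. adj (g y) * m y * g y)"
    and n: "\<And>y. y \<in> A \<Longrightarrow> n y \<in> carrier_mat (vrank E y) (vrank E y)"
      "\<And>V g. (V, g) \<in> frames E \<Longrightarrow> \<exists>h. continuous_mat_on (A \<inter> V) h \<and>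
        (\<forall>y\<in>A \<inter> V. h y \<in> carrier_mat (vrank E y) (vrank E y) \<and> n y = g y * h y * adj (g y))"
  shows "vbundle_map A F E (\<lambda>y. n y * adj (f y) * m y)"
proof (rule vbundle_mapI)
  show "n y * adj (f y) * m y \<in> carrier_mat (vrank E y) (vrank F y)" if "y \<in> A" for y
    by (rule mult_carrier_mat[OF mult_carrier_mat[OF n(1)[OF that] adj_carrier[OF vbundle_map_carrier[OF f that]]] m(1)[OF that]])
  fix V g V' g' assume Vg: "(V, g) \<in> frames F" "(V', g') \<in> frames E"
  let ?W = "A \<inter> V \<inter> V'"
  obtain a where a: "continuous_mat_on (A \<inter> V' \<inter> V) a"
    "\<And>y. y \<in> A \<inter> V' \<inter> V \<Longrightarrow> a y \<in> carrier_mat (vrank F y) (vrank E y)" "\<And>y. y \<in> A \<inter> V' \<inter> V \<Longrightarrow> f y * g' y = g y * a y"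
    using vbundle_map_factors[OF f Vg(2,1)] by (rule factors_onE) (rule that; simp)
  obtain h where h: "continuous_mat_on (A \<inter> V') h"
    "\<forall>y\<in>A \<inter> V'. h y \<in> carrier_mat (vrank E y) (vrank E y) \<and> n y = g' y * h y * adj (g' y)"
    using n(2)[OF Vg(2)] by (elim exE conjE)
  obtain r where r: "\<And>y. y \<in> A \<inter> V \<Longrightarrow> vrank F y = r" "\<And>y. y \<in> A \<inter> V \<Longrightarrow> g y \<in> carrier_mat r r"
    by (rule vbundle_on_rank[OF F Vg(1)]) (rule that; simp)
  obtain r' where r': "\<And>y. y \<in> A \<inter> V' \<Longrightarrow> vrank E y = r'" "\<And>y. y \<in> A \<inter> V' \<Longrightarrow> g' y \<in> carrier_mat r' r'"
    by (rule vbundle_on_rank[OF E Vg(2)]) (rule that; simp)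
  let ?G = "\<lambda>y. adj (g y) * m y * g y"
  have c: "a y \<in> carrier_mat r r'" "h y \<in> carrier_mat r' r'" "g y \<in> carrier_mat r r" "g' y \<in> carrier_mat r' r'"
    "m y \<in> carrier_mat r r" "n y = g' y * h y * adj (g' y)" "f y * g' y = g y * a y" "f y \<in> carrier_mat r r'"
    "vrank E y = r'" "vrank F y = r" if y: "y \<in> ?W" for y
  proof -
    have y': "y \<in> A" "y \<in> A \<inter> V" "y \<in> A \<inter> V'" "y \<in> A \<inter> V' \<inter> V" using y by blast+
    show "a y \<in> carrier_mat r r'" using a(2)[OF y'(4)] r(1)[OF y'(2)] r'(1)[OF y'(3)] by simp
    show "h y \<in> carrier_mat r' r'" "n y = g' y * h y * adj (g' y)" using h(2) y'(3) r'(1)[OF y'(3)] by auto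
    show "g y \<in> carrier_mat r r" "g' y \<in> carrier_mat r' r'" "vrank E y = r'" "vrank F y = r"
      using r r' y' by simp_all
    show "m y \<in> carrier_mat r r" using m(1)[OF y'(1)] r(1)[OF y'(2)] by simp
    show "f y * g' y = g y * a y" by (rule a(3)[OF y'(4)])
    show "f y \<in> carrier_mat r r'" using vbundle_map_carrier[OF f y'(1)] r(1)[OF y'(2)] r'(1)[OF y'(3)] by simp
  qed
  have Gc: "?G y \<in> carrier_mat r r" if "y \<in> ?W" for y
    by (rule mult_carrier_mat[OF mult_carrier_mat[OF adj_carrier[OF c(3)[OF that]] c(5)[OF that]] c(3)[OF that]])
  have a': "continuous_mat_on ?W a" by (rule continuous_mat_on_subset[OF a(1)]) blast
  have h': "continuous_mat_on ?W h" by (rule continuous_mat_on_subset[OF h(1)]) blast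
  have G': "continuous_mat_on ?W ?G" by (rule continuous_mat_on_subset[OF m(2)[OF Vg(1)]]) blast
  have aG: "continuous_mat_on ?W (\<lambda>y. adj (a y) * ?G y)"
    by (rule continuous_mat_on_mult[OF continuous_mat_on_adj[OF a' c(1)] adj_carrier[OF c(1)] G' Gc])
  have aGc: "adj (a y) * ?G y \<in> carrier_mat r' r" if "y \<in> ?W" for y
    by (rule mult_carrier_mat[OF adj_carrier[OF c(1)[OF that]] Gc[OF that]])
  have "continuous_mat_on ?W (\<lambda>y. h y * (adj (a y) * ?G y))"
    by (rule continuous_mat_on_mult[OF h' c(2) aG aGc])
  moreover have "h y * (adj (a y) * ?G y) \<in> carrier_mat (vrank E y) (vrank F y) \<and>
      n y * adj (f y) * m y * g y = g' y * (h y * (adj (a y) * ?G y))" if y: "y \<in> ?W" for y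
  proof
    note cy = c[OF y]
    note ga = adj_carrier[OF cy(3)] and g'a = adj_carrier[OF cy(4)] and fa = adj_carrier[OF cy(8)] and aa = adj_carrier[OF cy(1)]
    show "h y * (adj (a y) * ?G y) \<in> carrier_mat (vrank E y) (vrank F y)"
      unfolding cy(9,10) by (rule mult_carrier_mat[OF cy(2) aGc[OF y]])
    have gh: "g' y * h y \<in> carrier_mat r' r'" by (rule mult_carrier_mat[OF cy(4,2)])
    have "n y * adj (f y) = g' y * h y * (adj (g' y) * adj (f y))"
      unfolding cy(6) by (rule assoc_mult_mat[OF gh g'a fa])
    also have "adj (g' y) * adj (f y) = adj (a y) * adj (g y)"
      unfolding adj_mult[OF cy(8,4), symmetric] cy(7) adj_mult[OF cy(3,1)] ..
    finally have "n y * adj (f y) * m y * g y = g' y * h y * (adj (a y) * adj (g y)) * m y * g y" by simp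
    also have "\<dots> = g' y * h y * (adj (a y) * adj (g y)) * (m y * g y)"
      by (rule assoc_mult_mat[OF mult_carrier_mat[OF gh mult_carrier_mat[OF aa ga]] cy(5,3)])
    also have "\<dots> = g' y * h y * ((adj (a y) * adj (g y)) * (m y * g y))"
      by (rule assoc_mult_mat[OF gh mult_carrier_mat[OF aa ga] mult_carrier_mat[OF cy(5,3)]])
    also have "(adj (a y) * adj (g y)) * (m y * g y) = adj (a y) * (adj (g y) * (m y * g y))"
      by (rule assoc_mult_mat[OF aa ga mult_carrier_mat[OF cy(5,3)]])
    also have "adj (g y) * (m y * g y) = ?G y" by (rule assoc_mult_mat[OF ga cy(5,3), symmetric])
    also have "g' y * h y * (adj (a y) * ?G y) = g' y * (h y * (adj (a y) * ?G y))"
      by (rule assoc_mult_mat[OF cy(4,2) aGc[OF y]])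
    finally show "n y * adj (f y) * m y * g y = g' y * (h y * (adj (a y) * ?G y))" .
  qed
  ultimately show "factors_on ?W (vrank E) (vrank F) (\<lambda>y. n y * adj (f y) * m y * g y) g'"
    by (intro factors_onI[of _ "\<lambda>y. h y * (adj (a y) * ?G y)"]) simp_all
qed

lemma inj_iff_det:
  assumes p: "(p :: complex mat) \<in> carrier_mat r r" and g: "g \<in> carrier_mat r r" "invertible_mat g"
    and g': "g' \<in> carrier_mat r r" "invertible_mat g'" and h: "h \<in> carrier_mat r r" "p * g = g' * h"
  shows "det h \<noteq> 0 \<longleftrightarrow> (\<forall>x\<in>carrier_vec r. p *\<^sub>v x = 0\<^sub>v r \<longrightarrow> x = 0\<^sub>v r)"
proof -
  have nz: "det k \<noteq> 0" if k: "k \<in> carrier_mat r r" "invertible_mat k" for k :: "complex mat"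
  proof -
    obtain l where l: "l \<in> carrier_mat r r" "k * l = 1\<^sub>m r" by (rule invertible_matE[OF k(2,1)]) (rule that)
    have "det k * det l = 1" using det_mult[OF k(1) l(1)] l(2) by simp
    then show ?thesis by auto
  qed
  have "det p * det g = det g' * det h" using det_mult[OF p g(1)] det_mult[OF g'(1) h(1)] h(2) by simp
  then have "det h \<noteq> 0 \<longleftrightarrow> det p \<noteq> 0" using nz[OF g] nz[OF g'] by auto
  then show ?thesis using det_0_iff_vec_prod_zero[OF p] by blast
qed

text \<open>In local frames the locus is where a continuous determinant does not vanish; ranks are
  constant on the domain of a frame, so their equality at one point persists nearby.\<close>

lemma openin_iso_locus:
  assumes E: "vbundle_on A E" and F: "vbundle_on A F" and p: "vbundle_map A E F p"
  shows "openin (top_of_set A) {y\<in>A. vrank E y = vrank F y \<and>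
    (\<forall>x\<in>carrier_vec (vrank E y). p y *\<^sub>v x = 0\<^sub>v (vrank F y) \<longrightarrow> x = 0\<^sub>v (vrank E y))}" (is "openin _ ?U")
proof (subst openin_subopen, intro ballI)
  fix y assume y: "y \<in> ?U"
  then have yA: "y \<in> A" by blast
  obtain V g where Vg: "(V, g) \<in> frames E" "y \<in> V" by (rule vbundle_on_cover[OF E yA])
  obtain V' g' where Vg': "(V', g') \<in> frames F" "y \<in> V'" by (rule vbundle_on_cover[OF F yA])
  let ?W = "A \<inter> V \<inter> V'"
  obtain h where h: "continuous_mat_on ?W h" "\<And>y. y \<in> ?W \<Longrightarrow> h y \<in> carrier_mat (vrank F y) (vrank E y)"
    "\<And>y. y \<in> ?W \<Longrightarrow> p y * g y = g' y * h y"
    using vbundle_map_factors[OF p Vg(1) Vg'(1)] by (rule factors_onE) (rule that; simp)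
  obtain r where r: "\<And>y. y \<in> A \<inter> V \<Longrightarrow> vrank E y = r" by (rule vbundle_on_rank[OF E Vg(1)]) (rule that; simp)
  obtain r' where r': "\<And>y. y \<in> A \<inter> V' \<Longrightarrow> vrank F y = r'" by (rule vbundle_on_rank[OF F Vg'(1)]) (rule that; simp)
  have "r' = r" using y r[of y] r'[of y] yA Vg(2) Vg'(2) by auto
  then have rr: "vrank E z = r" "vrank F z = r" if "z \<in> ?W" for z using r[of z] r'[of z] that by auto
  have det: "det (h z) \<noteq> 0 \<longleftrightarrow> (\<forall>x\<in>carrier_vec r. p z *\<^sub>v x = 0\<^sub>v r \<longrightarrow> x = 0\<^sub>v r)" if z: "z \<in> ?W" for z
  proof (rule inj_iff_det[of "p z" r "g z" "g' z" "h z"])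
    have z': "z \<in> A" "z \<in> V" "z \<in> V'" using z by blast+
    show "p z \<in> carrier_mat r r" using vbundle_map_carrier[OF p z'(1)] rr[OF z] by simp
    show "g z \<in> carrier_mat r r" "invertible_mat (g z)" using vbundle_on_frame_carrier[OF E Vg(1) z'(1,2)] rr[OF z] by simp_all
    show "g' z \<in> carrier_mat r r" "invertible_mat (g' z)" using vbundle_on_frame_carrier[OF F Vg'(1) z'(1,3)] rr[OF z] by simp_all
    show "h z \<in> carrier_mat r r" "p z * g z = g' z * h z" using h(2,3)[OF z] rr[OF z] by simp_all
  qed
  have hc: "h z \<in> carrier_mat r r" if "z \<in> ?W" for z using h(2)[OF that] rr[OF that] by simp
  let ?T = "?W \<inter> (\<lambda>z. det (h z)) -` (- {0})"
  have "openin (top_of_set ?W) ?T"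
    by (rule continuous_openin_preimage_gen[OF continuous_on_det[OF h(1) hc]]) (simp_all add: open_Compl)
  moreover have "openin (top_of_set A) ?W"
    using openin_Int[OF vbundle_on_openin[OF E Vg(1)] vbundle_on_openin[OF F Vg'(1)]] by (simp add: Int_ac)
  ultimately have "openin (top_of_set A) ?T" by (rule openin_trans)
  moreover have "y \<in> ?W" using yA Vg(2) Vg'(2) by blast
  then have "y \<in> ?T" using det[of y] y rr[of y] by simp
  moreover have "?T \<subseteq> ?U"
  proof
    fix z assume z: "z \<in> ?T"
    then have zW: "z \<in> ?W" by blast
    then show "z \<in> ?U" using det[OF zW] z rr[OF zW] by simp
  qed
  ultimately show "\<exists>T. openin (top_of_set A) T \<and> y \<in> T \<and> T \<subseteq> ?U" by blast
qed

section \<open>The topological bundles and the complex of a matrix factorization\<close>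

lemma vrank_an_bundle [simp]: "vrank (an_bundle Y E) = rk E" by (simp add: an_bundle_def)

lemma frames_an_bundle: "(V, g) \<in> frames (an_bundle Y E) \<longleftrightarrow> local_frame Y E V g" by (simp add: an_bundle_def)

lemma local_frame_subset_space: "local_frame Y E V g \<Longrightarrow> V \<subseteq> Y"
  unfolding local_frame_def by (auto dest: zopen_in_subset)

lemma vbundle_map_an_bundle:
  assumes E: "locally_free Y E" and F: "locally_free Y F" and p: "sheaf_mor Y E F p"
  shows "vbundle_map Y (an_bundle Y E) (an_bundle Y F) p"
proof (rule vbundle_mapI)
  show "p y \<in> carrier_mat (vrank (an_bundle Y F) y) (vrank (an_bundle Y E) y)" if "y \<in> Y" for y
    using sheaf_mor_carrier[OF p that] by simp
  fix V g V' g' assume "(V, g) \<in> frames (an_bundle Y E)" "(V', g') \<in> frames (an_bundle Y F)"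
  then have fr: "local_frame Y E V g" "local_frame Y F V' g'" by (simp_all add: frames_an_bundle)
  obtain h where h: "\<And>i j. regular_on (V \<inter> V') (\<lambda>y. entry (h y) i j)"
    "\<And>y. y \<in> V \<inter> V' \<Longrightarrow> h y \<in> carrier_mat (rk F y) (rk E y) \<and> p y * g y = g' y * h y"
    by (rule sheaf_mor_frames[OF E F p fr]) (rule that; blast)
  have "Y \<inter> V \<inter> V' = V \<inter> V'" using local_frame_subset_space[OF fr(1)] by blast
  moreover have "continuous_mat_on (V \<inter> V') h"
    unfolding continuous_mat_on_def using regular_on_continuous[OF h(1)] by blast
  ultimately show "factors_on (Y \<inter> V \<inter> V') (vrank (an_bundle Y F)) (vrank (an_bundle Y E)) (\<lambda>y. p y * g y) g'"
    using h(2) by (intro factors_onI[of _ h]) simp_all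
qed

lemma vbundle_on_an_bundle:
  assumes E: "locally_free Y E" shows "vbundle_on Y (an_bundle Y E)"
proof (rule vbundle_onI)
  fix V g assume "(V, g) \<in> frames (an_bundle Y E)"
  then have fr: "local_frame Y E V g" by (simp add: frames_an_bundle)
  have VY: "Y \<inter> V = V" using local_frame_subset_space[OF fr] by blast
  obtain r where r: "zopen_in Y V" "\<And>y. y \<in> V \<Longrightarrow> rk E y = r" "\<And>y. y \<in> V \<Longrightarrow> g y \<in> carrier_mat r r"
    "\<And>y. y \<in> V \<Longrightarrow> invertible_mat (g y)"
    using fr by (rule local_frameE) (rule that; simp)
  show "frame_on Y (an_bundle Y E) V g"
    unfolding frame_on_def VY using zopen_in_openin[OF r(1)] r(2-4) by (intro conjI exI[of _ r]) simp_all
  fix V' g' assume fr': "(V', g') \<in> frames (an_bundle Y E)"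
  obtain r' where r': "\<And>y. y \<in> V' \<Longrightarrow> rk E y = r'" "\<And>y. y \<in> V' \<Longrightarrow> g' y \<in> carrier_mat r' r'"
    using fr'[unfolded frames_an_bundle] by (rule local_frameE) (rule that; simp)
  \<comment> \<open>Transition matrices are the matrices of the identity morphism in two frames, so
    their continuity is a case of the previous lemma.\<close>
  have "factors_on (Y \<inter> V' \<inter> V) (rk E) (rk E) (\<lambda>y. 1\<^sub>m (rk E y) * g' y) g"
    using vbundle_map_factors[OF vbundle_map_an_bundle[OF E E sheaf_mor_id[OF E]] fr' \<open>(V, g) \<in> frames (an_bundle Y E)\<close>] by simp
  moreover have "1\<^sub>m (rk E y) * g' y = g' y" if "y \<in> V'" for y using r'[OF that] by (metis left_mult_one_mat)
  ultimately show "factors_on (Y \<inter> V \<inter> V') (vrank (an_bundle Y E)) (vrank (an_bundle Y E)) g' g"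
    unfolding factors_on_def vrank_an_bundle by (simp add: Int_commute Int_left_commute conj_commute cong: conj_cong)
next
  fix y assume "y \<in> Y"
  then obtain V g where "y \<in> V" "local_frame Y E V g"
    by (rule locally_free_frame[OF E zopen_in_refl]) (rule that; simp)
  then show "\<exists>V g. (V, g) \<in> frames (an_bundle Y E) \<and> y \<in> V" unfolding frames_an_bundle by blast
qed

lemma mfact_bundles:
  assumes E: "is_mfact Y w E"
  shows "vbundle_on Y (an_bundle Y (mE1 E))" "vbundle_on Y (an_bundle Y (mE0 E))"
    "vbundle_map Y (an_bundle Y (mE1 E)) (an_bundle Y (mE0 E)) (phi1 E)"
    "vbundle_map Y (an_bundle Y (mE0 E)) (an_bundle Y (mE1 E)) (phi0 E)"
  using E unfolding is_mfact_def by (simp_all add: vbundle_on_an_bundle vbundle_map_an_bundle)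

lemma mfact_matrices:
  assumes E: "is_mfact Y w E" and y: "y \<in> Y"
  shows "phi0 E y \<in> carrier_mat (rk (mE1 E) y) (rk (mE0 E) y)" "phi1 E y \<in> carrier_mat (rk (mE0 E) y) (rk (mE1 E) y)"
    "phi0 E y * phi1 E y = w y \<cdot>\<^sub>m 1\<^sub>m (rk (mE1 E) y)" "phi1 E y * phi0 E y = w y \<cdot>\<^sub>m 1\<^sub>m (rk (mE0 E) y)"
  using E y vbundle_map_carrier[OF mfact_bundles(3)[OF E] y] vbundle_map_carrier[OF mfact_bundles(4)[OF E] y]
  unfolding is_mfact_def by simp_all

text \<open>Where \<open>w\<close> is nonzero, division by \<open>w\<close> turns
  \<open>\<phi>\<^sub>0\<close> into an inverse of \<open>\<phi>\<^sub>1\<close>; injectivity of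
  both structure maps also gives equality of the ranks.\<close>

lemma an_complex_rel:
  assumes E: "is_mfact Y w E" and B: "B \<subseteq> Y" "\<And>y. y \<in> B \<Longrightarrow> w y \<noteq> 0"
  shows "an_complex Y E \<in> rel_complexes Y B"
proof -
  have inj: "x = 0\<^sub>v r" if f: "f \<in> carrier_mat r' r" and g: "g \<in> carrier_mat r r'" and gf: "g * f = c \<cdot>\<^sub>m 1\<^sub>m r" and c: "c \<noteq> 0"
    and x: "x \<in> carrier_vec r" "f *\<^sub>v x = 0\<^sub>v r'" for f g :: "complex mat" and r r' c x
  proof -
    have "c \<cdot>\<^sub>v x = g *\<^sub>v (f *\<^sub>v x)"
      using assoc_mult_mat_vec[OF g f x(1)] gf smult_mat_mult_vec[OF one_carrier_mat x(1), of c] x(1) by simp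
    also have "\<dots> = 0\<^sub>v r" unfolding x(2) using g by (intro eq_vecI) auto
    finally have 0: "c \<cdot>\<^sub>v x = 0\<^sub>v r" .
    show ?thesis
    proof (rule eq_vecI)
      fix i assume "i < dim_vec (0\<^sub>v r :: complex Matrix.vec)"
      then have i: "i < r" by simp
      have "vec_index (c \<cdot>\<^sub>v x) i = 0" unfolding 0 using i by simp
      then show "vec_index x i = vec_index (0\<^sub>v r) i" using i x(1) c by simp
    qed (use x(1) in simp)
  qed
  have "exact_on B (an_complex Y E)"
    unfolding an_complex_two_term
  proof (rule exact_on_two_term_inj)
    fix y assume y: "y \<in> B"
    then have yY: "y \<in> Y" and wy: "w y \<noteq> 0" using B by auto
    note M = mfact_matrices[OF E yY]
    show "phi1 E y \<in> carrier_mat (vrank (an_bundle Y (mE0 E)) y) (vrank (an_bundle Y (mE1 E)) y)" using M(2) by simp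
    show "x = 0\<^sub>v (vrank (an_bundle Y (mE1 E)) y)" if "x \<in> carrier_vec (vrank (an_bundle Y (mE1 E)) y)"
      "phi1 E y *\<^sub>v x = 0\<^sub>v (vrank (an_bundle Y (mE0 E)) y)" for x
      using inj[OF M(2,1,3) wy] that by simp
    show "vrank (an_bundle Y (mE1 E)) y = vrank (an_bundle Y (mE0 E)) y"
      using inj_mat_dim[OF M(2) inj[OF M(2,1,3) wy]] inj_mat_dim[OF M(1) inj[OF M(1,2,4) wy]] by simp
  qed
  moreover have "complex_on Y (an_complex Y E)"
    unfolding an_complex_two_term by (rule complex_on_two_term[OF mfact_bundles(1-3)[OF E]])
  ultimately show ?thesis unfolding rel_complexes_def by simp
qed

text \<open>The homotopy is linear in the parameter, \<open>d (y, s) = \<phi>\<^sub>1 - s q\<close>.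
  Over \<open>Re w < 0\<close> it is injective for every \<open>s\<close> in \<open>{0..1}\<close>.
  \<open>U\<close> is taken as the locus where the end \<open>s = 1\<close> is invertible; it is
  open and contains the zero fibre, and by its choice that end is exact over all of
  \<open>U\<close>.\<close>

lemma acyc_null_homotopy:
  assumes acyc: "E \<in> acyc_objs Y w"
  obtains U C where "U \<in> fibre_nbhds Y w" "C \<in> rel_complexes (U \<times> {0..1}) (neg_part w U \<times> {0..1})"
    "slice 0 C = an_complex Y E" "complex_on U (slice 1 C)" "exact_on U (slice 1 C)"
proof -
  have E: "is_mfact Y w E" and ac: "\<And>y. y \<in> zero_fibre Y w \<Longrightarrow> acyclic_at y E" using acyc unfolding acyc_objs_def by auto
  let ?B1 = "an_bundle Y (mE1 E)" and ?B0 = "an_bundle Y (mE0 E)"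
  note B = mfact_bundles[OF E]
  obtain m where m: "\<And>y. y \<in> Y \<Longrightarrow> posdef (rk (mE1 E) y) (m y)"
    "\<And>V g. (V, g) \<in> frames ?B1 \<Longrightarrow> continuous_mat_on (Y \<inter> V) (\<lambda>y. adj (g y) * m y * g y)"
    by (rule hermitian_metrics_exist[OF B(1)]) (rule that; simp)
  obtain n where n: "\<And>y. y \<in> Y \<Longrightarrow> posdef (rk (mE0 E) y) (n y)"
    "\<And>V g. (V, g) \<in> frames ?B0 \<Longrightarrow> \<exists>h. continuous_mat_on (Y \<inter> V) h \<and>
        (\<forall>y\<in>Y \<inter> V. h y \<in> carrier_mat (vrank ?B0 y) (vrank ?B0 y) \<and> n y = g y * h y * adj (g y))"
    by (rule hermitian_metrics_exist[OF B(2)]) (rule that; simp)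
  define q where "q y = n y * adj (phi0 E y) * m y" for y
  have q: "vbundle_map Y ?B1 ?B0 q"
    unfolding q_def by (rule vbundle_map_adjoint[OF B(2,1,4) _ m(2) _ n(2)]) (use posdef_carrier[OF m(1)] posdef_carrier[OF n(1)] in simp_all)
  \<comment> \<open>The case distinction makes the slice at 0 literally the complex of
    \<open>E\<close>, also at points outside \<open>Y\<close>, where the sizes of the matrices are
    unknown.\<close>
  define d where "d z = (if snd z = 0 then phi1 E (fst z) else phi1 E (fst z) - of_real (snd z) \<cdot>\<^sub>m q (fst z))" for z :: "_ \<times> real"
  have d: "d (y, s) = phi1 E y - of_real s \<cdot>\<^sub>m q y" if y: "y \<in> Y" for y s
  proof (cases "s = 0")
    case True
    have "phi1 E y - 0 \<cdot>\<^sub>m q y = phi1 E y"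
      using mfact_matrices(2)[OF E y] vbundle_map_carrier[OF q y] by (intro eq_matI) auto
    then show ?thesis using True by (simp add: d_def)
  qed (simp add: d_def)
  have dmap: "vbundle_map (Y \<times> {0..1}) (cyl_bundle ?B1) (cyl_bundle ?B0) d"
    by (rule vbundle_map_cyl_minus[OF B(1,2,3) q]) (rule d)
  have inj: "x = 0\<^sub>v (rk (mE1 E) y)" if y: "y \<in> Y" and s: "s \<ge> 0" and w: "Re (w y) < 0 \<or> w y = 0 \<and> s > 0"
    and x: "x \<in> carrier_vec (rk (mE1 E) y)" "d (y, s) *\<^sub>v x = 0\<^sub>v (rk (mE0 E) y)" for y s x
  proof (rule perturbed_injective[OF mfact_matrices(1,2,3)[OF E y] m(1)[OF y] n(1)[OF y] s _ x(1)])
    show "(phi1 E y - of_real s \<cdot>\<^sub>m (n y * adj (phi0 E y) * m y)) *\<^sub>v x = 0\<^sub>v (rk (mE0 E) y)"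
      using x(2) unfolding d[OF y] q_def .
    show "Re (w y) < 0 \<or> w y = 0 \<and> s > 0 \<and> (\<forall>x\<in>carrier_vec (rk (mE1 E) y). phi1 E y *\<^sub>v x = 0\<^sub>v (rk (mE0 E) y) \<longrightarrow>
        (\<exists>z\<in>carrier_vec (rk (mE0 E) y). x = phi0 E y *\<^sub>v z))"
    proof (cases "Re (w y) < 0")
      case False
      then have "y \<in> zero_fibre Y w" using w y by (simp add: zero_fibre_def)
      then have "acyclic_at y E" by (rule ac)
      then have "\<forall>x\<in>carrier_vec (rk (mE1 E) y). phi1 E y *\<^sub>v x = 0\<^sub>v (rk (mE0 E) y) \<longrightarrow>
        (\<exists>z\<in>carrier_vec (rk (mE0 E) y). phi0 E y *\<^sub>v z = x)"
        unfolding acyclic_at_def by (elim allE[of _ 1]) (simp add: mfE_def mfphi_def)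
      then show ?thesis using w False by metis
    qed simp
  qed
  \<comment> \<open>Equality of ranks upgrades injectivity to invertibility, as exactness of a
    two-term complex demands.\<close>
  have rank: "rk (mE1 E) y = rk (mE0 E) y" if y: "y \<in> Y" and w: "Re (w y) < 0 \<or> w y = 0" for y
  proof (rule acyclic_ranks_eq[OF mfact_matrices[OF E y]])
    show "Re (w y) < 0 \<or> w y = 0 \<and> (\<forall>x\<in>carrier_vec (rk (mE1 E) y). phi1 E y *\<^sub>v x = 0\<^sub>v (rk (mE0 E) y) \<longrightarrow>
        (\<exists>z\<in>carrier_vec (rk (mE0 E) y). x = phi0 E y *\<^sub>v z)) \<and>
        (\<forall>x\<in>carrier_vec (rk (mE0 E) y). phi0 E y *\<^sub>v x = 0\<^sub>v (rk (mE1 E) y) \<longrightarrow>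
        (\<exists>z\<in>carrier_vec (rk (mE1 E) y). x = phi1 E y *\<^sub>v z))"
    proof (cases "Re (w y) < 0")
      case False
      then have "y \<in> zero_fibre Y w" using w y by (simp add: zero_fibre_def)
      then have a: "acyclic_at y E" by (rule ac)
      then have "\<forall>x\<in>carrier_vec (rk (mE1 E) y). phi1 E y *\<^sub>v x = 0\<^sub>v (rk (mE0 E) y) \<longrightarrow>
        (\<exists>z\<in>carrier_vec (rk (mE0 E) y). phi0 E y *\<^sub>v z = x)"
        unfolding acyclic_at_def by (elim allE[of _ 1]) (simp add: mfE_def mfphi_def)
      moreover from a have "\<forall>x\<in>carrier_vec (rk (mE0 E) y). phi0 E y *\<^sub>v x = 0\<^sub>v (rk (mE1 E) y) \<longrightarrow>
        (\<exists>z\<in>carrier_vec (rk (mE1 E) y). phi1 E y *\<^sub>v z = x)"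
        unfolding acyclic_at_def by (elim allE[of _ 0]) (simp add: mfE_def mfphi_def)
      ultimately show ?thesis using w False by metis
    qed simp
  qed
  have d1: "vbundle_map Y ?B1 ?B0 (\<lambda>y. d (y, 1))"
    using vbundle_map_slice[OF dmap, of 1] by (simp add: slice_cyl)
  define U where "U = {y\<in>Y. vrank ?B1 y = vrank ?B0 y \<and>
    (\<forall>x\<in>carrier_vec (vrank ?B1 y). d (y, 1) *\<^sub>v x = 0\<^sub>v (vrank ?B0 y) \<longrightarrow> x = 0\<^sub>v (vrank ?B1 y))}"
  have UY: "U \<subseteq> Y" unfolding U_def by blast
  have "zero_fibre Y w \<subseteq> U"
  proof
    fix y assume "y \<in> zero_fibre Y w"
    then have y: "y \<in> Y" "w y = 0" by (simp_all add: zero_fibre_def)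
    show "y \<in> U" unfolding U_def using y rank[OF y(1)] inj[OF y(1), of 1] by simp
  qed
  moreover have "openin (top_of_set Y) U" unfolding U_def by (rule openin_iso_locus[OF B(1,2) d1])
  ultimately have U: "U \<in> fibre_nbhds Y w" unfolding fibre_nbhds_def by simp
  let ?C = "two_term (cyl_bundle ?B1) (cyl_bundle ?B0) d"
  have UI: "U \<times> {0..1} \<subseteq> Y \<times> {0..1 :: real}" using UY by blast
  note cyl = vbundle_on_subset[OF vbundle_on_cyl[OF B(1)] UI] vbundle_on_subset[OF vbundle_on_cyl[OF B(2)] UI]
  have "complex_on (U \<times> {0..1}) ?C" by (rule complex_on_two_term[OF cyl vbundle_map_subset[OF dmap UI]])
  moreover have "exact_on (neg_part w U \<times> {0..1}) ?C"
  proof (rule exact_on_two_term_inj)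
    fix z assume "z \<in> neg_part w U \<times> {0..1 :: real}"
    then obtain y s where z: "z = (y, s)" "y \<in> Y" "Re (w y) < 0" "0 \<le> s" using UY unfolding neg_part_def by auto
    show "d z \<in> carrier_mat (vrank (cyl_bundle ?B0) z) (vrank (cyl_bundle ?B1) z)"
      using mfact_matrices(2)[OF E z(2)] vbundle_map_carrier[OF q z(2)] unfolding z(1) d[OF z(2)] by auto
    show "vrank (cyl_bundle ?B1) z = vrank (cyl_bundle ?B0) z" using rank[OF z(2)] z(1,3) by simp
    show "x = 0\<^sub>v (vrank (cyl_bundle ?B1) z)" if "x \<in> carrier_vec (vrank (cyl_bundle ?B1) z)"
      "d z *\<^sub>v x = 0\<^sub>v (vrank (cyl_bundle ?B0) z)" for x
      using inj[OF z(2,4)] that z(1,3) by simp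
  qed
  ultimately have C: "?C \<in> rel_complexes (U \<times> {0..1}) (neg_part w U \<times> {0..1})" unfolding rel_complexes_def by simp
  have s0: "slice 0 ?C = an_complex Y E"
    unfolding slice_two_term slice_cyl an_complex_two_term by (simp add: d_def)
  have s1: "slice 1 ?C = two_term ?B1 ?B0 (\<lambda>y. d (y, 1))" unfolding slice_two_term slice_cyl ..
  have c1: "complex_on U (slice 1 ?C)" unfolding s1
    by (rule complex_on_two_term[OF vbundle_on_subset[OF B(1) UY] vbundle_on_subset[OF B(2) UY] vbundle_map_subset[OF d1 UY]])
  have e1: "exact_on U (slice 1 ?C)" unfolding s1
  proof (rule exact_on_two_term_inj)
    fix y assume y: "y \<in> U"
    then have yY: "y \<in> Y" using UY by blast
    show "d (y, 1) \<in> carrier_mat (vrank ?B0 y) (vrank ?B1 y)" by (rule vbundle_map_carrier[OF d1 yY])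
    show "vrank ?B1 y = vrank ?B0 y" using y unfolding U_def by blast
    show "x = 0\<^sub>v (vrank ?B1 y)" if "x \<in> carrier_vec (vrank ?B1 y)" "d (y, 1) *\<^sub>v x = 0\<^sub>v (vrank ?B0 y)" for x
      using y that unfolding U_def by blast
  qed
  show thesis by (rule that[OF U C s0 c1 e1])
qed

section \<open>Additivity on cones\<close>

text \<open>In each degree the cone is the direct sum of \<open>F\<close> and \<open>E[1]\<close>,
  and its structure map is block upper triangular, so inclusion and projection are maps of
  complexes.\<close>

lemma short_exact_cone:
  assumes E: "is_mfact Y w E" and F: "is_mfact Y w F" and p: "p \<in> Z0_hom Y E F"
  shows "short_exact Y (an_complex Y F) (an_complex Y (mf_cone E F p)) (an_complex Y (mf_shift E))"
proof -
  note C = mf_cone_mfact[OF E F p] and S = mf_shift_mfact[OF E]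
  note i = cone_incl_Z0[OF E F p] and j = cone_proj_Z0[OF E F p]
  have map: "vbundle_map Y (an_bundle Y (mE1 A)) (an_bundle Y (mE1 B)) (snd f)"
    "vbundle_map Y (an_bundle Y (mE0 A)) (an_bundle Y (mE0 B)) (fst f)"
    "\<And>y. y \<in> Y \<Longrightarrow> fst f y * phi1 A y = phi1 B y * snd f y"
    if A: "is_mfact Y w A" and B: "is_mfact Y w B" and f: "f \<in> Z0_hom Y A B" for A B f
    using vbundle_map_an_bundle[OF mfact_locally_free[OF A, of 1] mfact_locally_free[OF B, of 1] Z0_mor[OF f, of 1]]
      vbundle_map_an_bundle[OF mfact_locally_free[OF A, of 0] mfact_locally_free[OF B, of 0] Z0_mor[OF f, of 0]]
      Z0_comm[OF f, of _ 1] by (simp_all add: mfE_def mfmap_def mfphi_def)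
  have ex: "mat_ker (mfmap k (cone_incl E F) y) = {0\<^sub>v (rk (mfE k F) y)} \<and>
      mat_ker (mfmap k (cone_proj E F) y) = mat_range (mfmap k (cone_incl E F) y) \<and>
      mat_range (mfmap k (cone_proj E F) y) = carrier_vec (rk (mfE (k + 1) E) y)" if y: "y \<in> Y" for k y
  proof -
    let ?r = "rk (mfE k F) y" and ?s = "rk (mfE (k + 1) E) y"
    let ?i = "mfmap k (cone_incl E F) y" and ?j = "mfmap k (cone_proj E F) y"
    have ic: "?i \<in> carrier_mat (?r + ?s) ?r" and jc: "?j \<in> carrier_mat ?s (?r + ?s)"
      using Z0_carrier[OF i y, of k] Z0_carrier[OF j y, of k] by (simp_all add: rk_dsum)
    have i0: "?i *\<^sub>v a = 0\<^sub>v (?r + ?s) \<longleftrightarrow> a = 0\<^sub>v ?r" if a: "a \<in> carrier_vec ?r" for a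
    proof -
      have "(0\<^sub>v (?r + ?s) :: complex Matrix.vec) = 0\<^sub>v ?r @\<^sub>v 0\<^sub>v ?s" by (intro eq_vecI) auto
      then show ?thesis using cone_incl_mult[OF a, of E] append_vec_eq_iff[OF a zero_carrier_vec, of "0\<^sub>v ?s" "0\<^sub>v ?s"] by simp
    qed
    have "mat_ker ?i = {0\<^sub>v ?r}" unfolding mat_ker_carrier[OF ic] using i0 by auto
    moreover have "mat_ker ?j = mat_range ?i"
    proof (intro Set.set_eqI iffI)
      fix v assume "v \<in> mat_ker ?j"
      then have v: "v \<in> carrier_vec (?r + ?s)" "?j *\<^sub>v v = 0\<^sub>v ?s" unfolding mat_ker_carrier[OF jc] by auto
      obtain a b where ab: "a \<in> carrier_vec ?r" "b \<in> carrier_vec ?s" "v = a @\<^sub>v b" by (rule vec_split_append[OF v(1)])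
      have "b = 0\<^sub>v ?s" using cone_proj_mult[OF ab(1,2)] v(2) unfolding ab(3) by simp
      then have "v = ?i *\<^sub>v a" using cone_incl_mult[OF ab(1), of E] ab(3) by simp
      then show "v \<in> mat_range ?i" unfolding mat_range_def using carrier_matD[OF ic] ab(1) by auto
    next
      fix v assume "v \<in> mat_range ?i"
      then obtain a where a: "a \<in> carrier_vec ?r" "v = ?i *\<^sub>v a" unfolding mat_range_def using carrier_matD[OF ic] by auto
      have "?j *\<^sub>v v = 0\<^sub>v ?s" unfolding a(2) cone_incl_mult[OF a(1)] by (rule cone_proj_mult[OF a(1) zero_carrier_vec])
      then show "v \<in> mat_ker ?j" unfolding mat_ker_carrier[OF jc] using a ic by auto
    qed
    moreover have "mat_range ?j = carrier_vec ?s"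
    proof (intro Set.set_eqI iffI)
      fix b :: "complex Matrix.vec" assume b: "b \<in> carrier_vec ?s"
      have "b = ?j *\<^sub>v (0\<^sub>v ?r @\<^sub>v b)" by (rule cone_proj_mult[OF zero_carrier_vec b, symmetric])
      moreover have "0\<^sub>v ?r @\<^sub>v b \<in> carrier_vec (?r + ?s)" using b by simp
      ultimately show "b \<in> mat_range ?j" unfolding mat_range_def using carrier_matD[OF jc] by auto
    next
      fix b assume "b \<in> mat_range ?j"
      then show "b \<in> carrier_vec ?s" unfolding mat_range_def using jc by auto
    qed
    ultimately show ?thesis by blast
  qed
  show ?thesis
    unfolding an_complex_two_term
  proof (rule short_exact_two_term[OF mfact_bundles(1,2)[OF F] mfact_bundles(1,2)[OF C] mfact_bundles(1,2)[OF S]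
        map(1,2)[OF F C i] map(1,2)[OF C S j] mfact_bundles(3)[OF F] mfact_bundles(3)[OF C] mfact_bundles(3)[OF S]
        map(3)[OF F C i] map(3)[OF C S j]])
    fix y assume y: "y \<in> Y"
    show "mat_ker (snd (cone_incl E F) y) = {0\<^sub>v (vrank (an_bundle Y (mE1 F)) y)} \<and>
      mat_ker (snd (cone_proj E F) y) = mat_range (snd (cone_incl E F) y) \<and>
      mat_range (snd (cone_proj E F) y) = carrier_vec (vrank (an_bundle Y (mE1 (mf_shift E))) y)"
      using ex[OF y, of 1] by (simp add: mfmap_def mfE_def mf_shift_def)
    show "mat_ker (fst (cone_incl E F) y) = {0\<^sub>v (vrank (an_bundle Y (mE0 F)) y)} \<and>
      mat_ker (fst (cone_proj E F) y) = mat_range (fst (cone_incl E F) y) \<and>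
      mat_range (fst (cone_proj E F) y) = carrier_vec (vrank (an_bundle Y (mE0 (mf_shift E))) y)"
      using ex[OF y, of 0] by (simp add: mfmap_def mfE_def mf_shift_def)
  qed
qed

section \<open>Presented groups and direct limits\<close>

lemma hom_free_Abelian_group_diff:
  assumes h: "h \<in> hom (free_Abelian_group S) G" and G: "group G" and ab: "Poly_Mapping.keys a \<subseteq> S" "Poly_Mapping.keys b \<subseteq> S"
  shows "h (a - b) = h a \<otimes>\<^bsub>G\<^esub> inv\<^bsub>G\<^esub> h b"
proof -
  interpret group_hom "free_Abelian_group S" G h
    using h G by (simp add: group_hom_def group_hom_axioms_def)
  have "h (a - b) = h (a \<otimes>\<^bsub>free_Abelian_group S\<^esub> inv\<^bsub>free_Abelian_group S\<^esub> b)" using ab by simp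
  also have "\<dots> = h a \<otimes>\<^bsub>G\<^esub> h (inv\<^bsub>free_Abelian_group S\<^esub> b)"
    by (rule hom_mult) (use ab in \<open>simp_all add: inv_closed\<close>)
  also have "h (inv\<^bsub>free_Abelian_group S\<^esub> b) = inv\<^bsub>G\<^esub> h b"
    by (rule hom_inv) (use ab in simp)
  finally show ?thesis .
qed

text \<open>Product and inverse in a free Abelian group are those of finitely supported functions,
  whatever the set of generators; so an element generated over \<open>S'\<close> is generated by the
  same word over \<open>S\<close>.\<close>

lemma generate_free_Abelian_group_mono:
  assumes R': "\<And>r. r \<in> R' \<Longrightarrow> Poly_Mapping.keys r \<subseteq> S'" and R: "\<And>r. r \<in> R \<Longrightarrow> Poly_Mapping.keys r \<subseteq> S" and RR: "R' \<subseteq> R"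
    and z: "z \<in> generate (free_Abelian_group S') R'"
  shows "z \<in> generate (free_Abelian_group S) R"
  using z
proof induction
  case one
  then show ?case using generate.one[of "free_Abelian_group S" R] by simp
next
  case (incl h)
  then show ?case using RR by (intro generate.incl) blast
next
  case (inv h)
  then have "h \<in> R" using RR by blast
  then have "inv\<^bsub>free_Abelian_group S\<^esub> h \<in> generate (free_Abelian_group S) R" by (rule generate.inv)
  then show ?case using R[OF \<open>h \<in> R\<close>] R'[OF inv] by simp
next
  case (eng h1 h2)
  then show ?case using generate.eng[of h1 "free_Abelian_group S" R h2] by simp
qed

locale presentation =
  fixes S :: "'a set" and R :: "('a \<Rightarrow>\<^sub>0 int) set"
  assumes rels: "r \<in> R \<Longrightarrow> Poly_Mapping.keys r \<subseteq> S"
begin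

sublocale free: comm_group "free_Abelian_group S" by (rule abelian_free_Abelian_group)

lemma rels_subset: "R \<subseteq> carrier (free_Abelian_group S)" using rels by auto

lemma subgroup_rels: "subgroup (generate (free_Abelian_group S) R) (free_Abelian_group S)"
  by (rule free.generate_is_subgroup[OF rels_subset])

lemma normal_rels: "generate (free_Abelian_group S) R \<lhd> free_Abelian_group S"
  by (rule free.subgroup_imp_normal[OF subgroup_rels])

lemma comm_group_presented: "comm_group (presented S R)"
  unfolding presented_def by (rule free.abelian_FactGroup[OF subgroup_rels])

lemma presented_class_hom: "presented_class S R \<in> hom (free_Abelian_group S) (presented S R)"
  unfolding presented_def presented_class_def[abs_def] by (rule normal.r_coset_hom_Mod[OF normal_rels])

lemma presented_classE:
  assumes "c \<in> carrier (presented S R)" obtains x where "Poly_Mapping.keys x \<subseteq> S" "c = presented_class S R x"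
  using assms unfolding presented_def presented_class_def FactGroup_def RCOSETS_def by auto

lemma presented_class_carrier: "Poly_Mapping.keys x \<subseteq> S \<Longrightarrow> presented_class S R x \<in> carrier (presented S R)"
  using hom_in_carrier[OF presented_class_hom] by simp

lemma presented_class_generate:
  assumes "z \<in> generate (free_Abelian_group S) R" shows "presented_class S R z = \<one>\<^bsub>presented S R\<^esub>"
proof -
  have "z \<in> carrier (free_Abelian_group S)" by (rule free.generate_in_carrier[OF rels_subset assms])
  then show ?thesis
    unfolding presented_def presented_class_def one_FactGroup by (rule free.coset_join2[OF _ subgroup_rels assms])
qed

lemma presented_class_rel: "r \<in> R \<Longrightarrow> presented_class S R r = \<one>\<^bsub>presented S R\<^esub>"
  by (intro presented_class_generate generate.incl)

lemma presented_class_add_generate: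
  assumes z: "z \<in> generate (free_Abelian_group S) R" and x: "Poly_Mapping.keys x \<subseteq> S"
  shows "presented_class S R (z + x) = presented_class S R x"
proof -
  interpret P: comm_group "presented S R" by (rule comm_group_presented)
  have zc: "z \<in> carrier (free_Abelian_group S)" by (rule free.generate_in_carrier[OF rels_subset z])
  have xc: "x \<in> carrier (free_Abelian_group S)" using x by simp
  have "presented_class S R (z + x) = presented_class S R z \<otimes>\<^bsub>presented S R\<^esub> presented_class S R x"
    using hom_mult[OF presented_class_hom zc xc] by simp
  then show ?thesis using presented_class_generate[OF z] presented_class_carrier[OF x] by simp
qed

lemma presented_class_eq_coset: "presented_class S R x = {z + x | z. z \<in> generate (free_Abelian_group S) R}"
  unfolding presented_class_def r_coset_def by auto

text \<open>Hypothesis \<open>rel\<close> speaks of an arbitrary homomorphism extending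
  \<open>f\<close>, so that a relation can be checked by evaluating it on generators, before the
  extension is named.\<close>

lemma presented_universal:
  assumes G: "comm_group G" and f: "\<And>s. s \<in> S \<Longrightarrow> f s \<in> carrier G"
    and rel: "\<And>h r. h \<in> hom (free_Abelian_group S) G \<Longrightarrow> (\<And>s. s \<in> S \<Longrightarrow> h (frag_of s) = f s) \<Longrightarrow> r \<in> R \<Longrightarrow> h r = \<one>\<^bsub>G\<^esub>"
  obtains \<alpha> where "\<alpha> \<in> hom (presented S R) G" "\<And>s. s \<in> S \<Longrightarrow> \<alpha> (presented_class S R (frag_of s)) = f s"
proof -
  interpret G: comm_group G by (rule G)
  have fS: "f ` S \<subseteq> carrier G" using f by blast
  obtain h where h: "h \<in> hom (free_Abelian_group S) G" "\<And>s. s \<in> S \<Longrightarrow> h (frag_of s) = f s"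
    by (rule G.free_Abelian_group_universal[OF fS]) blast
  interpret h: group_hom "free_Abelian_group S" G h
    using h(1) by (simp add: group_hom_def group_hom_axioms_def G.group_axioms)
  have "R \<subseteq> kernel (free_Abelian_group S) G h"
    unfolding kernel_def using rel[OF h] rels_subset by blast
  then have gen: "generate (free_Abelian_group S) R \<subseteq> kernel (free_Abelian_group S) G h"
    by (rule free.generate_subgroup_incl[OF _ h.subgroup_kernel])
  obtain g where g: "g \<in> hom (free_Abelian_group S Mod generate (free_Abelian_group S) R) G"
    "\<And>x. x \<in> carrier (free_Abelian_group S) \<Longrightarrow> g (generate (free_Abelian_group S) R #>\<^bsub>free_Abelian_group S\<^esub> x) = h x"
    by (rule h.FactGroup_universal_kernel[OF normal_rels gen]) blast
  show thesis
    by (rule that[of g]) (use g h(2) in \<open>simp_all add: presented_def presented_class_def\<close>)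
qed

end

section \<open>Direct limits as quotients of direct sums\<close>

locale direct_system =
  fixes I :: "'i set" and fol :: "'i \<Rightarrow> 'i \<Rightarrow> bool" and G :: "'i \<Rightarrow> 'g monoid" and f :: "'i \<Rightarrow> 'i \<Rightarrow> 'g \<Rightarrow> 'g"
  assumes comm_group: "i \<in> I \<Longrightarrow> comm_group (G i)"
    and transition: "i \<in> I \<Longrightarrow> j \<in> I \<Longrightarrow> fol i j \<Longrightarrow> x \<in> carrier (G i) \<Longrightarrow> f i j x \<in> carrier (G j)"
begin

lemma group: "i \<in> I \<Longrightarrow> group (G i)"
  using comm_group comm_group.axioms(2) by blast

lemma comm_group_sum: "comm_group (sum_group I G)"
proof (rule group.group_comm_groupI)
  show "group (sum_group I G)" by (rule sum_group) (rule group)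
  fix x x' assume "x \<in> carrier (sum_group I G)" "x' \<in> carrier (sum_group I G)"
  then have c: "x i \<in> carrier (G i)" "x' i \<in> carrier (G i)" if "i \<in> I" for i
    using that by (auto simp: carrier_sum_group group)
  have "x i \<otimes>\<^bsub>G i\<^esub> x' i = x' i \<otimes>\<^bsub>G i\<^esub> x i" if i: "i \<in> I" for i
  proof -
    interpret comm_group "G i" by (rule comm_group[OF i])
    show ?thesis by (rule m_comm[OF c[OF i]])
  qed
  then show "x \<otimes>\<^bsub>sum_group I G\<^esub> x' = x' \<otimes>\<^bsub>sum_group I G\<^esub> x" by (simp add: restrict_def fun_eq_iff)
qed

sublocale sum: comm_group "sum_group I G" by (rule comm_group_sum)

lemma sum_incl_hom: assumes i: "i \<in> I" shows "sum_incl I G i \<in> hom (G i) (sum_group I G)"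
proof (rule homI)
  interpret Gi: comm_group "G i" by (rule comm_group[OF i])
  have one: "\<one>\<^bsub>G j\<^esub> \<in> carrier (G j)" "\<one>\<^bsub>G j\<^esub> \<otimes>\<^bsub>G j\<^esub> \<one>\<^bsub>G j\<^esub> = \<one>\<^bsub>G j\<^esub>" if "j \<in> I" for j
  proof -
    interpret Gj: comm_group "G j" by (rule comm_group[OF that])
    show "\<one>\<^bsub>G j\<^esub> \<in> carrier (G j)" "\<one>\<^bsub>G j\<^esub> \<otimes>\<^bsub>G j\<^esub> \<one>\<^bsub>G j\<^esub> = \<one>\<^bsub>G j\<^esub>" by simp_all
  qed
  show "sum_incl I G i x \<in> carrier (sum_group I G)" if x: "x \<in> carrier (G i)" for x
  proof -
    have "sum_incl I G i x \<in> (\<Pi>\<^sub>E j\<in>I. carrier (G j))"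
      unfolding sum_incl_def using x one(1) by auto
    moreover have "finite {j \<in> I. sum_incl I G i x j \<noteq> \<one>\<^bsub>G j\<^esub>}"
      by (rule finite_subset[of _ "{i}"]) (auto simp: sum_incl_def)
    moreover have "carrier (sum_group I G) = {x \<in> \<Pi>\<^sub>E i\<in>I. carrier (G i). finite {i \<in> I. x i \<noteq> \<one>\<^bsub>G i\<^esub>}}"
      by (rule carrier_sum_group) (rule group)
    ultimately show ?thesis by simp
  qed
  show "sum_incl I G i (x \<otimes>\<^bsub>G i\<^esub> x') = sum_incl I G i x \<otimes>\<^bsub>sum_group I G\<^esub> sum_incl I G i x'" for x x'
    unfolding sum_incl_def mult_sum_group using one(2) by (intro restrict_ext) auto
qed

lemma sum_incl_carrier: "i \<in> I \<Longrightarrow> x \<in> carrier (G i) \<Longrightarrow> sum_incl I G i x \<in> carrier (sum_group I G)"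
  by (rule hom_in_carrier[OF sum_incl_hom])

definition kernel_gens where
  "kernel_gens = {sum_incl I G i x \<otimes>\<^bsub>sum_group I G\<^esub> inv\<^bsub>sum_group I G\<^esub> sum_incl I G j (f i j x) | i j x.
        i \<in> I \<and> j \<in> I \<and> fol i j \<and> x \<in> carrier (G i)}"

lemma limit_kernel_eq: "limit_kernel I fol G f = generate (sum_group I G) kernel_gens"
  unfolding limit_kernel_def kernel_gens_def ..

lemma kernel_gens_subset: "kernel_gens \<subseteq> carrier (sum_group I G)"
proof
  fix z assume "z \<in> kernel_gens"
  then obtain i j x where z: "z = sum_incl I G i x \<otimes>\<^bsub>sum_group I G\<^esub> inv\<^bsub>sum_group I G\<^esub> sum_incl I G j (f i j x)"
    "i \<in> I" "j \<in> I" "fol i j" "x \<in> carrier (G i)" unfolding kernel_gens_def by blast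
  show "z \<in> carrier (sum_group I G)" unfolding z(1)
    by (intro sum.m_closed sum.inv_closed sum_incl_carrier transition z)
qed

lemma subgroup_limit_kernel: "subgroup (limit_kernel I fol G f) (sum_group I G)"
  unfolding limit_kernel_eq by (rule sum.generate_is_subgroup[OF kernel_gens_subset])

lemma comm_group_direct_limit: "comm_group (direct_limit I fol G f)"
  unfolding direct_limit_def by (rule sum.abelian_FactGroup[OF subgroup_limit_kernel])

lemma to_limit_hom: assumes i: "i \<in> I" shows "to_limit I fol G f i \<in> hom (G i) (direct_limit I fol G f)"
proof -
  have "(\<lambda>z. limit_kernel I fol G f #>\<^bsub>sum_group I G\<^esub> z) \<in> hom (sum_group I G) (direct_limit I fol G f)"
    unfolding direct_limit_def by (rule normal.r_coset_hom_Mod[OF sum.subgroup_imp_normal[OF subgroup_limit_kernel]])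
  from hom_compose[OF sum_incl_hom[OF i] this] show ?thesis unfolding to_limit_def[abs_def] comp_def .
qed

text \<open>The two elements of the direct sum differ by a generator of the kernel, so their cosets
  agree.\<close>

lemma to_limit_transition:
  assumes ij: "i \<in> I" "j \<in> I" "fol i j" and x: "x \<in> carrier (G i)"
  shows "to_limit I fol G f j (f i j x) = to_limit I fol G f i x"
proof -
  let ?K = "limit_kernel I fol G f" and ?a = "sum_incl I G i x" and ?b = "sum_incl I G j (f i j x)"
  have a: "?a \<in> carrier (sum_group I G)" and b: "?b \<in> carrier (sum_group I G)"
    using sum_incl_carrier ij x transition by blast+
  have "?a \<otimes>\<^bsub>sum_group I G\<^esub> inv\<^bsub>sum_group I G\<^esub> ?b \<in> ?K"
    unfolding limit_kernel_eq by (rule generate.incl) (use ij x in \<open>auto simp: kernel_gens_def\<close>)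
  then have "(?a \<otimes>\<^bsub>sum_group I G\<^esub> inv\<^bsub>sum_group I G\<^esub> ?b) \<otimes>\<^bsub>sum_group I G\<^esub> ?b \<in> ?K #>\<^bsub>sum_group I G\<^esub> ?b"
    unfolding r_coset_def by blast
  moreover have "(?a \<otimes>\<^bsub>sum_group I G\<^esub> inv\<^bsub>sum_group I G\<^esub> ?b) \<otimes>\<^bsub>sum_group I G\<^esub> ?b = ?a"
    using sum.m_assoc[OF a sum.inv_closed[OF b] b] sum.l_inv[OF b] sum.r_one[OF a] by argo
  ultimately have "?a \<in> ?K #>\<^bsub>sum_group I G\<^esub> ?b" by argo
  then show ?thesis unfolding to_limit_def by (rule sum.repr_independence[OF _ b subgroup_limit_kernel])
qed

end

section \<open>Relative and critical K-theory\<close>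

lemma rel_complexes_subset:
  assumes C: "C \<in> rel_complexes A' B'" and AB: "A \<subseteq> A'" "B \<subseteq> B'" shows "C \<in> rel_complexes A B"
proof -
  have co: "complex_on A' C" and ex: "exact_on B' C" using C unfolding rel_complexes_def by simp_all
  have "complex_on A C"
    unfolding complex_on_def
  proof (intro conjI allI)
    fix i
    show "vbundle_on A (cbun C i)" using co vbundle_on_subset[OF _ AB(1)] unfolding complex_on_def by blast
    show "vbundle_map A (cbun C i) (cbun C (i + 1)) (cdiff C i)"
      using co vbundle_map_subset[OF _ AB(1)] unfolding complex_on_def by blast
    show "\<forall>y\<in>A. cdiff C (i + 1) y * cdiff C i y = 0\<^sub>m (vrank (cbun C (i + 2)) y) (vrank (cbun C i) y)"
      using co AB(1) unfolding complex_on_def by blast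
    obtain n where "\<forall>i. \<bar>i\<bar> > n \<longrightarrow> (\<forall>y\<in>A'. vrank (cbun C i) y = 0)" using co unfolding complex_on_def by blast
    then show "\<exists>n. \<forall>i. \<bar>i\<bar> > n \<longrightarrow> (\<forall>y\<in>A. vrank (cbun C i) y = 0)" using AB(1) by (intro exI[of _ n]) blast
  qed
  moreover have "exact_on B C" using ex AB(2) unfolding exact_on_def by blast
  ultimately show ?thesis unfolding rel_complexes_def by simp
qed

lemma short_exact_subset:
  assumes "short_exact A' C' C C''" "A \<subseteq> A'" shows "short_exact A C' C C''"
proof -
  have cm: "complex_map A D E f" if "complex_map A' D E f" for D E f
    using that assms(2) vbundle_map_subset[OF _ assms(2)] unfolding complex_map_def by blast
  obtain f g where fg: "complex_map A' C' C f" "complex_map A' C C'' g"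
    "\<forall>i. \<forall>y\<in>A'. mat_ker (f i y) = {0\<^sub>v (vrank (cbun C' i) y)} \<and> mat_ker (g i y) = mat_range (f i y) \<and>
        mat_range (g i y) = carrier_vec (vrank (cbun C'' i) y)"
    using assms(1) unfolding short_exact_def by (elim exE conjE)
  show ?thesis unfolding short_exact_def
    by (rule exI[of _ f], rule exI[of _ g]) (use cm[OF fg(1)] cm[OF fg(2)] fg(3) assms(2) in blast)
qed

lemma Ktop_relE:
  assumes "r \<in> Ktop_rels A B"
  obtains (ses) C C' C'' where "r = frag_of C - frag_of C' - frag_of C''" "C \<in> rel_complexes A B" "C' \<in> rel_complexes A B"
      "C'' \<in> rel_complexes A B" "short_exact A C' C C''"
    | (exact) C where "r = frag_of C" "complex_on A C" "exact_on A C"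
    | (homotopy) C where "r = frag_of (slice 0 C) - frag_of (slice 1 C)" "C \<in> rel_complexes (A \<times> {0..1}) (B \<times> {0..1})"
  using assms unfolding Ktop_rels_def by blast

text \<open>Restricting a complex changes nothing in its record, so a relation over the larger pair
  is, word for word, one over the smaller.\<close>

lemma Ktop_rels_subset:
  assumes AB: "A \<subseteq> A'" "B \<subseteq> B'" shows "Ktop_rels A' B' \<subseteq> Ktop_rels A B"
proof
  fix r assume "r \<in> Ktop_rels A' B'"
  then show "r \<in> Ktop_rels A B"
  proof (cases rule: Ktop_relE)
    case (ses C C' C'')
    then show ?thesis unfolding Ktop_rels_def
      using rel_complexes_subset[OF _ AB] short_exact_subset[OF _ AB(1)] by blast
  next
    case (exact C)
    then have "C \<in> rel_complexes A' A'" by (simp add: rel_complexes_def)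
    then have "C \<in> rel_complexes A A" by (rule rel_complexes_subset[OF _ AB(1) AB(1)])
    then show ?thesis using exact(1) unfolding Ktop_rels_def rel_complexes_def by blast
  next
    case (homotopy C)
    have "A \<times> {0..1} \<subseteq> A' \<times> {0..1 :: real}" "B \<times> {0..1} \<subseteq> B' \<times> {0..1 :: real}" using AB by blast+
    then have "C \<in> rel_complexes (A \<times> {0..1}) (B \<times> {0..1})" by (rule rel_complexes_subset[OF homotopy(2)])
    then show ?thesis using homotopy(1) unfolding Ktop_rels_def by blast
  qed
qed

lemma keys_diff_subset: "Poly_Mapping.keys a \<subseteq> S \<Longrightarrow> Poly_Mapping.keys b \<subseteq> S \<Longrightarrow> Poly_Mapping.keys (a - b :: 'a \<Rightarrow>\<^sub>0 int) \<subseteq> S"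
  using keys_diff[of a b] by blast

text \<open>\<open>B \<subseteq> A\<close> puts the complexes that are exact on \<open>A\<close>
  among the generators, and the slices of a relative complex on the cylinder are relative
  complexes.\<close>

lemma presentation_Ktop:
  assumes BA: "B \<subseteq> A" shows "presentation (rel_complexes A B) (Ktop_rels A B)"
proof
  fix r assume "r \<in> Ktop_rels A B"
  then show "Poly_Mapping.keys r \<subseteq> rel_complexes A B"
  proof (cases rule: Ktop_relE)
    case (ses C C' C'')
    show ?thesis unfolding ses(1) by (intro keys_diff_subset) (use ses(2-4) in auto)
  next
    case (exact C)
    then have "C \<in> rel_complexes A A" by (simp add: rel_complexes_def)
    then have "C \<in> rel_complexes A B" by (rule rel_complexes_subset[OF _ subset_refl BA])
    then show ?thesis unfolding exact(1) by simp
  next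
    case (homotopy C)
    have "slice 0 C \<in> rel_complexes A B" "slice 1 C \<in> rel_complexes A B" by (rule slice_rel_complexes[OF homotopy(2)]; simp)+
    then show ?thesis unfolding homotopy(1) by (intro keys_diff_subset) auto
  qed
qed

text \<open>All members \<open>z + x\<close> of the coset have the same class over the smaller pair,
  since \<open>z\<close> is generated by relations that hold there as well. The image of the coset
  is therefore a singleton, which \<open>the_elem\<close> unpacks.\<close>

lemma Ktop_restrict_class:
  assumes AB: "A \<subseteq> A'" "B \<subseteq> B'" and B: "B \<subseteq> A" "B' \<subseteq> A'" and x: "Poly_Mapping.keys x \<subseteq> rel_complexes A' B'"
  shows "Ktop_restrict A B (Ktop_class A' B' x) = Ktop_class A B x"
proof -
  interpret P: presentation "rel_complexes A B" "Ktop_rels A B" by (rule presentation_Ktop[OF B(1)])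
  interpret P': presentation "rel_complexes A' B'" "Ktop_rels A' B'" by (rule presentation_Ktop[OF B(2)])
  have x': "Poly_Mapping.keys x \<subseteq> rel_complexes A B" using x rel_complexes_subset[OF _ AB] by blast
  have eq: "Ktop_class A B (z + x) = Ktop_class A B x" if z: "z \<in> generate (free_Abelian_group (rel_complexes A' B')) (Ktop_rels A' B')" for z
    unfolding Ktop_class_def
    by (rule P.presented_class_add_generate[OF generate_free_Abelian_group_mono[OF P'.rels P.rels Ktop_rels_subset[OF AB] z] x'])
  have "0 \<in> generate (free_Abelian_group (rel_complexes A' B')) (Ktop_rels A' B')"
    using generate.one[of "free_Abelian_group (rel_complexes A' B')" "Ktop_rels A' B'"] by simp
  then have "Ktop_class A B ` {z + x | z. z \<in> generate (free_Abelian_group (rel_complexes A' B')) (Ktop_rels A' B')} = {Ktop_class A B x}"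
    using eq by blast
  moreover have "Ktop_class A' B' x = {z + x | z. z \<in> generate (free_Abelian_group (rel_complexes A' B')) (Ktop_rels A' B')}"
    unfolding Ktop_class_def by (rule P'.presented_class_eq_coset)
  ultimately show ?thesis unfolding Ktop_restrict_def by simp
qed

lemma neg_part_subset: "neg_part w U \<subseteq> U" "U \<subseteq> V \<Longrightarrow> neg_part w U \<subseteq> neg_part w V"
  unfolding neg_part_def by auto

lemma direct_system_Kcrit:
  "direct_system (fibre_nbhds Y w) (\<lambda>U V. V \<subseteq> U) (\<lambda>U. Ktop U (neg_part w U)) (\<lambda>U V. Ktop_restrict V (neg_part w V))"
proof (rule direct_system.intro)
  fix U
  show "comm_group (Ktop U (neg_part w U))"
    unfolding Ktop_def by (rule presentation.comm_group_presented[OF presentation_Ktop[OF neg_part_subset(1)]])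
  fix V c assume VU: "V \<subseteq> U" and c: "c \<in> carrier (Ktop U (neg_part w U))"
  interpret U: presentation "rel_complexes U (neg_part w U)" "Ktop_rels U (neg_part w U)"
    by (rule presentation_Ktop[OF neg_part_subset(1)])
  interpret V: presentation "rel_complexes V (neg_part w V)" "Ktop_rels V (neg_part w V)"
    by (rule presentation_Ktop[OF neg_part_subset(1)])
  obtain x where x: "Poly_Mapping.keys x \<subseteq> rel_complexes U (neg_part w U)" "c = Ktop_class U (neg_part w U) x"
    using c unfolding Ktop_def Ktop_class_def by (rule U.presented_classE)
  have "Poly_Mapping.keys x \<subseteq> rel_complexes V (neg_part w V)"
    using x(1) rel_complexes_subset[OF _ VU neg_part_subset(2)[OF VU]] by blast
  then show "Ktop_restrict V (neg_part w V) c \<in> carrier (Ktop V (neg_part w V))"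
    unfolding x(2) Ktop_restrict_class[OF VU neg_part_subset(2)[OF VU] neg_part_subset(1) neg_part_subset(1) x(1)]
    unfolding Ktop_class_def Ktop_def by (rule V.presented_class_carrier)
qed

section \<open>The homomorphism\<close>

context
  fixes Y :: "'n::finite cproj set" and w :: "'n cproj \<Rightarrow> complex"
begin

interpretation sys: direct_system "fibre_nbhds Y w" "\<lambda>U V. V \<subseteq> U" "\<lambda>U. Ktop U (neg_part w U)" "\<lambda>U V. Ktop_restrict V (neg_part w V)"
  by (rule direct_system_Kcrit)

interpretation K: comm_group "Kcrit Y w"
  unfolding Kcrit_def by (rule sys.comm_group_direct_limit)

private abbreviation "KC \<equiv> Kcrit Y w"

definition crit_class :: "'n cproj set \<Rightarrow> ('n cproj vcomplex \<Rightarrow>\<^sub>0 int) \<Rightarrow> ('n cproj set \<Rightarrow> ('n cproj vcomplex \<Rightarrow>\<^sub>0 int) set) set" where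
  "crit_class U x = to_limit (fibre_nbhds Y w) (\<lambda>U V. V \<subseteq> U)
     (\<lambda>U. Ktop U (neg_part w U)) (\<lambda>U V. Ktop_restrict V (neg_part w V)) U (Ktop_class U (neg_part w U) x)"

lemma crit_class_hom:
  assumes U: "U \<in> fibre_nbhds Y w"
  shows "crit_class U \<in> hom (free_Abelian_group (rel_complexes U (neg_part w U))) (Kcrit Y w)"
proof -
  have "Ktop_class U (neg_part w U) \<in> hom (free_Abelian_group (rel_complexes U (neg_part w U))) (Ktop U (neg_part w U))"
    unfolding Ktop_class_def Ktop_def by (rule presentation.presented_class_hom[OF presentation_Ktop[OF neg_part_subset(1)]])
  from hom_compose[OF this sys.to_limit_hom[OF U]] show ?thesis unfolding crit_class_def[abs_def] comp_def Kcrit_def .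
qed

lemma crit_class_rel:
  assumes U: "U \<in> fibre_nbhds Y w" and r: "r \<in> Ktop_rels U (neg_part w U)" shows "crit_class U r = \<one>\<^bsub>KC\<^esub>"
proof -
  have "Ktop_class U (neg_part w U) r = \<one>\<^bsub>Ktop U (neg_part w U)\<^esub>"
    unfolding Ktop_class_def Ktop_def by (rule presentation.presented_class_rel[OF presentation_Ktop[OF neg_part_subset(1)] r])
  then show ?thesis
    unfolding crit_class_def using hom_one[OF sys.to_limit_hom[OF U] sys.group[OF U]] K.group_axioms unfolding Kcrit_def by simp
qed

text \<open>A homotopy found only over a small neighbourhood can thereby be used for complexes on
  \<open>Y\<close>: transition maps are the identity on representatives.\<close>

lemma crit_class_subset:
  assumes U: "U \<in> fibre_nbhds Y w" and V: "V \<in> fibre_nbhds Y w" and VU: "V \<subseteq> U"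
    and x: "Poly_Mapping.keys x \<subseteq> rel_complexes U (neg_part w U)"
  shows "crit_class V x = crit_class U x"
proof -
  have "Ktop_class U (neg_part w U) x \<in> carrier (Ktop U (neg_part w U))"
    unfolding Ktop_class_def Ktop_def by (rule presentation.presented_class_carrier[OF presentation_Ktop[OF neg_part_subset(1)] x])
  from sys.to_limit_transition[OF U V VU this] show ?thesis
    unfolding crit_class_def Ktop_restrict_class[OF VU neg_part_subset(2)[OF VU] neg_part_subset(1) neg_part_subset(1) x] .
qed

lemma space_fibre_nbhd: "Y \<in> fibre_nbhds Y w"
  unfolding fibre_nbhds_def zero_fibre_def by auto

definition mf_class :: "'n cproj mfact \<Rightarrow> ('n cproj set \<Rightarrow> ('n cproj vcomplex \<Rightarrow>\<^sub>0 int) set) set" where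
  "mf_class E = crit_class Y (frag_of (an_complex Y E))"

lemma an_complex_rel_neg: "is_mfact Y w E \<Longrightarrow> an_complex Y E \<in> rel_complexes Y (neg_part w Y)"
  by (rule an_complex_rel) (auto simp: neg_part_def)

lemma mf_class_carrier: "is_mfact Y w E \<Longrightarrow> mf_class E \<in> carrier (Kcrit Y w)"
  unfolding mf_class_def by (rule hom_in_carrier[OF crit_class_hom[OF space_fibre_nbhd]]) (simp add: an_complex_rel_neg)

text \<open>\<open>w\<close> is nonzero where \<open>Re w < 0\<close>, so the pair with the negative
  part lies inside \<open>(Y, Y - X)\<close>, and restriction keeps the generator
  \<open>an_complex Y E\<close>.\<close>

lemma i_neg_alpha_star: assumes E: "is_mfact Y w E" shows "i_neg Y w (alpha_star Y w E) = mf_class E"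
proof -
  have "an_complex Y E \<in> rel_complexes Y (Y - zero_fibre Y w)"
    by (rule an_complex_rel[OF E]) (auto simp: zero_fibre_def)
  then have "Poly_Mapping.keys (frag_of (an_complex Y E)) \<subseteq> rel_complexes Y (Y - zero_fibre Y w)" by simp
  moreover have "neg_part w Y \<subseteq> Y - zero_fibre Y w" by (auto simp: neg_part_def zero_fibre_def)
  ultimately have "Ktop_restrict Y (neg_part w Y) (alpha_star Y w E) = Ktop_class Y (neg_part w Y) (frag_of (an_complex Y E))"
    unfolding alpha_star_def by (intro Ktop_restrict_class neg_part_subset subset_refl) auto
  then show ?thesis unfolding i_neg_def mf_class_def crit_class_def by simp
qed

text \<open>Over \<open>U\<close> the homotopy relation identifies the complex of \<open>E\<close>
  with one that is exact on \<open>U\<close>, whose class is trivial by another of the relations;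
  the comparison with \<open>Y\<close> happens in the limit.\<close>

lemma mf_class_acyclic: assumes "E \<in> acyc_objs Y w" shows "mf_class E = \<one>\<^bsub>KC\<^esub>"
proof -
  obtain U C where UC: "U \<in> fibre_nbhds Y w" "C \<in> rel_complexes (U \<times> {0..1}) (neg_part w U \<times> {0..1})"
    "slice 0 C = an_complex Y E" "complex_on U (slice 1 C)" "exact_on U (slice 1 C)" by (rule acyc_null_homotopy[OF assms])
  have E: "is_mfact Y w E" using assms by (simp add: acyc_objs_def)
  have UY: "U \<subseteq> Y" using UC(1) unfolding fibre_nbhds_def by (auto dest: openin_imp_subset)
  note h = crit_class_hom[OF UC(1)]
  have s: "slice 0 C \<in> rel_complexes U (neg_part w U)" "slice 1 C \<in> rel_complexes U (neg_part w U)"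
    by (rule slice_rel_complexes[OF UC(2)]; simp)+
  have c: "crit_class U (frag_of (slice t C)) \<in> carrier (Kcrit Y w)" if "slice t C \<in> rel_complexes U (neg_part w U)" for t
    by (rule hom_in_carrier[OF h]) (simp add: that)
  have "crit_class U (frag_of (slice 0 C) - frag_of (slice 1 C)) = \<one>\<^bsub>KC\<^esub>"
    by (rule crit_class_rel[OF UC(1)]) (use UC(2) in \<open>auto simp: Ktop_rels_def\<close>)
  moreover have "crit_class U (frag_of (slice 1 C)) = \<one>\<^bsub>KC\<^esub>"
    by (rule crit_class_rel[OF UC(1)]) (use UC(4,5) in \<open>auto simp: Ktop_rels_def\<close>)
  ultimately have "crit_class U (frag_of (slice 0 C)) = \<one>\<^bsub>KC\<^esub>"
    using hom_free_Abelian_group_diff[OF h K.group_axioms, of "frag_of (slice 0 C)" "frag_of (slice 1 C)"] s c[OF s(1)] by simp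
  moreover have "crit_class U (frag_of (an_complex Y E)) = crit_class Y (frag_of (an_complex Y E))"
    by (rule crit_class_subset[OF space_fibre_nbhd UC(1) UY]) (simp add: an_complex_rel_neg[OF E])
  ultimately show ?thesis unfolding mf_class_def UC(3) by simp
qed

lemma mf_class_cone:
  assumes E: "is_mfact Y w E" and F: "is_mfact Y w F" and p: "p \<in> Z0_hom Y E F"
  shows "mf_class (mf_cone E F p) = mf_class F \<otimes>\<^bsub>KC\<^esub> mf_class (mf_shift E)"
proof -
  note C = mf_cone_mfact[OF E F p] and S = mf_shift_mfact[OF E]
  note rc = an_complex_rel_neg[OF C] an_complex_rel_neg[OF F] an_complex_rel_neg[OF S]
  note h = crit_class_hom[OF space_fibre_nbhd]
  let ?c = "frag_of (an_complex Y (mf_cone E F p))" and ?f = "frag_of (an_complex Y F)" and ?s = "frag_of (an_complex Y (mf_shift E))"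
  have "crit_class Y (?c - ?f - ?s) = \<one>\<^bsub>KC\<^esub>"
  proof (rule crit_class_rel[OF space_fibre_nbhd])
    show "?c - ?f - ?s \<in> Ktop_rels Y (neg_part w Y)"
      unfolding Ktop_rels_def using rc short_exact_cone[OF E F p] by blast
  qed
  moreover have "crit_class Y (?c - ?f - ?s) = mf_class (mf_cone E F p) \<otimes>\<^bsub>KC\<^esub> inv\<^bsub>KC\<^esub> mf_class F
      \<otimes>\<^bsub>KC\<^esub> inv\<^bsub>KC\<^esub> mf_class (mf_shift E)"
  proof -
    have "Poly_Mapping.keys (?c - ?f) \<subseteq> rel_complexes Y (neg_part w Y)" by (intro keys_diff_subset) (use rc in auto)
    then show ?thesis
      using hom_free_Abelian_group_diff[OF h K.group_axioms] rc unfolding mf_class_def by simp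
  qed
  ultimately have "mf_class (mf_cone E F p) \<otimes>\<^bsub>KC\<^esub> inv\<^bsub>KC\<^esub> mf_class F
      \<otimes>\<^bsub>KC\<^esub> inv\<^bsub>KC\<^esub> mf_class (mf_shift E) = \<one>\<^bsub>KC\<^esub>" by simp
  then show ?thesis
    using K.inv_solve_right'[of "mf_class F" "mf_class (mf_cone E F p)"] mf_class_carrier[OF C] mf_class_carrier[OF F] mf_class_carrier[OF S]
    by (metis K.inv_closed K.inv_equality K.inv_inv K.inv_solve_right K.m_closed K.m_comm)
qed

lemma mf_class_shift:
  assumes E: "is_mfact Y w E" shows "mf_class E \<otimes>\<^bsub>KC\<^esub> mf_class (mf_shift E) = \<one>\<^bsub>KC\<^esub>"
proof -
  note id = Z0_id[OF E]
  have "coh_bij Y w E E (H0_class Y E E (mf_id E))" using coh_bij_id[OF E] unfolding H0_simps(3) .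
  then have "mf_cone E E (mf_id E) \<in> acyc_objs Y w" using coh_bij_class_iff[OF E E id] by simp
  then show ?thesis using mf_class_acyclic mf_class_cone[OF E E id] by simp
qed

text \<open>For a representative \<open>p\<close> of \<open>u\<close> the exact cone gives
  \<open>[F] + [E[1]] = 0\<close>, and \<open>mf_class_shift\<close> gives
  \<open>[E] + [E[1]] = 0\<close>; the shift cancels. Applied to both legs of a roof, this handles
  isomorphisms of \<open>MF\<close>.\<close>

lemma mf_class_coh_bij:
  assumes E: "is_mfact Y w E" and F: "is_mfact Y w F" and u: "u \<in> mor (H0_Fact Y w) E F" "coh_bij Y w E F u"
  shows "mf_class E = mf_class F"
proof -
  obtain p where p: "p \<in> Z0_hom Y E F" "u = H0_class Y E F p" using u(1) unfolding H0_simps(2) by blast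
  have "mf_cone E F p \<in> acyc_objs Y w" using coh_bij_class_iff[OF E F p(1)] u(2) p(2) by simp
  then have "mf_class F \<otimes>\<^bsub>KC\<^esub> mf_class (mf_shift E) = mf_class E \<otimes>\<^bsub>KC\<^esub> mf_class (mf_shift E)"
    using mf_class_acyclic mf_class_cone[OF E F p(1)] mf_class_shift[OF E] by simp
  then show ?thesis
    using K.right_cancel[OF mf_class_carrier[OF mf_shift_mfact[OF E]] mf_class_carrier[OF F] mf_class_carrier[OF E]] by simp
qed

lemma mf_class_H0_iso:
  assumes E: "is_mfact Y w E" and F: "is_mfact Y w F" and u: "is_iso (H0_Fact Y w) E F u"
  shows "mf_class E = mf_class F"
  by (rule mf_class_coh_bij[OF E F _ coh_bij_iso[OF E F u]]) (use u in \<open>simp add: is_iso_def\<close>)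

lemma mf_class_H0_tri:
  assumes "(A, B, C, u, v, x) \<in> tri (H0_Fact Y w)"
  shows "is_mfact Y w A \<and> is_mfact Y w B \<and> is_mfact Y w C \<and> mf_class B = mf_class A \<otimes>\<^bsub>KC\<^esub> mf_class C"
proof (rule H0_triE[OF assms])
  fix E F p a b c
  assume m: "is_mfact Y w A" "is_mfact Y w B" "is_mfact Y w C" "is_mfact Y w E" "is_mfact Y w F"
    and p: "p \<in> Z0_hom Y E F" and iso: "is_iso (H0_Fact Y w) A E a" "is_iso (H0_Fact Y w) B F b" "is_iso (H0_Fact Y w) C (mf_cone E F p) c"
  note cl = mf_class_carrier[OF m(4)] mf_class_carrier[OF m(5)] mf_class_carrier[OF mf_shift_mfact[OF m(4)]]
  \<comment> \<open>\<open>A\<close> and \<open>C\<close> are replaced by \<open>E\<close> and the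
    cone; after reordering, the contribution \<open>[E] + [E[1]]\<close> is trivial and
    \<open>[F]\<close> remains.\<close>
  have "mf_class A \<otimes>\<^bsub>KC\<^esub> mf_class C = mf_class E \<otimes>\<^bsub>KC\<^esub> (mf_class F \<otimes>\<^bsub>KC\<^esub> mf_class (mf_shift E))"
    using mf_class_H0_iso[OF m(1,4) iso(1)] mf_class_H0_iso[OF m(3) mf_cone_mfact[OF m(4,5) p] iso(3)] mf_class_cone[OF m(4,5) p] by simp
  also have "\<dots> = mf_class F \<otimes>\<^bsub>KC\<^esub> (mf_class E \<otimes>\<^bsub>KC\<^esub> mf_class (mf_shift E))"
    by (rule K.m_lcomm[OF cl])
  also have "\<dots> = mf_class B"
    using mf_class_shift[OF m(4)] mf_class_H0_iso[OF m(2,5) iso(2)] cl(2) by simp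
  finally show ?thesis using m by simp
qed

lemma mf_class_MF_iso:
  assumes A: "is_mfact Y w A" and B: "is_mfact Y w B" and L: "is_iso (MF Y w) A B L"
  shows "mf_class A = mf_class B"
proof -
  obtain G s f where r: "is_mfact Y w G" "s \<in> mor (H0_Fact Y w) G A" "f \<in> mor (H0_Fact Y w) G B"
    "coh_bij Y w G A s" "coh_bij Y w G B f"
    using MF_iso_roof[OF A B L] by blast
  show ?thesis using mf_class_coh_bij[OF r(1) A r(2,4)] mf_class_coh_bij[OF r(1) B r(3,5)] by simp
qed

lemma mf_class_MF_tri:
  assumes "(A, B, C, u, v, x) \<in> tri (MF Y w)"
  shows "is_mfact Y w A \<and> is_mfact Y w B \<and> is_mfact Y w C \<and> mf_class B = mf_class A \<otimes>\<^bsub>KC\<^esub> mf_class C"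
proof (rule MF_triE[OF assms])
  fix A' B' C' u' v' x' a b c
  assume m: "is_mfact Y w A" "is_mfact Y w B" "is_mfact Y w C" and t: "(A', B', C', u', v', x') \<in> tri (H0_Fact Y w)"
    and iso: "is_iso (MF Y w) A A' a" "is_iso (MF Y w) B B' b" "is_iso (MF Y w) C C' c"
  note t' = mf_class_H0_tri[OF t]
  show ?thesis
    using t' m mf_class_MF_iso[OF m(1) _ iso(1)] mf_class_MF_iso[OF m(2) _ iso(2)] mf_class_MF_iso[OF m(3) _ iso(3)] by simp
qed

text \<open>Every relation is \<open>[B] - [A] - [C]\<close> for a triangle of \<open>MF\<close>,
  and \<open>mf_class_MF_tri\<close> makes its image trivial.\<close>

lemma K0_MF_hom:
  obtains \<alpha> where "\<alpha> \<in> hom (K0 (MF Y w)) (Kcrit Y w)"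
    "\<And>E. is_mfact Y w E \<Longrightarrow> \<alpha> (K0_class (MF Y w) E) = mf_class E"
proof -
  have S: "ob (MF Y w) = {E. is_mfact Y w E}" by (rule MF_simps)
  have P: "presentation (ob (MF Y w)) (K0_rels (MF Y w))"
  proof
    fix r assume "r \<in> K0_rels (MF Y w)"
    then obtain A B C u v x where r: "r = frag_of B - frag_of A - frag_of C" "(A, B, C, u, v, x) \<in> tri (MF Y w)"
      unfolding K0_rels_def by blast
    show "Poly_Mapping.keys r \<subseteq> ob (MF Y w)"
      unfolding r(1) by (intro keys_diff_subset) (use mf_class_MF_tri[OF r(2)] S in auto)
  qed
  obtain \<alpha> where a: "\<alpha> \<in> hom (presented (ob (MF Y w)) (K0_rels (MF Y w))) (Kcrit Y w)"
    "\<And>E. E \<in> ob (MF Y w) \<Longrightarrow> \<alpha> (presented_class (ob (MF Y w)) (K0_rels (MF Y w)) (frag_of E)) = mf_class E"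
  proof (rule presentation.presented_universal[OF P K.comm_group_axioms])
    show "mf_class E \<in> carrier (Kcrit Y w)" if "E \<in> ob (MF Y w)" for E using that S mf_class_carrier by simp
    fix h r assume h: "h \<in> hom (free_Abelian_group (ob (MF Y w))) (Kcrit Y w)" "\<And>E. E \<in> ob (MF Y w) \<Longrightarrow> h (frag_of E) = mf_class E"
      and "r \<in> K0_rels (MF Y w)"
    then obtain A B C u v x where r: "r = frag_of B - frag_of A - frag_of C" "(A, B, C, u, v, x) \<in> tri (MF Y w)"
      unfolding K0_rels_def by blast
    note t = mf_class_MF_tri[OF r(2)]
    then have o: "A \<in> ob (MF Y w)" "B \<in> ob (MF Y w)" "C \<in> ob (MF Y w)" using S by simp_all
    have cl: "mf_class A \<in> carrier (Kcrit Y w)" "mf_class B \<in> carrier (Kcrit Y w)" "mf_class C \<in> carrier (Kcrit Y w)"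
      using t mf_class_carrier by simp_all
    have "Poly_Mapping.keys (frag_of B - frag_of A) \<subseteq> ob (MF Y w)" by (intro keys_diff_subset) (use o in auto)
    then have "h r = mf_class B \<otimes>\<^bsub>KC\<^esub> inv\<^bsub>KC\<^esub> mf_class A \<otimes>\<^bsub>KC\<^esub> inv\<^bsub>KC\<^esub> mf_class C"
      using hom_free_Abelian_group_diff[OF h(1) K.group_axioms] h(2) o unfolding r(1) by simp
    also have "\<dots> = \<one>\<^bsub>KC\<^esub>"
    proof -
      have "mf_class B \<otimes>\<^bsub>KC\<^esub> inv\<^bsub>KC\<^esub> mf_class A = mf_class C"
        using t cl by (simp add: K.m_comm[OF cl(1,3)] K.m_assoc)
      then show ?thesis using cl by simp
    qed
    finally show "h r = \<one>\<^bsub>KC\<^esub>" .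
  next
    fix \<alpha> assume "\<alpha> \<in> hom (presented (ob (MF Y w)) (K0_rels (MF Y w))) (Kcrit Y w)"
      "\<And>E. E \<in> ob (MF Y w) \<Longrightarrow> \<alpha> (presented_class (ob (MF Y w)) (K0_rels (MF Y w)) (frag_of E)) = mf_class E"
    then show thesis by (rule that)
  qed
  show thesis by (rule that[of \<alpha>]) (use a S in \<open>simp_all add: K0_def K0_class_def\<close>)
qed

end

theorem theorem3p1:
  fixes Y :: "'n::finite cproj set" and w :: "'n cproj \<Rightarrow> complex"
  assumes "lg_model Y w" and "\<exists>y\<in>Y. w y \<noteq> 0"
  shows "\<exists>\<alpha> \<in> hom (K0 (MF Y w)) (Kcrit Y w).
           \<forall>E \<in> ob (MF Y w). \<alpha> (K0_class (MF Y w) E) = i_neg Y w (alpha_star Y w E)"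
proof -
  obtain \<alpha> where "\<alpha> \<in> hom (K0 (MF Y w)) (Kcrit Y w)"
    "\<And>E. is_mfact Y w E \<Longrightarrow> \<alpha> (K0_class (MF Y w) E) = mf_class Y w E" by (rule K0_MF_hom) blast
  then show ?thesis by (intro bexI[of _ \<alpha>]) (simp_all add: i_neg_alpha_star MF_simps(1))
qed

end
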